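(* Let $\mathscr C$ be a non-empty set of finite totally ordered sets of odd cardinality, let $\mathcal Q$ be either the Temperley--Lieb category $\mathcal{TL}(\mathscr C)$ (planar Brauer partitions) or the anti-Temperley--Lieb category $\mathcal{TL}^\pm(\mathscr C)$ (planar or anti-planar Brauer partitions). Let $\xi$ be the least cardinal strictly greater than $|A|$ for every $A\in\mathscr C$, let $I_r=\{\alpha\in\mathcal Q:\operatorname{rank}(\alpha)\le r\}$ for odd $1\le r<\xi$, with $I_\omega=\mathcal Q$ if $\xi=\omega$, and for odd $1\le q<\xi$ let $\mathcal G_q$ be a group $\mathscr H$-class of $\mathcal Q$ contained in $D_q=\{\alpha\in\mathcal Q:\operatorname{rank}(\alpha)=q\}$. (i) The minimal ideal $I_1$ is (isomorphic to) a partial rectangular band, so its congruences are precisely those corresponding to the relations $\sigma_{\mathcal E_1,\mathcal E_2}$ described in the context. In particular, $\operatorname{Cong}(I_1)$ is isomorphic to the lattice direct product $$\prod_{A\in\mathscr C}\mathfrak{Eq}(\mathscr P_\circ^+(\mathfrak{Eq}_2(A)))\times\prod_{A\in\mathscr C}\mathfrak{Eq}(\mathscr P_\circ^+(\mathfrak{Eq}_2(A))).$$ (ii) For odd $r\ge3$ with $r<\xi$ (and also for $r=\omega$ if $\xi=\omega$), $$\operatorname{Cong}(I_r)=\{\Delta_{I_r},\lambda^{I_r}_{I_1},\rho^{I_r}_{I_1},R^{I_r}_{I_1}\}\cup\{R^{I_r}_{I_q,N}:1\le q<r,\ q\text{ odd},\ N\unlhd\mathcal G_{q+2}\}\cup\{\widetilde\nabla_{I_r}\}.$$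 The inclusion order is as follows: $\Delta_{I_r}\subset\lambda^{I_r}_{I_1},\rho^{I_r}_{I_1}\subset R^{I_r}_{I_1}$ with $\lambda^{I_r}_{I_1},\rho^{I_r}_{I_1}$ incomparable; the $R^{I_r}_{I_q,N}$ form a chain with bottom $R^{I_r}_{I_1}$, with $R^{I_r}_{I_q,N}\subseteq R^{I_r}_{I_{q'},N'}$ iff $q<q'$, or $q=q'$ and $N\le N'$ (here $\mathcal G_{q}$, $q\ge3$, is trivial if $\mathcal Q=\mathcal{TL}$ and cyclic of order 2 if $\mathcal Q=\mathcal{TL}^\pm$); and $\widetilde\nabla_{I_r}$ is the top element.
   Context: **Categories.** Let $X=\bigcup_{A\in\mathscr C}A$ with disjoint copies $X'$, $X''$. For $A,B\in\mathscr C$, a Brauer partition $\alpha\in\mathcal B_{A,B}$ is a set partition of $A\cup B'$ into blocks of size 2; $\mathbf d(\alpha)=A$, $\mathbf r(\alpha)=B$. For $\alpha\in\mathcal B_{A,B}$, $\beta\in\mathcal B_{B,C}$, regard them as equivalences, rename each $b'$ in $\alpha$ and each $b$ in $\beta$ to $b''$ ($b\in B$), take the join of the resulting equivalences on $A\cup B''\cup C'$, and restrict to $A\cup C'$: this is $\alpha\beta\in\mathcal B_{A,C}$. A block is a transversal if it meets both $A$ and $B'$; $\operatorname{rank}(\alpha)$ is the number of transversals. With $A=\{a_1<\cdots<a_k\}$, $B=\{b_1<\cdots<b_l\}$, $\alpha$ is planar if its blocks can be drawn as non-crossing edges inside the rectangle $[0,\max(k,l)+1]\times[0,1]$ with $a_i$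 at $(i,1)$ and $b_i'$ at $(i,0)$; $\alpha$ is anti-planar if $\gamma_A\alpha$ is planar, where $\gamma_A\in\mathcal B_{A,A}$ has blocks $\{a_i,a'_{k+1-i}\}$. $\mathcal Q$ is a stable regular category with $\mathscr J=\mathscr D$-classes the $D_q$, $q$ odd, $1\le q<\xi$. $\mathfrak{Eq}(Z)$ is the lattice of equivalences on $Z$. For $|A|$ odd, $\mathfrak{Eq}_2(A)$ is the set of equivalences on $A$ with exactly one singleton class and all other classes of size 2. For $U,V\subseteq A$: $U,V$ are separated if $u<v$ for all $u\in U,v\in V$ or $v<u$ for all such; $U$ is nested by $V$ if there are $v_1,v_2\in V$ with $v_1<u<v_2$ for all $u\in U$ and no $v\in V$ with $v_1<v<v_2$. An equivalence is planar if any two distinct classes are separated or one is nested by the other. $\mathscr P^+_\circ(\mathfrak{Eq}_2(A))$ is the set of planar members of $\mathfrak{Eq}_2(A)$ whose singleton class is not nested by any other class. **Congruences.** For a partial semigroup (category without necessarily having identities) $S$, write $x\sim y$ if $\mathbf d(x)=\mathbf d(y)$ and $\mathbf r(x)=\mathbf r(y)$. A congruence on $S$ is an equivalence contained in $\sim$ and compatible with all defined left and right multiplications. $\operatorname{Cong}(S)$ is the lattice of congruences. $\Delta_S$ is equality, $\widetilde\nabla_S=\{(x,y):x\sim y\}$. For an ideal $I$ (non-empty, closed under defined multiplication by elements of $S$ on either side), $R_I^S=\widetilde\nabla_I\cup\Delta_S$. Green's relations: $x\mathrel{\mathscr R}y\Leftrightarrow xS^1=yS^1$, $x\mathrel{\mathscr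 L}y\Leftrightarrow S^1x=S^1y$, $x\mathrel{\mathscr J}y\Leftrightarrow S^1xS^1=S^1yS^1$, $\mathscr H=\mathscr R\cap\mathscr L$ ($S^1$ is $S$ with identities adjoined where needed). For $N$ a normal subgroup of a group $\mathscr H$-class in a $\mathscr J$-class $D$ minimal among those in $S\setminus I$, $\nu_N=\{(axb,ayb):x,y\in N,\ a,b\in S^1,\ axb,ayb\in D\}$ and $R^S_{I,N}=R_I^S\cup\nu_N$. With $M=I_1$ the minimal ideal of $S=I_r$: $\lambda_{I_1}^{S}=\{(x,y)\in M\times M:x\sim y,\ (x,y)\in\mathscr L\}\cup\Delta_S$ and $\rho_{I_1}^{S}=\{(x,y)\in M\times M:x\sim y,\ (x,y)\in\mathscr R\}\cup\Delta_S$. **Partial rectangular bands.** Given non-empty sets $X_A,Y_A$ ($A\in\mathscr C$), the $X_A$ pairwise disjoint and the $Y_A$ pairwise disjoint, the partial rectangular band is $\bigcup_{A,B}X_A\times Y_B$ with $\mathbf d(x,y)=A$, $\mathbf r(x,y)=B$ for $x\in X_A,y\in Y_B$, and $(x_1,y_1)(x_2,y_2)=(x_1,y_2)$ when $\mathbf r(x_1,y_1)=\mathbf d(x_2,y_2)$. For tuples $\mathcal E_1=(\varepsilon^A_1)_A$, $\mathcal E_2=(\varepsilon_2^A)_A$ with $\varepsilon_1^A\in\mathfrak{Eq}(X_A)$, $\varepsilon_2^A\in\mathfrak{Eq}(Y_A)$, $\sigma_{\mathcal E_1,\mathcal E_2}$ relates $(x_1,y_1)$, $(x_2,y_2)$ iff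 both lie in a common $X_A\times Y_B$ and $(x_1,x_2)\in\varepsilon_1^A$, $(y_1,y_2)\in\varepsilon_2^B$. Isomorphisms preserve $\mathbf d$, $\mathbf r$. *)

theory Defs
  imports
    "HOL-Analysis.Analysis"
    "HOL-Algebra.Elementary_Groups"
begin

section \<open>Partial semigroups\<close>

text \<open>The product \<open>mul S x y\<close> counts as defined exactly when
  \<open>x, y \<in> arr S\<close> and \<open>rn S x = dm S y\<close>. Its value elsewhere is irrelevant, and every definition
  below guards its products accordingly.\<close>

record ('o, 'm) psemigroup =
  arr :: "'m set"
  dm :: "'m \<Rightarrow> 'o"
  rn :: "'m \<Rightarrow> 'o"
  mul :: "'m \<Rightarrow> 'm \<Rightarrow> 'm"

definition sub_psg :: "('o, 'm) psemigroup \<Rightarrow> 'm set \<Rightarrow> ('o, 'm) psemigroup" where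
  "sub_psg S I = S\<lparr>arr := I\<rparr>"

definition psg_iso ::
  "('o, 'm) psemigroup \<Rightarrow> ('o, 'n) psemigroup \<Rightarrow> ('m \<Rightarrow> 'n) \<Rightarrow> bool" where
  "psg_iso S T f \<longleftrightarrow>
     bij_betw f (arr S) (arr T) \<and>
     (\<forall>x\<in>arr S. dm T (f x) = dm S x \<and> rn T (f x) = rn S x) \<and>
     (\<forall>x\<in>arr S. \<forall>y\<in>arr S. rn S x = dm S y \<longrightarrow> f (mul S x y) = mul T (f x) (f y))"

definition parallel :: "('o, 'm) psemigroup \<Rightarrow> 'm \<Rightarrow> 'm \<Rightarrow> bool" where
  "parallel S x y \<longleftrightarrow> dm S x = dm S y \<and> rn S x = rn S y"

definition congruence :: "('o, 'm) psemigroup \<Rightarrow> 'm rel \<Rightarrow> bool" where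
  "congruence S \<sigma> \<longleftrightarrow>
     equiv (arr S) \<sigma> \<and>
     (\<forall>(x, y)\<in>\<sigma>. parallel S x y) \<and>
     (\<forall>(x, y)\<in>\<sigma>. \<forall>s\<in>arr S.
        (rn S s = dm S x \<longrightarrow> (mul S s x, mul S s y) \<in> \<sigma>) \<and>
        (rn S x = dm S s \<longrightarrow> (mul S x s, mul S y s) \<in> \<sigma>))"

definition Cong :: "('o, 'm) psemigroup \<Rightarrow> 'm rel set" where
  "Cong S = {\<sigma>. congruence S \<sigma>}"

definition is_ideal :: "('o, 'm) psemigroup \<Rightarrow> 'm set \<Rightarrow> bool" where
  "is_ideal S I \<longleftrightarrow>
     I \<noteq> {} \<and> I \<subseteq> arr S \<and>
     (\<forall>x\<in>I. \<forall>s\<in>arr S.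
        (rn S s = dm S x \<longrightarrow> mul S s x \<in> I) \<and>
        (rn S x = dm S s \<longrightarrow> mul S x s \<in> I))"

definition minimal_ideal :: "('o, 'm) psemigroup \<Rightarrow> 'm set \<Rightarrow> bool" where
  "minimal_ideal S I \<longleftrightarrow> is_ideal S I \<and> (\<forall>J. is_ideal S J \<longrightarrow> I \<subseteq> J)"

text \<open>\<open>left_mults S A\<close> consists of the maps \<open>x \<mapsto> ax\<close> for those \<open>a \<in> S\<^sup>1\<close> that can be multiplied
  with an \<open>x\<close> satisfying \<open>dm S x = A\<close>; the map \<open>id\<close> is multiplication by the identity at \<open>A\<close>,
  adjoined or not. \<open>right_mults\<close> is dual.\<close>

definition left_mults :: "('o, 'm) psemigroup \<Rightarrow> 'o \<Rightarrow> ('m \<Rightarrow> 'm) set" where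
  "left_mults S A = insert id {mul S a | a. a \<in> arr S \<and> rn S a = A}"

definition right_mults :: "('o, 'm) psemigroup \<Rightarrow> 'o \<Rightarrow> ('m \<Rightarrow> 'm) set" where
  "right_mults S B = insert id {\<lambda>x. mul S x b | b. b \<in> arr S \<and> dm S b = B}"

definition green_R :: "('o, 'm) psemigroup \<Rightarrow> 'm rel" where
  "green_R S = {(x, y) \<in> arr S \<times> arr S.
     {g x | g. g \<in> right_mults S (rn S x)} = {g y | g. g \<in> right_mults S (rn S y)}}"

definition green_L :: "('o, 'm) psemigroup \<Rightarrow> 'm rel" where
  "green_L S = {(x, y) \<in> arr S \<times> arr S.
     {f x | f. f \<in> left_mults S (dm S x)} = {f y | f. f \<in> left_mults S (dm S y)}}"

definition green_J :: "('o, 'm) psemigroup \<Rightarrow> 'm rel" where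
  "green_J S = {(x, y) \<in> arr S \<times> arr S.
     {g (f x) | f g. f \<in> left_mults S (dm S x) \<and> g \<in> right_mults S (rn S x)} =
     {g (f y) | f g. f \<in> left_mults S (dm S y) \<and> g \<in> right_mults S (rn S y)}}"

definition green_H :: "('o, 'm) psemigroup \<Rightarrow> 'm rel" where
  "green_H S = green_R S \<inter> green_L S"

definition group_of :: "('o, 'm) psemigroup \<Rightarrow> 'm set \<Rightarrow> 'm monoid" where
  "group_of S H =
     \<lparr>carrier = H, monoid.mult = mul S,
      one = (THE e. e \<in> H \<and> (\<forall>x\<in>H. mul S e x = x \<and> mul S x e = x))\<rparr>"

definition group_H_class :: "('o, 'm) psemigroup \<Rightarrow> 'm set \<Rightarrow> bool" where
  "group_H_class S H \<longleftrightarrow>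
     H \<in> arr S // green_H S \<and> (\<forall>x\<in>H. dm S x = rn S x) \<and> group (group_of S H)"

definition Delta :: "('o, 'm) psemigroup \<Rightarrow> 'm rel" where
  "Delta S = Id_on (arr S)"

definition Nabla :: "('o, 'm) psemigroup \<Rightarrow> 'm rel" where
  "Nabla S = {(x, y) \<in> arr S \<times> arr S. parallel S x y}"

definition Rees :: "('o, 'm) psemigroup \<Rightarrow> 'm set \<Rightarrow> 'm rel" where
  "Rees S I = Nabla (sub_psg S I) \<union> Delta S"

text \<open>In \<open>nu S N\<close> the set \<open>green_J S `` N\<close> is the \<open>\<J>\<close>-class of \<open>S\<close> containing \<open>N\<close>. As \<open>N\<close> lies in
  an \<open>\<H>\<close>-class, its elements share their domain and range, so \<open>axb\<close> and \<open>ayb\<close> are defined for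
  the same \<open>a\<close> and \<open>b\<close>.\<close>

definition nu :: "('o, 'm) psemigroup \<Rightarrow> 'm set \<Rightarrow> 'm rel" where
  "nu S N = {(g (f x), g (f y)) | x y f g.
     x \<in> N \<and> y \<in> N \<and> f \<in> left_mults S (dm S x) \<and> g \<in> right_mults S (rn S x) \<and>
     g (f x) \<in> green_J S `` N \<and> g (f y) \<in> green_J S `` N}"

definition Rees_normal :: "('o, 'm) psemigroup \<Rightarrow> 'm set \<Rightarrow> 'm set \<Rightarrow> 'm rel" where
  "Rees_normal S I N = Rees S I \<union> nu S N"

definition lambda_cong :: "('o, 'm) psemigroup \<Rightarrow> 'm set \<Rightarrow> 'm rel" where
  "lambda_cong S M =
     {(x, y) \<in> M \<times> M. parallel S x y \<and> (x, y) \<in> green_L S} \<union> Delta S"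

definition rho_cong :: "('o, 'm) psemigroup \<Rightarrow> 'm set \<Rightarrow> 'm rel" where
  "rho_cong S M =
     {(x, y) \<in> M \<times> M. parallel S x y \<and> (x, y) \<in> green_R S} \<union> Delta S"

section \<open>Partial rectangular bands\<close>

definition prb_data :: "'o set \<Rightarrow> ('o \<Rightarrow> 'x set) \<Rightarrow> ('o \<Rightarrow> 'y set) \<Rightarrow> bool" where
  "prb_data C X Y \<longleftrightarrow>
     (\<forall>A\<in>C. X A \<noteq> {} \<and> Y A \<noteq> {}) \<and>
     disjoint_family_on X C \<and> disjoint_family_on Y C"

definition prb :: "'o set \<Rightarrow> ('o \<Rightarrow> 'x set) \<Rightarrow> ('o \<Rightarrow> 'y set) \<Rightarrow> ('o, 'x \<times> 'y) psemigroup" where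
  "prb C X Y =
     \<lparr>arr = (\<Union>A\<in>C. \<Union>B\<in>C. X A \<times> Y B),
      dm = (\<lambda>p. THE A. A \<in> C \<and> fst p \<in> X A),
      rn = (\<lambda>p. THE B. B \<in> C \<and> snd p \<in> Y B),
      mul = (\<lambda>p q. (fst p, snd q))\<rparr>"

definition Eqs :: "'z set \<Rightarrow> 'z rel set" where
  "Eqs Z = {\<epsilon>. equiv Z \<epsilon>}"

definition sigma_cong ::
  "'o set \<Rightarrow> ('o \<Rightarrow> 'x set) \<Rightarrow> ('o \<Rightarrow> 'y set) \<Rightarrow> ('o \<Rightarrow> 'x rel) \<Rightarrow> ('o \<Rightarrow> 'y rel) \<Rightarrow> ('x \<times> 'y) rel"
where
  "sigma_cong C X Y E1 E2 = {((x1, y1), (x2, y2)). \<exists>A\<in>C. \<exists>B\<in>C.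
     x1 \<in> X A \<and> x2 \<in> X A \<and> y1 \<in> Y B \<and> y2 \<in> Y B \<and> (x1, x2) \<in> E1 A \<and> (y1, y2) \<in> E2 B}"

text \<open>Isomorphism of lattices, each given as a set with its lattice order.\<close>

definition lattice_iso ::
  "'u set \<Rightarrow> ('u \<Rightarrow> 'u \<Rightarrow> bool) \<Rightarrow> 'v set \<Rightarrow> ('v \<Rightarrow> 'v \<Rightarrow> bool) \<Rightarrow> bool" where
  "lattice_iso L R L' R' \<longleftrightarrow>
     (\<exists>f. bij_betw f L L' \<and> (\<forall>x\<in>L. \<forall>y\<in>L. R x y \<longleftrightarrow> R' (f x) (f y)))"

section \<open>Brauer partitions\<close>

text \<open>A totally ordered set is represented by its reflexive order relation \<open>A\<close>; the underlying
  set is \<open>Field A\<close>. The copies \<open>x\<close>, \<open>x''\<close>, \<open>x'\<close> of a point are \<open>Top x\<close>, \<open>Mid x\<close>, \<open>Bot x\<close>.\<close>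

datatype 'a vertex = Top 'a | Mid 'a | Bot 'a

datatype 'a brauer = Brauer (src: "'a rel") (trg: "'a rel") (blocks: "'a vertex set set")

definition verts :: "'a rel \<Rightarrow> 'a rel \<Rightarrow> 'a vertex set" where
  "verts A B = Top ` Field A \<union> Bot ` Field B"

definition brauer_hom :: "'a rel \<Rightarrow> 'a rel \<Rightarrow> 'a brauer set" where
  "brauer_hom A B =
     {Brauer A B P | P. partition_on (verts A B) P \<and> (\<forall>b\<in>P. card b = 2)}"

definition rel_of :: "'v set set \<Rightarrow> 'v rel" where
  "rel_of P = {(x, y). \<exists>b\<in>P. x \<in> b \<and> y \<in> b}"

definition equiv_join :: "'v set \<Rightarrow> 'v rel \<Rightarrow> 'v rel \<Rightarrow> 'v rel" where
  "equiv_join Z r s = \<Inter>{t. equiv Z t \<and> r \<subseteq> t \<and> s \<subseteq> t}"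

fun bot_to_mid :: "'a vertex \<Rightarrow> 'a vertex" where
  "bot_to_mid (Bot x) = Mid x"
| "bot_to_mid v = v"

fun top_to_mid :: "'a vertex \<Rightarrow> 'a vertex" where
  "top_to_mid (Top x) = Mid x"
| "top_to_mid v = v"

definition brauer_mult :: "'a brauer \<Rightarrow> 'a brauer \<Rightarrow> 'a brauer" where
  "brauer_mult \<alpha> \<beta> =
     (let A = src \<alpha>; B = trg \<alpha>; C = trg \<beta>;
          J = equiv_join (Top ` Field A \<union> Mid ` Field B \<union> Bot ` Field C)
                (map_prod bot_to_mid bot_to_mid ` rel_of (blocks \<alpha>))
                (map_prod top_to_mid top_to_mid ` rel_of (blocks \<beta>))
      in Brauer A C (verts A C // (J \<inter> verts A C \<times> verts A C)))"

definition rank :: "'a brauer \<Rightarrow> nat" where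
  "rank \<alpha> = card {b \<in> blocks \<alpha>.
     b \<inter> Top ` Field (src \<alpha>) \<noteq> {} \<and> b \<inter> Bot ` Field (trg \<alpha>) \<noteq> {}}"

text \<open>\<open>pos A a = i\<close> iff \<open>a = a\<^sub>i\<close>, where \<open>Field A = {a\<^sub>1 < \<dots> < a\<^sub>k}\<close>.\<close>

definition pos :: "'a rel \<Rightarrow> 'a \<Rightarrow> nat" where
  "pos A a = card {x \<in> Field A. (x, a) \<in> A}"

definition point :: "'a rel \<Rightarrow> 'a rel \<Rightarrow> 'a vertex \<Rightarrow> real^2" where
  "point A B v = (case v of
       Top a \<Rightarrow> vector [real (pos A a), 1]
     | Bot b \<Rightarrow> vector [real (pos B b), 0]
     | Mid _ \<Rightarrow> undefined)"

text \<open>The drawing: \<open>e b\<close> is the edge representing the block \<open>b\<close>.\<close>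

definition planar :: "'a brauer \<Rightarrow> bool" where
  "planar \<alpha> \<longleftrightarrow>
     (let A = src \<alpha>; B = trg \<alpha>; w = real (max (card (Field A)) (card (Field B)) + 1)
      in \<exists>e :: 'a vertex set \<Rightarrow> real \<Rightarrow> real^2.
        (\<forall>b\<in>blocks \<alpha>. arc (e b) \<and>
           path_image (e b) \<subseteq> cbox (vector [0, 0]) (vector [w, 1]) \<and>
           {pathstart (e b), pathfinish (e b)} = point A B ` b) \<and>
        (\<forall>b\<in>blocks \<alpha>. \<forall>c\<in>blocks \<alpha>. b \<noteq> c \<longrightarrow> path_image (e b) \<inter> path_image (e c) = {}))"

definition flip :: "'a rel \<Rightarrow> 'a brauer" where
  "flip A = Brauer A A
     {{Top a, Bot b} | a b. a \<in> Field A \<and> b \<in> Field A \<and> pos A a + pos A b = card (Field A) + 1}"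

definition anti_planar :: "'a brauer \<Rightarrow> bool" where
  "anti_planar \<alpha> \<longleftrightarrow> planar (brauer_mult (flip (src \<alpha>)) \<alpha>)"

definition TL :: "'a rel set \<Rightarrow> ('a rel, 'a brauer) psemigroup" where
  "TL C =
     \<lparr>arr = {\<alpha> \<in> \<Union>A\<in>C. \<Union>B\<in>C. brauer_hom A B. planar \<alpha>},
      dm = src, rn = trg, mul = brauer_mult\<rparr>"

definition TLpm :: "'a rel set \<Rightarrow> ('a rel, 'a brauer) psemigroup" where
  "TLpm C =
     \<lparr>arr = {\<alpha> \<in> \<Union>A\<in>C. \<Union>B\<in>C. brauer_hom A B. planar \<alpha> \<or> anti_planar \<alpha>},
      dm = src, rn = trg, mul = brauer_mult\<rparr>"

text \<open>The cardinal \<open>\<xi>\<close> is at most \<open>\<omega>\<close>, represented by \<open>\<infinity> :: enat\<close>.\<close>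

definition xi :: "'a rel set \<Rightarrow> enat" where
  "xi C = (LEAST k. \<forall>A\<in>C. enat (card (Field A)) < k)"

definition rank_ideal :: "('o, 'a brauer) psemigroup \<Rightarrow> enat \<Rightarrow> 'a brauer set" where
  "rank_ideal Q r = {\<alpha> \<in> arr Q. enat (rank \<alpha>) \<le> r}"

definition rank_class :: "('o, 'a brauer) psemigroup \<Rightarrow> nat \<Rightarrow> 'a brauer set" where
  "rank_class Q q = {\<alpha> \<in> arr Q. rank \<alpha> = q}"

section \<open>Planar equivalences on a totally ordered set\<close>

definition Eq2 :: "'a rel \<Rightarrow> 'a rel set" where
  "Eq2 A = {\<epsilon> \<in> Eqs (Field A).
     (\<exists>!U. U \<in> Field A // \<epsilon> \<and> card U = 1) \<and>
     (\<forall>U\<in>Field A // \<epsilon>. card U = 1 \<or> card U = 2)}"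

definition less_in :: "'a rel \<Rightarrow> 'a \<Rightarrow> 'a \<Rightarrow> bool" where
  "less_in A u v \<longleftrightarrow> (u, v) \<in> A \<and> u \<noteq> v"

definition separated :: "'a rel \<Rightarrow> 'a set \<Rightarrow> 'a set \<Rightarrow> bool" where
  "separated A U V \<longleftrightarrow>
     (\<forall>u\<in>U. \<forall>v\<in>V. less_in A u v) \<or> (\<forall>u\<in>U. \<forall>v\<in>V. less_in A v u)"

definition nested_by :: "'a rel \<Rightarrow> 'a set \<Rightarrow> 'a set \<Rightarrow> bool" where
  "nested_by A U V \<longleftrightarrow> (\<exists>v1\<in>V. \<exists>v2\<in>V.
     (\<forall>u\<in>U. less_in A v1 u \<and> less_in A u v2) \<and>
     \<not> (\<exists>v\<in>V. less_in A v1 v \<and> less_in A v v2))"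

definition planar_equiv :: "'a rel \<Rightarrow> 'a rel \<Rightarrow> bool" where
  "planar_equiv A \<epsilon> \<longleftrightarrow> (\<forall>U\<in>Field A // \<epsilon>. \<forall>V\<in>Field A // \<epsilon>. U \<noteq> V \<longrightarrow>
     separated A U V \<or> nested_by A U V \<or> nested_by A V U)"

definition planar_Eq2_open :: "'a rel \<Rightarrow> 'a rel set" where
  "planar_Eq2_open A = {\<epsilon> \<in> Eq2 A. planar_equiv A \<epsilon> \<and>
     (\<forall>U\<in>Field A // \<epsilon>. card U = 1 \<longrightarrow>
        \<not> (\<exists>V\<in>Field A // \<epsilon>. V \<noteq> U \<and> nested_by A U V))}"

end

theory Submission
  imports Defs
begin

text \<open>A Brauer partition is treated as a fixed-point-free involution on its vertices, and products are
  obtained by contracting the edges along the middle row one after another. Contraction of neighbours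
  preserves non-crossing matchings, which by a plane crossing argument are exactly the planar
  partitions. A planar or anti-planar partition is determined, up to the sign, by its upper and lower
  patterns of nested arcs, and these patterns decide the Green relations.

  Congruences are classified by descent on rank. If two related partitions differ in their patterns,
  a multiplier separates their ranks, and multiplying by projections produces related pairs at every
  lower rank; this collapses everything of at most the given rank. If they share their patterns, so
  that only the sign differs, everything two ranks below collapses. In rank one, a single related pair
  with different upper (lower) patterns yields all such pairs, because any two patterns with one defect
  are linked by patterns that extend a common pattern with three defects.\<close>

section \<open>Contracting perfect matchings\<close>

text \<open>A join of equivalences gives no direct access to the partner of a vertex. Contracting
  one edge at a time keeps a perfect matching at every stage, closed loops simply disappearing, and
  the relation \<open>glued\<close> states what the result has to do with the join without
  mentioning the order of contraction; planarity may then use an order of its own. The second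
  obstacle is that a congruence on an ideal admits multiplication only by elements of this ideal, so
  a multiplier that separates two partitions of rank q must itself have rank at most
  \<open>max q 3\<close>. The 3 is affordable because r is at least 3; to stay within the bound,
  open points are closed in adjacent pairs, each time by a contraction that still tells the two
  patterns apart and lowers the rank of at most one of them. Odd cardinalities keep ranks odd, so
  ranks fall by at least two and never reach 0. Both signs give at most two partitions with the same
  patterns, which makes the group part of a congruence all or nothing. The anti-involution
  \<open>star\<close> exchanges upper and lower patterns and halves most arguments.\<close>

definition matching :: "'v set => ('v => 'v) => bool" where
  "matching V f \<longleftrightarrow> (\<forall>v\<in>V. f v \<in> V \<and> f v \<noteq> v \<and> f (f v) = v)"

text \<open>Stated from the lower end of an arc only, which suits later key computations;
  \<open>noncross_iff\<close> restores the symmetry between the two ends.\<close>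

definition noncross :: "'v set => ('v => int) => ('v => 'v) => bool" where
  "noncross V k f \<longleftrightarrow>
     (\<forall>v\<in>V. \<forall>w\<in>V. k v < k w \<and> k w < k (f v) --> k v < k (f w) \<and> k (f w) < k (f v))"

lemma matchingD:
  assumes "matching V f" "v \<in> V"
  shows "f v \<in> V" "f v \<noteq> v" "f (f v) = v"
  using assms by (auto simp: matching_def)

lemma noncrossD:
  assumes "noncross V k f" "v \<in> V" "w \<in> V" "k v < k w" "k w < k (f v)"
  shows "k v < k (f w)" "k (f w) < k (f v)"
  using assms by (auto simp: noncross_def)

text \<open>An edge from x to y is inserted and shrunk: the arcs ending at x and at y become one arc
  between their far ends. If x and y are partners, no other vertex is affected and the closed loop
  is dropped.\<close>

definition contract :: "'v => 'v => ('v => 'v) => 'v => 'v" where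
  "contract x y f = (\<lambda>z. if f z = x then f y else if f z = y then f x else f z)"

lemma matching_contract:
  assumes "matching V f" "x \<in> V" "y \<in> V" "x \<noteq> y"
  shows "matching (V - {x, y}) (contract x y f)"
  using assms unfolding matching_def contract_def
  by (auto; metis)

definition btw :: "int => int => int => bool" where
  "btw a b z \<longleftrightarrow> a < z \<and> z < b \<or> b < z \<and> z < a"

text \<open>Interlacing of two disjoint pairs is symmetric: one pair separates the other exactly
  when it is separated by it.\<close>

lemma btw_sym:
  assumes "a \<noteq> c" "a \<noteq> d" "b \<noteq> c" "b \<noteq> d" "btw a b c = btw a b d" "a \<noteq> b" "c \<noteq> d"
  shows "btw c d a = btw c d b"
  using assms unfolding btw_def by linarith

text \<open>The symmetric form: no arc separates the two ends of another arc. To get it, the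
  one-sided condition is applied from both ends of the arc at v, and to w as well as to
  \<open>f w\<close>.\<close>

lemma noncross_iff:
  assumes m: "matching V f" and k: "inj_on k V"
  shows "noncross V k f \<longleftrightarrow> (\<forall>v\<in>V. \<forall>w\<in>V. w \<noteq> v \<and> w \<noteq> f v -->
    btw (k v) (k (f v)) (k w) = btw (k v) (k (f v)) (k (f w)))" (is "_ = ?R")
proof
  note M = matchingD[OF m]
  {
    assume n: "noncross V k f"
    show ?R
    proof (intro ballI impI)
      fix v w assume vw: "v \<in> V" "w \<in> V" "w \<noteq> v \<and> w \<noteq> f v"
      have *: "btw (k v) (k (f v)) (k (f w))" if "btw (k v) (k (f v)) (k w)" "w \<in> V" for w
        using that noncrossD[OF n, of v w] noncrossD[OF n, of "f v" w] M(1,3)[OF vw(1)] vw(1)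
        unfolding btw_def by auto
      show "btw (k v) (k (f v)) (k w) = btw (k v) (k (f v)) (k (f w))"
        using *[of w] *[of "f w"] M(1,3)[OF vw(2)] vw(2) by auto
    qed
  next
    assume R: ?R
    show "noncross V k f"
      unfolding noncross_def
    proof (intro ballI impI)
      fix v w assume a: "v \<in> V" "w \<in> V" "k v < k w \<and> k w < k (f v)"
      then have "btw (k v) (k (f v)) (k (f w))" using R by (auto simp: btw_def)
      then show "k v < k (f w) \<and> k (f w) < k (f v)" using a by (auto simp: btw_def)
    qed
  }
qed

text \<open>As x and y are neighbours, no pair of other vertices separates them. An old arc
  therefore has both ends of the new arc on one side; the exchanged roles are handled by
  \<open>btw_sym\<close>.\<close>

lemma noncross_contract:
  assumes m: "matching V f" and n: "noncross V k f" and k: "inj_on k V"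
    and xy: "x \<in> V" "y \<in> V" "k x < k y" and adj: "\<forall>z\<in>V. \<not> (k x < k z \<and> k z < k y)"
  shows "noncross (V - {x, y}) k (contract x y f)"
proof -
  let ?g = "contract x y f" and ?U = "V - {x, y}"
  note M = matchingD[OF m]
  have xy_ne: "x \<noteq> y" using xy by auto
  have mg: "matching ?U ?g" by (rule matching_contract[OF m xy(1,2) xy_ne])
  note G = matchingD[OF mg]
  have ki: "k a = k b \<longleftrightarrow> a = b" if "a \<in> V" "b \<in> V" for a b
    using k that by (auto dest: inj_onD)
  have nc: "btw (k v) (k (f v)) (k w) = btw (k v) (k (f v)) (k (f w))"
    if "v \<in> V" "w \<in> V" "w \<noteq> v" "w \<noteq> f v" for v w
    using n noncross_iff[OF m k] that by blast
  have bxy: "btw (k a) (k b) (k x) = btw (k a) (k b) (k y)" if "a \<in> ?U" "b \<in> ?U" for a b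
    using adj that ki[of a x] ki[of a y] ki[of b x] ki[of b y] xy unfolding btw_def by force
  have gi: "?g z = (if f z = x then f y else if f z = y then f x else f z)" for z
    by (simp add: contract_def)
  \<comment> \<open>Along the path from w through x and y to its new partner, every leg stays on the
    same side of the old arc at v.\<close>
  have A: "btw (k v) (k (f v)) (k w) = btw (k v) (k (f v)) (k (?g w))"
    if v: "v \<in> ?U" "w \<in> ?U" "w \<noteq> v" "w \<noteq> f v" "f v \<notin> {x, y}" for v w
  proof -
    have fv: "f v \<in> ?U" and V: "v \<in> V" "w \<in> V" using v M(1) by auto
    have x: "btw (k v) (k (f v)) (k x) = btw (k v) (k (f v)) (k (f x))"
      and y: "btw (k v) (k (f v)) (k y) = btw (k v) (k (f v)) (k (f y))"
      using nc[of v x] nc[of v y] v xy by auto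
    show ?thesis using x y nc[OF V v(3,4)] bxy[OF v(1) fv] unfolding gi by auto
  qed
  have "btw (k v) (k (?g v)) (k w) = btw (k v) (k (?g v)) (k (?g w))"
    if v: "v \<in> ?U" "w \<in> ?U" "w \<noteq> v" "w \<noteq> ?g v" for v w
  proof (cases "f v \<in> {x, y}")
    case False
    then have "?g v = f v" by (auto simp: gi)
    then show ?thesis using A[OF v(1-3)] v False by auto
  next
    case True
    have V: "v \<in> V" "w \<in> V" using v by auto
    \<comment> \<open>Only one arc is new. If it is the one at v, the arc at w is an old one, so the
      previous case applies with the roles exchanged.\<close>
    have fw: "f w \<notin> {x, y}"
    proof
      assume "f w \<in> {x, y}"
      then consider "f x = w" | "f y = w" using M(3)[OF V(2)] by auto
      then show False
        using True v(3,4) M(3)[OF V(1)] xy_ne M(3)[OF xy(1)] M(3)[OF xy(2)]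
        by cases (auto simp: gi split: if_splits)
    qed
    then have gw: "?g w = f w" by (auto simp: gi)
    have "v \<noteq> f w" using v(1) True fw M(3)[OF V(2)] v(2) by auto
    then have b: "btw (k w) (k (f w)) (k v) = btw (k w) (k (f w)) (k (?g v))"
      using A[OF v(2,1)] v(3) fw by auto
    show ?thesis unfolding gw
    proof (rule btw_sym[of "k w" "k v" "k (?g v)" "k (f w)"])
      have m: "?g v \<in> V" "f w \<in> V" "f w \<noteq> w" "?g v \<noteq> v" using G(1,2)[OF v(1)] M(1,2)[OF V(2)] by auto
      have "?g v \<noteq> f w" using v(1,2,3) G(3)[OF v(1)] G(3)[OF v(2)] gw by metis
      then show "k w \<noteq> k v" "k w \<noteq> k (?g v)" "k (f w) \<noteq> k v" "k (f w) \<noteq> k (?g v)"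
        "k w \<noteq> k (f w)" "k v \<noteq> k (?g v)"
        using m V v(3,4) ki \<open>v \<noteq> f w\<close> by auto
    qed (rule b)
  qed
  then show ?thesis
    using noncross_iff[OF mg inj_on_subset[OF k]] by blast
qed

text \<open>On \<open>W\<close> the join of the f-edges with \<open>P\<close> consists of the
  h-edges. The second conjunct bounds the join from below, in every equivalence t, and the third
  from above, by one separating equivalence \<open>R\<close>; this form passes through quotient maps
  without computing a join.\<close>

definition glued :: "'v set => ('v => 'v) => 'v rel => 'v set => ('v => 'v) => bool" where
  "glued V f P W h \<longleftrightarrow> matching W h \<and>
     (\<forall>t. equiv V t \<and> (\<forall>v\<in>V. (v, f v) \<in> t) \<and> P \<subseteq> t --> (\<forall>a\<in>W. (a, h a) \<in> t)) \<and>
     (\<exists>R. equiv V R \<and> (\<forall>v\<in>V. (v, f v) \<in> R) \<and> P \<subseteq> R \<and>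
        (\<forall>a\<in>W. \<forall>b\<in>W. (a, b) \<in> R --> b = a \<or> b = h a))"

lemma gluedE:
  assumes "glued V f P W h"
  obtains R where "equiv V R" "\<And>v. v \<in> V ==> (v, f v) \<in> R" "P \<subseteq> R"
    "\<And>a b. a \<in> W ==> b \<in> W ==> (a, b) \<in> R ==> b = a \<or> b = h a"
  using assms unfolding glued_def by metis

lemma gluedD:
  assumes "glued V f P W h"
  shows "matching W h"
    and "equiv V t ==> (\<And>v. v \<in> V ==> (v, f v) \<in> t) ==> P \<subseteq> t ==> a \<in> W ==> (a, h a) \<in> t"
  using assms unfolding glued_def by simp_all

lemma gluedI:
  assumes "matching W h"
    and "\<And>t a. equiv V t ==> (\<forall>v\<in>V. (v, f v) \<in> t) ==> P \<subseteq> t ==> a \<in> W ==> (a, h a) \<in> t"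
    and "equiv V R" "\<And>v. v \<in> V ==> (v, f v) \<in> R" "P \<subseteq> R"
    and "\<And>a b. a \<in> W ==> b \<in> W ==> (a, b) \<in> R ==> b = a \<or> b = h a"
  shows "glued V f P W h"
  unfolding glued_def using assms by meson

text \<open>Neighbourhood is tested among the vertices still present when the pair is contracted,
  which is what \<open>noncross_contract\<close> needs; nested pairs must be listed from the
  inside.\<close>

fun innermost_first :: "('v => int) => 'v set => ('v \<times> 'v) list => bool" where
  "innermost_first k V [] \<longleftrightarrow> True"
| "innermost_first k V ((x, y) # ps) \<longleftrightarrow> k x < k y \<and> (\<forall>z\<in>V. \<not> (k x < k z \<and> k z < k y)) \<and>
     innermost_first k (V - {x, y}) ps"

lemma equiv_memD:
  assumes "equiv V t"
  shows "v \<in> V ==> (v, v) \<in> t" "(u, v) \<in> t ==> (v, u) \<in> t" "(u, v) \<in> t ==> (v, w) \<in> t ==> (u, w) \<in> t"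
    "(u, v) \<in> t ==> u \<in> V" "(u, v) \<in> t ==> v \<in> V"
  using assms unfolding equiv_def refl_on_def sym_def trans_def by blast+

lemma equivI':
  assumes "t \<subseteq> V \<times> V" "\<And>v. v \<in> V ==> (v, v) \<in> t" "\<And>u v. (u, v) \<in> t ==> (v, u) \<in> t"
    "\<And>u v w. (u, v) \<in> t ==> (v, w) \<in> t ==> (u, w) \<in> t"
  shows "equiv V t"
  using assms unfolding equiv_def refl_on_def sym_def trans_def by blast

text \<open>Induction contracting the head of the list. The pairs being disjoint, the remaining ones
  survive in the smaller vertex set.\<close>

lemma ex_glued:
  assumes "matching V f" "distinct (map fst ps @ map snd ps)" "set (map fst ps @ map snd ps) \<subseteq> V"
  shows "\<exists>h. glued V f (set ps) (V - set (map fst ps @ map snd ps)) h \<and>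
     (noncross V k f \<and> inj_on k V \<and> innermost_first k V ps -->
      noncross (V - set (map fst ps @ map snd ps)) k h)"
  using assms
proof (induction ps arbitrary: V f)
  case Nil
  have "equiv V {(a, b). a \<in> V \<and> (b = a \<or> b = f a)}"
    using Nil(1) by (intro equivI') (auto simp: matching_def)
  then have "glued V f {} V f" unfolding glued_def using Nil(1) by (auto simp: matching_def)
  then show ?case by auto
next
  case (Cons p ps)
  obtain x y where p: "p = (x, y)" by fastforce
  have xy: "x \<in> V" "y \<in> V" "x \<noteq> y" using Cons(3,4) p by auto
  let ?g = "contract x y f" and ?U = "V - {x, y}"
  let ?W = "?U - set (map fst ps @ map snd ps)"
  have mg: "matching ?U ?g" using matching_contract Cons(2) xy by metis
  note M = matchingD[OF Cons(2)]
  have W: "V - set (map fst (p # ps) @ map snd (p # ps)) = ?W" using p by auto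
  obtain h where h: "glued ?U ?g (set ps) ?W h"
    and nh: "noncross ?U k ?g \<and> inj_on k ?U \<and> innermost_first k ?U ps --> noncross ?W k h"
  proof -
    have "distinct (map fst ps @ map snd ps)" "set (map fst ps @ map snd ps) \<subseteq> ?U"
      using Cons(3,4) p by auto
    from Cons(1)[OF mg this] show ?thesis by (elim exE conjE) (rule that)
  qed
  obtain R where R: "equiv ?U R" "\<And>v. v \<in> ?U ==> (v, ?g v) \<in> R" "set ps \<subseteq> R"
    "\<And>a b. a \<in> ?W ==> b \<in> ?W ==> (a, b) \<in> R ==> b = a \<or> b = h a"
    by (rule gluedE[OF h], rule that)
  \<comment> \<open>This map moves each removed vertex to a surviving vertex of its component, x to
    \<open>f x\<close> and y to \<open>f y\<close>. If x and y are partners they form a closed loop;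
    both go to x, which is outside the domain of \<open>R\<close> and hence becomes a class of its
    own.\<close>
  define \<rho> where "\<rho> v = (if v = x then if f x = y then x else f x
      else if v = y then if f x = y then x else f y else v)" for v
  define R' where "R' = {(a, b). a \<in> V \<and> b \<in> V \<and> (\<rho> a = \<rho> b \<or> (\<rho> a, \<rho> b) \<in> R)}"
  note RD = equiv_memD[OF R(1)]
  have eR: "equiv V R'"
  proof (rule equivI')
    show "(u, w) \<in> R'" if "(u, v) \<in> R'" "(v, w) \<in> R'" for u v w
      using that RD(3)[of "\<rho> u" "\<rho> v" "\<rho> w"] unfolding R'_def by auto
    show "(v, u) \<in> R'" if "(u, v) \<in> R'" for u v
      using that RD(2)[of "\<rho> u" "\<rho> v"] unfolding R'_def by auto
  qed (auto simp: R'_def)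
  have fR: "(v, f v) \<in> R'" if v: "v \<in> V" for v
  proof -
    have fxy: "f x = y \<longleftrightarrow> f y = x" "f v = x \<longleftrightarrow> f x = v" "f v = y \<longleftrightarrow> f y = v"
      using M(3) xy v by metis+
    have vg: "(v, ?g v) \<in> R" if "v \<notin> {x, y}" using R(2) that v by auto
    consider "v = x" | "v = y" | "v \<notin> {x, y}" "f v = x" | "v \<notin> {x, y}" "f v = y"
      | "v \<notin> {x, y}" "f v \<notin> {x, y}" by auto
    then have r: "\<rho> v = \<rho> (f v) \<or> (\<rho> v, \<rho> (f v)) \<in> R"
    proof cases
      case 1
      then show ?thesis using fxy M(2)[OF xy(1)] by (auto simp: \<rho>_def)
    next
      case 2
      then show ?thesis using fxy M(2)[OF xy(2)] xy by (auto simp: \<rho>_def)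
    next
      case 3
      then have "f x = v" "f x \<noteq> y" using fxy by auto
      then show ?thesis using 3 by (auto simp: \<rho>_def)
    next
      case 4
      then have "f y = v" "f x \<noteq> y" using fxy by auto
      then show ?thesis using 4 xy by (auto simp: \<rho>_def)
    next
      case 5
      then show ?thesis using vg by (auto simp: \<rho>_def contract_def)
    qed
    then show ?thesis using v M(1) unfolding R'_def by auto
  qed
  have PR: "set (p # ps) \<subseteq> R'"
  proof -
    have "(x, y) \<in> R'"
    proof (cases "f x = y")
      case True then show ?thesis using xy by (auto simp: R'_def \<rho>_def)
    next
      case False
      then have "f x \<in> ?U" "?g (f x) = f y" using M xy by (auto simp: contract_def)
      then have "(f x, f y) \<in> R" using R(2) by metis
      then show ?thesis using xy False by (auto simp: R'_def \<rho>_def)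
    qed
    moreover have "(a, b) \<in> R'" if "(a, b) \<in> set ps" for a b
    proof -
      have "(a, b) \<in> R" using R that by auto
      moreover have "a \<in> ?U" "b \<in> ?U" using RD(4,5)[OF \<open>(a, b) \<in> R\<close>] by auto
      ultimately show ?thesis by (auto simp: R'_def \<rho>_def)
    qed
    ultimately show ?thesis using p by auto
  qed
  have hR: "b = a \<or> b = h a" if ab: "a \<in> ?W" "b \<in> ?W" "(a, b) \<in> R'" for a b
  proof -
    have "\<rho> a = a" "\<rho> b = b" using ab by (auto simp: \<rho>_def)
    then have "a = b \<or> (a, b) \<in> R" using ab(3) by (auto simp: R'_def)
    then show ?thesis using R(4)[OF ab(1,2)] by blast
  qed
  have low: "(a, h a) \<in> t"
    if t: "equiv V t" "\<forall>v\<in>V. (v, f v) \<in> t" "set (p # ps) \<subseteq> t" and a: "a \<in> ?W" for t a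
  proof -
    note tD = equiv_memD[OF t(1)]
    \<comment> \<open>A contracted edge runs along two old edges and the pair (x, y), all of them in
      t, so the restriction of t contains it.\<close>
    let ?t = "t \<inter> ?U \<times> ?U"
    have "equiv ?U ?t"
    proof (rule equivI')
      show "(u, w) \<in> ?t" if "(u, v) \<in> ?t" "(v, w) \<in> ?t" for u v w
        using that tD(3)[of u v w] by auto
    qed (use tD(1,2) in auto)
    moreover have "(v, ?g v) \<in> ?t" if v: "v \<in> ?U" for v
    proof -
      have "(v, f v) \<in> t" "(x, y) \<in> t" "(x, f x) \<in> t" "(y, f y) \<in> t"
        using t v xy p by auto
      then have "(v, ?g v) \<in> t" unfolding contract_def using tD(2,3) by (metis (full_types))
      then show ?thesis using v matchingD(1)[OF mg v] by blast
    qed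
    moreover have "set ps \<subseteq> ?t"
    proof
      fix q assume q: "q \<in> set ps"
      then have "fst q \<in> set (map fst ps)" "snd q \<in> set (map snd ps)" by auto
      then have "fst q \<in> ?U" "snd q \<in> ?U" using Cons(3,4) p by auto
      moreover have "q \<in> t" using q t(3) by auto
      ultimately show "q \<in> ?t" by (cases q) auto
    qed
    ultimately have "(a, h a) \<in> ?t" using gluedD(2)[OF h, of ?t a] a by simp
    then show ?thesis by simp
  qed
  have "glued V f (set (p # ps)) ?W h"
    by (rule gluedI[OF gluedD(1)[OF h] low eR fR PR hR])
  moreover have "noncross ?W k h" if "noncross V k f" "inj_on k V" "innermost_first k V (p # ps)"
  proof -
    have "noncross ?U k ?g"
      using noncross_contract[OF Cons(2) that(1,2) xy(1,2)] that(3) p by auto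
    then show ?thesis using nh that p by (auto intro: inj_on_subset)
  qed
  ultimately show ?case unfolding W by blast
qed

text \<open>The map \<pi> identifies precisely the glued pairs, and \<open>R\<close> contains
  \<open>P\<close>; so \<open>R\<close> is saturated under \<pi> and its image is still an
  equivalence that separates different arcs.\<close>

lemma glued_push:
  assumes g: "glued V f P W h" and W: "W \<subseteq> V"
    and \<pi>: "\<And>u w. u \<in> V ==> w \<in> V ==> \<pi> u = \<pi> w \<longleftrightarrow> u = w \<or> (u, w) \<in> P \<or> (w, u) \<in> P"
  shows "\<exists>R. equiv (\<pi> ` V) R \<and> (\<forall>v\<in>V. (\<pi> v, \<pi> (f v)) \<in> R) \<and>
     (\<forall>a\<in>W. \<forall>b\<in>W. (\<pi> a, \<pi> b) \<in> R --> b = a \<or> b = h a)"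
proof -
  obtain R where R: "equiv V R" "\<And>v. v \<in> V ==> (v, f v) \<in> R" "P \<subseteq> R"
    "\<And>a b. a \<in> W ==> b \<in> W ==> (a, b) \<in> R ==> b = a \<or> b = h a"
    by (rule gluedE[OF g], rule that)
  note RD = equiv_memD[OF R(1)]
  let ?R = "map_prod \<pi> \<pi> ` R"
  have key: "(u, w) \<in> R" if "(\<pi> u, \<pi> w) \<in> ?R" "u \<in> V" "w \<in> V" for u w
  proof -
    from that(1) obtain q where q: "(\<pi> u, \<pi> w) = map_prod \<pi> \<pi> q" "q \<in> R" by (rule imageE)
    then obtain u' w' where uw: "(u', w') \<in> R" "\<pi> u = \<pi> u'" "\<pi> w = \<pi> w'" by (cases q) auto
    have V: "u' \<in> V" "w' \<in> V" using RD(4,5)[OF uw(1)] by auto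
    have "(u, u') \<in> R" using \<pi>[of u u'] uw(2) that(2) V R(3) RD(1,2) by auto
    moreover have "(w', w) \<in> R" using \<pi>[of w w'] uw(3) that(3) V R(3) RD(1,2) by auto
    ultimately show ?thesis using uw(1) RD(3) by meson
  qed
  have "equiv (\<pi> ` V) ?R"
  proof (rule equivI')
    fix u v w assume "(u, v) \<in> ?R" "(v, w) \<in> ?R"
    then obtain a b c d where abcd: "(a, b) \<in> R" "(c, d) \<in> R" "u = \<pi> a" "v = \<pi> b" "v = \<pi> c" "w = \<pi> d" by auto
    have "b \<in> V" "c \<in> V" using RD(4,5)[OF abcd(1)] RD(4,5)[OF abcd(2)] by auto
    then have "(b, c) \<in> R" using \<pi>[of b c] abcd(4,5) RD(1,2) R(3) by auto
    then have "(a, d) \<in> R" using abcd(1,2) RD(3) by meson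
    then show "(u, w) \<in> ?R" using abcd by force
  next
    fix u v assume "(u, v) \<in> ?R" then show "(v, u) \<in> ?R" using RD(2) by force
  next
    show "?R \<subseteq> \<pi> ` V \<times> \<pi> ` V" using RD(4,5) by force
  next
    fix v assume "v \<in> \<pi> ` V" then show "(v, v) \<in> ?R" using RD(1) by force
  qed
  moreover have "\<forall>v\<in>V. (\<pi> v, \<pi> (f v)) \<in> ?R" using R(2) by force
  moreover have "\<forall>a\<in>W. \<forall>b\<in>W. (\<pi> a, \<pi> b) \<in> ?R --> b = a \<or> b = h a"
  proof (intro ballI impI)
    fix a b assume "a \<in> W" "b \<in> W" "(\<pi> a, \<pi> b) \<in> ?R"
    then show "b = a \<or> b = h a" using R(4) key[of a b] W by (simp add: subset_iff)
  qed
  ultimately show ?thesis by (intro exI[of _ ?R] conjI)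
qed

text \<open>The connecting half under a quotient map: t is pulled back along \<pi>. Reflexivity on
  the image comes from walking along an edge and back.\<close>

lemma glued_path:
  assumes g: "glued V f P W h" and m: "matching V f" and W: "W \<subseteq> V"
    and P: "P \<subseteq> V \<times> V" "\<And>u w. (u, w) \<in> P ==> \<pi> u = \<pi> w"
    and t: "sym t" "trans t" "\<And>v. v \<in> V ==> (\<pi> v, \<pi> (f v)) \<in> t" and a: "a \<in> W"
  shows "(\<pi> a, \<pi> (h a)) \<in> t"
proof -
  let ?t = "{(u, w). u \<in> V \<and> w \<in> V \<and> (\<pi> u, \<pi> w) \<in> t}"
  have refl: "(\<pi> v, \<pi> v) \<in> t" if "v \<in> V" for v
    using t that by (meson symD transD)
  have "equiv V ?t"
  proof (rule equivI')
    show "(u, w) \<in> ?t" if "(u, v) \<in> ?t" "(v, w) \<in> ?t" for u v w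
      using that t(2) by (auto dest: transD)
    show "(v, u) \<in> ?t" if "(u, v) \<in> ?t" for u v
      using that t(1) by (auto dest: symD)
  qed (use refl in auto)
  moreover have "\<forall>v\<in>V. (v, f v) \<in> ?t" using t(3) m by (auto simp: matching_def)
  moreover have "P \<subseteq> ?t" using P refl by fastforce
  ultimately have "(a, h a) \<in> ?t" using gluedD(2)[OF g] a by meson
  then show ?thesis by simp
qed

section \<open>Products of Brauer partitions\<close>

abbreviation brauer_prod :: "'a brauer => 'a brauer => 'a brauer" (infixl "\<cdot>" 70)
  where "x \<cdot> y \<equiv> brauer_mult x y"

lemma verts_simps [simp]:
  "Top a \<in> verts A B \<longleftrightarrow> a \<in> Field A"
  "Bot a \<in> verts A B \<longleftrightarrow> a \<in> Field B"
  "Mid a \<notin> verts A B"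
  by (auto simp: verts_def)

lemma vertsE:
  assumes "v \<in> verts A B"
  obtains a where "v = Top a" "a \<in> Field A" | b where "v = Bot b" "b \<in> Field B"
  using assms by (auto simp: verts_def)

lemma brauer_hom_sel:
  "x \<in> brauer_hom A B ==> src x = A" "x \<in> brauer_hom A B ==> trg x = B"
  by (auto simp: brauer_hom_def)

section \<open>Brauer partitions as involutions on their vertices\<close>

definition mate :: "'a brauer => 'a vertex => 'a vertex" where
  "mate x v = (THE w. w \<noteq> v \<and> {v, w} \<in> blocks x)"

definition of_mate :: "'a rel => 'a rel => ('a vertex => 'a vertex) => 'a brauer" where
  "of_mate A B f = Brauer A B ((\<lambda>v. {v, f v}) ` verts A B)"

lemma mate_eqI:
  assumes "x \<in> brauer_hom A B" "{v, w} \<in> blocks x" "w \<noteq> v"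
  shows "mate x v = w"
  unfolding mate_def
proof (rule the_equality)
  show "w \<noteq> v \<and> {v, w} \<in> blocks x" using assms by simp
  fix u assume u: "u \<noteq> v \<and> {v, u} \<in> blocks x"
  have "partition_on (verts A B) (blocks x)" using assms(1) by (auto simp: brauer_hom_def)
  then have "{v, u} = {v, w}"
    using u assms(2) by (auto simp: partition_on_def dest: disjointD)
  then show "u = w" using u assms(3) by (auto simp: doubleton_eq_iff)
qed

lemma mate_block:
  assumes "x \<in> brauer_hom A B" "v \<in> verts A B"
  shows "{v, mate x v} \<in> blocks x" "mate x v \<noteq> v" "mate x v \<in> verts A B"
proof -
  have p: "partition_on (verts A B) (blocks x)" "\<forall>b\<in>blocks x. card b = 2"
    using assms(1) by (auto simp: brauer_hom_def)
  then obtain b where b: "b \<in> blocks x" "v \<in> b" using assms(2) by (auto simp: partition_on_def)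
  then obtain w where w: "b = {v, w}" "w \<noteq> v" using p(2) by (force simp: card_2_iff)
  then have "mate x v = w" using mate_eqI[OF assms(1)] b by simp
  then show "{v, mate x v} \<in> blocks x" "mate x v \<noteq> v" "mate x v \<in> verts A B"
    using w b p(1) by (auto simp: partition_on_def)
qed

lemma matching_mate:
  assumes "x \<in> brauer_hom A B"
  shows "matching (verts A B) (mate x)"
  unfolding matching_def
proof
  fix v assume v: "v \<in> verts A B"
  note m = mate_block[OF assms v]
  have "mate x (mate x v) = v"
    using mate_eqI[OF assms, of "mate x v" v] m by (simp add: insert_commute)
  then show "mate x v \<in> verts A B \<and> mate x v \<noteq> v \<and> mate x (mate x v) = v" using m by simp
qed

lemmas mateD = matchingD[OF matching_mate]

lemma blocks_mate:
  assumes "x \<in> brauer_hom A B"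
  shows "blocks x = (\<lambda>v. {v, mate x v}) ` verts A B"
proof
  show "(\<lambda>v. {v, mate x v}) ` verts A B \<subseteq> blocks x" using mate_block[OF assms] by auto
  have p: "partition_on (verts A B) (blocks x)" "\<forall>b\<in>blocks x. card b = 2"
    using assms(1) by (auto simp: brauer_hom_def)
  show "blocks x \<subseteq> (\<lambda>v. {v, mate x v}) ` verts A B"
  proof
    fix b assume b: "b \<in> blocks x"
    then obtain v w where vw: "b = {v, w}" "v \<noteq> w" using p(2) by (force simp: card_2_iff)
    then have "mate x v = w" using mate_eqI[OF assms] b by auto
    moreover have "v \<in> verts A B" using vw b p(1) by (auto simp: partition_on_def)
    ultimately show "b \<in> (\<lambda>v. {v, mate x v}) ` verts A B" using vw by auto
  qed
qed

lemma of_mate_mate: "x \<in> brauer_hom A B ==> of_mate A B (mate x) = x"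
  using blocks_mate[of x A B] brauer_hom_sel[of x A B] by (cases x) (auto simp: of_mate_def)

lemma of_mate_cong: "(\<And>v. v \<in> verts A B ==> f v = g v) ==> of_mate A B f = of_mate A B g"
  by (auto simp: of_mate_def intro!: image_cong)

lemma brauer_eqI:
  assumes "x \<in> brauer_hom A B" "y \<in> brauer_hom A B"
    and "\<And>v. v \<in> verts A B ==> mate x v = mate y v"
  shows "x = y"
  using of_mate_mate[OF assms(1)] of_mate_mate[OF assms(2)] of_mate_cong[of A B "mate x" "mate y"] assms(3)
  by metis

lemma of_mate_hom:
  assumes m: "matching (verts A B) f"
  shows "of_mate A B f \<in> brauer_hom A B"
proof -
  let ?P = "(\<lambda>v. {v, f v}) ` verts A B"
  note M = matchingD[OF m]
  have "partition_on (verts A B) ?P"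
  proof (rule partition_onI)
    show "\<Union> ?P = verts A B" using M by auto
    fix p q assume "p \<in> ?P" "q \<in> ?P" "p \<noteq> q"
    then show "disjnt p q" using M by (auto simp: disjnt_def; metis)
  qed auto
  moreover have "\<forall>b\<in>?P. card b = 2" using M(2) by (auto simp: card_2_iff; metis)
  ultimately show ?thesis by (auto simp: brauer_hom_def of_mate_def)
qed

lemma mate_of_mate:
  assumes m: "matching (verts A B) f" "v \<in> verts A B"
  shows "mate (of_mate A B f) v = f v"
  by (rule mate_eqI[OF of_mate_hom[OF m(1)]]) (use matchingD[OF m] m in \<open>auto simp: of_mate_def\<close>)

lemma rel_of_blocks:
  assumes "x \<in> brauer_hom A B"
  shows "rel_of (blocks x) = {(v, w). v \<in> verts A B \<and> (w = v \<or> w = mate x v)}"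
  unfolding blocks_mate[OF assms] rel_of_def using mateD[OF assms] by auto

section \<open>Stacks of composable partitions\<close>

fun place :: "nat => 'a vertex => nat \<times> 'a" where
  "place i (Top a) = (i, a)"
| "place i (Mid a) = (i, a)"
| "place i (Bot a) = (Suc i, a)"

text \<open>The disjoint union of all factors before any gluing. Factor j, counted from 0, occupies
  row 2j with its upper and row 2j+1 with its lower vertices.\<close>

definition stack :: "'a brauer list => nat \<times> 'a => nat \<times> 'a" where
  "stack xs p = place (2 * (fst p div 2))
     (mate (xs ! (fst p div 2)) (if even (fst p) then Top (snd p) else Bot (snd p)))"

text \<open>Rows 2j-1 and 2j both carry the object number j, whence \<open>(i + 1) div 2\<close>;
  row 0 and the last row carry the outer objects.\<close>

definition levels :: "'a rel list => (nat \<times> 'a) set" where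
  "levels As = {(i, a). i < 2 * (length As - 1) \<and> a \<in> Field (As ! ((i + 1) div 2))}"

definition composable :: "'a rel list => 'a brauer list => bool" where
  "composable As xs \<longleftrightarrow> length As = Suc (length xs) \<and>
     (\<forall>j<length xs. xs ! j \<in> brauer_hom (As ! j) (As ! Suc j))"

lemma stack_place:
  assumes "v \<in> verts A B" "even i"
  shows "stack xs (place i v) = place i (mate (xs ! (i div 2)) v)"
  using assms by (cases v) (auto simp: stack_def)

lemma place_levels:
  assumes "j < length xs" "composable As xs" "v \<in> verts (As ! j) (As ! Suc j)"
  shows "place (2 * j) v \<in> levels As"
  using assms by (cases v) (auto simp: levels_def composable_def)

lemma levelsE:
  assumes "p \<in> levels As" "composable As xs"
  obtains j v where "j < length xs" "v \<in> verts (As ! j) (As ! Suc j)" "p = place (2 * j) v"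
proof -
  obtain i a where p: "p = (i, a)" by fastforce
  let ?j = "i div 2" and ?v = "if even i then Top a else Bot a"
  have "?j < length xs" using assms p by (auto simp: levels_def composable_def)
  moreover have "?v \<in> verts (As ! ?j) (As ! Suc ?j)"
    using assms p by (auto simp: levels_def elim!: evenE oddE)
  moreover have "p = place (2 * ?j) ?v" using p by (auto elim!: evenE oddE)
  ultimately show thesis using that by blast
qed

lemma place_inj:
  "v \<in> verts A B ==> w \<in> verts A B ==> place i v = place i w \<longleftrightarrow> v = w"
  by (cases v; cases w) auto

lemma matching_stack:
  assumes c: "composable As xs"
  shows "matching (levels As) (stack xs)"
  unfolding matching_def
proof
  fix p assume "p \<in> levels As"
  then obtain j v where p: "j < length xs" "v \<in> verts (As ! j) (As ! Suc j)" "p = place (2 * j) v"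
    using levelsE c by blast
  have h: "xs ! j \<in> brauer_hom (As ! j) (As ! Suc j)" using c p by (auto simp: composable_def)
  note M = mateD[OF h p(2)]
  have s: "stack xs p = place (2 * j) (mate (xs ! j) v)" using stack_place[OF p(2)] p(3) by simp
  have s2: "stack xs (stack xs p) = p" unfolding s using stack_place[OF M(1), of "2 * j" xs] M(3) p(3) by simp
  show "stack xs p \<in> levels As \<and> stack xs p \<noteq> p \<and> stack xs (stack xs p) = p"
    using s s2 place_levels[OF p(1) c M(1)] place_inj[OF M(1) p(2)] M(2) p(3) by simp
qed

text \<open>The lower row of factor j-1 faces the upper row of factor j; only the inner objects
  occur.\<close>

definition seam :: "'a rel list => ((nat \<times> 'a) \<times> (nat \<times> 'a)) set" where
  "seam As = {((2 * j - 1, b), (2 * j, b)) | j b. 0 < j \<and> j < length As - 1 \<and> b \<in> Field (As ! j)}"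

text \<open>First components of the seam fill the odd rows except the last one, second components
  the even rows except row 0. What remains after contraction are the two outer rows, that is, the
  vertices of the product.\<close>

lemma ex_stack_glued:
  assumes c: "composable As xs" and ps: "set ps = seam As" "distinct ps"
  shows "\<exists>h. glued (levels As) (stack xs) (seam As)
      {(i, a) \<in> levels As. i = 0 \<or> i = 2 * length xs - 1} h \<and>
    (noncross (levels As) k (stack xs) \<and> inj_on k (levels As) \<and> innermost_first k (levels As) ps -->
      noncross {(i, a) \<in> levels As. i = 0 \<or> i = 2 * length xs - 1} k h)"
proof -
  have fst: "inj_on fst (seam As)" and snd: "inj_on snd (seam As)"
    by (auto simp: inj_on_def seam_def)
  have fs: "fst ` seam As = {(i, a) \<in> levels As. odd i \<and> i \<noteq> 2 * length xs - 1}"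
  proof (intro equalityI subsetI)
    fix p assume "p \<in> {(i, a) \<in> levels As. odd i \<and> i \<noteq> 2 * length xs - 1}"
    then obtain i a where p: "p = (i, a)" "(i, a) \<in> levels As" "odd i" "i \<noteq> 2 * length xs - 1" by auto
    then obtain j where j: "i = 2 * j + 1" by (auto elim: oddE)
    have "p = fst ((2 * Suc j - 1, a), (2 * Suc j, a))" using p j by simp
    moreover have "((2 * Suc j - 1, a), (2 * Suc j, a)) \<in> seam As"
      unfolding seam_def mem_Collect_eq by (rule exI[of _ "Suc j"], rule exI[of _ a])
        (use p j c in \<open>auto simp: levels_def composable_def\<close>)
    ultimately show "p \<in> fst ` seam As" by (metis image_eqI)
  qed (use c in \<open>auto simp: seam_def levels_def composable_def\<close>)
  have sn: "snd ` seam As = {(i, a) \<in> levels As. even i \<and> i \<noteq> 0}"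
  proof (intro equalityI subsetI)
    fix p assume "p \<in> {(i, a) \<in> levels As. even i \<and> i \<noteq> 0}"
    then obtain i a where p: "p = (i, a)" "(i, a) \<in> levels As" "even i" "i \<noteq> 0" by auto
    then obtain j where j: "i = 2 * j" by (auto elim: evenE)
    have "p = snd ((2 * j - 1, a), (2 * j, a))" using p j by simp
    moreover have "((2 * j - 1, a), (2 * j, a)) \<in> seam As"
      unfolding seam_def mem_Collect_eq by (rule exI[of _ j], rule exI[of _ a])
        (use p j c in \<open>auto simp: levels_def composable_def\<close>)
    ultimately show "p \<in> snd ` seam As" by (metis image_eqI)
  qed (use c in \<open>auto simp: seam_def levels_def composable_def\<close>)
  have d: "distinct (map fst ps @ map snd ps)"
    using ps fst snd fs sn by (auto simp: distinct_map)
  have U: "set (map fst ps @ map snd ps) = fst ` seam As \<union> snd ` seam As" using ps by simp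
  then have sub: "set (map fst ps @ map snd ps) \<subseteq> levels As" using fs sn by auto
  have W: "levels As - set (map fst ps @ map snd ps) = {(i, a) \<in> levels As. i = 0 \<or> i = 2 * length xs - 1}"
  proof -
    have "i = 0 \<or> i = 2 * length xs - 1 \<longleftrightarrow> \<not> (odd i \<and> i \<noteq> 2 * length xs - 1) \<and> \<not> (even i \<and> i \<noteq> 0)"
      if "(i, a) \<in> levels As" for i and a :: 'a
    proof -
      have "i < 2 * length xs" using that c by (auto simp: levels_def composable_def)
      then have "odd (2 * length xs - 1)" by (cases "length xs") auto
      then show ?thesis by (metis even_zero)
    qed
    then show ?thesis unfolding U fs sn by auto
  qed
  show ?thesis
    using ex_glued[OF matching_stack[OF c] d sub, of k] unfolding W ps(1) .
qed

text \<open>Cutting the rectangle open at its left side puts all vertices on a line, the upper row at negative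
  and the lower row at positive keys. Anti-planarity becomes non-crossing for the reversed
  order on the upper row.\<close>

definition vkey :: "('a => nat) => ('a => nat) => 'a vertex => int" where
  "vkey p q v = (case v of Top a => - int (p a) | Mid a => 0 | Bot b => int (q b))"

lemma vkey_simps [simp]:
  "vkey p q (Top a) = - int (p a)" "vkey p q (Bot b) = int (q b)"
  by (simp_all add: vkey_def)

lemma levels_3: "(i, a) \<in> levels [A, B, C] \<longleftrightarrow>
    i = 0 \<and> a \<in> Field A \<or> (i = 1 \<or> i = 2) \<and> a \<in> Field B \<or> i = 3 \<and> a \<in> Field C"
proof -
  have "i < 4 \<longleftrightarrow> i = 0 \<or> i = 1 \<or> i = 2 \<or> i = 3" by auto
  then show ?thesis by (auto simp: levels_def)
qed

lemma seam_3: "seam [A, B, C] = (\<lambda>b. ((1::nat, b), (2::nat, b))) ` Field B"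
proof (intro equalityI subsetI)
  fix p assume "p \<in> seam [A, B, C]"
  then obtain j b where p: "p = ((2 * j - 1, b), (2 * j, b))" "0 < j" "j < 2" "b \<in> Field ([A, B, C] ! j)"
    by (auto simp: seam_def)
  then have j: "j = 1" by simp
  show "p \<in> (\<lambda>b. ((1::nat, b), (2::nat, b))) ` Field B" using p(1,4) unfolding j by simp
next
  fix p assume "p \<in> (\<lambda>b. ((1::nat, b), (2::nat, b))) ` Field B"
  then obtain b where "b \<in> Field B" "p = ((1, b), (2, b))" by auto
  then show "p \<in> seam [A, B, C]"
    unfolding seam_def mem_Collect_eq by (intro exI[of _ 1] exI[of _ b]) simp
qed

text \<open>Two factors have rows 0 to 3; this is the quotient map that merges rows 1 and 2 into the
  middle row used in the definition of the product. \<open>outer\<close> is a section of it.\<close>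

fun collapse :: "nat \<times> 'a => 'a vertex" where
  "collapse (i, a) = (if i = 0 then Top a else if i = 3 then Bot a else Mid a)"

fun outer :: "'a vertex => nat \<times> 'a" where
  "outer (Top a) = (0, a)"
| "outer (Mid a) = (1, a)"
| "outer (Bot a) = (3, a)"

lemma collapse_outer [simp]: "collapse (outer v) = v"
  by (cases v) auto

lemma outer_levels: "{(i, a) \<in> levels [A, B, C]. i = 0 \<or> i = 3} = outer ` verts A C"
proof (intro equalityI subsetI)
  fix p assume "p \<in> {(i, a) \<in> levels [A, B, C]. i = 0 \<or> i = 3}"
  then obtain i a where p: "p = (i, a)" "i = 0 \<and> a \<in> Field A \<or> i = 3 \<and> a \<in> Field C"
    by (auto simp: levels_3)
  then have "p = outer (if i = 0 then Top a else Bot a)"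
    "(if i = 0 then Top a else Bot a) \<in> verts A C" by auto
  then show "p \<in> outer ` verts A C" by blast
qed (auto simp: levels_3 elim!: vertsE)

text \<open>This is the kernel condition demanded by \<open>glued_push\<close>.\<close>

lemma collapse_eq_iff:
  assumes "u \<in> levels [A, B, C]" "w \<in> levels [A, B, C]"
  shows "collapse u = collapse w \<longleftrightarrow> u = w \<or> (u, w) \<in> seam [A, B, C] \<or> (w, u) \<in> seam [A, B, C]"
proof -
  obtain i a j b where u: "u = (i, a)" "w = (j, b)" by fastforce
  have "(u, w) \<in> seam [A, B, C] \<longleftrightarrow> i = 1 \<and> j = 2 \<and> a = b \<and> a \<in> Field B"
    "(w, u) \<in> seam [A, B, C] \<longleftrightarrow> i = 2 \<and> j = 1 \<and> a = b \<and> a \<in> Field B"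
    by (auto simp: u seam_3)
  moreover have "i < 4" "j < 4" "i = 1 ==> a \<in> Field B" "i = 2 ==> a \<in> Field B"
    using assms by (auto simp: u levels_3)
  moreover have "i < 4 \<longleftrightarrow> i = 0 \<or> i = 1 \<or> i = 2 \<or> i = 3" "j < 4 \<longleftrightarrow> j = 0 \<or> j = 1 \<or> j = 2 \<or> j = 3"
    by auto
  ultimately show ?thesis by (auto simp: u)
qed

lemma collapse_levels:
  "collapse ` levels [A, B, C] = Top ` Field A \<union> Mid ` Field B \<union> Bot ` Field C"
proof (intro equalityI subsetI)
  fix v assume "v \<in> Top ` Field A \<union> Mid ` Field B \<union> Bot ` Field C"
  then have "outer v \<in> levels [A, B, C]" by (auto simp: levels_3)
  then show "v \<in> collapse ` levels [A, B, C]" by (metis collapse_outer image_eqI)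
qed (auto simp: levels_3 split: if_splits)

lemma collapse_place:
  assumes "v \<in> verts A B"
  shows "collapse (place 0 v) = bot_to_mid v" "collapse (place 2 v) = top_to_mid v"
  using assms by (cases v; simp)+

section \<open>The product as a contraction of a two-level stack\<close>

definition join_rel :: "'a brauer => 'a brauer => 'a vertex rel" where
  "join_rel x y = equiv_join (Top ` Field (src x) \<union> Mid ` Field (trg x) \<union> Bot ` Field (trg y))
      (map_prod bot_to_mid bot_to_mid ` rel_of (blocks x))
      (map_prod top_to_mid top_to_mid ` rel_of (blocks y))"

lemma brauer_mult_join_rel:
  "x \<cdot> y = Brauer (src x) (trg y)
     (verts (src x) (trg y) // (join_rel x y \<inter> verts (src x) (trg y) \<times> verts (src x) (trg y)))"
  by (simp add: brauer_mult_def join_rel_def Let_def)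

context
  fixes x y :: "'a brauer" and A B C :: "'a rel"
  assumes x: "x \<in> brauer_hom A B" and y: "y \<in> brauer_hom B C"
begin

abbreviation "mids \<equiv> Top ` Field A \<union> Mid ` Field B \<union> Bot ` Field C"

text \<open>Containment of the edges of both factors, expressed by partners; for an equivalence on
  \<open>mids\<close> this is the same as containing the two renamed block relations.\<close>

definition joins :: "'a vertex rel => bool" where
  "joins t \<longleftrightarrow> (\<forall>v\<in>verts A B. (bot_to_mid v, bot_to_mid (mate x v)) \<in> t) \<and>
     (\<forall>v\<in>verts B C. (top_to_mid v, top_to_mid (mate y v)) \<in> t)"

lemma composable_2: "composable [A, B, C] [x, y]"
  using x y by (auto simp: composable_def less_Suc_eq)

lemma joins_iff_stack:
  "joins t \<longleftrightarrow> (\<forall>v\<in>levels [A, B, C]. (collapse v, collapse (stack [x, y] v)) \<in> t)"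
proof -
  have a: "collapse (stack [x, y] (place 0 v)) = bot_to_mid (mate x v)" if "v \<in> verts A B" for v
    using stack_place[OF that, of 0 "[x, y]"] collapse_place(1)[OF mateD(1)[OF x that]] by simp
  have b: "collapse (stack [x, y] (place 2 v)) = top_to_mid (mate y v)" if "v \<in> verts B C" for v
    using stack_place[OF that, of 2 "[x, y]"] collapse_place(2)[OF mateD(1)[OF y that]] by simp
  have pl: "place 0 v \<in> levels [A, B, C]" if "v \<in> verts A B" for v
    using place_levels[OF _ composable_2, of 0 v] that by simp
  have pl2: "place 2 v \<in> levels [A, B, C]" if "v \<in> verts B C" for v
    using place_levels[OF _ composable_2, of 1 v] that by simp
  show ?thesis
  proof
    assume j: "joins t"
    show "\<forall>v\<in>levels [A, B, C]. (collapse v, collapse (stack [x, y] v)) \<in> t"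
    proof
      fix p assume "p \<in> levels [A, B, C]"
      then obtain j v where p: "j < 2" "v \<in> verts ([A, B, C] ! j) ([A, B, C] ! Suc j)" "p = place (2 * j) v"
        using levelsE[OF _ composable_2] by (metis length_Cons list.size(3) numeral_2_eq_2)
      consider "j = 0" "v \<in> verts A B" "p = place 0 v" | "j = 1" "v \<in> verts B C" "p = place 2 v"
        using p by (auto simp: less_2_cases_iff)
      then show "(collapse p, collapse (stack [x, y] p)) \<in> t"
      proof cases
        case 1
        then show ?thesis using j a[of v] collapse_place(1)[of v A B] by (simp add: joins_def)
      next
        case 2
        then show ?thesis using j b[of v] collapse_place(2)[of v B C] by (simp add: joins_def)
      qed
    qed
  next
    assume s: "\<forall>v\<in>levels [A, B, C]. (collapse v, collapse (stack [x, y] v)) \<in> t"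
    show "joins t" unfolding joins_def
    proof (intro conjI ballI)
      fix v assume v: "v \<in> verts A B"
      show "(bot_to_mid v, bot_to_mid (mate x v)) \<in> t"
        using s[rule_format, OF pl[OF v]] a[OF v] collapse_place(1)[OF v] by simp
    next
      fix v assume v: "v \<in> verts B C"
      show "(top_to_mid v, top_to_mid (mate y v)) \<in> t"
        using s[rule_format, OF pl2[OF v]] b[OF v] collapse_place(2)[OF v] by simp
    qed
  qed
qed

lemma join_rel_eq: "join_rel x y = \<Inter>{t. equiv mids t \<and> joins t}"
proof -
  have "map_prod bot_to_mid bot_to_mid ` rel_of (blocks x) \<subseteq> t \<and>
      map_prod top_to_mid top_to_mid ` rel_of (blocks y) \<subseteq> t \<longleftrightarrow> joins t" if t: "equiv mids t" for t
  proof -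
    have "(bot_to_mid v, bot_to_mid v) \<in> t" if "v \<in> verts A B" for v
      by (rule equiv_memD(1)[OF t]) (use that in \<open>cases v; auto\<close>)
    moreover have "(top_to_mid v, top_to_mid v) \<in> t" if "v \<in> verts B C" for v
      by (rule equiv_memD(1)[OF t]) (use that in \<open>cases v; auto\<close>)
    ultimately show ?thesis
      unfolding rel_of_blocks[OF x] rel_of_blocks[OF y] joins_def by auto
  qed
  then have "{t. equiv mids t \<and> map_prod bot_to_mid bot_to_mid ` rel_of (blocks x) \<subseteq> t \<and>
      map_prod top_to_mid top_to_mid ` rel_of (blocks y) \<subseteq> t} = {t. equiv mids t \<and> joins t}"
    by blast
  then show ?thesis
    using brauer_hom_sel[OF x] brauer_hom_sel[OF y] by (simp add: join_rel_def equiv_join_def)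
qed

text \<open>The separating half of \<open>glued\<close> gives one equivalence that bounds the join
  from above, the connecting half puts each contracted arc into every equivalence of the
  intersection. Restricted to the outer vertices the join is therefore the contracted
  matching.\<close>

lemma mult_glued:
  assumes g: "glued (levels [A, B, C]) (stack [x, y]) (seam [A, B, C]) (outer ` verts A C) h"
  shows "matching (verts A C) (\<lambda>v. collapse (h (outer v)))"
    and "join_rel x y \<inter> verts A C \<times> verts A C =
      {(v, w). v \<in> verts A C \<and> (w = v \<or> w = collapse (h (outer v)))}"
    and "x \<cdot> y = of_mate A C (\<lambda>v. collapse (h (outer v)))"
proof -
  let ?h = "\<lambda>v. collapse (h (outer v))"
  have W: "outer ` verts A C \<subseteq> levels [A, B, C]" unfolding outer_levels[of A B C, symmetric] by auto
  have mh: "matching (outer ` verts A C) h" using gluedD(1)[OF g] .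
  have oc: "outer (collapse w) = w" if "w \<in> outer ` verts A C" for w using that by auto
  show m: "matching (verts A C) ?h"
    unfolding matching_def
  proof
    fix v assume v: "v \<in> verts A C"
    then have ov: "outer v \<in> outer ` verts A C" by simp
    note M = matchingD[OF mh ov]
    obtain w where w: "w \<in> verts A C" "h (outer v) = outer w" using M(1) by auto
    then show "?h v \<in> verts A C \<and> ?h v \<noteq> v \<and> ?h (?h v) = v"
      using M(2,3) by auto
  qed
  obtain R where R: "equiv (collapse ` levels [A, B, C]) R"
    "\<forall>v\<in>levels [A, B, C]. (collapse v, collapse (stack [x, y] v)) \<in> R"
    "\<forall>a\<in>outer ` verts A C. \<forall>b\<in>outer ` verts A C. (collapse a, collapse b) \<in> R --> b = a \<or> b = h a"
  proof -
    have "\<exists>R. equiv (collapse ` levels [A, B, C]) R \<and>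
      (\<forall>v\<in>levels [A, B, C]. (collapse v, collapse (stack [x, y] v)) \<in> R) \<and>
      (\<forall>a\<in>outer ` verts A C. \<forall>b\<in>outer ` verts A C. (collapse a, collapse b) \<in> R --> b = a \<or> b = h a)"
      by (rule glued_push[OF g W]) (rule collapse_eq_iff)
    then show ?thesis by (elim exE conjE) (rule that)
  qed
  have RJ: "equiv mids R" "joins R" using R(1,2) joins_iff_stack collapse_levels by metis+
  show J: "join_rel x y \<inter> verts A C \<times> verts A C = {(v, w). v \<in> verts A C \<and> (w = v \<or> w = ?h v)}"
  proof (intro equalityI subsetI)
    fix p assume p: "p \<in> join_rel x y \<inter> verts A C \<times> verts A C"
    then obtain v w where vw: "p = (v, w)" "v \<in> verts A C" "w \<in> verts A C" by auto
    then have "(v, w) \<in> R" using p RJ unfolding join_rel_eq by blast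
    then have "outer w = outer v \<or> outer w = h (outer v)" using R(3) vw by force
    then have "w = v \<or> w = ?h v" by (metis collapse_outer)
    then show "p \<in> {(v, w). v \<in> verts A C \<and> (w = v \<or> w = ?h v)}" using vw by auto
  next
    fix p assume "p \<in> {(v, w). v \<in> verts A C \<and> (w = v \<or> w = ?h v)}"
    then obtain v w where vw: "p = (v, w)" "v \<in> verts A C" "w = v \<or> w = ?h v" by auto
    have mem: "w \<in> verts A C" using vw matchingD(1)[OF m] by auto
    have "(v, w) \<in> t" if t: "equiv mids t" "joins t" for t
    proof -
      have "(collapse (outer v), collapse (h (outer v))) \<in> t"
      proof (rule glued_path[OF g matching_stack[OF composable_2] W])
        show "seam [A, B, C] \<subseteq> levels [A, B, C] \<times> levels [A, B, C]" by (auto simp: seam_3 levels_3)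
        show "collapse u = collapse w" if "(u, w) \<in> seam [A, B, C]" for u w
          using that by (auto simp: seam_3)
        show "sym t" "trans t" using t(1) by (auto simp: equiv_def)
        show "(collapse v, collapse (stack [x, y] v)) \<in> t" if "v \<in> levels [A, B, C]" for v
          using joins_iff_stack t(2) that by blast
      qed (use vw in simp)
      moreover have "(v, v) \<in> t" by (rule equiv_memD(1)[OF t(1)]) (use vw in \<open>auto elim: vertsE\<close>)
      ultimately show ?thesis using vw(3) by auto
    qed
    then show "p \<in> join_rel x y \<inter> verts A C \<times> verts A C"
      using vw mem unfolding join_rel_eq by auto
  qed
  have "verts A C // {(v, w). v \<in> verts A C \<and> (w = v \<or> w = ?h v)} = (\<lambda>v. {v, ?h v}) ` verts A C"
    unfolding quotient_def by (auto simp: Image_def)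
  then show "x \<cdot> y = of_mate A C ?h"
    unfolding brauer_mult_join_rel of_mate_def using J brauer_hom_sel[OF x] brauer_hom_sel[OF y] by simp
qed

lemma joins_join_rel: "joins (join_rel x y)"
  unfolding join_rel_eq joins_def by auto

lemma equiv_join_rel: "equiv mids (join_rel x y)"
proof (rule equivI')
  have "equiv mids (mids \<times> mids)" by (auto intro: equivI')
  moreover have "joins (mids \<times> mids)"
  proof -
    have "bot_to_mid v \<in> mids" if "v \<in> verts A B" for v using that by (auto elim: vertsE)
    moreover have "top_to_mid v \<in> mids" if "v \<in> verts B C" for v using that by (auto elim: vertsE)
    ultimately show ?thesis
      using mateD(1)[OF x] mateD(1)[OF y] unfolding joins_def by simp
  qed
  ultimately show "join_rel x y \<subseteq> mids \<times> mids" unfolding join_rel_eq by (intro Inter_lower) simp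
  show "(v, v) \<in> join_rel x y" if "v \<in> mids" for v
    unfolding join_rel_eq using equiv_memD(1)[OF _ that] by simp
  show "(v, u) \<in> join_rel x y" if "(u, v) \<in> join_rel x y" for u v
    using that unfolding join_rel_eq by (auto dest: equiv_memD(2))
  show "(u, w) \<in> join_rel x y" if "(u, v) \<in> join_rel x y" "(v, w) \<in> join_rel x y" for u v w
    unfolding join_rel_eq
  proof clarify
    fix t assume "equiv mids t" "joins t"
    moreover from this have "(u, v) \<in> t" "(v, w) \<in> t" using that unfolding join_rel_eq by auto
    ultimately show "(u, w) \<in> t" using equiv_memD(3) by metis
  qed
qed

context
  assumes fin: "finite (Field B)"
begin

lemma ex_mult_glued:
  "\<exists>h. glued (levels [A, B, C]) (stack [x, y]) (seam [A, B, C]) (outer ` verts A C) h"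
proof -
  have "finite (seam [A, B, C])" using fin by (simp add: seam_3)
  then obtain ps where ps: "set ps = seam [A, B, C]" "distinct ps" using finite_distinct_list by blast
  show ?thesis using ex_stack_glued[OF composable_2 ps, of "\<lambda>_. 0"] outer_levels[of A B C] by auto
qed

lemma mult_hom: "x \<cdot> y \<in> brauer_hom A C"
  using ex_mult_glued mult_glued(1,3) of_mate_hom by metis

lemma join_rel_mate:
  "join_rel x y \<inter> verts A C \<times> verts A C = {(v, w). v \<in> verts A C \<and> (w = v \<or> w = mate (x \<cdot> y) v)}"
proof -
  obtain h where h: "glued (levels [A, B, C]) (stack [x, y]) (seam [A, B, C]) (outer ` verts A C) h"
    using ex_mult_glued ..
  have "mate (x \<cdot> y) v = collapse (h (outer v))" if "v \<in> verts A C" for v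
    unfolding mult_glued(3)[OF h] by (rule mate_of_mate[OF mult_glued(1)[OF h] that])
  then show ?thesis unfolding mult_glued(2)[OF h] by auto
qed

text \<open>Partners in a product are found by exhibiting a path: v is connected with w by edges of
  the two factors, read as a deduction in an arbitrary symmetric transitive relation t.\<close>

lemma mult_mateI:
  assumes "v \<in> verts A C" "w \<in> verts A C" "v \<noteq> w"
    and "\<And>t. sym t ==> trans t ==> joins t ==> (v, w) \<in> t"
  shows "mate (x \<cdot> y) v = w"
proof -
  have "(v, w) \<in> join_rel x y"
    using assms(4)[OF _ _ joins_join_rel] equiv_join_rel by (auto simp: equiv_def)
  then have "(v, w) \<in> join_rel x y \<inter> verts A C \<times> verts A C" using assms by blast
  then show ?thesis unfolding join_rel_mate using assms(3) by auto
qed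

text \<open>The converse use: a labelling e of the vertices under which the edges of the factors
  become related also relates the edges of the product. The labelling is arbitrary so that rows may
  be renumbered or exchanged later.\<close>

lemma mult_edge:
  fixes e :: "'a vertex => 'x"
  assumes t: "sym t" "trans t"
    and a: "\<And>v. v \<in> verts A B ==> (e (bot_to_mid v), e (bot_to_mid (mate x v))) \<in> t"
    and b: "\<And>v. v \<in> verts B C ==> (e (top_to_mid v), e (top_to_mid (mate y v))) \<in> t"
    and v: "v \<in> verts A C"
  shows "(e v, e (mate (x \<cdot> y) v)) \<in> t"
proof -
  let ?t = "{(u, w). u \<in> mids \<and> w \<in> mids \<and> (e u, e w) \<in> t}"
  have m: "bot_to_mid v \<in> mids" if "v \<in> verts A B" for v using that by (auto elim: vertsE)
  have m2: "top_to_mid v \<in> mids" if "v \<in> verts B C" for v using that by (auto elim: vertsE)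
  have re: "(e v, e v) \<in> t" if v: "v \<in> mids" for v
  proof -
    have "\<exists>w. (e v, w) \<in> t"
      using v a[of "Top _"] a[of "Bot _"] b[of "Bot _"] by fastforce
    then show ?thesis using t by (meson symD transD)
  qed
  have "equiv mids ?t"
  proof (rule equivI')
    show "(u, w) \<in> ?t" if "(u, v) \<in> ?t" "(v, w) \<in> ?t" for u v w
      using that t(2) by (auto dest: transD)
    show "(v, u) \<in> ?t" if "(u, v) \<in> ?t" for u v using that t(1) by (auto dest: symD)
    show "(v, v) \<in> ?t" if "v \<in> mids" for v using that re by simp
    show "?t \<subseteq> mids \<times> mids" by auto
  qed
  moreover have "joins ?t"
    unfolding joins_def using a b m m2 mateD(1)[OF x] mateD(1)[OF y] by simp
  moreover have "(v, mate (x \<cdot> y) v) \<in> join_rel x y"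
    using join_rel_mate v by auto
  ultimately show ?thesis unfolding join_rel_eq by auto
qed

end

end

section \<open>Products of non-crossing partitions\<close>

lemma innermost_first_seam:
  assumes "sorted_wrt (\<lambda>x y. q y \<le> q x) bs" "distinct bs" "set bs \<subseteq> Field B" "inj_on q (Field B)"
    and "\<And>b. b \<in> Field B ==> int (q b) \<le> M"
    and V: "V \<subseteq> levels [A, B, C]" "\<And>b. (1, b) \<in> V ==> b \<in> set bs" "\<And>b. (2, b) \<in> V ==> b \<in> set bs"
    and k: "\<And>a. k (0, a) \<le> (0::int)" "\<And>b. k (1, b) = int (q b)" "\<And>b. k (2, b) = 2 * M + 1 - int (q b)"
      "\<And>c. k (3, c) \<ge> 2 * M + 1"
  shows "innermost_first k V (map (\<lambda>b. ((1, b), (2, b))) bs)"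
  using assms(1-3) V
proof (induction bs arbitrary: V)
  case (Cons b bs)
  have b: "b \<in> Field B" using Cons by auto
  have "\<not> (k (1, b) < k z \<and> k z < k (2, b))" if z: "z \<in> V" for z
  proof -
    obtain i a where ia: "z = (i, a)" by fastforce
    have lv: "(i, a) \<in> levels [A, B, C]" using z Cons.prems(4) ia by auto
    consider "i = 0" | "i = 1" "a \<in> set (b # bs)" | "i = 2" "a \<in> set (b # bs)" | "i = 3"
      using lv Cons.prems(5)[of a] Cons.prems(6)[of a] z ia unfolding levels_3 by blast
    then show ?thesis
    proof cases
      case 1 then show ?thesis using k(1)[of a] k(2)[of b] ia by simp
    next
      case 2
      then have "q a \<le> q b" using Cons.prems(1) by auto
      then show ?thesis using 2 ia k(2) by simp
    next
      case 3
      then have "q a \<le> q b" using Cons.prems(1) by auto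
      then show ?thesis using 3 ia k(3) by simp
    next
      case 4 then show ?thesis using k(4)[of a] k(3)[of b] ia by simp
    qed
  qed
  moreover have "k (1, b) < k (2, b)" using assms(5)[OF b] k(2,3) by simp
  moreover have "innermost_first k (V - {(1, b), (2, b)}) (map (\<lambda>b. ((1, b), (2, b))) bs)"
  proof (rule Cons.IH)
    show "V - {(1, b), (2, b)} \<subseteq> levels [A, B, C]" using Cons.prems(4) by auto
    show "c \<in> set bs" if "(1, c) \<in> V - {(1, b), (2, b)}" for c using that Cons.prems(5)[of c] by auto
    show "c \<in> set bs" if "(2, c) \<in> V - {(1, b), (2, b)}" for c using that Cons.prems(6)[of c] by auto
  qed (use Cons.prems in auto)
  ultimately show ?case by simp
qed simp

text \<open>Both factors are unrolled onto one line, the second one shifted behind the first so that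
  its upper row appears mirrored. There the seam consists of nested pairs; contracting them from the
  inside, that is by decreasing q, only ever joins neighbours.\<close>

lemma noncross_mult:
  assumes \<alpha>: "\<alpha> \<in> brauer_hom A B" and \<beta>: "\<beta> \<in> brauer_hom B C" and fin: "finite (Field B)"
    and inj: "inj_on p (Field A)" "inj_on q (Field B)" "inj_on r (Field C)"
    and pos: "\<And>a. a \<in> Field A ==> 0 < p a" "\<And>b. b \<in> Field B ==> 0 < q b" "\<And>c. c \<in> Field C ==> 0 < r c"
    and nc: "noncross (verts A B) (vkey p q) (mate \<alpha>)" "noncross (verts B C) (vkey q r) (mate \<beta>)"
  shows "noncross (verts A C) (vkey p r) (mate (\<alpha> \<cdot> \<beta>))"
proof -
  obtain N where "\<forall>b\<in>Field B. q b \<le> N" using finite_nat_set_iff_bounded_le[of "q ` Field B"] fin by auto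
  then obtain M :: int where M: "\<And>b. b \<in> Field B ==> int (q b) \<le> M" by (metis of_nat_mono)
  \<comment> \<open>With an empty middle row M could be negative, and the blocks of keys below would
    then overlap.\<close>
  define M' where "M' = max M 0"
  have M': "M' \<ge> 0" "\<And>b. b \<in> Field B ==> int (q b) \<le> M'" using M by (auto simp: M'_def le_max_iff_disj)
  \<comment> \<open>The first factor fills the keys up to \<open>M'\<close>, the second those from
    \<open>M' + 1\<close> on; \<open>2 * M' + 1 - q\<close> reflects the upper row of the second
    factor, so that row 1 and row 2 face each other.\<close>
  define k :: "nat \<times> 'a => int" where "k = (\<lambda>(i, a). if i = 0 then - int (p a) else if i = 1 then int (q a)
     else if i = 2 then 2 * M' + 1 - int (q a) else 2 * M' + 1 + int (r a))"
  have k: "k (0, a) = - int (p a)" "k (1, a) = int (q a)" "k (2, a) = 2 * M' + 1 - int (q a)"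
    "k (3, a) = 2 * M' + 1 + int (r a)" "k (Suc 0, a) = int (q a)" for a by (simp_all add: k_def)
  obtain bs where bs: "set bs = Field B" "distinct bs" "sorted_wrt (\<lambda>x y. q y \<le> q x) bs"
  proof -
    obtain l where l: "set l = Field B" "distinct l" using finite_distinct_list[OF fin] by blast
    have "sorted (map q (sort_key q l))" by simp
    then have "sorted_wrt (\<lambda>x y. q x \<le> q y) (sort_key q l)" by (simp only: sorted_map)
    then have "sorted_wrt (\<lambda>x y. q y \<le> q x) (rev (sort_key q l))" by (simp add: sorted_wrt_rev)
    then show thesis using that[of "rev (sort_key q l)"] l by simp
  qed
  let ?L = "levels [A, B, C]"
  let ?ps = "map (\<lambda>b. ((1::nat, b), (2::nat, b))) bs"
  have ps: "set ?ps = seam [A, B, C]" "distinct ?ps" using bs by (auto simp: seam_3 distinct_map inj_on_def)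
  have lvE: "\<exists>v. v \<in> verts A B \<and> u = place 0 v \<or> v \<in> verts B C \<and> u = place 2 v" if u: "u \<in> ?L" for u
  proof -
    obtain j v where p: "j < 2" "v \<in> verts ([A, B, C] ! j) ([A, B, C] ! Suc j)" "u = place (2 * j) v"
      using levelsE[OF u composable_2[OF \<alpha> \<beta>]] by (metis length_Cons list.size(3) numeral_2_eq_2)
    then show ?thesis by (auto simp: less_2_cases_iff)
  qed
  have k0: "k (place 0 v) = vkey p q v" "stack [\<alpha>, \<beta>] (place 0 v) = place 0 (mate \<alpha> v)" "vkey p q v \<le> M'"
    if "v \<in> verts A B" for v
    using that k M' stack_place[OF that, of 0 "[\<alpha>, \<beta>]"] by (auto elim!: vertsE)
  have k2: "k (place 2 v) = 2 * M' + 1 + vkey q r v" "stack [\<alpha>, \<beta>] (place 2 v) = place 2 (mate \<beta> v)"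
    "2 * M' + 1 + vkey q r v \<ge> M' + 1"
    if "v \<in> verts B C" for v
    using that k M' stack_place[OF that, of 2 "[\<alpha>, \<beta>]"] by (auto elim!: vertsE)
  have injk: "inj_on k ?L"
  proof (rule inj_onI)
    fix u w assume u: "u \<in> ?L" "w \<in> ?L" "k u = k w"
    obtain i a j b where ia: "u = (i, a)" "w = (j, b)" by fastforce
    have range: "i = 0 \<and> k (i, a) < 0 \<or> i = 1 \<and> 0 < k (i, a) \<and> k (i, a) \<le> M' \<or>
      i = 2 \<and> M' < k (i, a) \<and> k (i, a) \<le> 2 * M' \<or> i = 3 \<and> 2 * M' + 1 < k (i, a)"
      if "(i, a) \<in> ?L" for i a
      using that pos(1)[of a] pos(2)[of a] pos(3)[of a] M'(2)[of a] unfolding levels_3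
      by (elim disjE conjE) (simp_all add: k)
    have "i = j" using range[of i a] range[of j b] u M'(1) unfolding ia by linarith
    moreover have "a = b"
      using u \<open>i = j\<close> inj_onD[OF inj(1), of a b] inj_onD[OF inj(2), of a b] inj_onD[OF inj(3), of a b]
      unfolding ia levels_3 by (auto simp: k)
    ultimately show "u = w" using ia by simp
  qed
  have nck: "noncross ?L k (stack [\<alpha>, \<beta>])"
    unfolding noncross_def
  proof (intro ballI impI)
    fix u w assume u: "u \<in> ?L" "w \<in> ?L" "k u < k w \<and> k w < k (stack [\<alpha>, \<beta>] u)"
    obtain v where v: "v \<in> verts A B \<and> u = place 0 v \<or> v \<in> verts B C \<and> u = place 2 v" using lvE[OF u(1)] ..
    obtain v' where v': "v' \<in> verts A B \<and> w = place 0 v' \<or> v' \<in> verts B C \<and> w = place 2 v'" using lvE[OF u(2)] ..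
    from v show "k u < k (stack [\<alpha>, \<beta>] w) \<and> k (stack [\<alpha>, \<beta>] w) < k (stack [\<alpha>, \<beta>] u)"
    proof
      assume v: "v \<in> verts A B \<and> u = place 0 v"
      note m = mateD(1)[OF \<alpha>, of v]
      have "v' \<in> verts A B \<and> w = place 0 v'"
        using v' u(3) v k0 k2 m by force
      then show ?thesis using v u(3) k0 mateD(1)[OF \<alpha>] noncrossD[OF nc(1), of v v'] by simp
    next
      assume v: "v \<in> verts B C \<and> u = place 2 v"
      note m = mateD(1)[OF \<beta>, of v]
      have "v' \<in> verts B C \<and> w = place 2 v'"
        using v' u(3) v k0 k2 m by force
      then show ?thesis using v u(3) k2 mateD(1)[OF \<beta>] noncrossD[OF nc(2), of v v'] by simp
    qed
  qed
  have inn: "innermost_first k ?L ?ps"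
    by (rule innermost_first_seam[OF bs(3,2) _ inj(2) M'(2)]) (use bs(1) M'(1) in \<open>auto simp: k levels_3\<close>)
  obtain h where h: "glued ?L (stack [\<alpha>, \<beta>]) (seam [A, B, C]) (outer ` verts A C) h"
    and nh: "noncross (outer ` verts A C) k h"
    using ex_stack_glued[OF composable_2[OF \<alpha> \<beta>] ps, of k] nck injk inn outer_levels[of A B C] by auto
  have mt: "mate (\<alpha> \<cdot> \<beta>) v = collapse (h (outer v))" if "v \<in> verts A C" for v
    unfolding mult_glued(3)[OF \<alpha> \<beta> h] by (rule mate_of_mate[OF mult_glued(1)[OF \<alpha> \<beta> h] that])
  have mh: "matching (outer ` verts A C) h" using gluedD(1)[OF h] .
  have mv: "mate (\<alpha> \<cdot> \<beta>) v \<in> verts A C" "outer (mate (\<alpha> \<cdot> \<beta>) v) = h (outer v)"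
    if v: "v \<in> verts A C" for v
  proof -
    have "h (outer v) \<in> outer ` verts A C" using matchingD(1)[OF mh] v by simp
    then obtain w where "w \<in> verts A C" "h (outer v) = outer w" by (rule imageE) (rule that)
    then show "mate (\<alpha> \<cdot> \<beta>) v \<in> verts A C" "outer (mate (\<alpha> \<cdot> \<beta>) v) = h (outer v)"
      using mt[OF v] by simp_all
  qed
  have kv: "k (outer v) < k (outer w) \<longleftrightarrow> vkey p r v < vkey p r w" if "v \<in> verts A C" "w \<in> verts A C" for v w
    using that k pos M'(1) by (auto elim!: vertsE; force)
  show ?thesis
    unfolding noncross_def
  proof (intro ballI impI)
    fix v w assume "v \<in> verts A C" "w \<in> verts A C"
      "vkey p r v < vkey p r w \<and> vkey p r w < vkey p r (mate (\<alpha> \<cdot> \<beta>) v)"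
    then show "vkey p r v < vkey p r (mate (\<alpha> \<cdot> \<beta>) w) \<and>
      vkey p r (mate (\<alpha> \<cdot> \<beta>) w) < vkey p r (mate (\<alpha> \<cdot> \<beta>) v)"
      using noncrossD[OF nh, of "outer v" "outer w"] mv(1) kv mv(2)[symmetric] by simp
  qed
qed

text \<open>Recording rows by numbers turns vertices of factors and of products into points of one
  common set.\<close>

definition tag :: "nat => nat => nat => 'a vertex => nat \<times> 'a" where
  "tag i j k v = (case v of Top a => (i, a) | Mid a => (j, a) | Bot a => (k, a))"

text \<open>Neither bracketing is contracted on its own. Gluing the stack of three factors yields
  one relation \<open>R\<close> on rows 0 to 3 that separates different arcs; by
  \<open>mult_edge\<close> the edges of both bracketings lie in \<open>R\<close>, so the partners
  agree.\<close>

lemma mult_assoc: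
  assumes \<alpha>: "\<alpha> \<in> brauer_hom A B" and \<beta>: "\<beta> \<in> brauer_hom B C" and z: "z \<in> brauer_hom C D"
    and fin: "finite (Field B)" "finite (Field C)"
  shows "\<alpha> \<cdot> \<beta> \<cdot> z = \<alpha> \<cdot> (\<beta> \<cdot> z)"
proof -
  let ?As = "[A, B, C, D]" and ?ms = "[\<alpha>, \<beta>, z]"
  let ?W = "{(i, a) \<in> levels ?As. i = 0 \<or> i = 2 * length ?ms - 1}"
  \<comment> \<open>\<open>(i + 1) div 2\<close> merges rows 1, 2 into row 1 and rows 3, 4 into row
    2, while row 5 becomes row 3.\<close>
  define \<pi> :: "nat \<times> 'a => nat \<times> 'a" where "\<pi> = (\<lambda>(i, a). ((i + 1) div 2, a))"
  have c: "composable ?As ?ms" using \<alpha> \<beta> z by (auto simp: composable_def less_Suc_eq)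
  have "seam ?As \<subseteq> (\<lambda>(j, b). ((2 * j - 1, b), (2 * j, b))) ` ({..<3} \<times> (Field B \<union> Field C))"
  proof
    fix p assume "p \<in> seam ?As"
    then obtain j b where p: "p = ((2 * j - 1, b), (2 * j, b))" "0 < j" "j < 3" "b \<in> Field (?As ! j)"
      by (auto simp: seam_def)
    then have "j = 1 \<or> j = 2" by auto
    then have "(j, b) \<in> {..<3} \<times> (Field B \<union> Field C)" using p by auto
    then show "p \<in> (\<lambda>(j, b). ((2 * j - 1, b), (2 * j, b))) ` ({..<3} \<times> (Field B \<union> Field C))"
      using p(1) by (metis (no_types, lifting) case_prod_conv image_eqI)
  qed
  then have "finite (seam ?As)" by (rule finite_subset) (use fin in simp)
  then obtain ps where ps: "set ps = seam ?As" "distinct ps" using finite_distinct_list by blast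
  obtain h where h: "glued (levels ?As) (stack ?ms) (seam ?As) ?W h"
    using ex_stack_glued[OF c ps, of "\<lambda>_. 0"] by blast
  have "\<exists>R. equiv (\<pi> ` levels ?As) R \<and> (\<forall>v\<in>levels ?As. (\<pi> v, \<pi> (stack ?ms v)) \<in> R) \<and>
     (\<forall>a\<in>?W. \<forall>b\<in>?W. (\<pi> a, \<pi> b) \<in> R --> b = a \<or> b = h a)"
  proof (rule glued_push[OF h])
    fix u w assume uw: "u \<in> levels ?As" "w \<in> levels ?As"
    obtain i a j b where ia: "u = (i, a)" "w = (j, b)" by fastforce
    show "\<pi> u = \<pi> w \<longleftrightarrow> u = w \<or> (u, w) \<in> seam ?As \<or> (w, u) \<in> seam ?As"
    proof
      assume "\<pi> u = \<pi> w"
      then have ij: "(i + 1) div 2 = (j + 1) div 2" "a = b" by (auto simp: \<pi>_def ia)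
      have lt: "i < 6" "j < 6" "a \<in> Field (?As ! ((i + 1) div 2))" using uw by (auto simp: levels_def ia)
      consider "i = j" | "j = Suc i" "odd i" | "i = Suc j" "odd j" using ij(1) by (cases "even i"; cases "even j") (auto elim!: evenE oddE)
      then show "u = w \<or> (u, w) \<in> seam ?As \<or> (w, u) \<in> seam ?As"
      proof cases
        case 2
        then have "(u, w) = ((2 * ((i + 1) div 2) - 1, a), (2 * ((i + 1) div 2), a))" using ia ij by (auto elim!: oddE)
        moreover have "0 < (i + 1) div 2" "(i + 1) div 2 < length ?As - 1" using 2 lt by (auto elim!: oddE)
        ultimately show ?thesis using lt(3) unfolding seam_def by blast
      next
        case 3
        then have "(w, u) = ((2 * ((i + 1) div 2) - 1, a), (2 * ((i + 1) div 2), a))" using ia ij by (auto elim!: oddE)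
        moreover have "0 < (i + 1) div 2" "(i + 1) div 2 < length ?As - 1" using 3 lt by (auto elim!: oddE)
        ultimately show ?thesis using lt(3) unfolding seam_def by blast
      qed (use ia ij in simp)
    next
      assume "u = w \<or> (u, w) \<in> seam ?As \<or> (w, u) \<in> seam ?As"
      then show "\<pi> u = \<pi> w"
        by (elim disjE) (auto simp: seam_def \<pi>_def)
    qed
  qed auto
  then obtain R where R: "equiv (\<pi> ` levels ?As) R" "\<forall>v\<in>levels ?As. (\<pi> v, \<pi> (stack ?ms v)) \<in> R"
     "\<forall>a\<in>?W. \<forall>b\<in>?W. (\<pi> a, \<pi> b) \<in> R --> b = a \<or> b = h a" by (elim exE conjE)
  have st: "sym R" "trans R" using R(1) by (auto simp: equiv_def)
  have \<pi>p: "\<pi> (place (2 * j) v) = tag j j (Suc j) v" for j v by (cases v) (auto simp: \<pi>_def tag_def)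
  have edge: "(tag j j (Suc j) v, tag j j (Suc j) (mate (?ms ! j) v)) \<in> R"
    if "j < 3" "v \<in> verts (?As ! j) (?As ! Suc j)" for j v
  proof -
    have "place (2 * j) v \<in> levels ?As" using place_levels[OF _ c that(2)] that(1) by simp
    then have "(\<pi> (place (2 * j) v), \<pi> (stack ?ms (place (2 * j) v))) \<in> R" using R(2) by simp
    then show ?thesis using stack_place[OF that(2), of "2 * j" ?ms] \<pi>p by simp
  qed
  have t1: "tag i j k (bot_to_mid v) = tag i i j v" "tag i j k (top_to_mid v) = tag j j k v"
    if "v \<in> verts E F" for i j k v and E F :: "'a rel"
    using that by (auto simp: tag_def elim: vertsE)
  have t2: "tag i j k v = tag i i k v" if "v \<in> verts E F" for i j k v and E F :: "'a rel"
    using that by (auto simp: tag_def elim: vertsE)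
  \<comment> \<open>Edges of a product lie in \<open>R\<close> once those of the factors do,
    whatever the rows i, j, k are; this is applied twice for each bracketing.\<close>
  have comp: "(tag i i k v, tag i i k (mate (\<delta> \<cdot> \<epsilon>) v)) \<in> R"
    if d: "\<delta> \<in> brauer_hom E F" and e: "\<epsilon> \<in> brauer_hom F G" and f: "finite (Field F)"
      and 1: "\<And>v. v \<in> verts E F ==> (tag i i j v, tag i i j (mate \<delta> v)) \<in> R"
      and 2: "\<And>v. v \<in> verts F G ==> (tag j j k v, tag j j k (mate \<epsilon> v)) \<in> R"
      and v: "v \<in> verts E G" for \<delta> \<epsilon> :: "'a brauer" and E F G i j k v
  proof -
    have "(tag i j k v, tag i j k (mate (\<delta> \<cdot> \<epsilon>) v)) \<in> R"
    proof (rule mult_edge[OF d e f st _ _ v])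
      show "(tag i j k (bot_to_mid v), tag i j k (bot_to_mid (mate \<delta> v))) \<in> R" if "v \<in> verts E F" for v
        using 1[OF that] t1(1)[OF that] t1(1)[OF mateD(1)[OF d that]] by simp
      show "(tag i j k (top_to_mid v), tag i j k (top_to_mid (mate \<epsilon> v))) \<in> R" if "v \<in> verts F G" for v
        using 2[OF that] t1(2)[OF that] t1(2)[OF mateD(1)[OF e that]] by simp
    qed
    then show ?thesis using t2[OF v, of i j k] t2[OF mateD(1)[OF mult_hom[OF d e f] v], of i j k] by simp
  qed
  have e0: "(tag 0 0 1 v, tag 0 0 1 (mate \<alpha> v)) \<in> R" if "v \<in> verts A B" for v
    using edge[of 0 v] that by simp
  have e1: "(tag 1 1 2 v, tag 1 1 2 (mate \<beta> v)) \<in> R" if "v \<in> verts B C" for v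
    using edge[of 1 v] that by (simp add: numeral_2_eq_2)
  have e2: "(tag 2 2 3 v, tag 2 2 3 (mate z v)) \<in> R" if "v \<in> verts C D" for v
    using edge[of 2 v] that by (simp add: numeral_2_eq_2 numeral_3_eq_3)
  note h1 = mult_hom[OF \<alpha> \<beta> fin(1)] and h2 = mult_hom[OF \<beta> z fin(2)]
  note X = mult_hom[OF h1 z fin(2)] and Y = mult_hom[OF \<alpha> h2 fin(1)]
  have x: "(tag 0 0 3 v, tag 0 0 3 (mate (\<alpha> \<cdot> \<beta> \<cdot> z) v)) \<in> R" if "v \<in> verts A D" for v
    by (rule comp[OF h1 z fin(2) comp[OF \<alpha> \<beta> fin(1) e0 e1] e2 that])
  have y: "(tag 0 0 3 v, tag 0 0 3 (mate (\<alpha> \<cdot> (\<beta> \<cdot> z)) v)) \<in> R" if "v \<in> verts A D" for v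
    by (rule comp[OF \<alpha> h2 fin(1) e0 comp[OF \<beta> z fin(2) e1 e2] that])
  have w5: "tag 0 0 5 v \<in> ?W" "\<pi> (tag 0 0 5 v) = tag 0 0 3 v" if "v \<in> verts A D" for v
    using that by (auto simp: tag_def \<pi>_def levels_def elim!: vertsE)
  have inj: "tag 0 0 5 v = tag 0 0 5 w ==> v = w" if "v \<in> verts A D" "w \<in> verts A D" for v w :: "'a vertex"
    using that by (auto simp: tag_def elim!: vertsE)
  have hh: "tag 0 0 5 w = h (tag 0 0 5 v)"
    if "v \<in> verts A D" "w \<in> verts A D" "w \<noteq> v" "(tag 0 0 3 v, tag 0 0 3 w) \<in> R" for v w
    using R(3)[rule_format, OF w5(1)[OF that(1)] w5(1)[OF that(2)]] w5(2) inj[OF that(2,1)] that by auto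
  show ?thesis
  proof (rule brauer_eqI[OF X Y])
    fix v assume v: "v \<in> verts A D"
    show "mate (\<alpha> \<cdot> \<beta> \<cdot> z) v = mate (\<alpha> \<cdot> (\<beta> \<cdot> z)) v"
      using hh[OF v mateD(1,2)[OF X v] x[OF v]] hh[OF v mateD(1,2)[OF Y v] y[OF v]]
        inj[OF mateD(1)[OF X v] mateD(1)[OF Y v]] by simp
  qed
qed

section \<open>Planarity and non-crossing partitions\<close>

definition fin_lin :: "'a rel => bool" where
  "fin_lin A \<longleftrightarrow> Linear_order A \<and> finite (Field A)"

lemma fin_linD:
  assumes "fin_lin A"
  shows "finite (Field A)"
    and "a \<in> Field A ==> (a, a) \<in> A"
    and "(a, b) \<in> A ==> (b, c) \<in> A ==> (a, c) \<in> A"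
    and "(a, b) \<in> A ==> (b, a) \<in> A ==> a = b"
    and "a \<in> Field A ==> b \<in> Field A ==> (a, b) \<in> A \<or> (b, a) \<in> A"
proof -
  have A: "refl_on (Field A) A" "trans A" "antisym A" "total_on (Field A) A" "finite (Field A)"
    using assms by (auto simp: fin_lin_def linear_order_on_def partial_order_on_def preorder_on_def)
  show "finite (Field A)" by (rule A)
  show r: "(a, a) \<in> A" if "a \<in> Field A" for a using A(1) that by (rule refl_onD)
  show "(a, c) \<in> A" if "(a, b) \<in> A" "(b, c) \<in> A" using A(2) that by (rule transD)
  show "a = b" if "(a, b) \<in> A" "(b, a) \<in> A" using A(3) that by (rule antisymD)
  show "(a, b) \<in> A \<or> (b, a) \<in> A" if "a \<in> Field A" "b \<in> Field A"
    using A(4) r that by (cases "a = b") (auto simp: total_on_def)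
qed

lemma fin_lin_converse: "fin_lin (A\<inverse>) \<longleftrightarrow> fin_lin A"
  by (simp add: fin_lin_def)

lemma pos_less:
  assumes A: "fin_lin A" and ab: "(a, b) \<in> A" "a \<noteq> b"
  shows "pos A a < pos A b"
  unfolding pos_def
proof (rule psubset_card_mono)
  have F: "a \<in> Field A" "b \<in> Field A" using ab by (auto simp: Field_def)
  show "finite {x \<in> Field A. (x, b) \<in> A}" using fin_linD(1)[OF A] by simp
  have "b \<notin> {x \<in> Field A. (x, a) \<in> A}" using fin_linD(4)[OF A, of a b] ab by auto
  moreover have "b \<in> {x \<in> Field A. (x, b) \<in> A}" using fin_linD(2)[OF A] F by auto
  moreover have "{x \<in> Field A. (x, a) \<in> A} \<subseteq> {x \<in> Field A. (x, b) \<in> A}"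
    using fin_linD(3)[OF A, of _ a b] ab by auto
  ultimately show "{x \<in> Field A. (x, a) \<in> A} \<subset> {x \<in> Field A. (x, b) \<in> A}" by blast
qed

lemma pos_le_iff:
  assumes A: "fin_lin A" and "a \<in> Field A" "b \<in> Field A"
  shows "(a, b) \<in> A \<longleftrightarrow> pos A a \<le> pos A b"
proof (cases "a = b")
  case True then show ?thesis using fin_linD(2)[OF A] assms by simp
next
  case False
  then show ?thesis
    using pos_less[OF A, of a b] pos_less[OF A, of b a] fin_linD(5)[OF A assms(2,3)] by fastforce
qed

lemma less_in_iff:
  assumes A: "fin_lin A" and "a \<in> Field A" "b \<in> Field A"
  shows "less_in A a b \<longleftrightarrow> pos A a < pos A b"
  using pos_le_iff[OF assms] pos_less[OF A, of a b] by (auto simp: less_in_def)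

lemma pos_inj: "fin_lin A ==> inj_on (pos A) (Field A)"
  by (rule inj_onI) (metis fin_linD(4) order_refl pos_le_iff)

lemma pos_bounds:
  assumes A: "fin_lin A" and a: "a \<in> Field A"
  shows "0 < pos A a" "pos A a \<le> card (Field A)"
proof -
  have "a \<in> {x \<in> Field A. (x, a) \<in> A}" using fin_linD(2)[OF A] a by auto
  then show "0 < pos A a" unfolding pos_def using fin_linD(1)[OF A] by (auto simp: card_gt_0_iff)
  show "pos A a \<le> card (Field A)" unfolding pos_def using fin_linD(1)[OF A] by (intro card_mono) auto
qed

lemma pos_converse:
  assumes A: "fin_lin A" and a: "a \<in> Field A"
  shows "pos (A\<inverse>) a + pos A a = card (Field A) + 1"
proof -
  let ?L = "{x \<in> Field A. (x, a) \<in> A}" and ?G = "{x \<in> Field A. (a, x) \<in> A}"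
  have "?L \<union> ?G = Field A" using fin_linD(5)[OF A] a by auto
  moreover have "?L \<inter> ?G = {a}" using fin_linD(2,4)[OF A] a by auto
  ultimately have "card ?L + card ?G = card (Field A) + 1"
    using card_Un_Int[of ?L ?G] fin_linD(1)[OF A] by simp
  then show ?thesis by (simp add: pos_def)
qed

text \<open>The orders are parameters, separate from the objects stored in x:
  \<open>ncr (A\<inverse>) B x\<close> reads the upper row backwards, which is how anti-planarity is
  expressed.\<close>

definition ncr :: "'a rel => 'a rel => 'a brauer => bool" where
  "ncr A B x \<longleftrightarrow> noncross (verts A B) (vkey (pos A) (pos B)) (mate x)"

lemma verts_converse [simp]: "verts (A\<inverse>) B = verts A B" "verts A (B\<inverse>) = verts A B"
  by (simp_all add: verts_def)

lemma brauer_hom_mate_bounds: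
  assumes "fin_lin A" "fin_lin B" "v \<in> verts A B"
  shows "vkey (pos A) (pos B) v \<noteq> 0"
    "\<bar>vkey (pos A) (pos B) v\<bar> \<le> int (max (card (Field A)) (card (Field B)))"
  using assms pos_bounds by (auto elim!: vertsE simp: max_def intro: le_trans dest: pos_bounds)

lemma vkey_inj:
  assumes "fin_lin A" "fin_lin B"
  shows "inj_on (vkey (pos A) (pos B)) (verts A B)"
proof (rule inj_onI)
  fix v w assume "v \<in> verts A B" "w \<in> verts A B" "vkey (pos A) (pos B) v = vkey (pos A) (pos B) w"
  then show "v = w"
    using inj_onD[OF pos_inj[OF assms(1)]] inj_onD[OF pos_inj[OF assms(2)]] pos_bounds(1)[OF assms(1)]
      pos_bounds(1)[OF assms(2)]
    by (elim vertsE) (force+)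
qed

section \<open>A half plane model of the rectangle\<close>

definition bdry :: "int => real" where
  "bdry z = of_int (sgn z) * exp (pi * of_int \<bar>z\<bar>)"

lemma bdry_strict_mono:
  assumes "z \<noteq> 0" "z' \<noteq> 0" "z < z'"
  shows "bdry z < bdry z'"
proof -
  consider "0 < z" | "z' < 0" | "z < 0" "0 < z'" using assms by linarith
  then show ?thesis
  proof cases
    case 3
    then have "bdry z = - exp (pi * of_int \<bar>z\<bar>)" "bdry z' = exp (pi * of_int \<bar>z'\<bar>)" by (auto simp: bdry_def)
    then show ?thesis by (metis exp_gt_zero neg_less_0_iff_less order.strict_trans)
  qed (use assms in \<open>auto simp: bdry_def\<close>)
qed

lemma bdry_nz: "z \<noteq> 0 ==> bdry z \<noteq> 0"
  by (auto simp: bdry_def sgn_if)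

text \<open>The map \<open>wrap\<close>, z to exp(pi z), bends the strip of height 1 onto the upper
  half plane: the lower row goes to the positive and the upper row to the negative axis, at the
  points \<open>bdry\<close>. \<open>chart\<close> inverts it, written in the abscissa X and the
  squared distance \<rho> from the origin.\<close>

definition chart :: "real => real => real^2" where
  "chart X \<rho> = vector [ln \<rho> / (2 * pi), arccos (X / sqrt \<rho>) / pi]"

lemma chart_inj:
  assumes "0 < \<rho>" "0 < \<rho>'" "X\<^sup>2 \<le> \<rho>" "X'\<^sup>2 \<le> \<rho>'" "chart X \<rho> = chart X' \<rho>'"
  shows "\<rho> = \<rho>'" "X = X'"
proof -
  have b: "\<bar>X / sqrt \<rho>\<bar> \<le> 1" if "0 < \<rho>" "X\<^sup>2 \<le> \<rho>" for X \<rho>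
  proof -
    have "\<bar>X\<bar> \<le> sqrt \<rho>" using that real_le_rsqrt by (simp add: real_le_rsqrt)
    then show ?thesis using that by (simp add: abs_divide divide_le_eq)
  qed
  have c: "ln \<rho> / (2 * pi) = ln \<rho>' / (2 * pi)" "arccos (X / sqrt \<rho>) / pi = arccos (X' / sqrt \<rho>') / pi"
    using arg_cong[OF assms(5), of "\<lambda>v. v $ 1"] arg_cong[OF assms(5), of "\<lambda>v. v $ 2"]
    by (simp_all add: chart_def)
  then show \<rho>: "\<rho> = \<rho>'" using assms by simp
  have "arccos (X / sqrt \<rho>) = arccos (X' / sqrt \<rho>')" using c by simp
  then have "X / sqrt \<rho> = X' / sqrt \<rho>'" using b[OF assms(1,3)] b[OF assms(2,4)] arccos_eq_iff by blast
  then show "X = X'" using \<rho> assms by simp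
qed

text \<open>The half circle over the segment from a to c: on it the squared distance from the origin
  is (a + c) X - a c, affine in the abscissa, so it interpolates between the squares of a and
  c.\<close>

definition semi :: "real => real => real => real^2" where
  "semi a c t = chart (a + t * (c - a)) ((1 - t) * a\<^sup>2 + t * c\<^sup>2)"

text \<open>The difference in the last equation is the squared height over the axis.\<close>

lemma semi_bounds:
  fixes a c t :: real
  assumes "a \<noteq> 0" "c \<noteq> 0" "a < c" "0 \<le> t" "t \<le> 1"
  shows "0 < (1 - t) * a\<^sup>2 + t * c\<^sup>2" "(a + t * (c - a))\<^sup>2 \<le> (1 - t) * a\<^sup>2 + t * c\<^sup>2"
    "(1 - t) * a\<^sup>2 + t * c\<^sup>2 - (a + t * (c - a))\<^sup>2 = (a + t * (c - a) - a) * (c - (a + t * (c - a)))"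
proof -
  have "min (a\<^sup>2) (c\<^sup>2) \<le> (1 - t) * a\<^sup>2 + t * c\<^sup>2"
    using convex_bound_le[of "- (a\<^sup>2)" "- min (a\<^sup>2) (c\<^sup>2)" "- (c\<^sup>2)" "1 - t" t] assms by simp
  moreover have "0 < min (a\<^sup>2) (c\<^sup>2)" using assms by simp
  ultimately show "0 < (1 - t) * a\<^sup>2 + t * c\<^sup>2" by linarith
  show eq: "(1 - t) * a\<^sup>2 + t * c\<^sup>2 - (a + t * (c - a))\<^sup>2 = (a + t * (c - a) - a) * (c - (a + t * (c - a)))"
    by (simp add: power2_eq_square algebra_simps)
  have "(a + t * (c - a) - a) * (c - (a + t * (c - a))) = t * (1 - t) * (c - a)\<^sup>2"
    by (simp add: power2_eq_square algebra_simps)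
  also have "\<dots> \<ge> 0" using assms by simp
  finally show "(a + t * (c - a))\<^sup>2 \<le> (1 - t) * a\<^sup>2 + t * c\<^sup>2" using eq by linarith
qed

lemma vector_2_axis: "(vector [x, y] :: real^2) = x *\<^sub>R axis 1 1 + y *\<^sub>R axis 2 1"
  by (simp add: vec_eq_iff forall_2 axis_def)

lemma continuous_on_vector_2:
  assumes "continuous_on S f" "continuous_on S g"
  shows "continuous_on S (\<lambda>x. vector [f x, g x] :: real^2)"
  unfolding vector_2_axis by (intro continuous_intros assms)

lemma arc_semi:
  assumes "a \<noteq> 0" "c \<noteq> 0" "a < c"
  shows "arc (semi a c)"
  unfolding arc_def
proof
  have nz: "(1 - t) * a\<^sup>2 + t * c\<^sup>2 \<noteq> 0" if "t \<in> {0..1}" for t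
    using semi_bounds(1)[OF assms, of t] that by auto
  have "continuous_on {0..1} (\<lambda>t. ln ((1 - t) * a\<^sup>2 + t * c\<^sup>2) / (2 * pi))"
    using nz by (intro continuous_intros) auto
  moreover have "continuous_on {0..1} (\<lambda>t. arccos ((a + t * (c - a)) / sqrt ((1 - t) * a\<^sup>2 + t * c\<^sup>2)) / pi)"
  proof (intro continuous_intros ballI)
    fix t :: real assume t: "t \<in> {0..1}"
    have "\<bar>a + t * (c - a)\<bar> \<le> sqrt ((1 - t) * a\<^sup>2 + t * c\<^sup>2)"
      using semi_bounds(2)[OF assms, of t] t by (simp add: real_le_rsqrt)
    then have "\<bar>(a + t * (c - a)) / sqrt ((1 - t) * a\<^sup>2 + t * c\<^sup>2)\<bar> \<le> 1"
      using semi_bounds(1)[OF assms, of t] t by (simp add: abs_divide divide_le_eq)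
    then show "- 1 \<le> (a + t * (c - a)) / sqrt ((1 - t) * a\<^sup>2 + t * c\<^sup>2) \<and>
        (a + t * (c - a)) / sqrt ((1 - t) * a\<^sup>2 + t * c\<^sup>2) \<le> 1" by linarith
  qed (use nz in auto)
  ultimately show "path (semi a c)"
    unfolding path_def semi_def chart_def by (rule continuous_on_vector_2)
  show "inj_on (semi a c) {0..1}"
  proof (rule inj_onI)
    fix s t :: real assume st: "s \<in> {0..1}" "t \<in> {0..1}" "semi a c s = semi a c t"
    then have "a + s * (c - a) = a + t * (c - a)"
      using chart_inj(2)[OF semi_bounds(1)[OF assms, of s] semi_bounds(1)[OF assms, of t]
        semi_bounds(2)[OF assms, of s] semi_bounds(2)[OF assms, of t]] by (simp add: semi_def)
    then show "s = t" using assms by simp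
  qed
qed

text \<open>At a common point the squared heights (X - a) (c - X) of both half circles agree; over
  disjoint intervals there is no common abscissa, and over nested ones the outer circle is strictly
  higher.\<close>

lemma semi_disjoint:
  assumes "a \<noteq> 0" "c \<noteq> 0" "a' \<noteq> 0" "c' \<noteq> 0" "a < c" "a' < c'"
    and "c < a' \<or> a < a' \<and> c' < c"
  shows "path_image (semi a c) \<inter> path_image (semi a' c') = {}"
proof -
  have "semi a c s \<noteq> semi a' c' t" if s: "0 \<le> s" "s \<le> 1" and t: "0 \<le> t" "t \<le> 1" for s t
  proof
    assume eq: "semi a c s = semi a' c' t"
    define X where "X = a + s * (c - a)"
    note b1 = semi_bounds[OF assms(1,2,5) s] and b2 = semi_bounds[OF assms(3,4,6) t]
    have X: "X = a' + t * (c' - a')" and \<rho>: "(1 - s) * a\<^sup>2 + s * c\<^sup>2 = (1 - t) * a'\<^sup>2 + t * c'\<^sup>2"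
      using chart_inj[OF b1(1) b2(1) b1(2) b2(2)] eq by (simp_all add: semi_def X_def)
    have p: "(X - a) * (c - X) = (X - a') * (c' - X)"
      using b1(3) b2(3) \<rho> unfolding X_def[symmetric] X[symmetric] by linarith
    have "s * (c - a) \<le> c - a" "t * (c' - a') \<le> c' - a'" "0 \<le> t * (c' - a')"
      using assms(5,6) s t by (auto intro!: mult_left_le_one_le)
    then have r1: "X \<le> c" and r2: "a' \<le> X" "X \<le> c'" unfolding X_def using X[unfolded X_def] by linarith+
    show False
    proof (cases "c < a'")
      case True then show False using r1 r2 by linarith
    next
      case False
      then have ac: "a < a'" "c' < c" using assms(7) by auto
      have "(X - a') * (c' - X) \<le> (X - a') * (c - X)" using ac r2 by (intro mult_left_mono) auto
      also have "\<dots> < (X - a) * (c - X)" using ac r2 by (intro mult_strict_right_mono) auto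
      finally show False using p by simp
    qed
  qed
  then show ?thesis by (auto simp: path_image_def)
qed

lemma chart_end:
  assumes "z \<noteq> 0"
  shows "chart (bdry z) ((bdry z)\<^sup>2) = vector [of_int \<bar>z\<bar>, if z < 0 then 1 else 0]"
proof -
  have "(bdry z)\<^sup>2 = exp (2 * pi * of_int \<bar>z\<bar>)"
    using assms by (simp add: bdry_def power_mult_distrib sgn_if flip: exp_double)
  then have 1: "ln ((bdry z)\<^sup>2) / (2 * pi) = of_int \<bar>z\<bar>" by simp
  have "bdry z / sqrt ((bdry z)\<^sup>2) = (if z < 0 then -1 else 1)"
    using assms by (auto simp: bdry_def sgn_if)
  then have "arccos (bdry z / sqrt ((bdry z)\<^sup>2)) / pi = (if z < 0 then 1 else 0)" by simp
  then show ?thesis unfolding chart_def 1 by simp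
qed

text \<open>Along the half circle the squared distance lies between its values at the ends, which
  are at least 1 and at most exp(2 pi w); these two bounds become the vertical sides of the
  box.\<close>

lemma semi_box:
  assumes z: "z \<noteq> 0" "z' \<noteq> 0" "z < z'" and w: "of_int \<bar>z\<bar> \<le> w" "of_int \<bar>z'\<bar> \<le> w"
  shows "path_image (semi (bdry z) (bdry z')) \<subseteq> cbox (vector [0, 0]) (vector [w, 1])"
proof
  fix p assume "p \<in> path_image (semi (bdry z) (bdry z'))"
  then obtain t where t: "0 \<le> t" "t \<le> 1" "p = semi (bdry z) (bdry z') t" by (auto simp: path_image_def)
  let ?\<rho> = "(1 - t) * (bdry z)\<^sup>2 + t * (bdry z')\<^sup>2" and ?X = "bdry z + t * (bdry z' - bdry z)"
  note b = semi_bounds[OF bdry_nz[OF z(1)] bdry_nz[OF z(2)] bdry_strict_mono[OF z] t(1,2)]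
  have sq: "(bdry z)\<^sup>2 = exp (2 * pi * of_int \<bar>z\<bar>)" if "z \<noteq> 0" for z
    using that by (simp add: bdry_def power_mult_distrib sgn_if flip: exp_double)
  have ge: "1 \<le> (bdry z)\<^sup>2" if "z \<noteq> 0" for z unfolding sq[OF that] by simp
  have le: "(bdry z)\<^sup>2 \<le> exp (2 * pi * w)" if "z \<noteq> 0" "of_int \<bar>z\<bar> \<le> w" for z unfolding sq[OF that(1)] using that by simp
  have "?\<rho> \<le> exp (2 * pi * w)"
    using convex_bound_le[OF le[OF z(1) w(1)] le[OF z(2) w(2)], of "1 - t" t] t by simp
  then have "ln ?\<rho> \<le> 2 * pi * w" using b(1) by (metis ln_exp ln_le_cancel_iff exp_gt_zero)
  then have 1: "ln ?\<rho> / (2 * pi) \<le> w" by (simp add: divide_le_eq mult.commute)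
  have "1 \<le> ?\<rho>" using convex_bound_le[of "- (bdry z)\<^sup>2" "-1" "- (bdry z')\<^sup>2" "1 - t" t] ge[OF z(1)] ge[OF z(2)] t by simp
  then have 2: "0 \<le> ln ?\<rho> / (2 * pi)" by simp
  have "\<bar>?X\<bar> \<le> sqrt ?\<rho>" using b(2) by (simp add: real_le_rsqrt)
  then have "\<bar>?X / sqrt ?\<rho>\<bar> \<le> 1" using b(1) by (simp add: abs_divide divide_le_eq)
  then have "- 1 \<le> ?X / sqrt ?\<rho>" "?X / sqrt ?\<rho> \<le> 1" by linarith+
  then have 3: "0 \<le> arccos (?X / sqrt ?\<rho>)" "arccos (?X / sqrt ?\<rho>) \<le> pi"
    by (rule arccos_lbound, rule arccos_ubound)
  show "p \<in> cbox (vector [0, 0]) (vector [w, 1])"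
    unfolding t(3) semi_def chart_def using 1 2 3 by (simp add: mem_box_cart forall_2)
qed

lemma point_vkey:
  assumes "fin_lin A" "fin_lin B" "v \<in> verts A B"
  shows "point A B v = chart (bdry (vkey (pos A) (pos B) v)) ((bdry (vkey (pos A) (pos B) v))\<^sup>2)"
  unfolding chart_end[OF brauer_hom_mate_bounds(1)[OF assms]]
  using assms(3) pos_bounds(1)[OF assms(1)] pos_bounds(1)[OF assms(2)]
  by (elim vertsE) (simp_all add: point_def)

definition wrap :: "real^2 => real^2" where
  "wrap z = vector [exp (pi * z $ 1) * cos (pi * z $ 2), exp (pi * z $ 1) * sin (pi * z $ 2)]"

lemma continuous_wrap: "continuous_on S wrap"
  unfolding wrap_def by (intro continuous_on_vector_2 continuous_intros)

lemma wrap_inj: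
  assumes "0 \<le> z $ 2" "z $ 2 \<le> 1" "0 \<le> z' $ 2" "z' $ 2 \<le> 1" "wrap z = wrap z'"
  shows "z = z'"
proof -
  have e: "exp (pi * z $ 1) * cos (pi * z $ 2) = exp (pi * z' $ 1) * cos (pi * z' $ 2)"
    "exp (pi * z $ 1) * sin (pi * z $ 2) = exp (pi * z' $ 1) * sin (pi * z' $ 2)"
    using arg_cong[OF assms(5), of "\<lambda>v. v $ 1"] arg_cong[OF assms(5), of "\<lambda>v. v $ 2"]
    by (simp_all add: wrap_def)
  have "(exp (pi * z $ 1))\<^sup>2 = (exp (pi * z $ 1) * cos (pi * z $ 2))\<^sup>2 + (exp (pi * z $ 1) * sin (pi * z $ 2))\<^sup>2" for z :: "real^2"
    unfolding power_mult_distrib by (simp flip: distrib_left)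
  then have "(exp (pi * z $ 1))\<^sup>2 = (exp (pi * z' $ 1))\<^sup>2" using e by metis
  then have x: "z $ 1 = z' $ 1" by (simp add: power2_eq_iff_nonneg)
  then have "cos (pi * z $ 2) = cos (pi * z' $ 2)" using e(1) by simp
  then have "pi * z $ 2 = pi * z' $ 2"
    using cos_inj_pi[of "pi * z $ 2" "pi * z' $ 2"] assms(1-4) mult_left_le[of "z $ 2" pi] mult_left_le[of "z' $ 2" pi]
    by simp
  then show ?thesis using x by (simp add: vec_eq_iff forall_2)
qed

lemma wrap_chart_end: "z \<noteq> 0 ==> wrap (chart (bdry z) ((bdry z)\<^sup>2)) = vector [bdry z, 0]"
  unfolding chart_end by (auto simp: wrap_def bdry_def sgn_if)

text \<open>After \<open>wrap\<close> the four ends lie interlaced on the lower side of a box in the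
  upper half plane, where \<open>fashoda_interlace\<close> forces the paths to meet; injectivity of
  \<open>wrap\<close> on the strip brings the common point back.\<close>

lemma crossing_edges_meet:
  assumes w: "0 \<le> w" and e: "path e" "path e'"
    and box: "path_image e \<subseteq> cbox (vector [0, 0]) (vector [w, 1])"
      "path_image e' \<subseteq> cbox (vector [0, 0]) (vector [w, 1])"
    and ends: "wrap (pathstart e) = vector [x1, 0]" "wrap (pathfinish e) = vector [y1, 0]"
      "wrap (pathstart e') = vector [x2, 0]" "wrap (pathfinish e') = vector [y2, 0]"
    and lt: "x1 < x2" "x2 < y1" "y1 < y2"
  shows "path_image e \<inter> path_image e' \<noteq> {}"
proof -
  let ?E = "exp (pi * w)"
  have strip: "0 \<le> z $ 2" "z $ 2 \<le> 1" "z $ 1 \<le> w" if "z \<in> cbox (vector [0, 0]) (vector [w, 1])" for z :: "real^2"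
    using that by (auto simp: mem_box_cart forall_2)
  have wb: "wrap z \<in> cbox (vector [- ?E, 0]) (vector [?E, ?E])"
    if z: "z \<in> cbox (vector [0, 0]) (vector [w, 1])" for z
  proof -
    have "exp (pi * z $ 1) \<le> ?E" using strip(3)[OF z] by simp
    moreover have "\<bar>exp (pi * z $ 1) * c\<bar> \<le> exp (pi * z $ 1)" if "\<bar>c\<bar> \<le> 1" for c
      using that by (simp add: abs_mult)
    ultimately have "\<bar>exp (pi * z $ 1) * cos (pi * z $ 2)\<bar> \<le> ?E" "\<bar>exp (pi * z $ 1) * sin (pi * z $ 2)\<bar> \<le> ?E"
      by (meson abs_cos_le_one abs_sin_le_one order_trans)+
    moreover have "0 \<le> sin (pi * z $ 2)"
      using strip(1,2)[OF z] mult_left_le[of "z $ 2" pi] by (intro sin_ge_zero) auto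
    ultimately show ?thesis by (simp add: wrap_def mem_box_cart forall_2 abs_le_iff)
  qed
  have p: "path (wrap \<circ> e)" "path (wrap \<circ> e')"
    using e continuous_wrap by (auto intro: path_continuous_image)
  have im: "path_image (wrap \<circ> e) = wrap ` path_image e" "path_image (wrap \<circ> e') = wrap ` path_image e'"
    by (auto simp: path_image_def)
  have ib: "path_image (wrap \<circ> e) \<subseteq> cbox (vector [- ?E, 0]) (vector [?E, ?E])"
    "path_image (wrap \<circ> e') \<subseteq> cbox (vector [- ?E, 0]) (vector [?E, ?E])"
    unfolding im using wb box by auto
  obtain z where z: "z \<in> path_image (wrap \<circ> e)" "z \<in> path_image (wrap \<circ> e')"
    by (rule fashoda_interlace[OF p ib])
      (use ends lt in \<open>simp_all add: pathstart_def pathfinish_def\<close>)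
  then obtain u u' where u: "u \<in> path_image e" "u' \<in> path_image e'" "wrap u = wrap u'"
    unfolding im by auto
  then have "u = u'" using box strip wrap_inj[of u u'] by blast
  then show ?thesis using u by auto
qed

text \<open>The partner of w escapes either below v or beyond \<open>f v\<close>. In the first case
  the arc of w, read from \<open>f w\<close>, is the left one of the crossing pair.\<close>

lemma matching_crossing:
  assumes m: "matching V f" and k: "inj_on k V" and n: "\<not> noncross V k f"
  obtains u u' where "u \<in> V" "u' \<in> V" "k u < k u'" "k u' < k (f u)" "k (f u) < k (f u')"
proof -
  note M = matchingD[OF m]
  obtain v w where vw: "v \<in> V" "w \<in> V" "k v < k w" "k w < k (f v)" "\<not> (k v < k (f w) \<and> k (f w) < k (f v))"
    using n by (auto simp: noncross_def)
  have ne: "f w \<noteq> v" "f w \<noteq> f v" using M(3) vw by (metis less_irrefl)+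
  then have ne: "k (f w) \<noteq> k v" "k (f w) \<noteq> k (f v)"
    using inj_onD[OF k] M(1) vw(1,2) by metis+
  show thesis
  proof (cases "k (f w) < k v")
    case True
    then show thesis using that[of "f w" v] M vw by simp
  next
    case False
    then have "k (f v) < k (f w)" using vw(5) ne by linarith
    then show thesis using that[of v w] vw by simp
  qed
qed

text \<open>Interlaced blocks would have meeting edges; conversely each block is drawn as the half
  circle over the interval between its ends on the axis, transported to the rectangle.\<close>

theorem planar_iff_ncr:
  assumes \<alpha>: "\<alpha> \<in> brauer_hom A B" and A: "fin_lin A" and B: "fin_lin B"
  shows "planar \<alpha> \<longleftrightarrow> ncr A B \<alpha>"
proof
  let ?k = "vkey (pos A) (pos B)"
  let ?w = "real (max (card (Field A)) (card (Field B)) + 1)"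
  note M = mateD[OF \<alpha>]
  note st = brauer_hom_sel[OF \<alpha>]
  have kb: "?k v \<noteq> 0" "of_int \<bar>?k v\<bar> \<le> ?w" if "v \<in> verts A B" for v
    using brauer_hom_mate_bounds[OF A B that] by linarith+
  have ki: "?k v = ?k w \<longleftrightarrow> v = w" if "v \<in> verts A B" "w \<in> verts A B" for v w
    using vkey_inj[OF A B] that by (auto dest: inj_onD)
  {
    assume "planar \<alpha>"
    then obtain e :: "'a vertex set => real => real^2" where
      E: "\<forall>b\<in>blocks \<alpha>. arc (e b) \<and> path_image (e b) \<subseteq> cbox (vector [0, 0]) (vector [?w, 1]) \<and>
        {pathstart (e b), pathfinish (e b)} = point A B ` b"
      "\<forall>b\<in>blocks \<alpha>. \<forall>c\<in>blocks \<alpha>. b \<noteq> c --> path_image (e b) \<inter> path_image (e c) = {}"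
      unfolding planar_def Let_def st by (elim exE conjE)
    then have e: "\<And>b. b \<in> blocks \<alpha> ==> arc (e b)"
        "\<And>b. b \<in> blocks \<alpha> ==> path_image (e b) \<subseteq> cbox (vector [0, 0]) (vector [?w, 1])"
        "\<And>b. b \<in> blocks \<alpha> ==> {pathstart (e b), pathfinish (e b)} = point A B ` b"
        "\<And>b c. b \<in> blocks \<alpha> ==> c \<in> blocks \<alpha> ==> b \<noteq> c ==> path_image (e b) \<inter> path_image (e c) = {}"
      by simp_all
    \<comment> \<open>An edge may be parametrised from either end, whereas the crossing argument
      needs it to start at v.\<close>
    have oriented: "\<exists>g. path g \<and> path_image g = path_image (e {v, mate \<alpha> v}) \<and>
        pathstart g = point A B v \<and> pathfinish g = point A B (mate \<alpha> v)" if v: "v \<in> verts A B" for v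
    proof -
      let ?b = "{v, mate \<alpha> v}"
      have b: "?b \<in> blocks \<alpha>" using mate_block(1)[OF \<alpha> v] .
      have p: "path (e ?b)" using e(1)[OF b] by (simp add: arc_imp_path)
      have "{pathstart (e ?b), pathfinish (e ?b)} = {point A B v, point A B (mate \<alpha> v)}" using e(3)[OF b] by simp
      then consider "pathstart (e ?b) = point A B v" "pathfinish (e ?b) = point A B (mate \<alpha> v)"
        | "pathfinish (e ?b) = point A B v" "pathstart (e ?b) = point A B (mate \<alpha> v)"
        by (auto simp: doubleton_eq_iff)
      then show ?thesis
      proof cases
        case 1 then show ?thesis using p by blast
      next
        case 2 then show ?thesis using p by (intro exI[of _ "reversepath (e ?b)"]) simp
      qed
    qed
    have wp: "wrap (point A B v) = vector [bdry (?k v), 0]" if "v \<in> verts A B" for v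
      unfolding point_vkey[OF A B that] by (rule wrap_chart_end[OF kb(1)[OF that]])
    show "ncr A B \<alpha>"
      unfolding ncr_def
    proof (rule ccontr)
      assume "\<not> noncross (verts A B) ?k (mate \<alpha>)"
      then obtain u u' where u: "u \<in> verts A B" "u' \<in> verts A B" "?k u < ?k u'" "?k u' < ?k (mate \<alpha> u)"
        "?k (mate \<alpha> u) < ?k (mate \<alpha> u')"
        by (rule matching_crossing[OF matching_mate[OF \<alpha>] vkey_inj[OF A B]])
      let ?b = "{u, mate \<alpha> u}" and ?b' = "{u', mate \<alpha> u'}"
      have b: "?b \<in> blocks \<alpha>" "?b' \<in> blocks \<alpha>" using mate_block(1)[OF \<alpha>] u by auto
      have "?b \<noteq> ?b'" using u by (auto simp: doubleton_eq_iff)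
      then have disj: "path_image (e ?b) \<inter> path_image (e ?b') = {}" using e(4)[OF b] by simp
      obtain g where g: "path g" "path_image g = path_image (e ?b)"
        "pathstart g = point A B u" "pathfinish g = point A B (mate \<alpha> u)" using oriented[OF u(1)] by blast
      obtain g' where g': "path g'" "path_image g' = path_image (e ?b')"
        "pathstart g' = point A B u'" "pathfinish g' = point A B (mate \<alpha> u')" using oriented[OF u(2)] by blast
      have "path_image g \<inter> path_image g' \<noteq> {}"
      proof (rule crossing_edges_meet[of ?w])
        show "path_image g \<subseteq> cbox (vector [0, 0]) (vector [?w, 1])"
          "path_image g' \<subseteq> cbox (vector [0, 0]) (vector [?w, 1])"
          using g(2) g'(2) e(2) b by simp_all
        show "bdry (?k u) < bdry (?k u')" "bdry (?k u') < bdry (?k (mate \<alpha> u))"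
          "bdry (?k (mate \<alpha> u)) < bdry (?k (mate \<alpha> u'))"
          using u kb(1) M(1) by (auto intro!: bdry_strict_mono)
      qed (use g g' wp u M(1) in simp_all)
      then show False using disj g g' by simp
    qed
  next
    assume "ncr A B \<alpha>"
    then have nc: "noncross (verts A B) ?k (mate \<alpha>)" by (simp add: ncr_def)
    define lo where "lo b = (THE v. v \<in> b \<and> v \<in> verts A B \<and> ?k v < ?k (mate \<alpha> v))" for b
    have lo: "lo b \<in> verts A B" "?k (lo b) < ?k (mate \<alpha> (lo b))" "b = {lo b, mate \<alpha> (lo b)}"
      if b: "b \<in> blocks \<alpha>" for b
    proof -
      obtain v where v: "v \<in> verts A B" "b = {v, mate \<alpha> v}" "?k v < ?k (mate \<alpha> v)"
      proof -
        obtain v where v: "v \<in> verts A B" "b = {v, mate \<alpha> v}" using b unfolding blocks_mate[OF \<alpha>] by auto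
        have "?k v \<noteq> ?k (mate \<alpha> v)" using ki v M(1,2) by metis
        then consider "?k v < ?k (mate \<alpha> v)" | "?k (mate \<alpha> v) < ?k v" by linarith
        then show thesis
        proof cases
          case 1 then show thesis using that v by simp
        next
          case 2 then show thesis using that[of "mate \<alpha> v"] v M by (simp add: insert_commute)
        qed
      qed
      have "lo b = v" unfolding lo_def
        by (rule the_equality) (use v M(3) in auto)
      then show "lo b \<in> verts A B" "?k (lo b) < ?k (mate \<alpha> (lo b))" "b = {lo b, mate \<alpha> (lo b)}" using v by simp_all
    qed
    let ?x = "\<lambda>v. bdry (?k v)"
    let ?e = "\<lambda>b. semi (?x (lo b)) (?x (mate \<alpha> (lo b)))"
    have nz: "?x v \<noteq> 0" if "v \<in> verts A B" for v using bdry_nz kb(1)[OF that] .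
    have mono: "?x v < ?x w" if "v \<in> verts A B" "w \<in> verts A B" "?k v < ?k w" for v w
      using bdry_strict_mono kb(1) that by simp
    have ends: "pathstart (semi (?x v) (?x w)) = point A B v" "pathfinish (semi (?x v) (?x w)) = point A B w"
      if "v \<in> verts A B" "w \<in> verts A B" for v w
      using that by (simp_all add: point_vkey[OF A B] pathstart_def pathfinish_def semi_def)
    have main: "arc (?e b)" "path_image (?e b) \<subseteq> cbox (vector [0, 0]) (vector [?w, 1])"
        "{pathstart (?e b), pathfinish (?e b)} = point A B ` b" if b: "b \<in> blocks \<alpha>" for b
    proof -
      note l = lo[OF b] and mv = M(1)[OF lo(1)[OF b]]
      show "arc (?e b)" by (rule arc_semi[OF nz[OF l(1)] nz[OF mv] mono[OF l(1) mv l(2)]])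
      show "path_image (?e b) \<subseteq> cbox (vector [0, 0]) (vector [?w, 1])"
        by (rule semi_box) (use l mv kb in simp_all)
      show "{pathstart (?e b), pathfinish (?e b)} = point A B ` b"
        using ends[OF l(1) mv] arg_cong[OF l(3), of "(`) (point A B)"] by simp
    qed
    have disj: "path_image (?e b) \<inter> path_image (?e c) = {}" if bc: "b \<in> blocks \<alpha>" "c \<in> blocks \<alpha>" "b \<noteq> c" for b c
    proof -
      have gen: "path_image (?e b) \<inter> path_image (?e c) = {}"
        if bc: "b \<in> blocks \<alpha>" "c \<in> blocks \<alpha>" "b \<noteq> c" and lt: "?k (lo b) < ?k (lo c)" for b c
      proof (rule semi_disjoint)
        note l = lo[OF bc(1)] lo[OF bc(2)] and mv = M(1)[OF lo(1)[OF bc(1)]] M(1)[OF lo(1)[OF bc(2)]]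
        show "?x (lo b) \<noteq> 0" "?x (mate \<alpha> (lo b)) \<noteq> 0" "?x (lo c) \<noteq> 0" "?x (mate \<alpha> (lo c)) \<noteq> 0"
          using nz l mv by auto
        show "?x (lo b) < ?x (mate \<alpha> (lo b))" "?x (lo c) < ?x (mate \<alpha> (lo c))" using mono l mv by auto
        have "mate \<alpha> (lo b) \<noteq> lo c" using l bc(3) M(3) by (metis insert_commute)
        then have "?k (mate \<alpha> (lo b)) \<noteq> ?k (lo c)" using ki l mv by simp
        then consider "?k (mate \<alpha> (lo b)) < ?k (lo c)" | "?k (lo c) < ?k (mate \<alpha> (lo b))" by linarith
        then show "?x (mate \<alpha> (lo b)) < ?x (lo c) \<or> ?x (lo b) < ?x (lo c) \<and> ?x (mate \<alpha> (lo c)) < ?x (mate \<alpha> (lo b))"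
        proof cases
          case 1 then show ?thesis using mono l mv by simp
        next
          case 2
          then have "?k (mate \<alpha> (lo c)) < ?k (mate \<alpha> (lo b))"
            using noncrossD(2)[OF nc l(1) l(4) lt] by simp
          then show ?thesis using mono l mv lt by simp
        qed
      qed
      have "?k (lo b) \<noteq> ?k (lo c)" using ki lo(1)[OF bc(1)] lo(1)[OF bc(2)] lo(3)[OF bc(1)] lo(3)[OF bc(2)] bc(3) by metis
      then consider "?k (lo b) < ?k (lo c)" | "?k (lo c) < ?k (lo b)" by linarith
      then show ?thesis
      proof cases
        case 1 then show ?thesis using gen[OF bc] by simp
      next
        case 2 then show ?thesis using gen[OF bc(2,1)] bc(3) by (simp add: Int_commute)
      qed
    qed
    show "planar \<alpha>"
      unfolding planar_def Let_def st
      by (rule exI[of _ ?e]) (use main disj in simp)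
  }
qed

section \<open>Upper and lower patterns\<close>

text \<open>A change of keys may exchange the inside and the outside of an arc, as recorded by s;
  only whether two ends lie on the same side of it matters.\<close>

lemma noncross_transfer:
  assumes m: "matching V f" and k: "inj_on k V" "inj_on k' V" and n: "noncross V k f"
    and t: "\<And>v w. v \<in> V ==> w \<in> V ==> w \<noteq> v ==> w \<noteq> f v ==>
      btw (k' v) (k' (f v)) (k' w) = (btw (k v) (k (f v)) (k w) = s v)"
  shows "noncross V k' f"
  unfolding noncross_iff[OF m k(2)]
proof (intro ballI impI)
  fix v w assume vw: "v \<in> V" "w \<in> V" "w \<noteq> v \<and> w \<noteq> f v"
  then have "f w \<in> V" "f w \<noteq> v" "f w \<noteq> f v" using matchingD[OF m] by metis+
  then show "btw (k' v) (k' (f v)) (k' w) = btw (k' v) (k' (f v)) (k' (f w))"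
    using t[of v w] t[of v "f w"] vw n[unfolded noncross_iff[OF m k(1)]] by simp
qed

text \<open>Reflection of the rectangle left to right. On the line of keys each row is reversed
  within itself: arcs within a row keep their inside, transversals exchange inside and
  outside.\<close>

lemma ncr_converse:
  assumes x: "x \<in> brauer_hom A B" and A: "fin_lin A" and B: "fin_lin B" and n: "ncr A B x"
  shows "ncr (A\<inverse>) (B\<inverse>) x"
proof -
  let ?k = "vkey (pos A) (pos B)" and ?k' = "vkey (pos (A\<inverse>)) (pos (B\<inverse>))"
  have A': "fin_lin (A\<inverse>)" and B': "fin_lin (B\<inverse>)" using A B by (simp_all add: fin_lin_converse)
  have kk: "?k' v = (if ?k v < 0 then - int (card (Field A)) - 1 - ?k v else int (card (Field B)) + 1 - ?k v)"
    "?k v \<noteq> 0" "- int (card (Field A)) \<le> ?k v" "?k v \<le> int (card (Field B))"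
    if "v \<in> verts A B" for v
    using that pos_converse[OF A] pos_converse[OF B] pos_bounds[OF A] pos_bounds[OF B]
    by (elim vertsE; force)+
  have "noncross (verts A B) ?k' (mate x)"
  proof (rule noncross_transfer[OF matching_mate[OF x] vkey_inj[OF A B] _ n[unfolded ncr_def],
        where s = "\<lambda>v. (?k v < 0) = (?k (mate x v) < 0)"])
    show "inj_on ?k' (verts A B)" using vkey_inj[OF A' B'] by simp
    fix v w assume vw: "v \<in> verts A B" "w \<in> verts A B" "w \<noteq> v" "w \<noteq> mate x v"
    have mv: "mate x v \<in> verts A B" using mateD(1)[OF x vw(1)] .
    have ne: "?k w \<noteq> ?k v" "?k w \<noteq> ?k (mate x v)"
      using inj_onD[OF vkey_inj[OF A B]] vw mv by metis+
    show "btw (?k' v) (?k' (mate x v)) (?k' w) =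
       (btw (?k v) (?k (mate x v)) (?k w) = ((?k v < 0) = (?k (mate x v) < 0)))"
      using ne kk(2-4)[OF vw(1)] kk(2-4)[OF vw(2)] kk(2-4)[OF mv]
      unfolding kk(1)[OF vw(1)] kk(1)[OF vw(2)] kk(1)[OF mv] btw_def by smt
  qed
  then show ?thesis by (simp add: ncr_def)
qed

fun swap :: "'a vertex => 'a vertex" where
  "swap (Top a) = Bot a"
| "swap (Mid a) = Mid a"
| "swap (Bot a) = Top a"

lemma swap_swap [simp]: "swap (swap v) = v"
  by (cases v) auto

lemma swap_verts [simp]: "swap v \<in> verts B A \<longleftrightarrow> v \<in> verts A B"
  by (cases v) auto

definition star :: "'a brauer => 'a brauer" where
  "star x = of_mate (trg x) (src x) (\<lambda>v. swap (mate x (swap v)))"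

lemma matching_swap:
  assumes "x \<in> brauer_hom A B"
  shows "matching (verts B A) (\<lambda>v. swap (mate x (swap v)))"
  unfolding matching_def
proof
  fix v assume "v \<in> verts B A"
  then have "swap v \<in> verts A B" by simp
  note M = mateD[OF assms this]
  show "swap (mate x (swap v)) \<in> verts B A \<and> swap (mate x (swap v)) \<noteq> v \<and>
      swap (mate x (swap (swap (mate x (swap v))))) = v"
    using M by (metis swap_swap swap_verts)
qed

lemma star_hom: "x \<in> brauer_hom A B ==> star x \<in> brauer_hom B A"
  using of_mate_hom[OF matching_swap] by (simp add: star_def brauer_hom_sel)

lemma mate_star: "x \<in> brauer_hom A B ==> v \<in> verts B A ==> mate (star x) v = swap (mate x (swap v))"
  using mate_of_mate[OF matching_swap] by (simp add: star_def brauer_hom_sel)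

lemma star_star:
  assumes "x \<in> brauer_hom A B"
  shows "star (star x) = x"
  by (rule brauer_eqI[OF star_hom[OF star_hom[OF assms]] assms])
    (simp add: mate_star[OF star_hom[OF assms]] mate_star[OF assms])

text \<open>Turning the rectangle upside down negates every key, so an arc has to be examined from
  its other end.\<close>

lemma ncr_star:
  assumes x: "x \<in> brauer_hom A B" and A: "fin_lin A" and B: "fin_lin B" and n: "ncr A B x"
  shows "ncr B A (star x)"
proof -
  let ?k = "vkey (pos A) (pos B)" and ?k' = "vkey (pos B) (pos A)"
  have ks: "?k' v = - ?k (swap v)" for v by (cases v) (auto simp: vkey_def)
  note M = mateD[OF x]
  have "noncross (verts B A) ?k' (mate (star x))"
    unfolding noncross_def
  proof (intro ballI impI)
    fix v w assume vw: "v \<in> verts B A" "w \<in> verts B A" "?k' v < ?k' w \<and> ?k' w < ?k' (mate (star x) v)"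
    let ?v = "swap v" and ?w = "swap w"
    have s: "?v \<in> verts A B" "?w \<in> verts A B" using vw by simp_all
    have "?k (mate x ?v) < ?k ?w" "?k ?w < ?k (mate x (mate x ?v))"
      using vw ks mate_star[OF x] M(3)[OF s(1)] by simp_all
    then show "?k' v < ?k' (mate (star x) w) \<and> ?k' (mate (star x) w) < ?k' (mate (star x) v)"
      using noncrossD[OF n[unfolded ncr_def] M(1)[OF s(1)] s(2)] vw ks mate_star[OF x] M(3)[OF s(1)] by simp
  qed
  then show ?thesis by (simp add: ncr_def)
qed

text \<open>The arcs inside the upper (lower) row form an involution \<open>upf x\<close> (\<open>dnf x\<close>) whose fixed points are the
  ends of the transversals; off the row it is the identity.\<close>

definition upf :: "'a brauer => 'a => 'a" where
  "upf x a = (if a \<in> Field (src x) then case mate x (Top a) of Top b => b | _ => a else a)"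

definition dnf :: "'a brauer => 'a => 'a" where
  "dnf x = upf (star x)"

lemma star_sel [simp]: "src (star x) = trg x" "trg (star x) = src x"
  by (simp_all add: star_def of_mate_def)

lemma upf_star: "x \<in> brauer_hom A B ==> upf (star x) = dnf x"
  by (simp add: dnf_def)

lemma dnf_star: "x \<in> brauer_hom A B ==> dnf (star x) = upf x"
  by (simp add: dnf_def star_star)

lemma mate_top_cases:
  assumes x: "x \<in> brauer_hom A B" and a: "a \<in> Field A"
  obtains (tt) b where "mate x (Top a) = Top b" "b \<in> Field A" "b \<noteq> a" "upf x a = b" "upf x b = a"
  | (tb) b where "mate x (Top a) = Bot b" "b \<in> Field B" "mate x (Bot b) = Top a" "upf x a = a" "dnf x b = b"
proof -
  have v: "Top a \<in> verts A B" using a by simp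
  note M = mateD[OF x v]
  from M(1) show thesis
  proof (cases rule: vertsE)
    case (1 b)
    then show thesis using tt[of b] M a brauer_hom_sel[OF x] by (auto simp: upf_def)
  next
    case (2 b)
    then have "mate (star x) (Top b) = Bot a" using mate_star[OF x, of "Top b"] M(3) by simp
    then show thesis using tb[of b] M a 2 brauer_hom_sel[OF x] by (simp add: upf_def dnf_def)
  qed
qed

lemma mate_bot_cases:
  assumes x: "x \<in> brauer_hom A B" and b: "b \<in> Field B"
  obtains (bb) c where "mate x (Bot b) = Bot c" "c \<in> Field B" "c \<noteq> b" "dnf x b = c" "dnf x c = b"
  | (bt) a where "mate x (Bot b) = Top a" "a \<in> Field A" "mate x (Top a) = Bot b" "dnf x b = b" "upf x a = a"
proof (cases rule: mate_top_cases[OF star_hom[OF x] b])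
  case (1 c)
  then show thesis using bb[of c] mate_star[OF x, of "Top b"] b
    by (metis dnf_def swap.simps(3) swap_swap verts_simps(1))
next
  case (2 c)
  then have "mate x (Bot b) = Top c" using mate_star[OF x, of "Top b"] b
    by (metis swap.simps(1) swap.simps(3) swap_swap verts_simps(1))
  moreover from this have "mate x (Top c) = Bot b" using mateD(3)[OF x, of "Bot b"] b by simp
  ultimately show thesis using bt[of c] 2 dnf_star[OF x] by (simp add: dnf_def)
qed

lemma upf_out: "x \<in> brauer_hom A B ==> a \<notin> Field A ==> upf x a = a"
  "x \<in> brauer_hom A B ==> b \<notin> Field B ==> dnf x b = b"
  by (simp_all add: upf_def dnf_def brauer_hom_sel)

lemma mate_top_upf:
  assumes x: "x \<in> brauer_hom A B" and a: "upf x a \<noteq> a"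
  shows "mate x (Top a) = Top (upf x a)" "a \<in> Field A"
proof -
  show "a \<in> Field A" using a upf_out(1)[OF x] by metis
  then show "mate x (Top a) = Top (upf x a)" by (cases rule: mate_top_cases[OF x]) (use a in auto)
qed

definition defects :: "'a rel => ('a => 'a) => 'a set" where
  "defects A p = {a \<in> Field A. p a = a}"

text \<open>Non-crossing arcs with no fixed point under an arc, since a transversal must be able to
  leave from it. Fixing everything off \<open>Field A\<close> makes patterns comparable as plain
  functions.\<close>

definition pat :: "'a rel => ('a => 'a) => bool" where
  "pat A p \<longleftrightarrow> (\<forall>a. a \<notin> Field A --> p a = a) \<and> (\<forall>a\<in>Field A. p a \<in> Field A \<and> p (p a) = a) \<and>
     (\<forall>a\<in>Field A. \<forall>b\<in>Field A. pos A a < pos A b \<and> pos A b < pos A (p a) -->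
        p b \<noteq> b \<and> pos A a < pos A (p b) \<and> pos A (p b) < pos A (p a))"

lemma patD:
  assumes "pat A p"
  shows "a \<notin> Field A ==> p a = a" "a \<in> Field A ==> p a \<in> Field A" "p (p a) = a"
    "a \<in> Field A ==> b \<in> Field A ==> pos A a < pos A b ==> pos A b < pos A (p a) ==>
      p b \<noteq> b \<and> pos A a < pos A (p b) \<and> pos A (p b) < pos A (p a)"
  using assms unfolding pat_def by metis+

lemma pat_converse:
  assumes A: "fin_lin A" and p: "pat A p"
  shows "pat (A\<inverse>) p"
  unfolding pat_def
proof (intro conjI allI ballI impI)
  fix a b assume ab: "a \<in> Field (A\<inverse>)" "b \<in> Field (A\<inverse>)"
    "pos (A\<inverse>) a < pos (A\<inverse>) b \<and> pos (A\<inverse>) b < pos (A\<inverse>) (p a)"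
  have F: "a \<in> Field A" "b \<in> Field A" "p a \<in> Field A" "p b \<in> Field A" using ab patD(2)[OF p] by auto
  note c = pos_converse[OF A F(1)] pos_converse[OF A F(2)] pos_converse[OF A F(3)] pos_converse[OF A F(4)]
  have "pos A (p a) < pos A b" "pos A b < pos A (p (p a))" using c ab(3) patD(3)[OF p] by simp_all
  then have h: "p b \<noteq> b \<and> pos A (p a) < pos A (p b) \<and> pos A (p b) < pos A a"
    using patD(4)[OF p F(3,2)] patD(3)[OF p] by simp
  then show "p b \<noteq> b" "pos (A\<inverse>) a < pos (A\<inverse>) (p b)" "pos (A\<inverse>) (p b) < pos (A\<inverse>) (p a)"
    using c by auto
qed (use patD[OF p] in auto)

lemma upf_invol: "x \<in> brauer_hom A B ==> upf x (upf x a) = a"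
  by (cases "a \<in> Field A") (auto simp: upf_out elim: mate_top_cases)

text \<open>Keys of the upper row decrease, so the arc is read from its right end. Under it there
  are upper vertices only, which forces the partner of b to be an upper vertex under the same
  arc.\<close>

lemma pat_upf:
  assumes x: "x \<in> brauer_hom A B" and A: "fin_lin A" and B: "fin_lin B" and n: "ncr A B x"
  shows "pat A (upf x)"
  unfolding pat_def
proof (intro conjI allI ballI impI)
  fix a b assume ab: "a \<in> Field A" "b \<in> Field A" "pos A a < pos A b \<and> pos A b < pos A (upf x a)"
  then have ne: "upf x a \<noteq> a" by auto
  have m: "mate x (Top a) = Top (upf x a)" using mate_top_upf[OF x ne] by simp
  then have m': "mate x (Top (upf x a)) = Top a" "Top (upf x a) \<in> verts A B"
    using mateD[OF x, of "Top a"] ab by auto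
  let ?k = "vkey (pos A) (pos B)"
  have k: "?k (Top (upf x a)) < ?k (mate x (Top b))" "?k (mate x (Top b)) < ?k (Top a)"
    using noncrossD[OF n[unfolded ncr_def] m'(2), of "Top b"] m' ab by auto
  show "upf x b \<noteq> b" "pos A a < pos A (upf x b)" "pos A (upf x b) < pos A (upf x a)"
    by (cases rule: mate_top_cases[OF x ab(2)]; use k in auto)+
next
  fix a assume "a \<in> Field A"
  then show "upf x a \<in> Field A" by (cases rule: mate_top_cases[OF x]) auto
qed (use upf_out(1)[OF x] upf_invol[OF x] in auto)

text \<open>Upper and lower defects are the two ends of the transversals.\<close>

lemma bij_betw_defects:
  assumes x: "x \<in> brauer_hom A B"
  obtains t where "bij_betw t (defects A (upf x)) (defects B (dnf x))"
    "\<And>a. a \<in> defects A (upf x) ==> mate x (Top a) = Bot (t a)"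
proof -
  define t where "t a = (THE b. mate x (Top a) = Bot b)" for a
  have t: "mate x (Top a) = Bot (t a)" "t a \<in> defects B (dnf x)" "mate x (Bot (t a)) = Top a"
    if a: "a \<in> defects A (upf x)" for a
  proof -
    have "a \<in> Field A" using a by (simp add: defects_def)
    then obtain b where b: "mate x (Top a) = Bot b" "b \<in> Field B" "mate x (Bot b) = Top a" "dnf x b = b"
      by (cases rule: mate_top_cases[OF x]) (use a in \<open>auto simp: defects_def\<close>)
    moreover from this have "t a = b" by (simp add: t_def)
    ultimately show "mate x (Top a) = Bot (t a)" "t a \<in> defects B (dnf x)" "mate x (Bot (t a)) = Top a"
      by (simp_all add: defects_def)
  qed
  have "bij_betw t (defects A (upf x)) (defects B (dnf x))"
    unfolding bij_betw_def
  proof (intro conjI inj_onI equalityI subsetI)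
    fix a c assume "a \<in> defects A (upf x)" "c \<in> defects A (upf x)" "t a = t c"
    then show "a = c" using t(3) by (metis vertex.inject(1))
  next
    fix b assume b: "b \<in> defects B (dnf x)"
    then have "b \<in> Field B" by (simp add: defects_def)
    then obtain a where a: "mate x (Top a) = Bot b" "a \<in> Field A" "upf x a = a"
      by (cases rule: mate_bot_cases[OF x]) (use b in \<open>auto simp: defects_def\<close>)
    then have "a \<in> defects A (upf x)" "t a = b" by (simp_all add: defects_def t_def)
    then show "b \<in> t ` defects A (upf x)" by blast
  qed (use t in auto)
  then show thesis using that t(1) by blast
qed

lemma rank_defects:
  assumes x: "x \<in> brauer_hom A B"
  shows "rank x = card (defects A (upf x))"
proof -
  let ?T = "{b \<in> blocks x. b \<inter> Top ` Field A \<noteq> {} \<and> b \<inter> Bot ` Field B \<noteq> {}}"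
  let ?g = "\<lambda>a. {Top a, mate x (Top a)}"
  have "bij_betw ?g (defects A (upf x)) ?T"
    unfolding bij_betw_def
  proof (intro conjI inj_onI equalityI subsetI)
    fix a c assume a: "a \<in> defects A (upf x)" "c \<in> defects A (upf x)" "?g a = ?g c"
    have "a \<in> Field A" using a by (simp add: defects_def)
    then show "a = c"
      by (cases rule: mate_top_cases[OF x]) (use a in \<open>auto simp: defects_def doubleton_eq_iff\<close>)
  next
    fix b assume b: "b \<in> ?g ` defects A (upf x)"
    then obtain a where a: "a \<in> defects A (upf x)" "b = ?g a" by auto
    then have aA: "a \<in> Field A" "upf x a = a" by (simp_all add: defects_def)
    from aA(1) obtain c where "mate x (Top a) = Bot c" "c \<in> Field B"
      by (cases rule: mate_top_cases[OF x]) (use aA in auto)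
    then show "b \<in> ?T" using a(2) aA mate_block(1)[OF x, of "Top a"] by auto
  next
    fix b assume "b \<in> ?T"
    then have b: "b \<in> blocks x" "b \<inter> Top ` Field A \<noteq> {}" "b \<inter> Bot ` Field B \<noteq> {}" by auto
    then obtain v where v: "v \<in> verts A B" "b = {v, mate x v}" unfolding blocks_mate[OF x] by auto
    from b(2,3) v(2) obtain a c where ac: "b = {Top a, Bot c}" "a \<in> Field A" "c \<in> Field B"
      by (auto simp: doubleton_eq_iff)
    then have "{Top a, Bot c} \<in> blocks x" using b(1) by simp
    then have m: "mate x (Top a) = Bot c" using mate_eqI[OF x] by simp
    have "upf x a = a" using ac(2) by (cases rule: mate_top_cases[OF x]) (use m in auto)
    then have "a \<in> defects A (upf x)" using ac by (simp add: defects_def)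
    then show "b \<in> ?g ` defects A (upf x)" using ac m by auto
  qed
  then show ?thesis using bij_betw_same_card brauer_hom_sel[OF x] by (simp add: rank_def) fastforce
qed

lemma rank_star: "x \<in> brauer_hom A B ==> rank (star x) = rank x"
  using bij_betw_defects[of x A B] rank_defects[of x A B] rank_defects[OF star_hom, of x A B] bij_betw_same_card
  by (metis dnf_def)

lemma rank_defects_dnf: "x \<in> brauer_hom A B ==> rank x = card (defects B (dnf x))"
  using rank_star rank_defects[OF star_hom] by (metis dnf_def)

section \<open>Partitions with prescribed patterns\<close>

lemma mono_bij_unique:
  fixes k :: "'a => nat" and l :: "'b => nat"
  assumes f: "bij_betw f S T" "\<And>x y. x \<in> S ==> y \<in> S ==> k x < k y ==> l (f x) < l (f y)"
    and g: "bij_betw g S T" "\<And>x y. x \<in> S ==> y \<in> S ==> k x < k y ==> l (g x) < l (g y)"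
    and inj: "inj_on k S" "inj_on l T"
  shows "a \<in> S ==> f a = g a"
proof (induction "k a" arbitrary: a rule: less_induct)
  case less
  \<comment> \<open>The value \<open>f a\<close> is attained by g at some c; monotonicity of g puts
    c before a, where f and g already agree, against injectivity of f.\<close>
  have key: "\<not> l (f a) < l (g a)"
    if f: "bij_betw f S T" and g: "bij_betw g S T" "\<And>x y. x \<in> S ==> y \<in> S ==> k x < k y ==> l (g x) < l (g y)"
      and ih: "\<And>c. k c < k a ==> c \<in> S ==> f c = g c" for f g
  proof
    assume lt: "l (f a) < l (g a)"
    have "f a \<in> g ` S" using f g(1) less.prems by (auto simp: bij_betw_def)
    then obtain c where c: "c \<in> S" "f a = g c" by auto
    have "\<not> k a < k c" using g(2)[OF less.prems c(1)] lt c by auto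
    moreover have "k a \<noteq> k c" using inj_onD[OF inj(1) _ less.prems c(1)] lt c by auto
    ultimately have "k c < k a" by simp
    then have "f c = f a" using ih c by simp
    then have "c = a" using f less.prems c(1) inj_onD[of f S c a] by (simp add: bij_betw_def)
    then show False using \<open>k c < k a\<close> by simp
  qed
  have "l (f a) = l (g a)"
    using key[OF f(1) g] key[OF g(1) f] less.hyps by (metis linorder_neqE_nat)
  moreover have "f a \<in> T" "g a \<in> T" using f(1) g(1) less.prems by (auto simp: bij_betw_def)
  ultimately show ?case using inj_onD[OF inj(2)] by metis
qed

text \<open>Read from its upper end c, the transversal of c encloses the key of a, because upper
  keys are reversed; so it encloses the lower end b as well.\<close>

lemma ncr_transversals:
  assumes x: "x \<in> brauer_hom A B" and B: "fin_lin B" and n: "ncr A B x"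
    and ac: "mate x (Top a) = Bot b" "mate x (Top c) = Bot d" "a \<in> Field A" "c \<in> Field A" "pos A a < pos A c"
  shows "pos B b < pos B d"
proof -
  have "d \<in> Field B" using mateD(1)[OF x, of "Top c"] ac by simp
  then have "0 < pos B d" using pos_bounds(1)[OF B] by simp
  then show ?thesis using noncrossD(2)[OF n[unfolded ncr_def], of "Top c" "Top a"] ac by simp
qed

lemma brauer_eq_transversals:
  assumes x: "x \<in> brauer_hom A B" and y: "y \<in> brauer_hom A B"
    and ud: "upf x = upf y" "dnf x = dnf y"
    and t: "\<And>a. a \<in> defects A (upf x) ==> mate x (Top a) = mate y (Top a)"
  shows "x = y"
proof (rule brauer_eqI[OF x y])
  have top: "mate x (Top a) = mate y (Top a)" if "a \<in> Field A" for a
  proof (cases "upf x a = a")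
    case True then show ?thesis using t that by (simp add: defects_def)
  next
    case False then show ?thesis using mate_top_upf(1)[OF x] mate_top_upf(1)[OF y] ud by simp
  qed
  fix v assume v: "v \<in> verts A B"
  then show "mate x v = mate y v"
  proof (cases rule: vertsE)
    case (2 b)
    show ?thesis
    proof (cases rule: mate_bot_cases[OF x 2(2)])
      case (1 c)
      show ?thesis by (rule mate_bot_cases[OF y 2(2)]) (use 1 2 ud in auto)
    next
      case (2 a)
      then have "mate y (Top a) = Bot b" using top by simp
      then show ?thesis using 2 \<open>v = Bot b\<close> mateD(3)[OF y, of "Top a"] by simp
    qed
  qed (use top in simp)
qed

text \<open>Both patterns given, only the matching of upper with lower defects is open, and
  non-crossing transversals preserve the order. The order \<open>A'\<close> is kept apart from the
  object \<open>A\<close> so that the same argument covers the reversed upper row.\<close>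

lemma ncr_unique:
  assumes \<alpha>: "\<alpha> \<in> brauer_hom A B" and \<beta>: "\<beta> \<in> brauer_hom A B"
    and A': "fin_lin A'" "Field A' = Field A" and B: "fin_lin B"
    and n: "ncr A' B \<alpha>" "ncr A' B \<beta>" and ud: "upf \<alpha> = upf \<beta>" "dnf \<alpha> = dnf \<beta>"
  shows "\<alpha> = \<beta>"
proof (rule brauer_eq_transversals[OF \<alpha> \<beta> ud])
  obtain s where s: "bij_betw s (defects A (upf \<alpha>)) (defects B (dnf \<alpha>))"
    "\<And>a. a \<in> defects A (upf \<alpha>) ==> mate \<alpha> (Top a) = Bot (s a)" using bij_betw_defects[OF \<alpha>] by blast
  obtain t where t: "bij_betw t (defects A (upf \<alpha>)) (defects B (dnf \<alpha>))"
    "\<And>a. a \<in> defects A (upf \<alpha>) ==> mate \<beta> (Top a) = Bot (t a)"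
    using bij_betw_defects[OF \<beta>] unfolding ud[symmetric] by blast
  have h: "\<alpha> \<in> brauer_hom A B ==> Brauer A' B (blocks \<alpha>) \<in> brauer_hom A' B" for \<alpha>
    using A'(2) by (auto simp: brauer_hom_def verts_def)
  have m: "mate (Brauer A' B (blocks \<alpha>)) = mate \<alpha>" for \<alpha> by (rule ext) (simp add: mate_def)
  have tr: "pos B b < pos B d"
    if "\<alpha> \<in> brauer_hom A B" "ncr A' B \<alpha>" "mate \<alpha> (Top a) = Bot b" "mate \<alpha> (Top c) = Bot d" "a \<in> Field A" "c \<in> Field A"
      "pos A' a < pos A' c" for \<alpha> a b c d
    using ncr_transversals[OF h[OF that(1)] B] that A'(2) by (simp add: ncr_def m)
  fix a assume a: "a \<in> defects A (upf \<alpha>)"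
  have "s a = t a"
  proof (rule mono_bij_unique[OF s(1) _ t(1) _ _ _ a, where k = "pos A'" and l = "pos B"])
    show "inj_on (pos A') (defects A (upf \<alpha>))" "inj_on (pos B) (defects B (dnf \<alpha>))"
      using pos_inj[OF A'(1)] pos_inj[OF B] A'(2) by (auto intro: inj_on_subset simp: defects_def)
    show "pos B (s x) < pos B (s y)" if "x \<in> defects A (upf \<alpha>)" "y \<in> defects A (upf \<alpha>)" "pos A' x < pos A' y" for x y
      using tr[OF \<alpha> n(1) s(2)[OF that(1)] s(2)[OF that(2)]] that by (simp add: defects_def)
    show "pos B (t x) < pos B (t y)" if "x \<in> defects A (upf \<alpha>)" "y \<in> defects A (upf \<alpha>)" "pos A' x < pos A' y" for x y
      using tr[OF \<beta> n(2) t(2)[OF that(1)] t(2)[OF that(2)]] that by (simp add: defects_def)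
  qed
  then show "mate \<alpha> (Top a) = mate \<beta> (Top a)" using s(2) t(2) a by simp
qed

text \<open>One defect on each side leaves a single way to join them, whatever the sign.\<close>

lemma rank_1_unique:
  assumes x: "x \<in> brauer_hom A B" and y: "y \<in> brauer_hom A B"
    and ud: "upf x = upf y" "dnf x = dnf y" and r: "rank x = 1"
  shows "x = y"
proof (rule brauer_eq_transversals[OF x y ud])
  obtain s where s: "bij_betw s (defects A (upf x)) (defects B (dnf x))"
    "\<And>a. a \<in> defects A (upf x) ==> mate x (Top a) = Bot (s a)" using bij_betw_defects[OF x] by blast
  obtain t where t: "bij_betw t (defects A (upf x)) (defects B (dnf x))"
    "\<And>a. a \<in> defects A (upf x) ==> mate y (Top a) = Bot (t a)"
    using bij_betw_defects[OF y] unfolding ud[symmetric] by blast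
  obtain b where b: "defects B (dnf x) = {b}" using r rank_defects_dnf[OF x] by (metis card_1_singletonE)
  fix a assume a: "a \<in> defects A (upf x)"
  then have "s a = b" "t a = b" using s(1) t(1) b by (auto simp: bij_betw_def)
  then show "mate x (Top a) = mate y (Top a)" using s(2) t(2) a by simp
qed

text \<open>The general partition with upper pattern p, lower pattern q and transversals from a to
  \<open>s a\<close>; t is meant to be the inverse of s.\<close>

definition link :: "('a => 'a) => ('a => 'a) => ('a => 'a) => ('a => 'a) => 'a vertex => 'a vertex" where
  "link p q s t v = (case v of
     Top a => if p a = a then Bot (s a) else Top (p a)
   | Mid a => Mid a
   | Bot b => if q b = b then Top (t b) else Bot (q b))"

context
  fixes A A' B :: "'a rel" and p q s t :: "'a => 'a"
  assumes A': "fin_lin A'" "Field A' = Field A" and B: "fin_lin B" and p: "pat A' p" and q: "pat B q"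
    and s: "\<And>a. a \<in> defects A p ==> s a \<in> defects B q \<and> t (s a) = a"
    and t: "\<And>b. b \<in> defects B q ==> t b \<in> defects A p \<and> s (t b) = b"
    and mono: "\<And>a c. a \<in> defects A p ==> c \<in> defects A p ==> pos A' a < pos A' c ==> pos B (s a) < pos B (s c)"
begin

lemma matching_link: "matching (verts A B) (link p q s t)"
  unfolding matching_def
proof
  fix v assume "v \<in> verts A B"
  then show "link p q s t v \<in> verts A B \<and> link p q s t v \<noteq> v \<and> link p q s t (link p q s t v) = v"
  proof (cases rule: vertsE)
    case (1 a)
    then show ?thesis using s[of a] patD[OF p, of a] A'(2) by (auto simp: link_def defects_def)
  next
    case (2 b)
    then show ?thesis using t[of b] patD[OF q, of b] by (auto simp: link_def defects_def)
  qed
qed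

lemma link_hom: "of_mate A B (link p q s t) \<in> brauer_hom A B"
  by (rule of_mate_hom[OF matching_link])

lemma mate_link: "v \<in> verts A B ==> mate (of_mate A B (link p q s t)) v = link p q s t v"
  by (rule mate_of_mate[OF matching_link])

lemma upf_link: "upf (of_mate A B (link p q s t)) = p"
proof
  fix a show "upf (of_mate A B (link p q s t)) a = p a"
    using mate_link[of "Top a"] patD(1)[OF p, of a] A'(2)
    by (auto simp: upf_def link_def brauer_hom_sel[OF link_hom])
qed

lemma dnf_link: "dnf (of_mate A B (link p q s t)) = q"
proof
  fix b show "dnf (of_mate A B (link p q s t)) b = q b"
    using mate_link[of "Bot b"] mate_star[OF link_hom, of "Top b"] patD(1)[OF q, of b]
    by (auto simp: dnf_def upf_def link_def brauer_hom_sel[OF link_hom] brauer_hom_sel[OF star_hom[OF link_hom]])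
qed

text \<open>No arc covers a defect, so arcs stay on one side of every transversal
  (\<open>outA\<close>, \<open>outB\<close>); transversals do not cross since s, and with it t, is
  monotone.\<close>

lemma ncr_link: "ncr A' B (of_mate A B (link p q s t))"
proof -
  let ?k = "vkey (pos A') (pos B)" and ?m = "link p q s t"
  have V: "verts A' B = verts A B" using A'(2) by (simp add: verts_def)
  have kA: "pos A' a \<noteq> pos A' b" if "a \<in> Field A" "b \<in> Field A" "a \<noteq> b" for a b
    using inj_onD[OF pos_inj[OF A'(1)]] that A'(2) by metis
  have kB: "pos B a \<noteq> pos B b" if "a \<in> Field B" "b \<in> Field B" "a \<noteq> b" for a b
    using inj_onD[OF pos_inj[OF B]] that by metis
  have outA: "pos A' (p c) < pos A' a" if "a \<in> defects A p" "c \<in> Field A" "p c \<noteq> c" "pos A' c < pos A' a" for a c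
  proof (rule ccontr)
    assume n: "\<not> pos A' (p c) < pos A' a"
    have "p c \<noteq> a" using that patD(3)[OF p, of c] by (auto simp: defects_def)
    then have "pos A' a < pos A' (p c)" using n kA[of "p c" a] that patD(2)[OF p, of c] A'(2) by (auto simp: defects_def)
    then show False using patD(4)[OF p, of c a] that A'(2) by (auto simp: defects_def)
  qed
  have outB: "pos B (q c) < pos B a" if "a \<in> defects B q" "c \<in> Field B" "q c \<noteq> c" "pos B c < pos B a" for a c
  proof (rule ccontr)
    assume n: "\<not> pos B (q c) < pos B a"
    have "q c \<noteq> a" using that patD(3)[OF q, of c] by (auto simp: defects_def)
    then have "pos B a < pos B (q c)" using n kB[of "q c" a] that patD(2)[OF q, of c] by (auto simp: defects_def)
    then show False using patD(4)[OF q, of c a] that by (auto simp: defects_def)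
  qed
  have tmono: "pos A' (t b) < pos A' (t d)" if "b \<in> defects B q" "d \<in> defects B q" "pos B b < pos B d" for b d
  proof (rule ccontr)
    assume n: "\<not> pos A' (t b) < pos A' (t d)"
    have "t b \<noteq> t d" using t that by (metis less_irrefl)
    then have "pos A' (t d) < pos A' (t b)" using n kA[of "t b" "t d"] t[OF that(1)] t[OF that(2)] by (auto simp: defects_def)
    then show False using mono[of "t d" "t b"] t that by fastforce
  qed
  have "noncross (verts A B) ?k ?m"
    unfolding noncross_def
  proof (intro ballI impI)
    fix v w assume vw: "v \<in> verts A B" "w \<in> verts A B" "?k v < ?k w \<and> ?k w < ?k (?m v)"
    from vw(1) show "?k v < ?k (?m w) \<and> ?k (?m w) < ?k (?m v)"
    proof (cases rule: vertsE)
      case v: (1 a)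
      show ?thesis
      proof (cases "p a = a")
        case False
        then have "?m v = Top (p a)" using v by (simp add: link_def)
        then obtain c where c: "w = Top c" "c \<in> Field A" "pos A' (p a) < pos A' c" "pos A' c < pos A' a"
          using vw v by (auto elim!: vertsE)
        then show ?thesis
          using patD(4)[OF p, of "p a" c] patD(2,3)[OF p, of a] v False A'(2) \<open>?m v = Top (p a)\<close> by (simp add: link_def)
      next
        case True
        then have a: "a \<in> defects A p" and mv: "?m v = Bot (s a)" using v by (simp_all add: link_def defects_def)
        from vw(2) show ?thesis
        proof (cases rule: vertsE)
          case w: (1 c)
          then have "pos A' c < pos A' a" using v vw by simp
          then show ?thesis
            using w v mv mono[of c a] outA[OF a w(2)] a s[OF a] pos_bounds(1)[OF B, of "s a"]
            by (cases "p c = c") (auto simp: link_def defects_def)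
        next
          case w: (2 d)
          then have "pos B d < pos B (s a)" using mv vw by simp
          then show ?thesis
            using w v mv tmono[of d "s a"] outB[of "s a" d] a s[OF a] pos_bounds(1)[OF A'(1), of "t d"] t[of d] A'(2)
              pos_bounds(1)[OF B, of "s a"] pos_bounds(1)[OF A'(1), of a] pos_bounds(1)[OF B, of "q d"] patD(2)[OF q, of d]
            by (cases "q d = d") (auto simp: link_def defects_def)
        qed
      qed
    next
      case v: (2 b)
      have "q b \<noteq> b"
      proof
        assume b: "q b = b"
        then have "?m v = Top (t b)" using v by (simp add: link_def)
        moreover have "?k v < ?k (?m v)" using vw(3) by linarith
        ultimately show False using v by simp
      qed
      then have mv: "?m v = Bot (q b)" using v by (simp add: link_def)
      then obtain c where c: "w = Bot c" "c \<in> Field B" "pos B b < pos B c" "pos B c < pos B (q b)"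
        using vw v by (auto elim!: vertsE)
      then show ?thesis using patD(4)[OF q, of b c] v mv by (simp add: link_def)
    qed
  qed
  then show ?thesis
    unfolding ncr_def V noncross_def using mate_link by simp
qed

end

text \<open>The two maxima are matched with each other and removed.\<close>

lemma ex_mono_bij:
  fixes k :: "'a => nat" and l :: "'b => nat"
  assumes S: "finite S" "inj_on k S" and T: "finite T" "inj_on l T" and c: "card S = card T"
  shows "\<exists>s. bij_betw s S T \<and> (\<forall>x\<in>S. \<forall>y\<in>S. k x < k y --> l (s x) < l (s y))"
  using assms
proof (induction "card S" arbitrary: S T)
  case 0
  then show ?case by (auto simp: bij_betw_def)
next
  case (Suc n)
  have ne: "S \<noteq> {}" "T \<noteq> {}" using Suc by auto
  have "Max (k ` S) \<in> k ` S" "Max (l ` T) \<in> l ` T" using ne Suc by auto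
  then obtain x y where x: "x \<in> S" "k x = Max (k ` S)" and y: "y \<in> T" "l y = Max (l ` T)" by auto
  have xm: "k z \<le> k x" if "z \<in> S" for z using x that Suc by auto
  have ym: "l z \<le> l y" if "z \<in> T" for z using y that Suc by auto
  have "\<exists>s. bij_betw s (S - {x}) (T - {y}) \<and> (\<forall>a\<in>S - {x}. \<forall>b\<in>S - {x}. k a < k b --> l (s a) < l (s b))"
    by (rule Suc.hyps(1)) (use Suc.prems Suc.hyps(2) x y in \<open>auto intro: inj_on_subset\<close>)
  then obtain s where s: "bij_betw s (S - {x}) (T - {y})"
    "\<forall>a\<in>S - {x}. \<forall>b\<in>S - {x}. k a < k b --> l (s a) < l (s b)" by blast
  let ?s = "s(x := y)"
  have "bij_betw ?s (S - {x}) (T - {y}) \<longleftrightarrow> bij_betw s (S - {x}) (T - {y})" by (rule bij_betw_cong) auto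
  then have "bij_betw ?s ({x} \<union> (S - {x})) ({y} \<union> (T - {y}))"
    using s(1) by (intro bij_betw_combine) auto
  then have "bij_betw ?s (insert x (S - {x})) (insert y (T - {y}))" by simp
  then have b: "bij_betw ?s S T" using x y by (simp add: insert_absorb)
  have "l (?s a) < l (?s c)" if a: "a \<in> S" "c \<in> S" "k a < k c" for a c
  proof -
    have ax: "a \<noteq> x" using a xm[of c] by auto
    show ?thesis
    proof (cases "c = x")
      case True
      have "s a \<in> T - {y}" using s(1) a ax by (auto simp: bij_betw_def)
      then have "l (s a) \<noteq> l y" "l (s a) \<le> l y" using ym inj_onD[OF Suc.prems(4)] y(1) by auto
      then show ?thesis using True ax by simp
    next
      case False
      then show ?thesis using s(2) a ax by simp
    qed
  qed
  then show ?case using b by blast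
qed

lemma ex_ncr:
  assumes A: "fin_lin A'" "Field A' = Field A" and B: "fin_lin B" and p: "pat A' p" and q: "pat B q"
    and c: "card (defects A p) = card (defects B q)"
  shows "\<exists>\<alpha>\<in>brauer_hom A B. ncr A' B \<alpha> \<and> upf \<alpha> = p \<and> dnf \<alpha> = q"
proof -
  have "\<exists>s. bij_betw s (defects A p) (defects B q) \<and>
    (\<forall>x\<in>defects A p. \<forall>y\<in>defects A p. pos A' x < pos A' y --> pos B (s x) < pos B (s y))"
    by (rule ex_mono_bij)
      (use fin_linD(1)[OF A(1)] fin_linD(1)[OF B] pos_inj[OF A(1)] pos_inj[OF B] A(2) c in
        \<open>auto simp: defects_def intro: inj_on_subset\<close>)
  then obtain s where s: "bij_betw s (defects A p) (defects B q)"
    "\<And>x y. x \<in> defects A p ==> y \<in> defects A p ==> pos A' x < pos A' y ==> pos B (s x) < pos B (s y)" by blast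
  let ?t = "inv_into (defects A p) s"
  have st: "s a \<in> defects B q \<and> ?t (s a) = a" if "a \<in> defects A p" for a
    using s(1) that by (auto simp: bij_betw_def)
  have ts: "?t b \<in> defects A p \<and> s (?t b) = b" if "b \<in> defects B q" for b
    using s(1) that by (auto simp: bij_betw_def f_inv_into_f inv_into_into)
  note L = A B p q st ts s(2)
  show ?thesis
    using link_hom[OF L] ncr_link[OF L] upf_link[OF L] dnf_link[OF L] by blast
qed

section \<open>Projections and the behaviour of patterns under products\<close>

definition proj :: "'a rel => ('a => 'a) => 'a brauer" where
  "proj A p = of_mate A A (link p p id id)"

lemma proj:
  assumes A: "fin_lin A" and p: "pat A p"
  shows proj_hom: "proj A p \<in> brauer_hom A A" and ncr_proj: "ncr A A (proj A p)"
    and upf_proj: "upf (proj A p) = p" and dnf_proj: "dnf (proj A p) = p"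
    and mate_proj: "v \<in> verts A A ==> mate (proj A p) v = link p p id id v"
  using link_hom[of A A A p p id id] ncr_link[of A A A p p id id] upf_link[of A A A p p id id]
    dnf_link[of A A A p p id id] mate_link[of A A A p p id id v] assms
  by (simp_all add: proj_def)

lemma joinsD:
  assumes x: "x \<in> brauer_hom A B" and y: "y \<in> brauer_hom B C" and t: "joins x y A B C t"
  shows "mate x (Top a) = Top b ==> a \<in> Field A ==> (Top a, Top b) \<in> t"
    and "mate x (Top a) = Bot b ==> a \<in> Field A ==> (Top a, Mid b) \<in> t"
    and "mate x (Bot a) = Bot b ==> a \<in> Field B ==> (Mid a, Mid b) \<in> t"
    and "mate y (Top a) = Top b ==> a \<in> Field B ==> (Mid a, Mid b) \<in> t"
    and "mate y (Top a) = Bot b ==> a \<in> Field B ==> (Mid a, Bot b) \<in> t"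
    and "mate y (Bot a) = Bot b ==> a \<in> Field C ==> (Bot a, Bot b) \<in> t"
proof -
  have 1: "(bot_to_mid v, bot_to_mid (mate x v)) \<in> t" if "v \<in> verts A B" for v
    using t[unfolded joins_def[OF x y]] that by blast
  have 2: "(top_to_mid v, top_to_mid (mate y v)) \<in> t" if "v \<in> verts B C" for v
    using t[unfolded joins_def[OF x y]] that by blast
  show "mate x (Top a) = Top b ==> a \<in> Field A ==> (Top a, Top b) \<in> t"
    "mate x (Top a) = Bot b ==> a \<in> Field A ==> (Top a, Mid b) \<in> t"
    "mate x (Bot a) = Bot b ==> a \<in> Field B ==> (Mid a, Mid b) \<in> t"
    "mate y (Top a) = Top b ==> a \<in> Field B ==> (Mid a, Mid b) \<in> t"
    "mate y (Top a) = Bot b ==> a \<in> Field B ==> (Mid a, Bot b) \<in> t"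
    "mate y (Bot a) = Bot b ==> a \<in> Field C ==> (Bot a, Bot b) \<in> t"
    using 1[of "Top a"] 1[of "Bot a"] 2[of "Top a"] 2[of "Bot a"] by simp_all
qed

text \<open>Exchanging the rows with \<open>swap\<close> is a labelling to which
  \<open>mult_edge\<close> applies.\<close>

lemma mult_star:
  assumes x: "x \<in> brauer_hom A B" and y: "y \<in> brauer_hom B C" and f: "finite (Field B)"
  shows "star (x \<cdot> y) = star y \<cdot> star x"
proof (rule brauer_eqI[OF star_hom[OF mult_hom[OF x y f]] mult_hom[OF star_hom[OF y] star_hom[OF x] f]])
  note a = star_hom[OF x] and b = star_hom[OF y] and m = mult_hom[OF x y f]
  fix v assume v: "v \<in> verts C A"
  let ?w = "swap (mate (x \<cdot> y) (swap v))"
  have v': "swap v \<in> verts A C" using v by simp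
  have "mate (star y \<cdot> star x) v = ?w"
  proof (rule mult_mateI[OF b a f v])
    show "?w \<in> verts C A" using mateD(1)[OF m v'] by simp
    show "v \<noteq> ?w" using mateD(2)[OF m v'] by (metis swap_swap)
    fix t :: "'a vertex rel" assume t: "sym t" "trans t" "joins (star y) (star x) C B A t"
    have "(swap (swap v), swap (mate (x \<cdot> y) (swap v))) \<in> t"
    proof (rule mult_edge[OF x y f t(1,2) _ _ v'])
      have s: "swap (bot_to_mid u) = top_to_mid (swap u)" "swap (top_to_mid u) = bot_to_mid (swap u)" for u :: "'a vertex"
        by (cases u; simp)+
      show "(swap (bot_to_mid u), swap (bot_to_mid (mate x u))) \<in> t" if u: "u \<in> verts A B" for u
      proof -
        have "(top_to_mid (swap u), top_to_mid (mate (star x) (swap u))) \<in> t"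
          using t(3)[unfolded joins_def[OF b a]] u by simp
        then show ?thesis using mate_star[OF x, of "swap u"] u by (simp add: s)
      qed
      show "(swap (top_to_mid u), swap (top_to_mid (mate y u))) \<in> t" if u: "u \<in> verts B C" for u
      proof -
        have "(bot_to_mid (swap u), bot_to_mid (mate (star y) (swap u))) \<in> t"
          using t(3)[unfolded joins_def[OF b a]] u by simp
        then show ?thesis using mate_star[OF y, of "swap u"] u by (simp add: s)
      qed
    qed
    then show "(v, ?w) \<in> t" by simp
  qed
  then show "mate (star (x \<cdot> y)) v = mate (star y \<cdot> star x) v"
    using mate_star[OF m v] by simp
qed

lemma upf_eqI:
  assumes "x \<in> brauer_hom A B" "a \<in> Field A" "mate x (Top a) = Top b"
  shows "upf x a = b"
  using assms by (simp add: upf_def brauer_hom_sel)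

text \<open>An upper arc of the first factor never reaches the middle row.\<close>

lemma upf_mult:
  assumes x: "x \<in> brauer_hom A B" and y: "y \<in> brauer_hom B C" and f: "finite (Field B)"
    and a: "upf x a \<noteq> a"
  shows "upf (x \<cdot> y) a = upf x a"
proof -
  note m = mate_top_upf[OF x a]
  have "Top (upf x a) \<in> verts A B" using mateD(1)[OF x, of "Top a"] m by simp
  then have "mate (x \<cdot> y) (Top a) = Top (upf x a)"
    using m a by (intro mult_mateI[OF x y f]) (auto intro: joinsD(1)[OF x y])
  then show ?thesis using upf_eqI[OF mult_hom[OF x y f] m(2)] by simp
qed

lemma dnf_mult:
  assumes x: "x \<in> brauer_hom A B" and y: "y \<in> brauer_hom B C" and f: "finite (Field B)"
    and b: "dnf y b \<noteq> b"
  shows "dnf (x \<cdot> y) b = dnf y b"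
  using upf_mult[OF star_hom[OF y] star_hom[OF x] f] b mult_star[OF x y f] by (simp add: dnf_def)

context
  fixes x y :: "'a brauer" and A B C :: "'a rel"
  assumes x: "x \<in> brauer_hom A B" and y: "y \<in> brauer_hom B C"
    and fin: "finite (Field A)" "finite (Field B)" "finite (Field C)"
begin

lemma defects_mult: "defects A (upf (x \<cdot> y)) \<subseteq> defects A (upf x)"
  using upf_mult[OF x y fin(2)] by (force simp: defects_def)

lemma rank_mult_left: "rank (x \<cdot> y) \<le> rank x"
  unfolding rank_defects[OF x] rank_defects[OF mult_hom[OF x y fin(2)]]
  by (rule card_mono[OF _ defects_mult]) (use fin in \<open>simp add: defects_def\<close>)

text \<open>Multiplication on the right can only add upper arcs; equal rank means equally many
  defects, so none was added.\<close>

lemma upf_mult_eq: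
  assumes "rank (x \<cdot> y) = rank x"
  shows "upf (x \<cdot> y) = upf x"
proof
  have "defects A (upf (x \<cdot> y)) = defects A (upf x)"
    using assms unfolding rank_defects[OF x] rank_defects[OF mult_hom[OF x y fin(2)]]
    by (intro card_subset_eq[OF _ defects_mult]) (use fin in \<open>simp_all add: defects_def\<close>)
  then show "upf (x \<cdot> y) a = upf x a" for a
    using upf_mult[OF x y fin(2), of a] upf_out(1)[OF x] upf_out(1)[OF mult_hom[OF x y fin(2)]]
    by (cases "a \<in> Field A"; cases "upf x a = a") (auto simp: defects_def)
qed

end

lemma rank_mult_right:
  assumes x: "x \<in> brauer_hom A B" and y: "y \<in> brauer_hom B C"
    and f: "finite (Field A)" "finite (Field B)" "finite (Field C)"
  shows "rank (x \<cdot> y) \<le> rank y"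
  using rank_mult_left[OF star_hom[OF y] star_hom[OF x] f(3,2,1)] rank_star[OF y]
    rank_star[OF mult_hom[OF x y f(2)]] mult_star[OF x y f(2)] by simp

lemma dnf_mult_eq:
  assumes x: "x \<in> brauer_hom A B" and y: "y \<in> brauer_hom B C"
    and f: "finite (Field A)" "finite (Field B)" "finite (Field C)"
    and r: "rank (x \<cdot> y) = rank y"
  shows "dnf (x \<cdot> y) = dnf y"
  using upf_mult_eq[OF star_hom[OF y] star_hom[OF x] f(3,2,1)] rank_star[OF y] r
    rank_star[OF mult_hom[OF x y f(2)]] mult_star[OF x y f(2)] by (simp add: dnf_def)

text \<open>The arcs of p repeat arcs already present in y, and all other points are passed straight
  on. \<open>fixed\<close> ensures that an arc of y starting at a fixed point of p also ends at
  one.\<close>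

lemma proj_mult:
  assumes A: "fin_lin A" and p: "pat A p" and y: "y \<in> brauer_hom A B"
    and sub: "\<And>a. p a \<noteq> a ==> upf y a = p a"
  shows "proj A p \<cdot> y = y"
proof -
  note e = proj_hom[OF A p] and f = fin_linD(1)[OF A]
  note J = joinsD[OF e y]
  have top: "mate (proj A p) (Top a) = (if p a = a then Bot a else Top (p a))" if "a \<in> Field A" for a
    using mate_proj[OF A p, of "Top a"] that by (simp add: link_def)
  have fixed: "p b = b" if "p a = a" "upf y a = b" for a b
    using sub[of b] that upf_invol[OF y, of a] by (metis patD(3)[OF p])
  show ?thesis
  proof (rule brauer_eqI[OF mult_hom[OF e y f] y])
    fix v assume v: "v \<in> verts A B"
    show "mate (proj A p \<cdot> y) v = mate y v"
    proof (rule mult_mateI[OF e y f v mateD(1)[OF y v] mateD(2)[OF y v, symmetric]])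
      fix t :: "'a vertex rel" assume t: "sym t" "trans t" "joins (proj A p) y A A B t"
      note J = joinsD[OF e y t(3)]
      from v show "(v, mate y v) \<in> t"
      proof (cases rule: vertsE)
        case (1 a)
        show ?thesis
        proof (cases "p a = a")
          case False
          then have "mate y (Top a) = Top (p a)" using sub mate_top_upf(1)[OF y, of a] by simp
          then show ?thesis using 1 J(1)[of a "p a"] top[of a] False by simp
        next
          case True
          then have a: "(Top a, Mid a) \<in> t" using J(2)[of a a] top[of a] 1 by simp
          from 1(2) show ?thesis
          proof (cases rule: mate_top_cases[OF y, consumes 1])
            case (1 b)
            then have "p b = b" using fixed True by simp
            then have "(Top b, Mid b) \<in> t" using J(2)[of b b] top[of b] 1 by simp
            moreover have "(Mid a, Mid b) \<in> t" using J(4)[of a b] 1 \<open>a \<in> Field A\<close> by simp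
            ultimately show ?thesis using a t(1,2) 1(1) \<open>v = Top a\<close> by (metis symD transD)
          next
            case (2 b)
            then have "(Mid a, Bot b) \<in> t" using J(5)[of a b] \<open>a \<in> Field A\<close> by simp
            then show ?thesis using a t(2) 2(1) \<open>v = Top a\<close> by (metis transD)
          qed
        qed
      next
        case (2 b)
        from 2(2) show ?thesis
        proof (cases rule: mate_bot_cases[OF y, consumes 1])
          case (1 c)
          then show ?thesis using J(6)[of b c] 2 by simp
        next
          case (2 a)
          then have "p a = a" using sub[of a] by metis
          then have "(Top a, Mid a) \<in> t" using J(2)[of a a] top[of a] 2 by simp
          moreover have "(Mid a, Bot b) \<in> t" using J(5)[of a b] 2 by simp
          ultimately show ?thesis using t(1,2) 2(1) \<open>v = Bot b\<close> by (metis symD transD)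
        qed
      qed
    qed
  qed
qed

lemma star_proj:
  assumes A: "fin_lin A" and p: "pat A p"
  shows "star (proj A p) = proj A p"
  by (rule ncr_unique[OF star_hom[OF proj_hom[OF A p]] proj_hom[OF A p] A refl A
        ncr_star[OF proj_hom[OF A p] A A ncr_proj[OF A p]] ncr_proj[OF A p]])
    (simp_all add: upf_star[OF proj_hom[OF A p]] dnf_star[OF proj_hom[OF A p]] upf_proj[OF A p] dnf_proj[OF A p])

lemma mult_proj:
  assumes B: "fin_lin B" and p: "pat B p" and x: "x \<in> brauer_hom A B"
    and sub: "\<And>a. p a \<noteq> a ==> dnf x a = p a"
  shows "x \<cdot> proj B p = x"
proof -
  have "proj B p \<cdot> star x = star x"
    using proj_mult[OF B p star_hom[OF x]] sub by (simp add: dnf_def)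
  then have "star (x \<cdot> proj B p) = star x"
    using mult_star[OF x proj_hom[OF B p] fin_linD(1)[OF B]] star_proj[OF B p] by simp
  then show ?thesis
    using star_star[OF x] star_star[OF mult_hom[OF x proj_hom[OF B p] fin_linD(1)[OF B]]] by metis
qed

text \<open>In the mirror image every transversal is followed back to the point below the one where
  it started, and the arcs along the middle row close up to loops.\<close>

lemma brauer_mult_star_self:
  assumes A: "fin_lin A" and B: "fin_lin B" and x: "x \<in> brauer_hom A B" and p: "pat A (upf x)"
  shows "x \<cdot> star x = proj A (upf x)"
proof -
  note s = star_hom[OF x] and f = fin_linD(1)[OF B] and e = proj_hom[OF A p]
  show ?thesis
  proof (rule brauer_eqI[OF mult_hom[OF x s f] e])
    fix v assume v: "v \<in> verts A A"
    show "mate (x \<cdot> star x) v = mate (proj A (upf x)) v"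
    proof (rule mult_mateI[OF x s f v mateD(1)[OF e v] mateD(2)[OF e v, symmetric]])
      fix t :: "'a vertex rel" assume t: "sym t" "trans t" "joins x (star x) A B A t"
      note J = joinsD[OF x s t(3)]
      have ms: "mate (star x) (Top b) = swap (mate x (Bot b))" if "b \<in> Field B" for b
        using mate_star[OF x, of "Top b"] that by simp
      have ms2: "mate (star x) (Bot a) = swap (mate x (Top a))" if "a \<in> Field A" for a
        using mate_star[OF x, of "Bot a"] that by simp
      have key: "(Top a, Top (upf x a)) \<in> t \<and> (Bot a, Bot (upf x a)) \<in> t" if "a \<in> Field A" "upf x a \<noteq> a" for a
        using J(1)[of a "upf x a"] J(6)[of a "upf x a"] mate_top_upf[OF x that(2)] ms2[OF that(1)] that by simp
      have key2: "(Top a, Bot a) \<in> t" if a: "a \<in> Field A" "upf x a = a" for a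
      proof -
        obtain b where b: "mate x (Top a) = Bot b" "b \<in> Field B" "mate x (Bot b) = Top a"
          by (rule mate_top_cases[OF x a(1)]) (use a in auto)
        then have "(Top a, Mid b) \<in> t" "(Mid b, Bot a) \<in> t" using J(2)[of a b] J(5)[of b a] a ms by simp_all
        then show ?thesis using t(2) by (metis transD)
      qed
      from v show "(v, mate (proj A (upf x)) v) \<in> t"
        using key key2 t(1) mate_proj[OF A p v] by (cases rule: vertsE) (auto simp: link_def dest: symD)
    qed
  qed
qed

section \<open>Combinatorics of patterns\<close>

text \<open>Inclusion of arc sets, with fixed points of F still open. It is the order in which upper
  patterns grow under multiplication on the right.\<close>

definition arcs_le :: "('a => 'a) => ('a => 'a) => bool" where
  "arcs_le F p \<longleftrightarrow> (\<forall>a. F a \<noteq> a --> p a = F a)"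

definition consec :: "'a rel => ('a => 'a) => 'a => 'a => bool" where
  "consec A F x y \<longleftrightarrow> x \<in> defects A F \<and> y \<in> defects A F \<and> pos A x < pos A y \<and>
     (\<forall>z\<in>defects A F. \<not> (pos A x < pos A z \<and> pos A z < pos A y))"

definition add_arc :: "('a => 'a) => 'a => 'a => 'a => 'a" where
  "add_arc F x y = F(x := y, y := x)"

lemma arcs_leD: "arcs_le F p ==> F a \<noteq> a ==> p a = F a"
  by (simp add: arcs_le_def)

lemma arcs_le_refl [simp]: "arcs_le F F"
  by (simp add: arcs_le_def)

lemma arcs_le_trans: "arcs_le F G ==> arcs_le G H ==> arcs_le F H"
  by (auto simp: arcs_le_def)

lemma arcs_le_add: "F x = x ==> F y = y ==> arcs_le F (add_arc F x y)"
  by (auto simp: arcs_le_def add_arc_def)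

lemma add_arc_le:
  assumes "pat A p" "arcs_le F p" "p x = y" "x \<noteq> y"
  shows "arcs_le (add_arc F x y) p"
  using assms patD(3)[OF assms(1), of x] by (auto simp: arcs_le_def add_arc_def)

lemma defects_add_arc: "x \<noteq> y ==> F x = x ==> F y = y ==> defects A (add_arc F x y) = defects A F - {x, y}"
  by (auto simp: defects_def add_arc_def)

lemma arcs_le_defects: "arcs_le F p ==> defects A p \<subseteq> defects A F"
  by (force simp: defects_def arcs_le_def)

lemma consecD:
  assumes "consec A F x y"
  shows "x \<in> Field A" "y \<in> Field A" "F x = x" "F y = y" "x \<noteq> y" "pos A x < pos A y"
    "z \<in> defects A F ==> \<not> (pos A x < pos A z \<and> pos A z < pos A y)"
  using assms by (auto simp: consec_def defects_def)

lemma pos_eq_iff: "fin_lin A ==> a \<in> Field A ==> b \<in> Field A ==> pos A a = pos A b \<longleftrightarrow> a = b"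
  using pos_inj by (auto dest: inj_onD)

lemma pat_id: "pat A (\<lambda>a. a)"
  by (auto simp: pat_def)

lemma finite_defects: "fin_lin A ==> finite (defects A p)"
  by (rule finite_subset[OF _ fin_linD(1)]) (auto simp: defects_def)

lemma card_add_arc:
  assumes A: "fin_lin A" and c: "consec A F x y"
  shows "card (defects A (add_arc F x y)) = card (defects A F) - 2" "2 \<le> card (defects A F)"
proof -
  note D = consecD[OF c]
  have s: "{x, y} \<subseteq> defects A F" using c by (auto simp: consec_def)
  show "2 \<le> card (defects A F)" using card_mono[OF finite_defects[OF A] s] D(5) by simp
  show "card (defects A (add_arc F x y)) = card (defects A F) - 2"
    using card_Diff_subset[of "{x, y}" "defects A F"] s D(5) defects_add_arc[OF D(5,3,4)] by simp
qed

text \<open>The new arc covers no defect because x and y are neighbouring ones, and an arc of F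
  crossing it would have to cover x or y.\<close>

lemma pat_add_arc:
  assumes A: "fin_lin A" and F: "pat A F" and c: "consec A F x y"
  shows "pat A (add_arc F x y)"
proof -
  note D = consecD[OF c]
  let ?p = "add_arc F x y"
  have inv: "F a \<noteq> x" "F a \<noteq> y" if "a \<noteq> x" "a \<noteq> y" for a
    using that D(3,4) patD(3)[OF F] by metis+
  have p: "?p x = y" "?p y = x" "a \<noteq> x ==> a \<noteq> y ==> ?p a = F a" for a
    using D(5) by (auto simp: add_arc_def)
  show ?thesis
    unfolding pat_def
  proof (intro conjI allI ballI impI)
    show "?p a = a" if "a \<notin> Field A" for a using that D p patD(1)[OF F] by metis
    show "?p a \<in> Field A" if "a \<in> Field A" for a using that D p patD(2)[OF F] by metis
    show "?p (?p a) = a" for a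
    proof (cases "a = x \<or> a = y")
      case False
      then show ?thesis using p(3)[of a] p(3)[of "F a"] inv[of a] patD(3)[OF F, of a] by simp
    qed (use p in auto)
    fix a b assume ab: "a \<in> Field A" "b \<in> Field A" "pos A a < pos A b \<and> pos A b < pos A (?p a)"
    have "?p b \<noteq> b \<and> pos A a < pos A (?p b) \<and> pos A (?p b) < pos A (?p a)"
    proof (cases "a = x \<or> a = y")
      case True
      then have ax: "a = x" "?p a = y" using ab p D(6) by auto
      then have b: "b \<noteq> x" "b \<noteq> y" using ab by auto
      have nd: "F b \<noteq> b" using D(7)[of b] ab ax by (auto simp: defects_def)
      have Fb: "F b \<in> Field A" "F b \<noteq> x" "F b \<noteq> y" using patD(2)[OF F ab(2)] inv b by auto
      have 1: "\<not> pos A (F b) < pos A x"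
      proof
        assume "pos A (F b) < pos A x"
        then show False using patD(4)[OF F Fb(1) D(1)] patD(3)[OF F, of b] ab ax D(3) by simp
      qed
      have 2: "\<not> pos A y < pos A (F b)"
        using patD(4)[OF F ab(2) D(2)] ab ax D(4) by auto
      have "pos A (F b) \<noteq> pos A x" "pos A (F b) \<noteq> pos A y" using pos_eq_iff[OF A Fb(1)] D(1,2) Fb by auto
      then show ?thesis using 1 2 nd p(3)[OF b] ax by simp
    next
      case False
      then have a: "?p a = F a" using p by simp
      have "F b \<noteq> b \<and> pos A a < pos A (F b) \<and> pos A (F b) < pos A (F a)"
        using patD(4)[OF F ab(1,2)] ab(3) a by simp
      moreover from this have "b \<noteq> x" "b \<noteq> y" using D by auto
      ultimately show ?thesis using p(3) a by simp
    qed
    then show "?p b \<noteq> b" "pos A a < pos A (?p b)" "pos A (?p b) < pos A (?p a)" by auto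
  qed
qed

lemma arcs_le_closed:
  assumes "pat A F" "pat A p" "arcs_le F p" "F a = a"
  shows "F (p a) = p a"
  using assms(4) arcs_leD[OF assms(3), of "p a"] patD(3)[OF assms(2), of a] patD(3)[OF assms(1), of "p a"] by metis

text \<open>A shortest arc of p between defects of F is taken. A defect of F under it would have its
  partner under it as well, and their arc would be shorter.\<close>

lemma ex_consec_arc:
  assumes A: "fin_lin A" and F: "pat A F" and p: "pat A p" and le: "arcs_le F p" and ne: "p \<noteq> F"
  shows "\<exists>x y. consec A F x y \<and> p x = y"
proof -
  let ?P = "\<lambda>a. a \<in> Field A \<and> F a = a \<and> pos A a < pos A (p a)"
  have "\<exists>a. ?P a"
  proof -
    obtain a where a: "p a \<noteq> F a" using ne by auto
    then have Fa: "F a = a" using arcs_leD[OF le, of a] by auto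
    then have aA: "a \<in> Field A" using a patD(1)[OF p] patD(1)[OF F] by metis
    have "pos A a \<noteq> pos A (p a)" using pos_eq_iff[OF A aA patD(2)[OF p aA]] a Fa by auto
    then consider "pos A a < pos A (p a)" | "pos A (p a) < pos A a" by linarith
    then show ?thesis
    proof cases
      case 2
      then show ?thesis using patD(2)[OF p aA] patD(3)[OF p, of a] arcs_le_closed[OF F p le Fa] by metis
    qed (use aA Fa in blast)
  qed
  then obtain x where x: "?P x" and min: "\<And>a. ?P a ==> pos A (p x) - pos A x \<le> pos A (p a) - pos A a"
    using ex_has_least_nat[of ?P _ "\<lambda>a. pos A (p a) - pos A a"] by blast
  have "consec A F x (p x)"
    unfolding consec_def
  proof (intro conjI ballI notI)
    show "x \<in> defects A F" "p x \<in> defects A F"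
      using x patD(2)[OF p] arcs_le_closed[OF F p le] by (auto simp: defects_def)
    show "pos A x < pos A (p x)" using x by simp
    fix z assume z: "z \<in> defects A F" "pos A x < pos A z \<and> pos A z < pos A (p x)"
    then have zA: "z \<in> Field A" "F z = z" by (auto simp: defects_def)
    have pz: "p z \<noteq> z" "pos A x < pos A (p z)" "pos A (p z) < pos A (p x)" using patD(4)[OF p _ zA(1), of x] z x by auto
    have "pos A z \<noteq> pos A (p z)" using pos_eq_iff[OF A zA(1) patD(2)[OF p zA(1)]] pz by auto
    then consider "pos A z < pos A (p z)" | "pos A (p z) < pos A z" by linarith
    then show False
    proof cases
      case 1
      then show False using min[of z] zA z pz by simp
    next
      case 2
      have "?P (p z)" using 2 patD(2)[OF p zA(1)] patD(3)[OF p, of z] arcs_le_closed[OF F p le zA(2)] by simp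
      then have "pos A (p x) - pos A x \<le> pos A z - pos A (p z)" using min[of "p z"] patD(3)[OF p, of z] by simp
      then show False using z(2) pz(2,3) 2 by linarith
    qed
  qed
  then show ?thesis by blast
qed

lemma defect_list:
  assumes A: "fin_lin A"
  obtains ds where "set ds = defects A F" "length ds = card (defects A F)"
    "\<And>i j. i < j ==> j < length ds ==> pos A (ds ! i) < pos A (ds ! j)"
    "\<And>i. Suc i < length ds ==> consec A F (ds ! i) (ds ! Suc i)"
proof -
  obtain l where l: "set l = defects A F" "distinct l" using finite_distinct_list[OF finite_defects[OF A]] by blast
  define ds where "ds = sort_key (pos A) l"
  have ds: "set ds = defects A F" "distinct ds" "sorted (map (pos A) ds)" using l by (simp_all add: ds_def)
  have len: "length ds = card (defects A F)" using ds distinct_card by metis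
  have lt: "pos A (ds ! i) < pos A (ds ! j)" if "i < j" "j < length ds" for i j
  proof -
    have "pos A (ds ! i) \<le> pos A (ds ! j)" using sorted_nth_mono[OF ds(3), of i j] that by simp
    moreover have "ds ! i \<noteq> ds ! j" using ds(2) that by (simp add: nth_eq_iff_index_eq)
    moreover have "ds ! i \<in> Field A" "ds ! j \<in> Field A"
      using nth_mem[of i ds] nth_mem[of j ds] that ds(1) by (auto simp: defects_def)
    ultimately show ?thesis using pos_eq_iff[OF A, of "ds ! i" "ds ! j"] by simp
  qed
  have "consec A F (ds ! i) (ds ! Suc i)" if i: "Suc i < length ds" for i
    unfolding consec_def
  proof (intro conjI ballI notI)
    show "ds ! i \<in> defects A F" "ds ! Suc i \<in> defects A F" using ds(1) i nth_mem by force+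
    show "pos A (ds ! i) < pos A (ds ! Suc i)" using lt i by simp
    fix z assume z: "z \<in> defects A F" "pos A (ds ! i) < pos A z \<and> pos A z < pos A (ds ! Suc i)"
    then obtain j where j: "j < length ds" "z = ds ! j" using ds(1) by (metis in_set_conv_nth)
    have "j < i \<or> j = i \<or> j = Suc i \<or> Suc i < j" by linarith
    then show False using lt[of j i] lt[of "Suc i" j] z j i by auto
  qed
  then show thesis using that[OF ds(1) len lt] by blast
qed

lemma consec_add_arc:
  assumes A: "fin_lin A" and c: "consec A F x y" and d: "consec A F z w" and n: "pos A y < pos A z"
  shows "consec A (add_arc F x y) z w"
proof -
  note D = consecD[OF c] and E = consecD[OF d]
  have "z \<noteq> x" "z \<noteq> y" "w \<noteq> x" "w \<noteq> y" using n D(6) E(6) by auto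
  then show ?thesis using d unfolding consec_def defects_add_arc[OF D(5,3,4)] by auto
qed

text \<open>Neighbouring defects are closed one pair at a time, here always the first pair.\<close>

lemma ex_extension:
  assumes A: "fin_lin A"
  shows "pat A F ==> m \<le> card (defects A F) ==> even (card (defects A F) - m) ==>
    \<exists>p. pat A p \<and> arcs_le F p \<and> card (defects A p) = m"
proof (induction "card (defects A F)" arbitrary: F rule: less_induct)
  case less
  show ?case
  proof (cases "card (defects A F) = m")
    case True
    then show ?thesis using less.prems arcs_le_refl by blast
  next
    case False
    obtain j where j: "card (defects A F) - m = 2 * j" using less.prems(3) by (rule evenE)
    then have "j \<noteq> 0" using False less.prems(2) by auto
    then have m2: "m + 2 \<le> card (defects A F)" using j by linarith
    obtain ds where ds: "length ds = card (defects A F)" "\<And>i. Suc i < length ds ==> consec A F (ds ! i) (ds ! Suc i)"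
      using defect_list[OF A, of F] by metis
    have c: "consec A F (ds ! 0) (ds ! Suc 0)" using ds m2 by simp
    note D = consecD[OF c] and ca = card_add_arc[OF A c]
    let ?G = "add_arc F (ds ! 0) (ds ! Suc 0)"
    have "\<exists>p. pat A p \<and> arcs_le ?G p \<and> card (defects A p) = m"
    proof (rule less.hyps[OF _ pat_add_arc[OF A less.prems(1) c]])
      show "card (defects A ?G) < card (defects A F)" "m \<le> card (defects A ?G)" using ca m2 by simp_all
      have "card (defects A F) - m = 2 + (card (defects A ?G) - m)" using ca m2 by simp
      then show "even (card (defects A ?G) - m)" using less.prems(3) by simp
    qed
    then show ?thesis using arcs_le_trans[OF arcs_le_add[OF D(3,4)]] by blast
  qed
qed

lemma arcs_le_defects_eq:
  assumes A: "fin_lin A" and F: "pat A F" and p: "pat A p" and le: "arcs_le F p"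
    and c: "card (defects A F) \<le> card (defects A p)"
  shows "p = F"
proof
  have e: "defects A p = defects A F"
    by (rule card_seteq[OF finite_defects[OF A] arcs_le_defects[OF le] c])
  fix a show "p a = F a"
  proof (cases "F a = a")
    case True
    then show ?thesis using e patD(1)[OF p, of a] by (cases "a \<in> Field A") (auto simp: defects_def)
  qed (use arcs_leD[OF le] in auto)
qed

text \<open>Induction on the number of defects of F. \<open>G i\<close> adds to F the arc between
  its i-th and its next defect; every pattern above F with one defect lies above some
  \<open>G i\<close>, and those above one \<open>G i\<close> are linked by induction. So it remains
  to link the different \<open>G i\<close> with each other.\<close>

lemma patterns_connected:
  assumes A: "fin_lin A"
    and sym: "\<And>x y. R x y ==> R y x" and trans: "\<And>x y z. R x y ==> R y z ==> R x z"
    and base: "\<And>u x y. pat A u ==> card (defects A u) = 3 ==> pat A x ==> pat A y ==>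
      card (defects A x) = 1 ==> card (defects A y) = 1 ==> arcs_le u x ==> arcs_le u y ==> x \<noteq> y ==> R x y"
  shows "pat A F ==> odd (card (defects A F)) ==> pat A x ==> pat A y ==>
    card (defects A x) = 1 ==> card (defects A y) = 1 ==> arcs_le F x ==> arcs_le F y ==> x = y \<or> R x y"
proof (induction "card (defects A F)" arbitrary: F x y rule: less_induct)
  case less
  let ?n = "card (defects A F)"
  let ?R = "\<lambda>x y. x = y \<or> R x y"
  have symR: "?R x y ==> ?R y x" for x y using sym by blast
  have transR: "?R x y ==> ?R y z ==> ?R x z" for x y z using trans by blast
  obtain h where "?n = 2 * h + 1" using less.prems(2) by (rule oddE)
  moreover have "h = 0 \<or> h = 1 \<or> h \<ge> 2" by linarith
  ultimately have "?n = 1 \<or> ?n = 3 \<or> ?n \<ge> 5" by auto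
  then consider "?n = 1" | "?n = 3" | "?n \<ge> 5" by blast
  then show ?case
  proof cases
    case 1
    then have "x = F" "y = F" using arcs_le_defects_eq[OF A less.prems(1)] less.prems by auto
    then show ?thesis by simp
  next
    case 2
    then show ?thesis using base[OF less.prems(1) _ less.prems(3-8)] by blast
  next
    case 3
    obtain ds where ds: "set ds = defects A F" "length ds = ?n"
      "\<And>i j. i < j ==> j < length ds ==> pos A (ds ! i) < pos A (ds ! j)"
      "\<And>i. Suc i < length ds ==> consec A F (ds ! i) (ds ! Suc i)"
      using defect_list[OF A, of F] by metis
    define G where "G i = add_arc F (ds ! i) (ds ! Suc i)" for i
    have G: "pat A (G i)" "card (defects A (G i)) < ?n" "odd (card (defects A (G i)))" if i: "Suc i < ?n" for i
    proof -
      have c: "consec A F (ds ! i) (ds ! Suc i)" using ds i by simp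
      show "pat A (G i)" using pat_add_arc[OF A less.prems(1) c] by (simp add: G_def)
      show "card (defects A (G i)) < ?n" "odd (card (defects A (G i)))"
        using card_add_arc[OF A c] less.prems(2) by (simp_all add: G_def)
    qed
    have same: "?R v w" if "Suc i < ?n" "pat A v" "pat A w" "card (defects A v) = 1" "card (defects A w) = 1"
      "arcs_le (G i) v" "arcs_le (G i) w" for i v w
      using less.hyps[OF G(2,1,3)[OF that(1)] that(2-7)] .
    have "\<exists>v. pat A v \<and> arcs_le (G i) v \<and> card (defects A v) = 1" if i: "Suc i < ?n" for i
      by (rule ex_extension[OF A G(1)[OF i]]) (use G(3)[OF i] in \<open>auto elim!: oddE\<close>)
    then obtain r where r: "\<And>i. Suc i < ?n ==> pat A (r i) \<and> arcs_le (G i) (r i) \<and> card (defects A (r i)) = 1"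
      by metis
    \<comment> \<open>Arcs without a common end can be added together, so a completion v of both
      links a completion of \<open>G i\<close> with one of \<open>G j\<close>.\<close>
    have far: "?R (r i) (r j)" if ij: "Suc i < j" "Suc j < ?n" for i j
    proof -
      have ci: "consec A F (ds ! i) (ds ! Suc i)" and cj: "consec A F (ds ! j) (ds ! Suc j)" using ds ij by simp_all
      have lt: "pos A (ds ! Suc i) < pos A (ds ! j)" using ds(2,3) ij by simp
      have c: "consec A (G i) (ds ! j) (ds ! Suc j)" using consec_add_arc[OF A ci cj lt] by (simp add: G_def)
      let ?H = "add_arc (G i) (ds ! j) (ds ! Suc j)"
      have H: "pat A ?H" using pat_add_arc[OF A G(1) c] ij by simp
      have Gi: "arcs_le (G i) ?H" by (rule arcs_le_add[OF consecD(3,4)[OF c]])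
      have Gj: "arcs_le (G j) ?H"
        using arcs_le_add consecD(3,4)[OF ci] consecD(3-6)[OF cj] consecD(3-6)[OF c]
        by (auto simp: arcs_le_def add_arc_def G_def split: if_splits)
      have cH: "odd (card (defects A ?H))" using card_add_arc[OF A c] G(3)[of i] ij by simp
      have "\<exists>v. pat A v \<and> arcs_le ?H v \<and> card (defects A v) = 1"
        by (rule ex_extension[OF A H]) (use cH in \<open>auto elim!: oddE\<close>)
      then obtain v where v: "pat A v" "arcs_le ?H v" "card (defects A v) = 1" by blast
      have "?R (r i) v" using same[of i "r i" v] r[of i] v arcs_le_trans[OF Gi v(2)] ij by auto
      moreover have "?R v (r j)" using same[of j v "r j"] r[of j] v arcs_le_trans[OF Gj v(2)] ij by auto
      ultimately show ?thesis by (rule transR)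
    qed
    \<comment> \<open>The arcs of \<open>G 0\<close> and \<open>G 1\<close> share an end and have no
      common extension; the detour from 1 over 3 to 0 exists because there are at least five
      defects.\<close>
    have all: "?R (r i) (r 0)" if i: "Suc i < ?n" for i
    proof -
      have 0: "?R (r i) (r 0)" if "2 \<le> i" "Suc i < ?n" for i using symR[OF far[of 0 i]] that by simp
      consider "i = 0" | "i = 1" | "2 \<le> i" by linarith
      then show ?thesis
      proof cases
        case 1 then show ?thesis by simp
      next
        case 2
        then show ?thesis using transR[OF far[of 1 3] 0[of 3]] 3 by simp
      qed (use 0 i in blast)
    qed
    have to0: "?R v (r 0)" if v: "pat A v" "card (defects A v) = 1" "arcs_le F v" for v
    proof -
      have "v \<noteq> F" using v(2) 3 by auto
      then obtain a b where ab: "consec A F a b" "v a = b" using ex_consec_arc[OF A less.prems(1) v(1,3)] by blast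
      then have "a \<in> set ds" "b \<in> set ds" using ds(1) by (auto simp: consec_def)
      then obtain i j where ij: "i < length ds" "j < length ds" "a = ds ! i" "b = ds ! j" by (metis in_set_conv_nth)
      have "i < j" using ds(3)[of j i] consecD(6)[OF ab(1)] ij by (metis linorder_neqE_nat not_less_iff_gr_or_eq)
      moreover have "\<not> Suc i < j"
        using consecD(7)[OF ab(1), of "ds ! Suc i"] ds(1) ds(3)[of i "Suc i"] ds(3)[of "Suc i" j] ij by fastforce
      ultimately have j: "j = Suc i" by simp
      then have "arcs_le (G i) v" using add_arc_le[OF v(1,3) ab(2)] consecD(5)[OF ab(1)] ij by (simp add: G_def)
      moreover have i: "Suc i < ?n" using ij ds(2) j by simp
      ultimately have "?R v (r i)" using same[of i v "r i"] r[OF i] v by simp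
      then show ?thesis using all[OF i] by (rule transR)
    qed
    show ?thesis using transR[OF to0 symR[OF to0]] less.prems by blast
  qed
qed

text \<open>\<open>contract\<close> for involutions with fixed points: arcs ending at x and at y
  merge, and if one of x, y is a defect, the far end of the arc at the other one becomes a
  defect.\<close>

definition con :: "'a => 'a => ('a => 'a) => 'a => 'a" where
  "con x y p z = (if p z = x then if p y = y then z else p y
     else if p z = y then if p x = x then z else p x else p z)"

lemma con_commute: "x \<noteq> y ==> con x y p = con y x p"
  by (auto simp: con_def fun_eq_iff)

text \<open>Compared only on the other defects of F, which are the points left open by the
  contraction.\<close>

definition same_con :: "'a rel => ('a => 'a) => ('a => 'a) => ('a => 'a) => 'a => 'a => bool" where
  "same_con A F p p' x y \<longleftrightarrow> (\<forall>z\<in>defects A F - {x, y}. con x y p z = con x y p' z)"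

lemma consec_converse:
  assumes A: "fin_lin A" and c: "consec A F x y"
  shows "consec (A\<inverse>) F y x"
proof -
  have "pos (A\<inverse>) a < pos (A\<inverse>) b \<longleftrightarrow> pos A b < pos A a" if "a \<in> Field A" "b \<in> Field A" for a b
    using pos_converse[OF A that(1)] pos_converse[OF A that(2)] by linarith
  then show ?thesis using c by (auto simp: consec_def defects_def)
qed

lemma defects_converse [simp]: "defects (A\<inverse>) F = defects A F"
  by (simp add: defects_def)

lemma arcs_le_fixed_closed:
  assumes "pat A F" "pat A p" "arcs_le F p" "a \<in> defects A F"
  shows "p a \<in> defects A F"
  using arcs_le_closed[OF assms(1-3), of a] assms(4) patD(2)[OF assms(2), of a] by (simp add: defects_def)

text \<open>If the pattern \<open>p\<close> contains the adjacent arc \<open>xy\<close>, contracting at \<open>xy\<close> and at \<open>yw\<close> has the same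
  effect on \<open>p\<close> up to shifting; the same must hold for \<open>p'\<close>, which forces the arc \<open>yw\<close>.\<close>

lemma same_con_forces_arc:
  assumes A: "fin_lin A" and F: "pat A F" and p: "pat A p" "arcs_le F p" and p': "pat A p'" "arcs_le F p'"
    and card: "card (defects A p) = card (defects A p')"
    and xy: "consec A F x y" and yw: "consec A F y w"
    and pxy: "p x = y" and p'xy: "p' x \<noteq> y"
    and H: "same_con A F p p' x y" "same_con A F p p' y w"
  shows "p' y = w" "p' x = (if p w = w then x else p w)"
proof -
  let ?V = "defects A F"
  note D = consecD[OF xy] and E = consecD[OF yw]
  note P = patD[OF p(1)] and P' = patD[OF p'(1)]
  have py: "p y = x" using P(3)[of x] pxy by simp
  have V: "x \<in> ?V" "y \<in> ?V" "w \<in> ?V" using xy yw by (auto simp: consec_def)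
  have wx: "w \<noteq> x" using D E by auto
  have H1: "con x y p' z = p z" if "z \<in> ?V" "z \<noteq> x" "z \<noteq> y" for z
  proof -
    have "p z \<noteq> x" "p z \<noteq> y" using pxy py that P(3) by metis+
    then have "con x y p z = p z" by (simp add: con_def)
    then show ?thesis using H(1) that by (simp add: same_con_def)
  qed
  have W: "con y w p' x = (if p w = w then x else p w)"
  proof -
    have "con y w p x = (if p w = w then x else p w)" using pxy by (simp add: con_def)
    moreover have "x \<in> ?V - {y, w}" using V D wx by auto
    ultimately show ?thesis using H(2) by (simp add: same_con_def)
  qed
  have p'V: "p' a \<in> ?V" if "a \<in> ?V" for a using arcs_le_fixed_closed[OF F p' that] .
  \<comment> \<open>An arc xw would cover y, whose partner would have to be a further defect of F
    between x and w; there is none besides y.\<close>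
  have p'xw: "p' x \<noteq> w"
  proof
    assume xw: "p' x = w"
    then have "p' y \<noteq> y \<and> pos A x < pos A (p' y) \<and> pos A (p' y) < pos A w"
      using P'(4)[OF D(1,2)] D(6) E(6) by simp
    moreover have "p' y \<in> ?V" using p'V V by simp
    moreover from this have "pos A (p' y) \<noteq> pos A y"
      using pos_eq_iff[OF A _ D(2), of "p' y"] calculation by (auto simp: defects_def)
    ultimately show False using D(7)[of "p' y"] E(7)[of "p' y"] by linarith
  qed
  show y: "p' y = w"
  proof (rule ccontr)
    assume t: "p' y \<noteq> w"
    have s: "p' x = (if p w = w then x else p w)" using W p'xw p'xy by (simp add: con_def)
    have "p' w \<noteq> x" "p' w \<noteq> y" using p'xw t P'(3) by metis+
    then have w: "p' w = p w" using H1[of w] V E wx by (simp add: con_def)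
    show False
    proof (cases "p w = w")
      case False
      then have "p' x = p' w" using s w by simp
      then show False using P'(3) wx by metis
    next
      case True
      then have fx: "p' x = x" "p' w = w" using s w by simp_all
      \<comment> \<open>As x and w are defects of p', an arc at y has no room: it would cover one of
        them.\<close>
      have fy: "p' y = y"
      proof (rule ccontr)
        assume n: "p' y \<noteq> y"
        have mem: "p' y \<in> ?V" using p'V V by simp
        then have mA: "p' y \<in> Field A" by (simp add: defects_def)
        have "p' y \<noteq> x" using p'xy P'(3) by metis
        have c: "pos A (p' y) \<noteq> pos A x" "pos A (p' y) \<noteq> pos A y" "pos A (p' y) \<noteq> pos A w"
          using pos_eq_iff[OF A mA] D E n t \<open>p' y \<noteq> x\<close> by simp_all
        have "pos A (p' y) < pos A x \<or> pos A w < pos A (p' y)"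
          using D(7)[OF mem] E(7)[OF mem] c by linarith
        then show False
        proof
          assume "pos A (p' y) < pos A x"
          then show False using P'(4)[OF mA D(1)] P'(3)[of y] D(6) fx by simp
        next
          assume "pos A w < pos A (p' y)"
          then show False using P'(4)[OF D(2) E(2)] E(6) fx by simp
        qed
      qed
      have eq: "p' z = p z" if "z \<in> ?V" "z \<noteq> x" "z \<noteq> y" for z
      proof -
        have "p' z \<noteq> x" "p' z \<noteq> y" using fx fy that P'(3) by metis+
        then show ?thesis using H1[OF that] by (simp add: con_def)
      qed
      \<comment> \<open>Away from x and y the two patterns coincide, so p' would have two more
        defects than p, against the equal numbers.\<close>
      have "defects A p = defects A p' - {x, y}"
      proof (rule Set.set_eqI)
        fix a
        show "a \<in> defects A p \<longleftrightarrow> a \<in> defects A p' - {x, y}"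
        proof (cases "a \<in> ?V \<and> a \<noteq> x \<and> a \<noteq> y")
          case True
          then show ?thesis using eq[of a] by (simp add: defects_def)
        next
          case False
          then consider "a = x" | "a = y" | "a \<notin> ?V" by blast
          then show ?thesis
            using arcs_le_defects[OF p(2), of A] arcs_le_defects[OF p'(2), of A] pxy py D(5)
            by cases (auto simp: defects_def)
        qed
      qed
      moreover have "{x, y} \<subseteq> defects A p'" using fx fy D by (auto simp: defects_def)
      ultimately have "defects A p \<subset> defects A p'" by blast
      then have "card (defects A p) < card (defects A p')" by (rule psubset_card_mono[OF finite_defects[OF A]])
      then show False using card by simp
    qed
  qed
  have "p' x \<noteq> y" "p' x \<noteq> w" using p'xy p'xw by auto
  then show "p' x = (if p w = w then x else p w)" using W by (simp add: con_def)
qed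

text \<open>Three further defects on one side of the arc xy suffice. Once the arc yw is forced in
  p', the contraction at wj disagrees at x, unless p' joins x to j; then p joins w to j and the
  contraction at ji disagrees at y.\<close>

lemma same_con_end:
  assumes A: "fin_lin A" and F: "pat A F" and p: "pat A p" "arcs_le F p" and p': "pat A p'" "arcs_le F p'"
    and card: "card (defects A p) = card (defects A p')"
    and c: "consec A F x y" "consec A F y w" "consec A F w j" "consec A F j i"
    and pxy: "p x = y" and p'xy: "p' x \<noteq> y"
    and H: "\<And>u v. consec A F u v ==> \<not> (p u = u \<and> p v = v \<and> p' u = u \<and> p' v = v) ==> same_con A F p p' u v"
  shows False
proof -
  note D = consecD[OF c(1)] and E = consecD[OF c(2)] and G = consecD[OF c(3)] and I = consecD[OF c(4)]
  have H1: "same_con A F p p' x y" using H[OF c(1)] pxy D(5) by auto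
  have py: "p y = x" using patD(3)[OF p(1), of x] pxy by simp
  have H2: "same_con A F p p' y w" using H[OF c(2)] py D(5) by auto
  note y = same_con_forces_arc[OF A F p p' card c(1,2) pxy p'xy H1 H2]
  have ne: "x \<noteq> w" "x \<noteq> j" "x \<noteq> i" "y \<noteq> j" "y \<noteq> i" "w \<noteq> i" using D(6) E(6) G(6) I(6) by auto
  have V: "x \<in> defects A F" using c(1) by (simp add: consec_def)
  show False
  proof (cases "p' x = j")
    case False
    have "same_con A F p p' w j" using H[OF c(3)] y(1) patD(3)[OF p'(1), of y] E(5) by auto
    then have "con w j p x = con w j p' x" using V ne by (simp add: same_con_def)
    moreover have "con w j p x = y" using pxy E(5) ne by (auto simp: con_def)
    moreover have "p' x \<noteq> w" using y patD(3)[OF p'(1)] D(5) by metis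
    ultimately show False using False p'xy by (simp add: con_def)
  next
    case True
    then have "p w = j" using y(2) ne by (auto split: if_splits)
    then have "p j = w" using patD(3)[OF p(1), of w] by simp
    then have "same_con A F p p' j i" using H[OF c(4)] G(5) by auto
    then have "con j i p y = con j i p' y" using c(1) ne by (simp add: same_con_def consec_def)
    moreover have "con j i p y = x" using py ne by (auto simp: con_def)
    moreover have "con j i p' y = w" using y(1) G(5) ne by (auto simp: con_def)
    ultimately show False using ne by simp
  qed
qed

text \<open>With defects on both sides of xy, forcing to the right gives the arc yw of p' and, in
  the reversed order, forcing to the left gives ux. Then p must join u to w, and the contraction at
  wj disagrees at x.\<close>

lemma same_con_middle:
  assumes A: "fin_lin A" and F: "pat A F" and p: "pat A p" "arcs_le F p" and p': "pat A p'" "arcs_le F p'"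
    and card: "card (defects A p) = card (defects A p')"
    and c: "consec A F u x" "consec A F x y" "consec A F y w" "consec A F w j"
    and pxy: "p x = y" and p'xy: "p' x \<noteq> y"
    and H: "\<And>u v. consec A F u v ==> \<not> (p u = u \<and> p v = v \<and> p' u = u \<and> p' v = v) ==> same_con A F p p' u v"
  shows False
proof -
  note B = consecD[OF c(1)] and D = consecD[OF c(2)] and E = consecD[OF c(3)] and G = consecD[OF c(4)]
  have py: "p y = x" using patD(3)[OF p(1), of x] pxy by simp
  have p'yx: "p' y \<noteq> x" using patD(3)[OF p'(1), of y] p'xy by auto
  have H1: "same_con A F p p' x y" using H[OF c(2)] pxy D(5) by auto
  have H2: "same_con A F p p' y w" using H[OF c(3)] py D(5) by auto
  have H0: "same_con A F p p' u x" using H[OF c(1)] pxy D(5) by auto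
  note y = same_con_forces_arc[OF A F p p' card c(2,3) pxy p'xy H1 H2]
  have x: "p' x = u"
  proof (rule same_con_forces_arc(1)[OF _ pat_converse[OF A F] pat_converse[OF A p(1)] p(2) pat_converse[OF A p'(1)] p'(2)])
    show "fin_lin (A\<inverse>)" using A by (simp add: fin_lin_converse)
    show "consec (A\<inverse>) F y x" "consec (A\<inverse>) F x u" using consec_converse[OF A] c by auto
    show "same_con (A\<inverse>) F p p' y x" "same_con (A\<inverse>) F p p' x u"
      using H1 H0 con_commute[OF D(5)] con_commute[OF B(5)] by (simp_all add: same_con_def insert_commute)
  qed (use py p'yx card in simp_all)
  have ne: "x \<noteq> w" "x \<noteq> j" "u \<noteq> y" "u \<noteq> w" "u \<noteq> j" "y \<noteq> j" using B(6) D(6) E(6) G(6) by auto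
  have pw: "p w = u" using y(2) x B(5) by (auto split: if_splits)
  have "same_con A F p p' w j" using H[OF c(4)] pw ne by auto
  then have "con w j p x = con w j p' x" using c(2) ne by (simp add: same_con_def consec_def)
  moreover have "con w j p x = y" using pxy E(5) ne by (auto simp: con_def)
  moreover have "con w j p' x = u" using x ne by (auto simp: con_def)
  ultimately show False using ne by simp
qed

text \<open>If no contraction told p and p' apart, an arc xy of p between neighbouring defects of F
  could not belong to p', and forcing would propagate from it. The excluded situation, x and y
  defects of both, is the one in which both ranks would drop.\<close>

lemma ex_distinguishing_contraction:
  assumes A: "fin_lin A" and F: "pat A F" and p: "pat A p" "arcs_le F p" and p': "pat A p'" "arcs_le F p'"
    and card: "card (defects A p) = card (defects A p')" and n: "5 \<le> card (defects A F)" and ne: "p \<noteq> p'"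
  obtains x y where "consec A F x y" "\<not> (p x = x \<and> p y = y \<and> p' x = x \<and> p' y = y)" "\<not> same_con A F p p' x y"
proof (rule ccontr)
  note goal = that
  assume "\<not> thesis"
  then have H: "same_con A F p p' u v"
    if "consec A F u v" "\<not> (p u = u \<and> p v = v \<and> p' u = u \<and> p' v = v)" for u v
    using goal[OF that] by blast
  have "p \<noteq> F"
  proof
    assume "p = F"
    then have "p' = F" using arcs_le_defects_eq[OF A F p'] card by simp
    then show False using ne \<open>p = F\<close> by simp
  qed
  then obtain x y where xy: "consec A F x y" "p x = y" using ex_consec_arc[OF A F p] by blast
  note D = consecD[OF xy(1)]
  have py: "p y = x" using patD(3)[OF p(1), of x] xy by simp
  have "p' x \<noteq> y"
  proof
    assume p'x: "p' x = y"
    have p'y: "p' y = x" using patD(3)[OF p'(1), of x] p'x by simp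
    have "p a = p' a" for a
    proof (cases "a \<in> defects A F \<and> a \<noteq> x \<and> a \<noteq> y")
      case True
      then have "p a \<noteq> x" "p a \<noteq> y" "p' a \<noteq> x" "p' a \<noteq> y"
        using xy(2) py p'x p'y patD(3)[OF p(1)] patD(3)[OF p'(1)] by metis+
      moreover have "con x y p a = con x y p' a"
      proof -
        have "same_con A F p p' x y" using H[OF xy(1)] xy D(5) by auto
        then show ?thesis using True by (simp add: same_con_def)
      qed
      ultimately show ?thesis by (simp add: con_def)
    next
      case False
      then consider "a = x" | "a = y" | "a \<notin> Field A" | "F a \<noteq> a" by (auto simp: defects_def)
      then show ?thesis
        using xy py p'x p'y patD(1)[OF p(1)] patD(1)[OF p'(1)] arcs_leD[OF p(2)] arcs_leD[OF p'(2)] by cases auto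
    qed
    then show False using ne by auto
  qed
  note p'xy = this
  have p'yx: "p' y \<noteq> x" using patD(3)[OF p'(1), of y] p'xy by auto
  obtain ds where ds: "set ds = defects A F" "length ds = card (defects A F)"
      "\<And>i j. i < j ==> j < length ds ==> pos A (ds ! i) < pos A (ds ! j)"
      "\<And>i. Suc i < length ds ==> consec A F (ds ! i) (ds ! Suc i)"
    using defect_list[OF A, of F] by metis
  have "x \<in> set ds" "y \<in> set ds" using ds(1) xy(1) by (auto simp: consec_def)
  then obtain i j where ij: "i < length ds" "j < length ds" "x = ds ! i" "y = ds ! j" by (metis in_set_conv_nth)
  have "i < j" using ds(3)[of j i] D(6) ij by (metis linorder_neqE_nat not_less_iff_gr_or_eq)
  moreover have "\<not> Suc i < j"
    using D(7)[of "ds ! Suc i"] ds(1) ds(3)[of i "Suc i"] ds(3)[of "Suc i" j] ij by fastforce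
  ultimately have j: "j = Suc i" by simp
  note A' = fin_lin_converse[of A, THEN iffD2, OF A]
  have H': "same_con (A\<inverse>) F p p' u v"
    if c: "consec (A\<inverse>) F u v" and "\<not> (p u = u \<and> p v = v \<and> p' u = u \<and> p' v = v)" for u v
  proof -
    have c': "consec A F v u" using consec_converse[OF A' c] by simp
    then have "same_con A F p p' v u" using H that by blast
    then show ?thesis by (simp add: same_con_def insert_commute con_commute[OF consecD(5)[OF c']])
  qed
  note conv = A' pat_converse[OF A F] pat_converse[OF A p(1)] p(2) pat_converse[OF A p'(1)] p'(2)
  have card': "card (defects (A\<inverse>) p) = card (defects (A\<inverse>) p')" using card by simp
  have dsc: "consec (A\<inverse>) F (ds ! Suc k) (ds ! k)" if "Suc k < length ds" for k
    using consec_converse[OF A ds(4)[OF that]] .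
  have s: "Suc i < length ds" using ij j by simp
  \<comment> \<open>Five defects leave at least three besides x and y: three on one side, or two on
    one side and one on the other.\<close>
  consider "Suc (Suc (Suc (Suc i))) < length ds" | "3 \<le> i" | "1 \<le> i" "Suc (Suc (Suc i)) < length ds"
    | "2 \<le> i" "Suc (Suc i) < length ds" using n ds(2) s by linarith
  then show False
  proof cases
    case 1
    show False
      by (rule same_con_end[OF A F p p' card xy(1) _ _ _ xy(2) p'xy H, of "ds ! Suc (Suc i)" "ds ! Suc (Suc (Suc i))"
          "ds ! Suc (Suc (Suc (Suc i)))"])
        (use ds(4) 1 ij j in auto)
  next
    case 2
    then obtain k where k: "i = Suc (Suc (Suc k))" by (metis Suc_le_D numeral_3_eq_3 Suc_le_mono)
    show False
      by (rule same_con_end[OF conv card' consec_converse[OF A xy(1)] _ _ _ py p'yx H', of "ds ! Suc (Suc k)" "ds ! Suc k" "ds ! k"])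
        (use dsc k ij in auto)
  next
    case 3
    then obtain k where k: "i = Suc k" by (metis Suc_le_D One_nat_def)
    show False
      by (rule same_con_middle[OF A F p p' card _ xy(1) _ _ xy(2) p'xy H, of "ds ! k" "ds ! Suc (Suc i)" "ds ! Suc (Suc (Suc i))"])
        (use ds(4) k ij j 3 in auto)
  next
    case 4
    then obtain k where k: "i = Suc (Suc k)" by (metis Suc_le_D numeral_2_eq_2 Suc_le_mono)
    show False
      by (rule same_con_middle[OF conv card' _ consec_converse[OF A xy(1)] _ _ py p'yx H', of "ds ! Suc (Suc i)" "ds ! Suc k" "ds ! k"])
        (use dsc k ij j 4 in auto)
  qed
qed

section \<open>Anti-planarity and separation\<close>

text \<open>A partition stores the orders of its objects, but its mates depend on the blocks only;
  renaming the objects makes results for one order available for another.\<close>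

lemma relabel:
  assumes "x \<in> brauer_hom A B" "Field A' = Field A" "Field B' = Field B"
  shows "Brauer A' B' (blocks x) \<in> brauer_hom A' B'" "mate (Brauer A' B' (blocks x)) = mate x"
    "ncr D E (Brauer A' B' (blocks x)) \<longleftrightarrow> ncr D E x" "upf (Brauer A' B' (blocks x)) = upf x"
proof -
  show "Brauer A' B' (blocks x) \<in> brauer_hom A' B'" using assms by (auto simp: brauer_hom_def verts_def)
  show m: "mate (Brauer A' B' (blocks x)) = mate x" by (rule ext) (simp add: mate_def)
  show "ncr D E (Brauer A' B' (blocks x)) \<longleftrightarrow> ncr D E x" by (simp add: ncr_def m)
  show "upf (Brauer A' B' (blocks x)) = upf x"
    using brauer_hom_sel[OF assms(1)] assms(2) by (simp add: upf_def m fun_eq_iff)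
qed

lemma ncr_reverse:
  assumes x: "x \<in> brauer_hom A B" and A: "fin_lin A'" "Field A' = Field A" and B: "fin_lin B'" "Field B' = Field B"
    and n: "ncr A' B' x"
  shows "ncr (A'\<inverse>) (B'\<inverse>) x"
  using ncr_converse[OF relabel(1)[OF x A(2) B(2)] A(1) B(1)] n relabel(3)[OF x A(2) B(2)] by simp

definition diagram :: "'a rel => 'a rel => 'a brauer => bool" where
  "diagram A B x \<longleftrightarrow> x \<in> brauer_hom A B \<and> (ncr A B x \<or> ncr (A\<inverse>) B x)"

lemma diagramD: "diagram A B x ==> x \<in> brauer_hom A B"
  by (simp add: diagram_def)

lemma pat_upf_diagram:
  assumes d: "diagram A B x" and A: "fin_lin A" and B: "fin_lin B"
  shows "pat A (upf x)"
proof -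
  note h = diagramD[OF d]
  have A': "fin_lin (A\<inverse>)" using A by (simp add: fin_lin_converse)
  consider "ncr A B x" | "ncr (A\<inverse>) B x" using d by (auto simp: diagram_def)
  then show ?thesis
  proof cases
    case 2
    have "pat (A\<inverse>) (upf x)"
      using pat_upf[OF relabel(1)[OF h, of "A\<inverse>" B] A' B] relabel(3,4)[OF h, of "A\<inverse>" B] 2 by simp
    then show ?thesis using pat_converse[OF A'] by force
  qed (use pat_upf[OF h A B] in simp)
qed

lemma ncr_mult:
  assumes x: "x \<in> brauer_hom A B" and y: "y \<in> brauer_hom B C"
    and A: "fin_lin A'" "Field A' = Field A" and B: "fin_lin B'" "Field B' = Field B" and C: "fin_lin C'" "Field C' = Field C"
    and n: "ncr A' B' x" "ncr B' C' y"
  shows "ncr A' C' (x \<cdot> y)"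
proof -
  have v: "verts A' B' = verts A B" "verts B' C' = verts B C" "verts A' C' = verts A C"
    using A B C by (simp_all add: verts_def)
  have "noncross (verts A C) (vkey (pos A') (pos C')) (mate (x \<cdot> y))"
    by (rule noncross_mult[OF x y, where q = "pos B'"])
      (use A B C n pos_inj[OF A(1)] pos_inj[OF B(1)] pos_inj[OF C(1)] pos_bounds(1)[OF A(1)] pos_bounds(1)[OF B(1)]
        pos_bounds(1)[OF C(1)] fin_linD(1)[OF B(1)] in \<open>simp_all add: ncr_def v\<close>)
  then show ?thesis by (simp add: ncr_def v)
qed

text \<open>Signs multiply. If the second factor is anti-planar, \<open>ncr_reverse\<close> replaces
  the reversal of its upper row by one of its lower row, so that the middle orders match; reversing
  both outer rows afterwards gives the stated form.\<close>

lemma ncr_mult_signs: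
  assumes x: "x \<in> brauer_hom A B" and y: "y \<in> brauer_hom B C" and A: "fin_lin A" and B: "fin_lin B" and C: "fin_lin C"
  shows "ncr A B x ==> ncr B C y ==> ncr A C (x \<cdot> y)"
    and "ncr (A\<inverse>) B x ==> ncr B C y ==> ncr (A\<inverse>) C (x \<cdot> y)"
    and "ncr A B x ==> ncr (B\<inverse>) C y ==> ncr (A\<inverse>) C (x \<cdot> y)"
    and "ncr (A\<inverse>) B x ==> ncr (B\<inverse>) C y ==> ncr A C (x \<cdot> y)"
proof -
  note A' = fin_lin_converse[of A, THEN iffD2, OF A] and B' = fin_lin_converse[of B, THEN iffD2, OF B]
    and C' = fin_lin_converse[of C, THEN iffD2, OF C]
  note m = mult_hom[OF x y fin_linD(1)[OF B]]
  show "ncr A B x ==> ncr B C y ==> ncr A C (x \<cdot> y)"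
    using ncr_mult[OF x y A refl B refl C refl] .
  show "ncr (A\<inverse>) B x ==> ncr B C y ==> ncr (A\<inverse>) C (x \<cdot> y)"
    using ncr_mult[OF x y A' _ B refl C refl] by simp
  have r: "ncr (B\<inverse>) C y ==> ncr B (C\<inverse>) y" using ncr_reverse[OF y B' _ C refl] by simp
  show "ncr A C (x \<cdot> y)" if "ncr (A\<inverse>) B x" "ncr (B\<inverse>) C y"
  proof -
    have "ncr (A\<inverse>) (C\<inverse>) (x \<cdot> y)" using ncr_mult[OF x y A' _ B refl C' _ that(1) r[OF that(2)]] by simp
    then show ?thesis using ncr_reverse[OF m A' _ C'] by simp
  qed
  show "ncr (A\<inverse>) C (x \<cdot> y)" if "ncr A B x" "ncr (B\<inverse>) C y"
  proof -
    have "ncr A (C\<inverse>) (x \<cdot> y)" using ncr_mult[OF x y A refl B refl C' _ that(1) r[OF that(2)]] by simp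
    then show ?thesis using ncr_reverse[OF m A refl C'] by simp
  qed
qed

text \<open>Turning upside down moves the reversal to the lower row; reversing both rows brings it
  back to the upper one.\<close>

lemma ncr_star_signs:
  assumes x: "x \<in> brauer_hom A B" and A: "fin_lin A" and B: "fin_lin B" and n: "ncr (A\<inverse>) B x"
  shows "ncr (B\<inverse>) A (star x)"
proof -
  note A' = fin_lin_converse[of A, THEN iffD2, OF A]
  note h = relabel[OF x, of "A\<inverse>" B]
  have h1: "Brauer (A\<inverse>) B (blocks x) \<in> brauer_hom (A\<inverse>) B" and h3: "ncr (A\<inverse>) B (Brauer (A\<inverse>) B (blocks x))"
    using h(1,3) n by auto
  have "ncr B (A\<inverse>) (star (Brauer (A\<inverse>) B (blocks x)))" by (rule ncr_star[OF h1 A' B h3])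
  moreover have "mate (star (Brauer (A\<inverse>) B (blocks x))) v = mate (star x) v" if "v \<in> verts B A" for v
    using mate_star[OF h1, of v] mate_star[OF x, of v] that h(2) by simp
  ultimately have "ncr B (A\<inverse>) (star x)"
    using mateD(1)[OF star_hom[OF x]] unfolding ncr_def noncross_def by simp
  then show ?thesis using ncr_reverse[OF star_hom[OF x] B refl A'] by simp
qed

lemma diagram_mult:
  assumes "diagram A B x" "diagram B C y" "fin_lin A" "fin_lin B" "fin_lin C"
  shows "diagram A C (x \<cdot> y)"
  using assms ncr_mult_signs[OF diagramD[OF assms(1)] diagramD[OF assms(2)] assms(3-5)]
    mult_hom[OF diagramD[OF assms(1)] diagramD[OF assms(2)] fin_linD(1)[OF assms(4)]]
  unfolding diagram_def by blast

lemma diagram_proj: "fin_lin A ==> pat A p ==> diagram A A (proj A p)"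
  by (simp add: diagram_def proj_hom ncr_proj)

lemma rank_proj: "fin_lin A ==> pat A p ==> rank (proj A p) = card (defects A p)"
  by (simp add: rank_defects[OF proj_hom] upf_proj)

text \<open>The order reversing bijection behind \<open>flip\<close>.\<close>

lemma ex_reversal:
  assumes A: "fin_lin A"
  obtains \<phi> where "\<And>a. a \<in> Field A ==> \<phi> a \<in> Field A" "\<And>a. a \<in> Field A ==> \<phi> (\<phi> a) = a"
    "\<And>a. a \<in> Field A ==> pos A (\<phi> a) = pos (A\<inverse>) a"
proof -
  have im: "pos A ` Field A = {1..card (Field A)}"
  proof (rule card_seteq)
    show "pos A ` Field A \<subseteq> {1..card (Field A)}" using pos_bounds[OF A] by force
    show "card {1..card (Field A)} \<le> card (pos A ` Field A)" using card_image[OF pos_inj[OF A]] by simp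
  qed simp
  have "\<exists>b\<in>Field A. pos A b = pos (A\<inverse>) a" if a: "a \<in> Field A" for a
  proof -
    have "pos (A\<inverse>) a \<in> {1..card (Field A)}"
      using pos_converse[OF A a] pos_bounds[OF A a] by simp
    then show ?thesis using im by (metis imageE)
  qed
  then obtain \<phi> where \<phi>: "\<And>a. a \<in> Field A ==> \<phi> a \<in> Field A \<and> pos A (\<phi> a) = pos (A\<inverse>) a" by metis
  moreover have "\<phi> (\<phi> a) = a" if a: "a \<in> Field A" for a
  proof -
    have "pos A (\<phi> (\<phi> a)) = pos A a"
      using \<phi>[OF a] \<phi>[of "\<phi> a"] pos_converse[OF A a] pos_converse[OF A, of "\<phi> a"] by simp
    then show ?thesis using pos_eq_iff[OF A, of "\<phi> (\<phi> a)" a] \<phi>[OF a] \<phi>[of "\<phi> a"] a by simp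
  qed
  ultimately show thesis using that by blast
qed

text \<open>Multiplying by \<open>flip\<close> only renames the upper vertices by \<phi>, and \<phi>
  turns positions in \<open>A\<close> into positions in its converse. So both sides are the same
  condition, read through \<psi>.\<close>

theorem anti_planar_iff_ncr:
  assumes \<alpha>: "\<alpha> \<in> brauer_hom A B" and A: "fin_lin A" and B: "fin_lin B"
  shows "anti_planar \<alpha> \<longleftrightarrow> ncr (A\<inverse>) B \<alpha>"
proof -
  obtain \<phi> where \<phi>: "\<And>a. a \<in> Field A ==> \<phi> a \<in> Field A" "\<And>a. a \<in> Field A ==> \<phi> (\<phi> a) = a"
    "\<And>a. a \<in> Field A ==> pos A (\<phi> a) = pos (A\<inverse>) a" using ex_reversal[OF A] by blast
  define f where "f v = (case v of Top a => Bot (\<phi> a) | Mid a => Mid a | Bot a => Top (\<phi> a))" for v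
  have mf: "matching (verts A A) f"
    unfolding matching_def using \<phi>(1,2) by (auto simp: f_def elim!: vertsE)
  have partner: "pos A a + pos A b = card (Field A) + 1 \<longleftrightarrow> b = \<phi> a" if "a \<in> Field A" "b \<in> Field A" for a b
    using pos_converse[OF A that(1)] \<phi>(1,3)[OF that(1)] pos_eq_iff[OF A that(2), of "\<phi> a"] by auto
  have fl: "flip A = of_mate A A f"
  proof -
    have "{{Top a, Bot b} | a b. a \<in> Field A \<and> b \<in> Field A \<and> pos A a + pos A b = card (Field A) + 1} = (\<lambda>v. {v, f v}) ` verts A A"
    proof (intro equalityI subsetI)
      fix x assume "x \<in> (\<lambda>v. {v, f v}) ` verts A A"
      then obtain v where v: "v \<in> verts A A" "x = {v, f v}" by auto
      from v(1) show "x \<in> {{Top a, Bot b} | a b. a \<in> Field A \<and> b \<in> Field A \<and> pos A a + pos A b = card (Field A) + 1}"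
      proof (cases rule: vertsE)
        case (1 a)
        then show ?thesis using v \<phi>(1) partner[of a "\<phi> a"] by (auto simp: f_def)
      next
        case (2 a)
        then have "x = {Top (\<phi> a), Bot a}" "\<phi> a \<in> Field A" "pos A (\<phi> a) + pos A a = card (Field A) + 1"
          using v \<phi>(1,2) partner[of "\<phi> a" a] by (auto simp: f_def)
        then show ?thesis using 2 by blast
      qed
    next
      fix x assume "x \<in> {{Top a, Bot b} | a b. a \<in> Field A \<and> b \<in> Field A \<and> pos A a + pos A b = card (Field A) + 1}"
      then obtain a b where "x = {Top a, Bot b}" "a \<in> Field A" "b = \<phi> a" using partner by blast
      then have "x = {Top a, f (Top a)}" "Top a \<in> verts A A" by (auto simp: f_def)
      then show "x \<in> (\<lambda>v. {v, f v}) ` verts A A" by blast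
    qed
    then show ?thesis by (simp add: flip_def of_mate_def)
  qed
  have fh: "flip A \<in> brauer_hom A A" unfolding fl by (rule of_mate_hom[OF mf])
  have fm: "mate (flip A) (Top a) = Bot (\<phi> a)" "mate (flip A) (Bot a) = Top (\<phi> a)" if "a \<in> Field A" for a
    using mate_of_mate[OF mf, of "Top a"] mate_of_mate[OF mf, of "Bot a"] that by (simp_all add: fl f_def)
  let ?y = "flip A \<cdot> \<alpha>"
  note fin = fin_linD(1)[OF A]
  note y = mult_hom[OF fh \<alpha> fin]
  define \<psi> where "\<psi> v = (case v of Top a => Top (\<phi> a) | Mid a => Mid a | Bot a => Bot a)" for v
  have \<psi>: "\<psi> v \<in> verts A B" "\<psi> (\<psi> v) = v" "vkey (pos A) (pos B) (\<psi> v) = vkey (pos (A\<inverse>)) (pos B) v" if "v \<in> verts A B" for v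
    using that \<phi> by (auto simp: \<psi>_def elim!: vertsE)
  have y\<psi>: "mate ?y (\<psi> v) = \<psi> (mate \<alpha> v)" if v: "v \<in> verts A B" for v
  proof (rule mult_mateI[OF fh \<alpha> fin \<psi>(1)[OF v] \<psi>(1)[OF mateD(1)[OF \<alpha> v]]])
    show "\<psi> v \<noteq> \<psi> (mate \<alpha> v)" using \<psi>(2)[OF v] \<psi>(2)[OF mateD(1)[OF \<alpha> v]] mateD(2)[OF \<alpha> v] by metis
    fix t :: "'a vertex rel" assume t: "sym t" "trans t" "joins (flip A) \<alpha> A A B t"
    note J = joinsD[OF fh \<alpha> t(3)]
    have up: "(Top (\<phi> a), Mid a) \<in> t" if "a \<in> Field A" for a
      using J(2)[of "\<phi> a" a] fm(1)[of "\<phi> a"] \<phi>(1,2)[OF that] by simp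
    from v show "(\<psi> v, \<psi> (mate \<alpha> v)) \<in> t"
    proof (cases rule: vertsE)
      case (1 a)
      have "mate \<alpha> v \<in> verts A B" using mateD(1)[OF \<alpha> v] .
      then show ?thesis
      proof (cases rule: vertsE)
        case (1 c)
        have "(Mid a, Mid c) \<in> t" using J(4)[of a c] 1 \<open>v = Top a\<close> \<open>a \<in> Field A\<close> by simp
        then show ?thesis using up[OF \<open>a \<in> Field A\<close>] up[OF 1(2)] t(1,2) 1 \<open>v = Top a\<close>
          by (simp add: \<psi>_def) (metis symD transD)
      next
        case (2 c)
        have "(Mid a, Bot c) \<in> t" using J(5)[of a c] 2 \<open>v = Top a\<close> \<open>a \<in> Field A\<close> by simp
        then show ?thesis using up[OF \<open>a \<in> Field A\<close>] t(2) 2 \<open>v = Top a\<close>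
          by (simp add: \<psi>_def) (metis transD)
      qed
    next
      case (2 b)
      have "mate \<alpha> v \<in> verts A B" using mateD(1)[OF \<alpha> v] .
      then show ?thesis
      proof (cases rule: vertsE)
        case (1 c)
        then have "mate \<alpha> (Top c) = Bot b" using mateD(3)[OF \<alpha> v] 2 by simp
        then have "(Mid c, Bot b) \<in> t" using J(5)[of c b] 1 by simp
        then show ?thesis using up[OF 1(2)] t(1,2) 1 \<open>v = Bot b\<close>
          by (simp add: \<psi>_def) (metis symD transD)
      next
        case (2 c)
        then show ?thesis using J(6)[of b c] \<open>v = Bot b\<close> \<open>b \<in> Field B\<close> by (simp add: \<psi>_def)
      qed
    qed
  qed
  have "ncr A B ?y \<longleftrightarrow> ncr (A\<inverse>) B \<alpha>"
  proof
    assume n: "ncr A B ?y"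
    show "ncr (A\<inverse>) B \<alpha>"
      unfolding ncr_def noncross_def
    proof (intro ballI impI)
      fix v w assume vw: "v \<in> verts (A\<inverse>) B" "w \<in> verts (A\<inverse>) B"
        "vkey (pos (A\<inverse>)) (pos B) v < vkey (pos (A\<inverse>)) (pos B) w \<and>
         vkey (pos (A\<inverse>)) (pos B) w < vkey (pos (A\<inverse>)) (pos B) (mate \<alpha> v)"
      then have V: "v \<in> verts A B" "w \<in> verts A B" by simp_all
      show "vkey (pos (A\<inverse>)) (pos B) v < vkey (pos (A\<inverse>)) (pos B) (mate \<alpha> w) \<and>
         vkey (pos (A\<inverse>)) (pos B) (mate \<alpha> w) < vkey (pos (A\<inverse>)) (pos B) (mate \<alpha> v)"
        using noncrossD[OF n[unfolded ncr_def] \<psi>(1)[OF V(1)] \<psi>(1)[OF V(2)]] vw(3) y\<psi>[OF V(1)] y\<psi>[OF V(2)]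
          \<psi>(3)[OF V(1)] \<psi>(3)[OF V(2)] \<psi>(3)[OF mateD(1)[OF \<alpha> V(1)]] \<psi>(3)[OF mateD(1)[OF \<alpha> V(2)]] by simp
    qed
  next
    assume n: "ncr (A\<inverse>) B \<alpha>"
    show "ncr A B ?y"
      unfolding ncr_def noncross_def
    proof (intro ballI impI)
      fix v w assume vw: "v \<in> verts A B" "w \<in> verts A B"
        "vkey (pos A) (pos B) v < vkey (pos A) (pos B) w \<and> vkey (pos A) (pos B) w < vkey (pos A) (pos B) (mate ?y v)"
      note p = \<psi>(1)[OF vw(1)] \<psi>(1)[OF vw(2)]
      have e: "mate ?y v = \<psi> (mate \<alpha> (\<psi> v))" "mate ?y w = \<psi> (mate \<alpha> (\<psi> w))"
        using y\<psi>[OF p(1)] y\<psi>[OF p(2)] \<psi>(2)[OF vw(1)] \<psi>(2)[OF vw(2)] by simp_all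
      have k: "vkey (pos (A\<inverse>)) (pos B) (\<psi> v) = vkey (pos A) (pos B) v" "vkey (pos (A\<inverse>)) (pos B) (\<psi> w) = vkey (pos A) (pos B) w"
        using \<psi>(3)[OF p(1)] \<psi>(3)[OF p(2)] \<psi>(2)[OF vw(1)] \<psi>(2)[OF vw(2)] by simp_all
      show "vkey (pos A) (pos B) v < vkey (pos A) (pos B) (mate ?y w) \<and>
          vkey (pos A) (pos B) (mate ?y w) < vkey (pos A) (pos B) (mate ?y v)"
        using noncrossD[OF n[unfolded ncr_def], of "\<psi> v" "\<psi> w"] p vw(3) k \<psi>(3)[OF mateD(1)[OF \<alpha> p(1)]] \<psi>(3)[OF mateD(1)[OF \<alpha> p(2)]]
        by (simp add: e)
    qed
  qed
  then show ?thesis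
    using planar_iff_ncr[OF y A B] brauer_hom_sel[OF \<alpha>] by (simp add: anti_planar_def)
qed

lemma even_card_involution:
  assumes "finite S" "\<And>x. x \<in> S ==> f x \<in> S \<and> f x \<noteq> x \<and> f (f x) = x"
  shows "even (card S)"
  using assms
proof (induction "card S" arbitrary: S rule: less_induct)
  case less
  show ?case
  proof (cases "S = {}")
    case False
    then obtain x where x: "x \<in> S" by blast
    have fx: "f x \<in> S" "f x \<noteq> x" "f (f x) = x" using less.prems(2)[OF x] by auto
    let ?T = "S - {x, f x}"
    have c: "card S = card ?T + 2" using card_Diff_subset[of "{x, f x}" S] x fx less.prems(1) card_mono[of S "{x, f x}"] by simp
    have "even (card ?T)"
    proof (rule less.hyps)
      show "card ?T < card S" using c by simp
      show "finite ?T" using less.prems(1) by simp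
      fix y assume y: "y \<in> ?T"
      then have "f y \<in> S" "f y \<noteq> y" "f (f y) = y" using less.prems(2)[of y] by auto
      moreover have "f y \<noteq> x" "f y \<noteq> f x" using y \<open>f (f y) = y\<close> fx by auto
      ultimately show "f y \<in> ?T \<and> f y \<noteq> y \<and> f (f y) = y" by simp
    qed
    then show ?thesis using c by simp
  qed simp
qed

text \<open>Off its defects p is an involution without fixed points.\<close>

lemma odd_defects:
  assumes A: "fin_lin A" and o: "odd (card (Field A))" and p: "pat A p"
  shows "odd (card (defects A p))"
proof -
  have "even (card (Field A - defects A p))"
    by (rule even_card_involution[where f = p]) (use fin_linD(1)[OF A] patD[OF p] in \<open>auto simp: defects_def\<close>)
  moreover have "card (Field A) = card (Field A - defects A p) + card (defects A p)"
    using card_Diff_subset[OF finite_defects[OF A], of p "Field A"] card_mono[OF fin_linD(1)[OF A], of "defects A p"]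
    by (simp add: defects_def)
  ultimately show ?thesis using o by simp
qed

text \<open>The lower arc xy of the projection joins x with y on top of \<beta>, its other lower
  arcs already occur in \<beta>, and its defects lead straight through. What a path from a defect z
  meets on its way is the case analysis of \<open>con\<close>.\<close>

lemma hook:
  assumes A: "fin_lin A" and F: "pat A F" and c: "consec A F x y" and \<beta>: "\<beta> \<in> brauer_hom A B"
    and le: "arcs_le F (upf \<beta>)" and p: "pat A (upf \<beta>)"
  shows "arcs_le (add_arc F x y) (upf (proj A (add_arc F x y) \<cdot> \<beta>))"
    and "z \<in> defects A F - {x, y} ==> upf (proj A (add_arc F x y) \<cdot> \<beta>) z = con x y (upf \<beta>) z"
proof -
  let ?G = "add_arc F x y" and ?u = "upf \<beta>"
  note G = pat_add_arc[OF A F c] and D = consecD[OF c]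
  note e = proj_hom[OF A G] and fin = fin_linD(1)[OF A]
  note m = mult_hom[OF e \<beta> fin]
  show "arcs_le ?G (upf (proj A ?G \<cdot> \<beta>))"
    using upf_mult[OF e \<beta> fin] by (simp add: arcs_le_def upf_proj[OF A G])
  have top: "mate (proj A ?G) (Top a) = (if ?G a = a then Bot a else Top (?G a))"
    "mate (proj A ?G) (Bot a) = (if ?G a = a then Top a else Bot (?G a))" if "a \<in> Field A" for a
    using mate_proj[OF A G, of "Top a"] mate_proj[OF A G, of "Bot a"] that by (simp_all add: link_def)
  assume z: "z \<in> defects A F - {x, y}"
  then have zA: "z \<in> Field A" "?G z = z" by (auto simp: defects_def add_arc_def)
  have Gd: "?G a = a \<longleftrightarrow> F a = a \<and> a \<noteq> x \<and> a \<noteq> y" for a using D(3-5) by (auto simp: add_arc_def)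
  have closed: "a \<in> Field A ==> F a = a ==> ?u a \<in> Field A \<and> F (?u a) = ?u a" for a
    using arcs_le_closed[OF F p le] patD(2)[OF p] by blast
  have inv: "?u (?u a) = a" for a using patD(3)[OF p] .
  have conz: "con x y ?u z \<in> Field A" "?G (con x y ?u z) = con x y ?u z"
  proof -
    have F1: "?u z \<in> Field A" "F (?u z) = ?u z" "?u x \<in> Field A" "F (?u x) = ?u x" "?u y \<in> Field A" "F (?u y) = ?u y"
      using closed D zA Gd by auto
    have n: "?u z = x ==> ?u x = z" "?u z = y ==> ?u y = z" using inv[of z] by auto
    have n2: "?u z = x ==> ?u y \<noteq> x" "?u z = y ==> ?u x \<noteq> y" using inv z n by (metis DiffD2 insertCI)+
    show "con x y ?u z \<in> Field A" using F1 zA by (simp add: con_def)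
    show "?G (con x y ?u z) = con x y ?u z"
      using F1 zA(2) n n2 unfolding Gd con_def by auto
  qed
  show "upf (proj A ?G \<cdot> \<beta>) z = con x y ?u z"
  proof -
    have key: "mate (proj A ?G \<cdot> \<beta>) (Top z) = w"
      if w: "w \<in> verts A B" "w \<noteq> Top z" "\<And>t. sym t ==> trans t ==> joins (proj A ?G) \<beta> A A B t ==> (Mid z, w) \<in> t" for w
    proof (rule mult_mateI[OF e \<beta> fin _ w(1) w(2)[symmetric]])
      fix t :: "'a vertex rel" assume t: "sym t" "trans t" "joins (proj A ?G) \<beta> A A B t"
      have "(Top z, Mid z) \<in> t" using joinsD(2)[OF e \<beta> t(3), of z z] top(1)[of z] zA by simp
      then show "(Top z, w) \<in> t" using w(3)[OF t] t(2) by (metis transD)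
    qed (use zA in simp)
    have toTop: "(Mid a, Top a) \<in> t" if "a \<in> Field A" "?G a = a" "joins (proj A ?G) \<beta> A A B t" "sym t" for a t
      using joinsD(2)[OF e \<beta> that(3), of a a] top(1)[of a] that by (auto dest: symD)
    have mid: "(Mid a, Mid (?u a)) \<in> t" if "?u a \<noteq> a" "joins (proj A ?G) \<beta> A A B t" for a t
      using joinsD(4)[OF e \<beta> that(2), of a "?u a"] mate_top_upf[OF \<beta> that(1)] by simp
    have xy: "(Mid x, Mid y) \<in> t" if "joins (proj A ?G) \<beta> A A B t" for t
      using joinsD(3)[OF e \<beta> that, of x y] top(2)[of x] D by (simp add: add_arc_def)
    have bot: "\<exists>b\<in>Field B. \<forall>t. joins (proj A ?G) \<beta> A A B t --> (Mid a, Bot b) \<in> t" if a: "a \<in> Field A" "?u a = a" for a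
    proof -
      obtain b where "mate \<beta> (Top a) = Bot b" "b \<in> Field B"
        by (rule mate_top_cases[OF \<beta> a(1)]) (use a(2) in auto)
      then show ?thesis using joinsD(5)[OF e \<beta>] a(1) by blast
    qed
    have viaBot: "upf (proj A ?G \<cdot> \<beta>) z = z"
      if a: "a \<in> Field A" "?u a = a" and t: "\<And>t. sym t ==> trans t ==> joins (proj A ?G) \<beta> A A B t ==> a = z \<or> (Mid z, Mid a) \<in> t" for a
    proof -
      obtain b where b: "b \<in> Field B" "\<And>t. joins (proj A ?G) \<beta> A A B t ==> (Mid a, Bot b) \<in> t" using bot[OF a] by blast
      have "mate (proj A ?G \<cdot> \<beta>) (Top z) = Bot b"
        by (rule key) (use b t in \<open>auto dest: transD\<close>)
      then show ?thesis using zA brauer_hom_sel[OF m] by (simp add: upf_def)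
    qed
    have viaTop: "upf (proj A ?G \<cdot> \<beta>) z = a"
      if a: "a \<in> Field A" "?G a = a" "a \<noteq> z" and t: "\<And>t. sym t ==> trans t ==> joins (proj A ?G) \<beta> A A B t ==> (Mid z, Mid a) \<in> t" for a
    proof -
      have "mate (proj A ?G \<cdot> \<beta>) (Top z) = Top a"
      proof (rule key)
        fix t :: "'a vertex rel" assume t': "sym t" "trans t" "joins (proj A ?G) \<beta> A A B t"
        show "(Mid z, Top a) \<in> t" using t[OF t'] toTop[OF a(1,2) t'(3,1)] t'(2) by (metis transD)
      qed (use a in auto)
      then show ?thesis by (rule upf_eqI[OF m zA(1)])
    qed
    have zxy: "z \<noteq> x" "z \<noteq> y" using z by auto
    consider "?u z = z" | "?u z = x" | "?u z = y" | "?u z \<noteq> z" "?u z \<noteq> x" "?u z \<noteq> y" by blast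
    then show ?thesis
    proof cases
      case 1
      then have "con x y ?u z = z" using zxy by (simp add: con_def)
      then show ?thesis using viaBot[OF zA(1) 1] by simp
    next
      case 2
      have s: "(Mid z, Mid y) \<in> t" if "trans t" "joins (proj A ?G) \<beta> A A B t" for t
        using mid[OF _ that(2), of z] xy[OF that(2)] 2 zxy that(1) by (metis transD)
      show ?thesis
      proof (cases "?u y = y")
        case True
        then have "con x y ?u z = z" using 2 by (simp add: con_def)
        then show ?thesis using viaBot[OF D(2) True] s by simp
      next
        case False
        then have cz: "con x y ?u z = ?u y" using 2 by (simp add: con_def)
        have "?u y \<noteq> z" using 2 inv[of y] D(5) by auto
        moreover have "(Mid z, Mid (?u y)) \<in> t" if "trans t" "joins (proj A ?G) \<beta> A A B t" for t
          using s[OF that] mid[OF False that(2)] that(1) by (metis transD)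
        ultimately show ?thesis using viaTop[of "?u y"] conz cz by simp
      qed
    next
      case 3
      have s: "(Mid z, Mid x) \<in> t" if "trans t" "joins (proj A ?G) \<beta> A A B t" "sym t" for t
        using mid[OF _ that(2), of z] xy[OF that(2)] 3 zxy that(1,3) by (metis transD symD)
      show ?thesis
      proof (cases "?u x = x")
        case True
        then have "con x y ?u z = z" using 3 D(5) by (simp add: con_def)
        then show ?thesis using viaBot[OF D(1) True] s by simp
      next
        case False
        then have cz: "con x y ?u z = ?u x" using 3 D(5) by (simp add: con_def)
        have "?u x \<noteq> z" using 3 inv[of x] D(5) by auto
        moreover have "(Mid z, Mid (?u x)) \<in> t" if "trans t" "joins (proj A ?G) \<beta> A A B t" "sym t" for t
          using s[OF that] mid[OF False that(2)] that(1) by (metis transD)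
        ultimately show ?thesis using viaTop[of "?u x"] conz cz by simp
      qed
    next
      case 4
      then have cz: "con x y ?u z = ?u z" by (simp add: con_def)
      then show ?thesis using viaTop[of "?u z"] conz mid[of z] 4 by simp
    qed
  qed
qed

text \<open>Joining two defects would lose both. If only one of x, y is a defect, it is lost, but
  the partner of the other one becomes a defect; if neither is, nothing is lost.\<close>

lemma card_defects_con:
  assumes A: "fin_lin A" and F: "pat A F" and p: "pat A p" and le: "arcs_le F p" and c: "consec A F x y"
    and nf: "\<not> (p x = x \<and> p y = y)"
  shows "card (defects A p) \<le> card {z \<in> defects A F - {x, y}. con x y p z = z}"
proof -
  note D = consecD[OF c]
  let ?S = "{z \<in> defects A F - {x, y}. con x y p z = z}"
  have inv: "p (p a) = a" for a using patD(3)[OF p] .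
  have V: "a \<in> defects A F ==> p a \<in> defects A F" for a by (rule arcs_le_fixed_closed[OF F p le])
  have xyV: "x \<in> defects A F" "y \<in> defects A F" using c by (auto simp: consec_def)
  have fin: "finite ?S" using finite_defects[OF A] by simp
  have sub: "a \<in> ?S" if "a \<in> defects A p" "a \<noteq> x" "a \<noteq> y" for a
    using that arcs_le_defects[OF le, of A] by (auto simp: con_def defects_def)
  have swap: "card (defects A p) \<le> card ?S" if a: "a \<in> {x, y}" "b \<in> {x, y}" "a \<noteq> b" "p a = a" "p b \<noteq> b" for a b
  proof -
    have pb: "p b \<noteq> a" "p b \<noteq> b" using a inv by metis+
    then have pbS: "p b \<in> ?S" using V xyV a inv[of b] by (auto simp: con_def)
    have "p b \<notin> defects A p" using a(5) inv[of b] by (auto simp: defects_def)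
    have s1: "insert (p b) (defects A p - {a}) \<subseteq> ?S" using pbS sub a by (auto simp: defects_def)
    have "a \<in> defects A p" using a D by (auto simp: defects_def)
    have s2: "card (insert (p b) (defects A p - {a})) = card (defects A p)"
    proof -
      have "card (insert (p b) (defects A p - {a})) = Suc (card (defects A p - {a}))"
        using \<open>p b \<notin> defects A p\<close> finite_defects[OF A, of p] by simp
      then show ?thesis using card_Suc_Diff1[OF finite_defects[OF A] \<open>a \<in> defects A p\<close>] by simp
    qed
    show ?thesis using card_mono[OF fin s1] s2 by linarith
  qed
  consider "p x = x" "p y \<noteq> y" | "p y = y" "p x \<noteq> x" | "p x \<noteq> x" "p y \<noteq> y" using nf by blast
  then show ?thesis
  proof cases
    case 1 then show ?thesis using swap[of x y] D(5) by simp
  next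
    case 2 then show ?thesis using swap[of y x] D(5) by simp
  next
    case 3
    then have "defects A p \<subseteq> ?S" using sub by (auto simp: defects_def)
    then show ?thesis by (rule card_mono[OF fin])
  qed
qed

text \<open>Induction on the number of defects of a common subpattern F. With three of them the rank
  is 1 and the projection at F, of rank 3, changes nothing; this is the origin of
  \<open>max q 3\<close>. With five or more a distinguishing contraction is applied: if both ranks
  survive, F has gained an arc, and if one drops, the ranks are already separated.\<close>

lemma separation:
  assumes A: "fin_lin A" and B: "fin_lin B" and odd: "odd (card (Field A))"
  shows "diagram A B \<alpha> ==> diagram A B \<beta> ==> rank \<alpha> = q ==> rank \<beta> = q ==> upf \<alpha> \<noteq> upf \<beta> ==>
    pat A F ==> arcs_le F (upf \<alpha>) ==> arcs_le F (upf \<beta>) ==>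
    \<exists>\<gamma>\<in>brauer_hom A A. ncr A A \<gamma> \<and> rank \<gamma> \<le> max q 3 \<and> upf (\<gamma> \<cdot> \<alpha>) \<noteq> upf (\<gamma> \<cdot> \<beta>) \<and>
      (3 \<le> q --> rank (\<gamma> \<cdot> \<alpha>) \<noteq> rank (\<gamma> \<cdot> \<beta>) \<and>
        max (rank (\<gamma> \<cdot> \<alpha>)) (rank (\<gamma> \<cdot> \<beta>)) = q)"
proof (induction "card (defects A F)" arbitrary: F \<alpha> \<beta> rule: less_induct)
  case less
  let ?p = "upf \<alpha>" and ?p' = "upf \<beta>"
  note \<alpha> = diagramD[OF less.prems(1)] and \<beta> = diagramD[OF less.prems(2)] and F = less.prems(6)
  note p = pat_upf_diagram[OF less.prems(1) A B] and p' = pat_upf_diagram[OF less.prems(2) A B]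
  note fin = fin_linD(1)[OF A] fin_linD(1)[OF A] fin_linD(1)[OF B]
  have rk: "card (defects A ?p) = q" "card (defects A ?p') = q"
    using less.prems(3,4) rank_defects[OF \<alpha>] rank_defects[OF \<beta>] by simp_all
  have q: "q < card (defects A F)"
  proof (rule ccontr)
    assume "\<not> q < card (defects A F)"
    then have "?p = F" "?p' = F"
      using arcs_le_defects_eq[OF A F p less.prems(7)] arcs_le_defects_eq[OF A F p' less.prems(8)] rk by simp_all
    then show False using less.prems(5) by simp
  qed
  have oF: "odd (card (defects A F))" by (rule odd_defects[OF A odd F])
  have oq: "odd q" using odd_defects[OF A odd p] rk by simp
  obtain h where h: "card (defects A F) = 2 * h + 1" using oF by (rule oddE)
  obtain g where g: "q = 2 * g + 1" using oq by (rule oddE)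
  show ?case
  proof (cases "5 \<le> card (defects A F)")
    case False
    then have n: "card (defects A F) = 3" "q = 1" using h g q by simp_all
    have e: "proj A F \<cdot> \<alpha> = \<alpha>" "proj A F \<cdot> \<beta> = \<beta>"
      using proj_mult[OF A F \<alpha>] proj_mult[OF A F \<beta>] less.prems(7,8) by (simp_all add: arcs_le_def)
    show ?thesis
      by (rule bexI[OF _ proj_hom[OF A F]]) (use n e less.prems(5) in \<open>simp add: ncr_proj[OF A F] rank_proj[OF A F]\<close>)
  next
    case True
    have cc: "card (defects A ?p) = card (defects A ?p')" using rk by simp
    obtain x y where xy: "consec A F x y" "\<not> (?p x = x \<and> ?p y = y \<and> ?p' x = x \<and> ?p' y = y)"
      "\<not> same_con A F ?p ?p' x y"
      by (rule ex_distinguishing_contraction[OF A F p less.prems(7) p' less.prems(8) cc True less.prems(5)])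
    let ?G = "add_arc F x y"
    let ?e = "proj A ?G"
    let ?\<alpha> = "?e \<cdot> \<alpha>" and ?\<beta> = "?e \<cdot> \<beta>"
    note D = consecD[OF xy(1)]
    note G = pat_add_arc[OF A F xy(1)]
    note e = proj_hom[OF A G]
    note hk\<alpha> = hook[OF A F xy(1) \<alpha> less.prems(7) p] and hk\<beta> = hook[OF A F xy(1) \<beta> less.prems(8) p']
    note d\<alpha> = diagram_mult[OF diagram_proj[OF A G] less.prems(1) A A B]
    note d\<beta> = diagram_mult[OF diagram_proj[OF A G] less.prems(2) A A B]
    note m\<alpha> = diagramD[OF d\<alpha>] and m\<beta> = diagramD[OF d\<beta>]
    have ne: "upf ?\<alpha> \<noteq> upf ?\<beta>"
    proof -
      obtain z where "z \<in> defects A F - {x, y}" "con x y ?p z \<noteq> con x y ?p' z"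
        using xy(3) unfolding same_con_def by blast
      then show ?thesis using hk\<alpha>(2)[of z] hk\<beta>(2)[of z] by auto
    qed
    have le: "rank ?\<alpha> \<le> q" "rank ?\<beta> \<le> q"
      using rank_mult_right[OF e \<alpha> fin] rank_mult_right[OF e \<beta> fin] less.prems(3,4) by simp_all
    have full: "rank (?e \<cdot> w) = q"
      if w: "w \<in> brauer_hom A B" "pat A (upf w)" "arcs_le F (upf w)" "card (defects A (upf w)) = q"
        "\<not> (upf w x = x \<and> upf w y = y)" "rank (?e \<cdot> w) \<le> q" for w
    proof -
      have "{z \<in> defects A F - {x, y}. con x y (upf w) z = z} \<subseteq> defects A (upf (?e \<cdot> w))"
        using hook(2)[OF A F xy(1) w(1,3,2)] by (auto simp: defects_def)
      from card_mono[OF finite_defects[OF A] this]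
      have "q \<le> card (defects A (upf (?e \<cdot> w)))"
        using card_defects_con[OF A F w(2,3) xy(1) w(5)] w(4) by linarith
      then show ?thesis using w(6) rank_defects[OF mult_hom[OF e w(1) fin(1)]] by simp
    qed
    have some: "rank ?\<alpha> = q \<or> rank ?\<beta> = q"
      using full[OF \<alpha> p less.prems(7) rk(1) _ le(1)] full[OF \<beta> p' less.prems(8) rk(2) _ le(2)] xy(2) by blast
    have assoc: "\<gamma> \<cdot> ?e \<cdot> w = \<gamma> \<cdot> (?e \<cdot> w)"
      if "\<gamma> \<in> brauer_hom A A" "w \<in> brauer_hom A B" for \<gamma> w
      by (rule mult_assoc[OF that(1) e that(2) fin(1,1)])
    have lift: ?thesis
      if \<gamma>: "\<gamma> \<in> brauer_hom A A" "ncr A A \<gamma>" "rank \<gamma> \<le> max q 3" "upf (\<gamma> \<cdot> ?\<alpha>) \<noteq> upf (\<gamma> \<cdot> ?\<beta>)"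
        "3 \<le> q --> rank (\<gamma> \<cdot> ?\<alpha>) \<noteq> rank (\<gamma> \<cdot> ?\<beta>) \<and>
          max (rank (\<gamma> \<cdot> ?\<alpha>)) (rank (\<gamma> \<cdot> ?\<beta>)) = q" for \<gamma>
    proof (rule bexI[OF _ mult_hom[OF \<gamma>(1) e fin(1)]])
      have "rank (\<gamma> \<cdot> ?e) \<le> max q 3" using rank_mult_left[OF \<gamma>(1) e fin(1,1,1)] \<gamma>(3) by simp
      then show "ncr A A (\<gamma> \<cdot> ?e) \<and> rank (\<gamma> \<cdot> ?e) \<le> max q 3 \<and>
          upf (\<gamma> \<cdot> ?e \<cdot> \<alpha>) \<noteq> upf (\<gamma> \<cdot> ?e \<cdot> \<beta>) \<and>
          (3 \<le> q --> rank (\<gamma> \<cdot> ?e \<cdot> \<alpha>) \<noteq> rank (\<gamma> \<cdot> ?e \<cdot> \<beta>) \<and>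
            max (rank (\<gamma> \<cdot> ?e \<cdot> \<alpha>)) (rank (\<gamma> \<cdot> ?e \<cdot> \<beta>)) = q)"
        unfolding assoc[OF \<gamma>(1) \<alpha>] assoc[OF \<gamma>(1) \<beta>]
        using \<gamma> ncr_mult_signs(1)[OF \<gamma>(1) e A A A \<gamma>(2) ncr_proj[OF A G]] by blast
    qed
    \<comment> \<open>The projection used so far may have rank above q. Composing with the
      projection at the surviving pattern brings the rank of the multiplier down to q without
      changing w.\<close>
    have half: ?thesis if d: "diagram A B w" "diagram A B \<epsilon>" "rank w = q" "rank \<epsilon> < q"
      and eq: "{w, \<epsilon>} = {?\<alpha>, ?\<beta>}" for w \<epsilon>
    proof -
      note pd = pat_upf_diagram[OF d(1) A B] and hd = diagramD[OF d(1)] and he = diagramD[OF d(2)]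
      let ?\<gamma> = "proj A (upf w)"
      have 1: "?\<gamma> \<cdot> w = w" by (rule proj_mult[OF A pd hd]) simp
      have 2: "rank (?\<gamma> \<cdot> \<epsilon>) < q" using rank_mult_right[OF proj_hom[OF A pd] he fin] d(4) by simp
      have r: "rank ?\<gamma> = q" using rank_proj[OF A pd] rank_defects[OF hd] d(3) by simp
      have u: "upf (?\<gamma> \<cdot> w) \<noteq> upf (?\<gamma> \<cdot> \<epsilon>)"
        using 1 2 d(3) rank_defects[OF hd] rank_defects[OF mult_hom[OF proj_hom[OF A pd] he fin(1)]] by auto
      show ?thesis
        using eq 1 2 r u d(3) by (intro lift[OF proj_hom[OF A pd] ncr_proj[OF A pd]]) (auto simp: doubleton_eq_iff)
    qed
    consider "rank ?\<alpha> = q" "rank ?\<beta> = q" | "rank ?\<alpha> = q" "rank ?\<beta> < q" | "rank ?\<beta> = q" "rank ?\<alpha> < q"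
      using some le by linarith
    then show ?thesis
    proof cases
      case 1
      have "card (defects A ?G) < card (defects A F)" using card_add_arc[OF A xy(1)] by simp
      from less.hyps[OF this d\<alpha> d\<beta> 1 ne G hk\<alpha>(1) hk\<beta>(1)] show ?thesis using lift by blast
    next
      case 2 then show ?thesis using half[OF d\<alpha> d\<beta>] by simp
    next
      case 3 then show ?thesis using half[OF d\<beta> d\<alpha>] by (simp add: insert_commute)
    qed
  qed
qed

section \<open>Congruences on the ideals\<close>

lemma consec_nth:
  assumes ds: "set ds = defects A F"
      "\<And>i j. i < j ==> j < length ds ==> pos A (ds ! i) < pos A (ds ! j)"
    and c: "consec A F x y"
  obtains i where "Suc i < length ds" "x = ds ! i" "y = ds ! Suc i"
proof -
  have "x \<in> set ds" "y \<in> set ds" using ds(1) c by (auto simp: consec_def)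
  then obtain i j where ij: "i < length ds" "j < length ds" "x = ds ! i" "y = ds ! j" by (metis in_set_conv_nth)
  have "i < j" using ds(2)[of j i] consecD(6)[OF c] ij by (metis linorder_neqE_nat not_less_iff_gr_or_eq)
  moreover have "\<not> Suc i < j"
    using consecD(7)[OF c, of "ds ! Suc i"] ds(1) ds(2)[of i "Suc i"] ds(2)[of "Suc i" j] ij by fastforce
  ultimately have "j = Suc i" by simp
  then show thesis using that ij by simp
qed

text \<open>Three defects have only two pairs of neighbours that could be joined next.\<close>

lemma two_completions:
  assumes A: "fin_lin A" and u: "pat A u" "card (defects A u) = 3"
  obtains v w where "\<And>x. pat A x ==> card (defects A x) = 1 ==> arcs_le u x ==> x = v \<or> x = w"
proof -
  obtain ds where ds: "set ds = defects A u" "length ds = card (defects A u)"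
      "\<And>i j. i < j ==> j < length ds ==> pos A (ds ! i) < pos A (ds ! j)"
    using defect_list[OF A, of u] by metis
  show thesis
  proof (rule that)
    fix x assume x: "pat A x" "card (defects A x) = 1" "arcs_le u x"
    then have "x \<noteq> u" using u by auto
    then obtain a b where ab: "consec A u a b" "x a = b" using ex_consec_arc[OF A u(1) x(1,3)] by blast
    obtain i where i: "Suc i < length ds" "a = ds ! i" "b = ds ! Suc i" by (rule consec_nth[OF ds(1,3) ab(1)])
    have "arcs_le (add_arc u a b) x" using add_arc_le[OF x(1,3) ab(2)] consecD(5)[OF ab(1)] by simp
    then have "x = add_arc u a b"
      using arcs_le_defects_eq[OF A pat_add_arc[OF A u(1) ab(1)] x(1)] card_add_arc[OF A ab(1)] u(2) x(2) by simp
    moreover have "i = 0 \<or> i = 1" using i ds(2) u(2) by linarith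
    ultimately show "x = add_arc u (ds ! 0) (ds ! 1) \<or> x = add_arc u (ds ! 1) (ds ! 2)"
      using i by (auto simp: numeral_2_eq_2)
  qed
qed

lemma congruenceI:
  assumes "equiv (arr S) \<sigma>" "\<And>x y. (x, y) \<in> \<sigma> ==> parallel S x y"
    and "\<And>x y s. (x, y) \<in> \<sigma> ==> s \<in> arr S ==> rn S s = dm S x ==> (mul S s x, mul S s y) \<in> \<sigma>"
    and "\<And>x y s. (x, y) \<in> \<sigma> ==> s \<in> arr S ==> rn S x = dm S s ==> (mul S x s, mul S y s) \<in> \<sigma>"
  shows "congruence S \<sigma>"
  unfolding congruence_def using assms by auto

section \<open>The two categories treated together\<close>

locale tl =
  fixes C :: "'a rel set" and pm :: bool and Q :: "('a rel, 'a brauer) psemigroup"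
  assumes C_ne: "C \<noteq> {}" and C_lin: "A \<in> C ==> fin_lin A" and C_odd: "A \<in> C ==> odd (card (Field A))"
    and Q_def: "Q = (if pm then TLpm C else TL C)"
begin

definition ar :: "'a rel => 'a rel => 'a brauer => bool" where
  "ar A B x \<longleftrightarrow> A \<in> C \<and> B \<in> C \<and> x \<in> brauer_hom A B \<and> (ncr A B x \<or> pm \<and> ncr (A\<inverse>) B x)"

lemma Q_sel [simp]: "dm Q = src" "rn Q = trg" "mul Q = brauer_mult"
  by (auto simp: Q_def TL_def TLpm_def)

lemma arD:
  assumes "ar A B x"
  shows "A \<in> C" "B \<in> C" "x \<in> brauer_hom A B" "diagram A B x" "fin_lin A" "fin_lin B" "finite (Field A)"
    "finite (Field B)" "src x = A" "trg x = B" "pat A (upf x)"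
proof -
  show AB: "A \<in> C" "B \<in> C" "x \<in> brauer_hom A B" using assms by (simp_all add: ar_def)
  show d: "diagram A B x" using assms by (auto simp: ar_def diagram_def)
  show l: "fin_lin A" "fin_lin B" using C_lin AB by simp_all
  show "finite (Field A)" "finite (Field B)" by (fact fin_linD(1)[OF l(1)] fin_linD(1)[OF l(2)])+
  show "src x = A" "trg x = B" by (fact brauer_hom_sel[OF AB(3)])+
  show "pat A (upf x)" by (rule pat_upf_diagram[OF d l])
qed

lemma in_arr: "x \<in> arr Q \<longleftrightarrow> (\<exists>A B. ar A B x)"
proof -
  have "x \<in> brauer_hom A B \<and> (planar x \<or> pm \<and> anti_planar x) \<longleftrightarrow> ar A B x" if "A \<in> C" "B \<in> C" for A B
    using planar_iff_ncr[of x A B] anti_planar_iff_ncr[of x A B] C_lin that by (auto simp: ar_def)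
  moreover have "x \<in> arr Q \<longleftrightarrow> (\<exists>A\<in>C. \<exists>B\<in>C. x \<in> brauer_hom A B \<and> (planar x \<or> pm \<and> anti_planar x))"
    by (auto simp: Q_def TL_def TLpm_def)
  ultimately show ?thesis by (metis ar_def)
qed

lemma ar_mult:
  assumes a: "ar A B x" and b: "ar B D y"
  shows "ar A D (x \<cdot> y)"
proof -
  note m = ncr_mult_signs[OF arD(3)[OF a] arD(3)[OF b] arD(5)[OF a] arD(6)[OF a] arD(6)[OF b]]
  show ?thesis
    using a b m mult_hom[OF arD(3)[OF a] arD(3)[OF b] arD(8)[OF a]] unfolding ar_def by blast
qed

lemma ar_star:
  assumes a: "ar A B x"
  shows "ar B A (star x)"
  using a ncr_star[OF arD(3,5,6)[OF a]] ncr_star_signs[OF arD(3,5,6)[OF a]] star_hom[OF arD(3)[OF a]]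
  unfolding ar_def by blast

lemma pat_dnf: "ar A B x ==> pat B (dnf x)"
  using arD(11)[OF ar_star] by (simp add: dnf_def)

lemma ar_planar: "A \<in> C ==> B \<in> C ==> x \<in> brauer_hom A B ==> ncr A B x ==> ar A B x"
  by (simp add: ar_def)

lemma ar_proj: "A \<in> C ==> pat A p ==> ar A A (proj A p)"
  using proj_hom[OF C_lin] ncr_proj[OF C_lin] by (simp add: ar_planar)

lemma ex_ar:
  assumes "A \<in> C" "B \<in> C" "pat A p" "pat B q" "card (defects A p) = card (defects B q)"
  obtains x where "ar A B x" "ncr A B x" "upf x = p" "dnf x = q" "rank x = card (defects A p)"
proof -
  obtain x where a: "x \<in> brauer_hom A B" "ncr A B x" "upf x = p" "dnf x = q"
    using ex_ncr[OF C_lin[OF assms(1)] refl C_lin[OF assms(2)] assms(3-5)] by blast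
  show thesis
    by (rule that[OF ar_planar[OF assms(1,2) a(1,2)] a(2-4)]) (use rank_defects[OF a(1)] a(3) in simp)
qed

lemma rank_up: "ar A B x ==> rank x = card (defects A (upf x))"
  using rank_defects arD(3) by metis

lemma rank_dn: "ar A B x ==> rank x = card (defects B (dnf x))"
  using rank_defects_dnf arD(3) by metis

lemma rank_odd: "ar A B x ==> odd (rank x)"
  using rank_up odd_defects[OF arD(5) C_odd[OF arD(1)] arD(11)] by metis

lemma rank_ge1: "ar A B x ==> 1 \<le> rank x"
  using rank_odd[of A B x] by (cases "rank x") auto

lemma assoc:
  "ar A B x ==> ar B D y ==> ar D E z ==>
    x \<cdot> y \<cdot> z = x \<cdot> (y \<cdot> z)"
  using mult_assoc[OF arD(3) arD(3) arD(3) arD(8) arD(8)] .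

lemma star_mult: "ar A B x ==> ar B D y ==> star (x \<cdot> y) = star y \<cdot> star x"
  using mult_star[OF arD(3) arD(3) arD(8)] .

lemma ar_star_star: "ar A B x ==> star (star x) = x"
  using star_star arD(3) by metis

lemma up_star: "ar A B x ==> upf (star x) = dnf x" "ar A B x ==> dnf (star x) = upf x"
  using upf_star dnf_star arD(3) by metis+

lemma ar_rank_star: "ar A B x ==> rank (star x) = rank x"
  using rank_star arD(3) by metis

lemma rank_left: "ar A B x ==> ar B D y ==> rank (x \<cdot> y) \<le> rank x"
  using rank_mult_left[OF arD(3) arD(3) arD(7) arD(8) arD(8)] .

lemma rank_right: "ar A B x ==> ar B D y ==> rank (x \<cdot> y) \<le> rank y"
  using rank_mult_right[OF arD(3) arD(3) arD(7) arD(8) arD(8)] .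

lemma up_le: "ar A B x ==> ar B D y ==> arcs_le (upf x) (upf (x \<cdot> y))"
  using upf_mult[OF arD(3) arD(3) arD(8)] by (auto simp: arcs_le_def)

lemma dn_le: "ar A B x ==> ar B D y ==> arcs_le (dnf y) (dnf (x \<cdot> y))"
  using dnf_mult[OF arD(3) arD(3) arD(8)] by (auto simp: arcs_le_def)

lemma up_eq: "ar A B x ==> ar B D y ==> rank (x \<cdot> y) = rank x ==> upf (x \<cdot> y) = upf x"
  using upf_mult_eq[OF arD(3) arD(3) arD(7) arD(8) arD(8)] .

lemma dn_eq: "ar A B x ==> ar B D y ==> rank (x \<cdot> y) = rank y ==> dnf (x \<cdot> y) = dnf y"
  using dnf_mult_eq[OF arD(3) arD(3) arD(7) arD(8) arD(8)] .

lemma mult_star_self: "ar A B x ==> x \<cdot> star x = proj A (upf x)"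
  using brauer_mult_star_self[OF arD(5,6,3,11)] .

lemma star_mult_self: "ar A B x ==> star x \<cdot> x = proj B (dnf x)"
  using mult_star_self[OF ar_star, of A B x] ar_star_star[of A B x] by (simp add: dnf_def)

lemma proj_left: "ar A B y ==> pat A p ==> arcs_le p (upf y) ==> proj A p \<cdot> y = y"
  by (rule proj_mult[OF arD(5)]) (auto dest: arD arcs_leD)

lemma proj_right: "ar A B y ==> pat B p ==> arcs_le p (dnf y) ==> y \<cdot> proj B p = y"
  by (rule mult_proj[OF arD(6)]) (auto dest: arD arcs_leD)

lemma proj_sel:
  assumes "A \<in> C" "pat A p"
  shows "upf (proj A p) = p" "dnf (proj A p) = p" "rank (proj A p) = card (defects A p)" "star (proj A p) = proj A p"
  using upf_proj dnf_proj rank_proj star_proj C_lin assms by blast+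

text \<open>Multiplying by \<open>star y\<close> undoes y, because the projection at the common
  pattern acts trivially on x. So no rank is lost.\<close>

lemma match:
  assumes a: "ar A B x" and b: "ar B D y" and e: "dnf x = upf y"
  shows "rank (x \<cdot> y) = rank x" "upf (x \<cdot> y) = upf x" "dnf (x \<cdot> y) = dnf y"
proof -
  note m = ar_mult[OF a b]
  have "x \<cdot> y \<cdot> star y = x"
    unfolding assoc[OF a b ar_star[OF b]] mult_star_self[OF b] using proj_right[OF a arD(11)[OF b]] arcs_le_refl[of "upf y"] by (simp add: e)
  then have "rank x \<le> rank (x \<cdot> y)" using rank_left[OF m ar_star[OF b]] by simp
  then show r: "rank (x \<cdot> y) = rank x" using rank_left[OF a b] by simp
  show "upf (x \<cdot> y) = upf x" by (rule up_eq[OF a b r])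
  have "rank x = rank y" using rank_dn[OF a] rank_up[OF b] e by simp
  then show "dnf (x \<cdot> y) = dnf y" using dn_eq[OF a b] r by simp
qed

lemma planar_eq:
  assumes "ar A B x" "ar A B y" "ncr A B x" "ncr A B y" "upf x = upf y" "dnf x = dnf y"
  shows "x = y"
  using ncr_unique[OF arD(3)[OF assms(1)] arD(3)[OF assms(2)] arD(5)[OF assms(1)] refl arD(6)[OF assms(1)]] assms by blast

text \<open>The patterns determine a planar partition and likewise an anti-planar one, and among
  three partitions two have the same sign.\<close>

lemma H_class_card:
  assumes "ar A B x" "ar A B y" "ar A B z" "upf x = upf y" "dnf x = dnf y" "upf y = upf z" "dnf y = dnf z"
  shows "x = y \<or> y = z \<or> x = z"
proof -
  have A': "fin_lin (A\<inverse>)" using arD(5)[OF assms(1)] by (simp add: fin_lin_converse)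
  have anti: "w = e" if "ar A B w" "ar A B e" "ncr (A\<inverse>) B w" "ncr (A\<inverse>) B e" "upf w = upf e" "dnf w = dnf e" for w e
    by (rule ncr_unique[OF arD(3)[OF that(1)] arD(3)[OF that(2)] A' _ arD(6)[OF that(1)]]) (use that in auto)
  have s: "ncr A B w \<or> ncr (A\<inverse>) B w" if "ar A B w" for w using that by (auto simp: ar_def)
  show ?thesis
    using s[OF assms(1)] s[OF assms(2)] s[OF assms(3)] planar_eq[OF assms(1,2)] planar_eq[OF assms(2,3)]
      planar_eq[OF assms(1,3)] anti[OF assms(1,2)] anti[OF assms(2,3)] anti[OF assms(1,3)] assms(4-7) by metis
qed

lemma rank1_eq:
  assumes "ar A B x" "ar A B y" "rank x = 1" "upf x = upf y" "dnf x = dnf y"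
  shows "x = y"
  using rank_1_unique[OF arD(3)[OF assms(1)] arD(3)[OF assms(2)]] assms by blast

text \<open>Ranks are odd, so a product involving rank 1 cannot fall below 1.\<close>

lemma rank1_mult:
  assumes "ar A B x" "ar B D y"
  shows "rank x = 1 ==> rank (x \<cdot> y) = 1 \<and> upf (x \<cdot> y) = upf x"
    and "rank y = 1 ==> rank (x \<cdot> y) = 1 \<and> dnf (x \<cdot> y) = dnf y"
proof -
  have ge: "1 \<le> rank (x \<cdot> y)" by (rule rank_ge1[OF ar_mult[OF assms]])
  show "rank x = 1 ==> rank (x \<cdot> y) = 1 \<and> upf (x \<cdot> y) = upf x"
    using ge rank_left[OF assms] up_eq[OF assms] by simp
  show "rank y = 1 ==> rank (x \<cdot> y) = 1 \<and> dnf (x \<cdot> y) = dnf y"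
    using ge rank_right[OF assms] dn_eq[OF assms] by simp
qed

lemma ar_unique_objs: "ar A B x ==> ar A' B' x ==> A = A' \<and> B = B'"
  using arD(9,10) by metis

text \<open>With r infinite this is the whole category, so finite and infinite r are treated
  uniformly.\<close>

definition ideal :: "enat => ('a rel, 'a brauer) psemigroup" where
  "ideal r = sub_psg Q (rank_ideal Q r)"

lemma ideal_sel [simp]: "dm (ideal r) = src" "rn (ideal r) = trg" "mul (ideal r) = brauer_mult"
  by (simp_all add: ideal_def sub_psg_def)

lemma in_ideal: "x \<in> arr (ideal r) \<longleftrightarrow> (\<exists>A B. ar A B x) \<and> enat (rank x) \<le> r"
  by (simp add: ideal_def sub_psg_def rank_ideal_def in_arr)

end

section \<open>Consequences of a single related pair\<close>

locale tl_cong = tl +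
  fixes r :: enat and \<sigma> :: "'a brauer rel"
  assumes cong: "congruence (ideal r) \<sigma>"
begin

lemma refl: "ar A B x ==> enat (rank x) \<le> r ==> (x, x) \<in> \<sigma>"
  using cong in_ideal by (auto simp: congruence_def dest: equiv_memD(1))

lemma sym: "(x, y) \<in> \<sigma> ==> (y, x) \<in> \<sigma>"
  using cong by (auto simp: congruence_def dest: equiv_memD(2))

lemma trans: "(x, y) \<in> \<sigma> ==> (y, z) \<in> \<sigma> ==> (x, z) \<in> \<sigma>"
proof -
  have "equiv (arr (ideal r)) \<sigma>" using cong by (simp add: congruence_def)
  then show "(x, y) \<in> \<sigma> ==> (y, z) \<in> \<sigma> ==> (x, z) \<in> \<sigma>" by (rule equiv_memD(3))
qed

lemma members:
  assumes "(x, y) \<in> \<sigma>"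
  obtains A B where "ar A B x" "ar A B y" "enat (rank x) \<le> r" "enat (rank y) \<le> r"
proof -
  have "x \<in> arr (ideal r)" "y \<in> arr (ideal r)" using cong assms by (auto simp: congruence_def dest: equiv_memD(4,5))
  then obtain A B A' B' where ab: "ar A B x" "ar A' B' y" "enat (rank x) \<le> r" "enat (rank y) \<le> r"
    by (auto simp: in_ideal)
  have "parallel (ideal r) x y" using cong assms by (auto simp: congruence_def)
  then have "A = A'" "B = B'" using arD(9,10)[OF ab(1)] arD(9,10)[OF ab(2)] by (auto simp: parallel_def)
  then show thesis using that ab by simp
qed

lemma member:
  assumes "(x, y) \<in> \<sigma>" "ar A B x"
  shows "ar A B y" "enat (rank x) \<le> r" "enat (rank y) \<le> r"
  using members[OF assms(1)] ar_unique_objs[OF assms(2)] by metis+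

lemma left:
  assumes "(x, y) \<in> \<sigma>" "ar A B x" "ar D A z" "enat (rank z) \<le> r"
  shows "(z \<cdot> x, z \<cdot> y) \<in> \<sigma>"
proof -
  have "z \<in> arr (ideal r)" using assms by (auto simp: in_ideal)
  then show ?thesis using cong assms(1) arD(9)[OF assms(2)] arD(10)[OF assms(3)] by (auto simp: congruence_def)
qed

lemma right:
  assumes "(x, y) \<in> \<sigma>" "ar A B x" "ar B D z" "enat (rank z) \<le> r"
  shows "(x \<cdot> z, y \<cdot> z) \<in> \<sigma>"
proof -
  have "z \<in> arr (ideal r)" using assms by (auto simp: in_ideal)
  then show ?thesis using cong assms(1) arD(10)[OF assms(2)] arD(9)[OF assms(3)] by (auto simp: congruence_def)
qed

text \<open>Turning all partitions upside down gives a congruence again, so each statement on upper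
  patterns yields one on lower patterns. Membership is required explicitly since \<open>star\<close>
  is known to be an involution only on proper partitions.\<close>

definition dual :: "'a brauer rel" where
  "dual = {(x, y). (star x, star y) \<in> \<sigma> \<and> x \<in> arr (ideal r) \<and> y \<in> arr (ideal r)}"

lemma dual_iff:
  assumes "ar A B x" "ar A B y"
  shows "(star x, star y) \<in> dual \<longleftrightarrow> (x, y) \<in> \<sigma>"
proof -
  have "(x, y) \<in> \<sigma> ==> star x \<in> arr (ideal r) \<and> star y \<in> arr (ideal r)"
    using member[OF _ assms(1)] ar_star ar_rank_star assms in_ideal by metis
  then show ?thesis using ar_star_star assms by (auto simp: dual_def)
qed

lemma dual_cong: "tl_cong C pm Q r dual"
proof (intro tl_cong.intro tl_cong_axioms.intro)
  show "tl C pm Q" by (rule tl_axioms)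
  have st: "star x \<in> arr (ideal r)" if "x \<in> arr (ideal r)" for x
    using that ar_star ar_rank_star by (metis in_ideal)
  have core: "\<exists>A B. ar A B x \<and> ar A B y \<and> (star x, star y) \<in> \<sigma>" if ab: "(x, y) \<in> dual" for x y
  proof -
    have s: "(star x, star y) \<in> \<sigma>" and m: "x \<in> arr (ideal r)" "y \<in> arr (ideal r)" using ab by (auto simp: dual_def)
    obtain A B where A: "ar A B x" using m by (auto simp: in_ideal)
    have sb: "ar B A (star y)" using member(1)[OF s ar_star[OF A]] .
    obtain A' B' where A': "ar A' B' y" using m by (auto simp: in_ideal)
    have "ar A B y" using ar_star[OF sb] ar_star_star[OF A'] by simp
    then show ?thesis using A s by blast
  qed
  show "congruence (ideal r) dual"
  proof (rule congruenceI)
    show "equiv (arr (ideal r)) dual"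
    proof (rule equivI')
      show "dual \<subseteq> arr (ideal r) \<times> arr (ideal r)" by (auto simp: dual_def)
      show "(x, x) \<in> dual" if "x \<in> arr (ideal r)" for x
        using st[OF that] that refl by (auto simp: dual_def in_ideal)
      show "(y, x) \<in> dual" if "(x, y) \<in> dual" for x y using that sym by (simp add: dual_def)
      show "(x, z) \<in> dual" if "(x, y) \<in> dual" "(y, z) \<in> dual" for x y z
        using that trans[of "star x" "star y" "star z"] by (simp add: dual_def)
    qed
    show "parallel (ideal r) x y" if "(x, y) \<in> dual" for x y
      using core[OF that] arD(9,10) by (auto simp: parallel_def)
  next
    fix x y z assume ab: "(x, y) \<in> dual" and g: "z \<in> arr (ideal r)" and e: "rn (ideal r) z = dm (ideal r) x"
    obtain A B where A: "ar A B x" "ar A B y" "(star x, star y) \<in> \<sigma>" using core[OF ab] by blast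
    obtain D E where g': "ar D E z" "enat (rank z) \<le> r" using g by (auto simp: in_ideal)
    have E: "E = A" using e arD(10)[OF g'(1)] arD(9)[OF A(1)] by simp
    note g1 = g'(1)[unfolded E]
    note 1 = ar_mult[OF g1 A(1)] ar_mult[OF g1 A(2)]
    have "(star x \<cdot> star z, star y \<cdot> star z) \<in> \<sigma>"
      by (rule right[OF A(3) ar_star[OF A(1)] ar_star[OF g1]]) (use ar_rank_star[OF g1] g' in simp)
    then have s: "(star (z \<cdot> x), star (z \<cdot> y)) \<in> \<sigma>"
      using star_mult[OF g1 A(1)] star_mult[OF g1 A(2)] by simp
    then show "(mul (ideal r) z x, mul (ideal r) z y) \<in> dual"
      using 1 member(2,3)[OF s ar_star[OF 1(1)]] ar_rank_star[OF 1(1)] ar_rank_star[OF 1(2)]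
      by (auto simp: dual_def in_ideal)
  next
    fix x y z assume ab: "(x, y) \<in> dual" and g: "z \<in> arr (ideal r)" and e: "rn (ideal r) x = dm (ideal r) z"
    obtain A B where A: "ar A B x" "ar A B y" "(star x, star y) \<in> \<sigma>" using core[OF ab] by blast
    obtain D E where g': "ar D E z" "enat (rank z) \<le> r" using g by (auto simp: in_ideal)
    have D: "D = B" using e arD(9)[OF g'(1)] arD(10)[OF A(1)] by simp
    note g1 = g'(1)[unfolded D]
    note 1 = ar_mult[OF A(1) g1] ar_mult[OF A(2) g1]
    have "(star z \<cdot> star x, star z \<cdot> star y) \<in> \<sigma>"
      by (rule left[OF A(3) ar_star[OF A(1)] ar_star[OF g1]]) (use ar_rank_star[OF g1] g' in simp)
    then have s: "(star (x \<cdot> z), star (y \<cdot> z)) \<in> \<sigma>"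
      using star_mult[OF A(1) g1] star_mult[OF A(2) g1] by simp
    then show "(mul (ideal r) x z, mul (ideal r) y z) \<in> dual"
      using 1 member(2,3)[OF s ar_star[OF 1(1)]] ar_rank_star[OF 1(1)] ar_rank_star[OF 1(2)]
      by (auto simp: dual_def in_ideal)
  qed
qed

text \<open>A separating multiplier \<open>g0\<close> must have rank 3. Exchanging its upper pattern
  for an arbitrary u with three defects still separates, and above u there are at most two patterns
  with one defect, so these are related. \<open>patterns_connected\<close> then links all patterns
  with one defect.\<close>

lemma rank1_left:
  assumes r: "enat 3 \<le> r" and s: "(\<alpha>, \<beta>) \<in> \<sigma>" and a: "ar A B \<alpha>" and r1: "rank \<alpha> = 1" "rank \<beta> = 1"
    and ne: "upf \<alpha> \<noteq> upf \<beta>"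
    and \<alpha>': "ar A' B' \<alpha>'" "rank \<alpha>' = 1" and \<beta>': "ar A' B' \<beta>'" "rank \<beta>' = 1" and dn: "dnf \<alpha>' = dnf \<beta>'"
  shows "(\<alpha>', \<beta>') \<in> \<sigma>"
proof -
  note b = member(1)[OF s a]
  have small: "enat (rank \<delta>) \<le> r" if "rank \<delta> \<le> 3" for \<delta> using that r by (meson enat_ord_simps(1) order_trans)
  let ?id = "\<lambda>a :: 'a. a"
  obtain g0 where g0: "g0 \<in> brauer_hom A A" "ncr A A g0" "rank g0 \<le> 3"
    "upf (g0 \<cdot> \<alpha>) \<noteq> upf (g0 \<cdot> \<beta>)"
    using separation[OF arD(5,6)[OF a] C_odd[OF arD(1)[OF a]] arD(4)[OF a] arD(4)[OF b] r1 ne pat_id] by (auto simp: arcs_le_def)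
  have ag: "ar A A g0" using ar_planar[OF arD(1,1)[OF a] g0(1,2)] by simp
  \<comment> \<open>A multiplier of rank 1 would impose its own upper pattern on both
    products.\<close>
  have "rank g0 \<noteq> 1" using rank1_mult(1)[OF ag a] rank1_mult(1)[OF ag b] g0(4) by auto
  then have rg: "rank g0 = 3" using rank_odd[OF ag] g0(3) by (auto elim!: oddE)
  let ?v = "dnf g0"
  have cv: "card (defects A ?v) = 3" using rank_dn[OF ag] rg by simp
  \<comment> \<open>This factor replaces the lower pattern by the required one and leaves upper
    patterns alone.\<close>
  obtain \<delta> where d: "ar B B' \<delta>" "upf \<delta> = dnf \<alpha>" "dnf \<delta> = dnf \<alpha>'" "rank \<delta> = 1"
    by (rule ex_ar[OF arD(2)[OF a] arD(2)[OF \<alpha>'(1)] pat_dnf[OF a] pat_dnf[OF \<alpha>'(1)]])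
      (use rank_dn[OF a] rank_dn[OF \<alpha>'(1)] r1 \<alpha>'(2) in auto)
  let ?a = "\<alpha> \<cdot> \<delta>" and ?b = "\<beta> \<cdot> \<delta>"
  have s2: "(?a, ?b) \<in> \<sigma>" by (rule right[OF s a d(1)]) (rule small, use d in simp)
  have a2: "ar A B' ?a" "ar A B' ?b" using ar_mult a b d by auto
  define R where "R x y \<longleftrightarrow> (\<exists>\<epsilon> \<zeta>. ar A' B' \<epsilon> \<and> ar A' B' \<zeta> \<and> (\<epsilon>, \<zeta>) \<in> \<sigma> \<and> rank \<epsilon> = 1 \<and> rank \<zeta> = 1 \<and>
     dnf \<epsilon> = dnf \<alpha>' \<and> dnf \<zeta> = dnf \<alpha>' \<and> upf \<epsilon> = x \<and> upf \<zeta> = y)" for x y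
  note A' = arD(5)[OF \<alpha>'(1)]
  have "upf \<alpha>' = upf \<beta>' \<or> R (upf \<alpha>') (upf \<beta>')"
  proof (rule patterns_connected[OF A', where F = ?id])
    show "R y x" if "R x y" for x y using that sym unfolding R_def by blast
    show "R x z" if xyz: "R x y" "R y z" for x y z
    proof -
      obtain \<epsilon> \<zeta> where e: "ar A' B' \<epsilon>" "ar A' B' \<zeta>" "(\<epsilon>, \<zeta>) \<in> \<sigma>" "rank \<epsilon> = 1" "rank \<zeta> = 1"
        "dnf \<epsilon> = dnf \<alpha>'" "dnf \<zeta> = dnf \<alpha>'" "upf \<epsilon> = x" "upf \<zeta> = y" using xyz(1) unfolding R_def by blast
      obtain \<epsilon>' \<zeta>' where f: "ar A' B' \<epsilon>'" "ar A' B' \<zeta>'" "(\<epsilon>', \<zeta>') \<in> \<sigma>" "rank \<epsilon>' = 1" "rank \<zeta>' = 1"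
        "dnf \<epsilon>' = dnf \<alpha>'" "dnf \<zeta>' = dnf \<alpha>'" "upf \<epsilon>' = y" "upf \<zeta>' = z" using xyz(2) unfolding R_def by blast
      have "\<zeta> = \<epsilon>'" by (rule rank1_eq[OF e(2) f(1)]) (use e f in simp_all)
      then have "(\<epsilon>, \<zeta>') \<in> \<sigma>" using e(3) f(3) trans by simp
      then show ?thesis using e f unfolding R_def by blast
    qed
    show "pat A' ?id" by (rule pat_id)
    show "odd (card (defects A' ?id))" by (rule odd_defects[OF A' C_odd[OF arD(1)[OF \<alpha>'(1)]] pat_id])
    show "pat A' (upf \<alpha>')" "pat A' (upf \<beta>')" using arD(11) \<alpha>' \<beta>' by auto
    show "card (defects A' (upf \<alpha>')) = 1" "card (defects A' (upf \<beta>')) = 1" using rank_up \<alpha>' \<beta>' by auto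
    show "arcs_le ?id (upf \<alpha>')" "arcs_le ?id (upf \<beta>')" by (simp_all add: arcs_le_def)
    fix u x y assume u: "pat A' u" "card (defects A' u) = 3" and x: "pat A' x" "card (defects A' x) = 1" "arcs_le u x"
      and y: "pat A' y" "card (defects A' y) = 1" "arcs_le u y" and xy: "x \<noteq> y"
    obtain g where g: "ar A' A g" "ncr A' A g" "upf g = u" "dnf g = ?v" "rank g = 3"
      by (rule ex_ar[OF arD(1)[OF \<alpha>'(1)] arD(1)[OF a] u(1) pat_dnf[OF ag]]) (use u cv in auto)
    let ?x = "g \<cdot> ?a" and ?y = "g \<cdot> ?b"
    have s3: "(?x, ?y) \<in> \<sigma>" by (rule left[OF s2 a2(1) g(1)]) (rule small, use g in simp)
    have xyar: "ar A' B' ?x" "ar A' B' ?y" using ar_mult g a2 by auto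
    have ra: "rank ?a = 1" "rank ?b = 1" "dnf ?a = dnf \<alpha>'" "dnf ?b = dnf \<alpha>'"
      using rank1_mult(2)[OF a d(1)] rank1_mult(2)[OF b d(1)] d by simp_all
    have rx: "rank ?x = 1" "rank ?y = 1" "dnf ?x = dnf \<alpha>'" "dnf ?y = dnf \<alpha>'"
      using rank1_mult(2)[OF g(1) a2(1)] rank1_mult(2)[OF g(1) a2(2)] ra by simp_all
    \<comment> \<open>Equality would survive multiplication by k, which turns g back into
      \<open>g0\<close>.\<close>
    have nex: "upf ?x \<noteq> upf ?y"
    proof
      assume "upf ?x = upf ?y"
      then have xeq: "?x = ?y" using rank1_eq[OF xyar] rx by simp
      obtain k where k: "ar A A' k" "ncr A A' k" "upf k = upf g0" "dnf k = u"
        by (rule ex_ar[OF arD(1)[OF a] arD(1)[OF \<alpha>'(1)] arD(11)[OF ag] u(1)]) (use u rank_up[OF ag] rg in auto)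
      have "ncr A A (k \<cdot> g)"
        by (rule ncr_mult_signs(1)[OF arD(3)[OF k(1)] arD(3)[OF g(1)] arD(5)[OF a] A' arD(5)[OF a] k(2) g(2)])
      then have kg: "k \<cdot> g = g0"
        using planar_eq[OF ar_mult[OF k(1) g(1)] ag] g0(2) match[OF k(1) g(1)] k g by simp
      have "g0 \<cdot> ?a = g0 \<cdot> ?b"
        using assoc[OF k(1) g(1) a2(1)] assoc[OF k(1) g(1) a2(2)] kg xeq by simp
      then have "g0 \<cdot> \<alpha> \<cdot> \<delta> = g0 \<cdot> \<beta> \<cdot> \<delta>"
        using assoc[OF ag a d(1)] assoc[OF ag b d(1)] by simp
      moreover have "upf (g0 \<cdot> \<alpha> \<cdot> \<delta>) = upf (g0 \<cdot> \<alpha>)"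
        using rank1_mult(1)[OF ar_mult[OF ag a] d(1)] rank1_mult(2)[OF ag a] r1 by simp
      moreover have "upf (g0 \<cdot> \<beta> \<cdot> \<delta>) = upf (g0 \<cdot> \<beta>)"
        using rank1_mult(1)[OF ar_mult[OF ag b] d(1)] rank1_mult(2)[OF ag b] r1 by simp
      ultimately show False using g0(4) by simp
    qed
    obtain v w where vw: "\<And>x. pat A' x ==> card (defects A' x) = 1 ==> arcs_le u x ==> x = v \<or> x = w"
      using two_completions[OF A' u] by metis
    have lex: "arcs_le u (upf ?x)" "arcs_le u (upf ?y)" using up_le[OF g(1) a2(1)] up_le[OF g(1) a2(2)] g by simp_all
    have "upf ?x = v \<or> upf ?x = w" "upf ?y = v \<or> upf ?y = w"
      using vw[OF arD(11)[OF xyar(1)] _ lex(1)] vw[OF arD(11)[OF xyar(2)] _ lex(2)] rank_up[OF xyar(1)] rank_up[OF xyar(2)] rx by simp_all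
    then have "x = upf ?x \<and> y = upf ?y \<or> x = upf ?y \<and> y = upf ?x"
      using vw[OF x] vw[OF y] xy nex by metis
    moreover have "R (upf ?x) (upf ?y)" unfolding R_def using xyar s3 rx by blast
    moreover have "R (upf ?y) (upf ?x)" unfolding R_def using xyar sym[OF s3] rx by blast
    ultimately show "R x y" by auto
  qed
  then show ?thesis
  proof
    assume "upf \<alpha>' = upf \<beta>'"
    then have "\<alpha>' = \<beta>'" using rank1_eq[OF \<alpha>'(1) \<beta>'(1) \<alpha>'(2)] dn by simp
    then show ?thesis using refl[OF \<alpha>'(1)] small[of \<alpha>'] \<alpha>'(2) by simp
  next
    assume "R (upf \<alpha>') (upf \<beta>')"
    then obtain \<epsilon> \<zeta> where e: "ar A' B' \<epsilon>" "ar A' B' \<zeta>" "(\<epsilon>, \<zeta>) \<in> \<sigma>" "rank \<epsilon> = 1" "rank \<zeta> = 1"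
        "dnf \<epsilon> = dnf \<alpha>'" "dnf \<zeta> = dnf \<alpha>'" "upf \<epsilon> = upf \<alpha>'" "upf \<zeta> = upf \<beta>'" unfolding R_def by blast
    have "\<epsilon> = \<alpha>'" by (rule rank1_eq[OF e(1) \<alpha>'(1)]) (use e in simp_all)
    moreover have "\<zeta> = \<beta>'" by (rule rank1_eq[OF e(2) \<beta>'(1)]) (use e dn in simp_all)
    ultimately show ?thesis using e(3) by simp
  qed
qed

end

lemma dnf_eqI:
  assumes "x \<in> brauer_hom A B" "b \<in> Field B" "mate x (Bot b) = Bot c"
  shows "dnf x b = c"
  unfolding dnf_def
  by (rule upf_eqI[OF star_hom[OF assms(1)] assms(2)]) (use mate_star[OF assms(1), of "Top b"] assms(2,3) in simp)

text \<open>The other pair is chosen to avoid one end of xy, which therefore stays open in the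
  second extension.\<close>

lemma other_consec:
  assumes A: "fin_lin A" and c: "consec A p x y" and n: "3 \<le> card (defects A p)"
  obtains x' y' where "consec A p x' y'" "\<not> arcs_le (add_arc p x y) (add_arc p x' y')"
proof -
  obtain ds where ds: "set ds = defects A p" "length ds = card (defects A p)"
      "\<And>i j. i < j ==> j < length ds ==> pos A (ds ! i) < pos A (ds ! j)"
      "\<And>i. Suc i < length ds ==> consec A p (ds ! i) (ds ! Suc i)"
    using defect_list[OF A, of p] by metis
  obtain i where i: "Suc i < length ds" "x = ds ! i" "y = ds ! Suc i" by (rule consec_nth[OF ds(1,3) c])
  note D = consecD[OF c]
  have ne: "ds ! a \<noteq> ds ! b" if "a < b" "b < length ds" for a b using ds(3)[OF that] by auto
  have pxy: "add_arc p x y x = y" "add_arc p x y y = x" using D(5) by (simp_all add: add_arc_def)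
  show thesis
  proof (cases i)
    case 0
    have "x \<noteq> ds ! 1" "x \<noteq> ds ! 2" using ne[of 0 1] ne[of 0 2] 0 i n ds(2) by simp_all
    then have "add_arc p (ds ! 1) (ds ! 2) x = x" using D by (simp add: add_arc_def)
    then have "\<not> arcs_le (add_arc p x y) (add_arc p (ds ! 1) (ds ! 2))"
      using arcs_leD[of "add_arc p x y" "add_arc p (ds ! 1) (ds ! 2)" x] pxy D(5) by auto
    then show thesis using that[of "ds ! 1" "ds ! 2"] ds(4)[of 1] n ds(2) by (simp add: numeral_2_eq_2)
  next
    case (Suc k)
    have "y \<noteq> ds ! 0" "y \<noteq> ds ! 1" using ne[of 0 "Suc i"] ne[of 1 "Suc i"] Suc i by simp_all
    then have "add_arc p (ds ! 0) (ds ! 1) y = y" using D by (simp add: add_arc_def)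
    then have "\<not> arcs_le (add_arc p x y) (add_arc p (ds ! 0) (ds ! 1))"
      using arcs_leD[of "add_arc p x y" "add_arc p (ds ! 0) (ds ! 1)" y] pxy D(5) by auto
    then show thesis using that[of "ds ! 0" "ds ! 1"] ds(4)[of 0] n ds(2) by simp
  qed
qed

context tl
begin

text \<open>On \<open>ideal r\<close> this says that \<sigma> contains the Rees congruence of the
  ideal of rank at most q, once q is at most r.\<close>

definition nab :: "nat => 'a brauer rel => bool" where
  "nab q \<sigma> \<longleftrightarrow> (\<forall>A B z w. ar A B z \<and> ar A B w \<and> rank z \<le> q \<and> rank w \<le> q --> (z, w) \<in> \<sigma>)"

lemma nabD: "nab q \<sigma> ==> ar A B z ==> ar A B w ==> rank z \<le> q ==> rank w \<le> q ==> (z, w) \<in> \<sigma>"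
  unfolding nab_def by blast

end

context tl_cong
begin

lemma rank1_right:
  assumes r: "enat 3 \<le> r" and s: "(x, y) \<in> \<sigma>" and a: "ar A B x" and r1: "rank x = 1" "rank y = 1"
    and ne: "dnf x \<noteq> dnf y"
    and x': "ar A' B' x'" "rank x' = 1" and y': "ar A' B' y'" "rank y' = 1" and up: "upf x' = upf y'"
  shows "(x', y') \<in> \<sigma>"
proof -
  interpret D: tl_cong C pm Q r dual by (rule dual_cong)
  note b = member(1)[OF s a]
  have "(star x, star y) \<in> dual" using dual_iff[OF a b] s by simp
  then have "(star x', star y') \<in> dual"
    by (rule D.rank1_left[OF r _ ar_star[OF a] _ _ _ ar_star[OF x'(1)] _ ar_star[OF y'(1)]])
      (use r1 ne up x' y' ar_rank_star a b up_star in auto)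
  then show ?thesis using dual_iff[OF x'(1) y'(1)] by simp
qed

text \<open>Two parallel elements of rank 1 are joined through the one with the upper pattern of the
  first and the lower pattern of the second.\<close>

lemma nab1:
  assumes r: "enat 3 \<le> r"
    and u: "(x, y) \<in> \<sigma>" "ar A B x" "rank x = 1" "rank y = 1" "upf x \<noteq> upf y"
    and d: "(z, w) \<in> \<sigma>" "ar A' B' z" "rank z = 1" "rank w = 1" "dnf z \<noteq> dnf w"
  shows "nab 1 \<sigma>"
  unfolding nab_def
proof (intro allI impI; elim conjE)
  fix A B \<epsilon> v assume e: "ar A B \<epsilon>" "ar A B v" "rank \<epsilon> \<le> 1" "rank v \<le> 1"
  then have r1: "rank \<epsilon> = 1" "rank v = 1" using rank_ge1 by force+
  obtain \<eta> where h: "ar A B \<eta>" "upf \<eta> = upf \<epsilon>" "dnf \<eta> = dnf v" "rank \<eta> = 1"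
    by (rule ex_ar[OF arD(1,2)[OF e(1)] arD(11)[OF e(1)] pat_dnf[OF e(2)]])
      (use r1 rank_up[OF e(1)] rank_dn[OF e(2)] in auto)
  have "(\<epsilon>, \<eta>) \<in> \<sigma>" by (rule rank1_right[OF r d e(1) r1(1) h(1,4)]) (use h in simp)
  moreover have "(\<eta>, v) \<in> \<sigma>" by (rule rank1_left[OF r u h(1,4) e(2) r1(2)]) (use h in simp)
  ultimately show "(\<epsilon>, v) \<in> \<sigma>" by (rule trans)
qed

text \<open>Multiplication by \<open>star \<alpha>\<close> turns \<alpha> into a projection e;
  sandwiching its companion between copies of e puts it below e. As its rank is smaller, it has an
  arc joining neighbouring defects of the pattern, and the projection with this arc acts trivially
  on it from the left.\<close>

lemma projection_drop:
  assumes s: "(\<alpha>, \<beta>) \<in> \<sigma>" and a: "ar A B \<alpha>" and lt: "rank \<beta> < rank \<alpha>"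
  obtains x y where "consec A (upf \<alpha>) x y" "(proj A (upf \<alpha>), proj A (add_arc (upf \<alpha>) x y)) \<in> \<sigma>"
proof -
  let ?p = "upf \<alpha>"
  let ?e = "proj A ?p"
  note b = member[OF s a] and A = arD(1)[OF a] and p = arD(11)[OF a]
  note e = ar_proj[OF A p] and ps = proj_sel[OF A p]
  have re: "enat (rank ?e) \<le> r" using ps rank_up[OF a] b by simp
  note b1 = ar_mult[OF b(1) ar_star[OF a]]
  have "(\<alpha> \<cdot> star \<alpha>, \<beta> \<cdot> star \<alpha>) \<in> \<sigma>"
    by (rule right[OF s a ar_star[OF a]]) (use ar_rank_star[OF a] b in simp)
  then have s1: "(?e, \<beta> \<cdot> star \<alpha>) \<in> \<sigma>" using mult_star_self[OF a] by simp
  let ?b1 = "\<beta> \<cdot> star \<alpha>"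
  have ee: "?e \<cdot> ?e = ?e" using proj_left[OF e p] ps by simp
  have s2: "(?e, ?b1 \<cdot> ?e) \<in> \<sigma>" using right[OF s1 e e re] ee by simp
  note b2 = ar_mult[OF b1 e]
  let ?b3 = "?e \<cdot> (?b1 \<cdot> ?e)"
  have s3: "(?e, ?b3) \<in> \<sigma>" using left[OF s2 e e re] ee by simp
  note b3 = ar_mult[OF e b2]
  have le: "arcs_le ?p (upf ?b3)" using up_le[OF e b2] ps by simp
  have "rank ?b3 \<le> rank \<beta>"
    using rank_right[OF e b2] rank_left[OF b1 e] rank_left[OF b(1) ar_star[OF a]] by linarith
  then have "upf ?b3 \<noteq> ?p" using rank_up[OF b3] rank_up[OF a] lt by auto
  then obtain x y where xy: "consec A ?p x y" "upf ?b3 x = y"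
    using ex_consec_arc[OF arD(5)[OF a] p arD(11)[OF b3] le] by blast
  let ?q = "add_arc ?p x y"
  note D = consecD[OF xy(1)]
  note q = pat_add_arc[OF arD(5)[OF a] p xy(1)]
  have le': "arcs_le ?q (upf ?b3)" by (rule add_arc_le[OF arD(11)[OF b3] le xy(2) D(5)])
  note e1 = ar_proj[OF A q] and qs = proj_sel[OF A q]
  have "enat (rank (proj A ?q)) \<le> r"
  proof -
    have "rank (proj A ?q) \<le> rank ?e" using qs ps card_add_arc(1)[OF arD(5)[OF a] xy(1)] by simp
    then show ?thesis using re by (meson enat_ord_simps(1) order_trans)
  qed
  then have "(proj A ?q \<cdot> ?e, proj A ?q \<cdot> ?b3) \<in> \<sigma>" using left[OF s3 e e1] by simp
  moreover have "proj A ?q \<cdot> ?e = proj A ?q"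
    using proj_right[OF e1 p] qs arcs_le_add[OF D(3,4)] by simp
  moreover have "proj A ?q \<cdot> ?b3 = ?b3" by (rule proj_left[OF b3 q le'])
  ultimately have "(?e, proj A ?q) \<in> \<sigma>" using s3 sym trans by metis
  then show thesis using that xy by blast
qed

text \<open>One cannot descend below \<open>e\<close> directly, but the two products of \<open>e\<^sub>1\<close> with a different \<open>e\<^sub>2\<close> below
  \<open>e\<close> yield related elements of smaller rank that are not \<open>\<L>\<close>- resp.\ \<open>\<R>\<close>-related.\<close>

lemma projection_pairs:
  assumes A: "A \<in> C" and p: "pat A p" and n: "3 \<le> card (defects A p)" and xy: "consec A p x y"
    and s: "(proj A p, proj A (add_arc p x y)) \<in> \<sigma>"
  obtains u v h where "ar A A u" "rank u = card (defects A p) - 2" "(u, v) \<in> \<sigma>" "rank v \<le> rank u" "dnf u \<noteq> dnf v"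
    "(u, h) \<in> \<sigma>" "rank h \<le> rank u" "upf u \<noteq> upf h"
proof -
  note L = C_lin[OF A]
  obtain x' y' where xy': "consec A p x' y'" "\<not> arcs_le (add_arc p x y) (add_arc p x' y')"
    by (rule other_consec[OF L xy n])
  let ?q = "add_arc p x y" and ?q' = "add_arc p x' y'"
  let ?e = "proj A p" and ?e1 = "proj A ?q" and ?e2 = "proj A ?q'"
  note q = pat_add_arc[OF L p xy] and q' = pat_add_arc[OF L p xy'(1)]
  note e = ar_proj[OF A p] and e1 = ar_proj[OF A q] and e2 = ar_proj[OF A q']
  note es = proj_sel[OF A p] and e1s = proj_sel[OF A q] and e2s = proj_sel[OF A q']
  have le: "arcs_le p ?q'" using arcs_le_add consecD(3,4)[OF xy'(1)] by metis
  have r2: "rank ?e2 = card (defects A p) - 2" using e2s card_add_arc(1)[OF L xy'(1)] by simp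
  have "rank ?e2 \<le> rank ?e" using r2 es by simp
  then have small: "enat (rank ?e2) \<le> r" using member(2)[OF s e] by (meson enat_ord_simps(1) order_trans)
  have i1: "?e2 \<cdot> ?e = ?e2" "?e \<cdot> ?e2 = ?e2"
    using proj_right[OF e2 p] proj_left[OF e2 p] e2s le by simp_all
  have s1: "(?e2, ?e2 \<cdot> ?e1) \<in> \<sigma>" using left[OF s e e2 small] i1 by simp
  have s2: "(?e2, ?e1 \<cdot> ?e2) \<in> \<sigma>" using right[OF s e e2 small] i1 by simp
  have "dnf ?e2 \<noteq> dnf (?e2 \<cdot> ?e1)" using dn_le[OF e2 e1] e1s e2s xy'(2) by auto
  moreover have "upf ?e2 \<noteq> upf (?e1 \<cdot> ?e2)" using up_le[OF e1 e2] e1s e2s xy'(2) by auto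
  ultimately show thesis using that[OF e2 r2 s1 _ _ s2] rank_left[OF e2 e1] rank_right[OF e1 e2] by simp
qed

text \<open>Every z of rank q factors as \<open>z \<cdot> star k \<cdot> k\<close> with k starting
  at the pattern p, and replacing k, which is \<open>e \<cdot> k\<close>, by
  \<open>e1 \<cdot> k\<close> moves z to an element of lower rank, where everything is
  related.\<close>

lemma nab_step:
  assumes A: "A \<in> C" and p: "pat A p" and q: "card (defects A p) = q" "3 \<le> q" and xy: "consec A p x y"
    and s: "(proj A p, proj A (add_arc p x y)) \<in> \<sigma>" and n: "nab (q - 2) \<sigma>"
  shows "nab q \<sigma>"
proof -
  note L = C_lin[OF A]
  let ?e = "proj A p" and ?e1 = "proj A (add_arc p x y)"
  note p1 = pat_add_arc[OF L p xy]
  note e = ar_proj[OF A p] and e1 = ar_proj[OF A p1]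
  note es = proj_sel[OF A p] and e1s = proj_sel[OF A p1]
  have r1: "rank ?e1 = q - 2" using e1s card_add_arc(1)[OF L xy] q by simp
  have oq: "odd q" using rank_odd[OF e] es q by simp
  have small: "enat q \<le> r" using member(2)[OF s e] es q by simp
  have red: "\<exists>z'. (z, z') \<in> \<sigma> \<and> rank z' \<le> q - 2" if g: "ar A' B' z" "rank z \<le> q" for A' B' z
  proof (cases "rank z = q")
    case False
    have og: "odd (rank z)" by (rule rank_odd[OF g(1)])
    then have "rank z \<noteq> q - 1" using oq by (cases q) auto
    then have "rank z \<le> q - 2" using False g(2) by linarith
    moreover have "enat (rank z) \<le> r" using g(2) small by (meson enat_ord_simps(1) order_trans)
    ultimately show ?thesis using refl[OF g(1)] by blast
  next
    case True
    obtain k where k: "ar A B' k" "upf k = p" "dnf k = dnf z" "rank k = q"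
      by (rule ex_ar[OF A arD(2)[OF g(1)] p pat_dnf[OF g(1)]]) (use q True rank_dn[OF g(1)] in auto)
    note sk = ar_star[OF k(1)]
    have gk: "ar A' A (z \<cdot> star k)" by (rule ar_mult[OF g(1) sk])
    have "(?e \<cdot> k, ?e1 \<cdot> k) \<in> \<sigma>" by (rule right[OF s e k(1)]) (use k small in simp)
    then have 1: "(k, ?e1 \<cdot> k) \<in> \<sigma>" using proj_left[OF k(1) p] k(2) by simp
    have rgk: "enat (rank (z \<cdot> star k)) \<le> r"
      using rank_left[OF g(1) sk] True small by (metis enat_ord_simps(1) order_trans)
    have 2: "(z \<cdot> star k \<cdot> k, z \<cdot> star k \<cdot> (?e1 \<cdot> k)) \<in> \<sigma>"
      by (rule left[OF 1 k(1) gk rgk])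
    have "z \<cdot> star k \<cdot> k = z"
      using assoc[OF g(1) sk k(1)] star_mult_self[OF k(1)] proj_right[OF g(1) pat_dnf[OF g(1)]] k(3) by simp
    moreover have "rank (z \<cdot> star k \<cdot> (?e1 \<cdot> k)) \<le> q - 2"
      using rank_right[OF gk ar_mult[OF e1 k(1)]] rank_left[OF e1 k(1)] r1 by linarith
    ultimately show ?thesis using 2 by auto
  qed
  show ?thesis
    unfolding nab_def
  proof (intro allI impI; elim conjE)
    fix A B z w assume g: "ar A B z" "ar A B w" "rank z \<le> q" "rank w \<le> q"
    obtain z' where g': "(z, z') \<in> \<sigma>" "rank z' \<le> q - 2" using red[OF g(1,3)] by blast
    obtain w' where d': "(w, w') \<in> \<sigma>" "rank w' \<le> q - 2" using red[OF g(2,4)] by blast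
    have "(z', w') \<in> \<sigma>" by (rule nabD[OF n member(1)[OF g'(1) g(1)] member(1)[OF d'(1) g(2)] g'(2) d'(2)])
    then show "(z, w) \<in> \<sigma>" using g'(1) d'(1) sym trans by metis
  qed
qed

end

text \<open>In \<open>drop\<close> the ranks differ, and projections bring the claim down to rank q
  - 2. In \<open>up\<close> a separating multiplier first makes the ranks differ; its rank is at
  most \<open>max q 3\<close>, which is q, so it lies in the ideal. Lower patterns are treated in
  the dual congruence.\<close>

lemma (in tl) nab_from_pair:
  assumes r: "enat 3 \<le> r"
  shows "tl_cong C pm Q r \<sigma> ==> (\<alpha>, \<beta>) \<in> \<sigma> ==> ar A B \<alpha> ==> rank \<alpha> = q ==> 3 \<le> q ==> rank \<beta> \<le> q ==>
    \<not> (upf \<alpha> = upf \<beta> \<and> dnf \<alpha> = dnf \<beta>) ==> nab q \<sigma>"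
proof (induction q arbitrary: \<sigma> \<alpha> \<beta> A B rule: less_induct)
  case (less q)
  \<comment> \<open>Stated for every congruence \<tau>, because it has to serve for the dual
    congruence as well.\<close>
  have drop: "nab q \<tau>" if \<tau>: "tl_cong C pm Q r \<tau>" and s: "(z, w) \<in> \<tau>" and g: "ar D E z" "rank z = q" "rank w < q"
    for \<tau> z w D E
  proof -
    interpret T: tl_cong C pm Q r \<tau> by (rule \<tau>)
    let ?p = "upf z"
    note D = arD(1)[OF g(1)] and p = arD(11)[OF g(1)]
    have cp: "card (defects D ?p) = q" using rank_up[OF g(1)] g(2) by simp
    obtain x y where xy: "consec D ?p x y" "(proj D ?p, proj D (add_arc ?p x y)) \<in> \<tau>"
      by (rule T.projection_drop[OF s g(1)]) (use g in auto)
    obtain u v \<eta> where e: "ar D D u" "rank u = q - 2" "(u, v) \<in> \<tau>" "rank v \<le> rank u" "dnf u \<noteq> dnf v"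
      "(u, \<eta>) \<in> \<tau>" "rank \<eta> \<le> rank u" "upf u \<noteq> upf \<eta>"
      by (rule T.projection_pairs[OF D p _ xy]) (use cp less.prems(5) in auto)
    have "nab (q - 2) \<tau>"
    proof (cases "3 \<le> q - 2")
      case True
      show ?thesis by (rule less.IH[OF _ \<tau> e(3,1,2) True]) (use e less.prems(5) in auto)
    next
      case False
      \<comment> \<open>At the bottom of the descent all elements have rank 1, and one pair with
        different upper and one with different lower patterns is at hand.\<close>
      then have "rank u = 1" using e(2) rank_odd[OF e(1)] less.prems(5) by (cases "rank u = 2") auto
      moreover from this have "rank v = 1" "rank \<eta> = 1"
        using e(4,7) rank_ge1[OF T.member(1)[OF e(3,1)]] rank_ge1[OF T.member(1)[OF e(6,1)]] by simp_all
      ultimately show ?thesis using T.nab1[OF r e(6,1) _ _ e(8) e(3,1) _ _ e(5)] e(2) by simp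
    qed
    then show "nab q \<tau>" by (rule T.nab_step[OF D p cp less.prems(5) xy])
  qed
  have up: "nab q \<tau>" if \<tau>: "tl_cong C pm Q r \<tau>" and s: "(z, w) \<in> \<tau>" and g: "ar D E z" "rank z = q" "rank w = q" "upf z \<noteq> upf w"
    for \<tau> z w D E
  proof -
    interpret T: tl_cong C pm Q r \<tau> by (rule \<tau>)
    note d = T.member[OF s g(1)]
    let ?id = "\<lambda>a :: 'a. a"
    obtain h where h: "h \<in> brauer_hom D D" "ncr D D h" "rank h \<le> max q 3"
      "rank (h \<cdot> z) \<noteq> rank (h \<cdot> w)" "max (rank (h \<cdot> z)) (rank (h \<cdot> w)) = q"
      using separation[OF arD(5,6)[OF g(1)] C_odd[OF arD(1)[OF g(1)]] arD(4)[OF g(1)] arD(4)[OF d(1)] g(2-4) pat_id]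
        less.prems(5) by (auto simp: arcs_le_def)
    have ah: "ar D D h" using ar_planar[OF arD(1,1)[OF g(1)] h(1,2)] .
    have "rank h \<le> rank z" using h(3) g(2) less.prems(5) by simp
    then have rh: "enat (rank h) \<le> r" using d(2) by (meson enat_ord_simps(1) order_trans)
    note hs = T.left[OF s g(1) ah rh] and hg = ar_mult[OF ah g(1)] and hd = ar_mult[OF ah d(1)]
    show "nab q \<tau>"
    proof (cases "rank (h \<cdot> z) = q")
      case True
      then show ?thesis using drop[OF \<tau> hs hg] h(4,5) by (metis le_neq_implies_less max.cobounded2)
    next
      case False
      then show ?thesis using drop[OF \<tau> T.sym[OF hs] hd] h(4,5) by (metis le_neq_implies_less max.cobounded1 max_def)
    qed
  qed
  interpret S: tl_cong C pm Q r \<sigma> by (rule less.prems(1))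
  note s = less.prems(2) and a = less.prems(3)
  note b = S.member[OF s a]
  consider "rank \<beta> < q" | "rank \<beta> = q" "upf \<alpha> \<noteq> upf \<beta>" | "rank \<beta> = q" "dnf \<alpha> \<noteq> dnf \<beta>"
    using less.prems(6,7) by linarith
  then show ?case
  proof cases
    case 1
    then show ?thesis using drop[OF less.prems(1) s a less.prems(4)] by simp
  next
    case 2
    then show ?thesis using up[OF less.prems(1) s a less.prems(4)] by simp
  next
    case 3
    have "(star \<alpha>, star \<beta>) \<in> S.dual" using S.dual_iff[OF a b(1)] s by simp
    then have n: "nab q S.dual"
      by (rule up[OF S.dual_cong _ ar_star[OF a]])
        (use 3 less.prems(4) ar_rank_star[OF a] ar_rank_star[OF b(1)] up_star[OF a] up_star[OF b(1)] in simp_all)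
    show ?thesis
      unfolding nab_def
    proof (intro allI impI; elim conjE)
      fix A B z w assume g: "ar A B z" "ar A B w" "rank z \<le> q" "rank w \<le> q"
      have "(star z, star w) \<in> S.dual"
        by (rule nabD[OF n ar_star[OF g(1)] ar_star[OF g(2)]]) (use g ar_rank_star in auto)
      then show "(z, w) \<in> \<sigma>" using S.dual_iff[OF g(1,2)] by simp
    qed
  qed
qed

context tl_cong
begin

text \<open>A partition with the patterns of the projection differs from it by a permutation t of
  the defects. Some neighbouring pair is not invariant under t; joining it leaves a lower arc at
  this pair in one product and at its image in the other.\<close>

lemma H_pair_moves:
  assumes A: "A \<in> C" and p: "pat A p" and n: "3 \<le> card (defects A p)"
    and f: "ar A A f" "upf f = p" "dnf f = p" "f \<noteq> proj A p" and s: "(proj A p, f) \<in> \<sigma>"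
  obtains u v where "ar A A u" "rank u = card (defects A p) - 2" "(u, v) \<in> \<sigma>" "rank v \<le> rank u" "dnf u \<noteq> dnf v"
proof -
  note L = C_lin[OF A] and h = arD(3)[OF f(1)]
  note e = ar_proj[OF A p] and es = proj_sel[OF A p]
  obtain t where t: "bij_betw t (defects A p) (defects A p)" "\<And>a. a \<in> defects A p ==> mate f (Top a) = Bot (t a)"
    using bij_betw_defects[OF h] f(2,3) by metis
  have tinj: "t a = t b ==> a = b" if "a \<in> defects A p" "b \<in> defects A p" for a b
    using t(1) that by (auto simp: bij_betw_def dest: inj_onD)
  obtain ds where ds: "set ds = defects A p" "length ds = card (defects A p)"
      "\<And>i j. i < j ==> j < length ds ==> pos A (ds ! i) < pos A (ds ! j)"
      "\<And>i. Suc i < length ds ==> consec A p (ds ! i) (ds ! Suc i)"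
    using defect_list[OF L, of p] by metis
  have mem: "ds ! i \<in> defects A p" if "i < length ds" for i using ds(1) nth_mem that by metis
  have ne: "ds ! a \<noteq> ds ! b" if "a < b" "b < length ds" for a b using ds(3)[OF that] by auto
  \<comment> \<open>If all neighbouring pairs were invariant, each inner defect, lying in two pairs,
    would be fixed, and then the two outer ones as well; with three defects there is an inner
    one.\<close>
  have "\<exists>i. Suc i < length ds \<and> {t (ds ! i), t (ds ! Suc i)} \<noteq> {ds ! i, ds ! Suc i}"
  proof (rule ccontr)
    assume "\<not> ?thesis"
    then have st: "{t (ds ! i), t (ds ! Suc i)} = {ds ! i, ds ! Suc i}" if "Suc i < length ds" for i using that by blast
    have mid: "t (ds ! Suc i) = ds ! Suc i" if "Suc (Suc i) < length ds" for i
    proof -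
      have "t (ds ! Suc i) \<in> {ds ! i, ds ! Suc i}" "t (ds ! Suc i) \<in> {ds ! Suc i, ds ! Suc (Suc i)}"
        using st[of i] st[of "Suc i"] that by auto
      then show ?thesis using ne[of i "Suc (Suc i)"] that by auto
    qed
    have fixed: "t (ds ! j) = ds ! j" if j: "j < length ds" for j
    proof -
      consider "j = 0" | k where "j = Suc k" "Suc (Suc k) < length ds" | k where "j = Suc (Suc k)" "Suc (Suc k) < length ds"
        using j n ds(2) by (cases j) (auto, metis (no_types) Suc_lessI not0_implies_Suc numeral_3_eq_3 Suc_le_lessD less_numeral_extra(3) nat_neq_iff)
      then show ?thesis
      proof cases
        case 1
        then show ?thesis using st[of 0] mid[of 0] n ds(2) ne[of 0 1] by (auto simp: doubleton_eq_iff)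
      next
        case (2 k)
        then show ?thesis using mid by simp
      next
        case (3 k)
        then show ?thesis using st[of "Suc k"] mid[of k] ne[of "Suc k" "Suc (Suc k)"] by (auto simp: doubleton_eq_iff)
      qed
    qed
    have "f = proj A p"
    proof (rule brauer_eq_transversals[OF h arD(3)[OF e]])
      fix a assume a: "a \<in> defects A (upf f)"
      then have a': "a \<in> defects A p" using f(2) by simp
      then obtain j where "j < length ds" "a = ds ! j" using ds(1) by (metis in_set_conv_nth)
      then have "mate f (Top a) = Bot a" using t(2)[OF a'] fixed by simp
      moreover have "mate (proj A p) (Top a) = Bot a"
        using mate_proj[OF L p, of "Top a"] a' by (simp add: link_def defects_def)
      ultimately show "mate f (Top a) = mate (proj A p) (Top a)" by simp
    qed (use f es in simp_all)
    then show False using f(4) by simp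
  qed
  then obtain i where i: "Suc i < length ds" "{t (ds ! i), t (ds ! Suc i)} \<noteq> {ds ! i, ds ! Suc i}" by blast
  let ?x = "ds ! i" and ?y = "ds ! Suc i"
  note xy = ds(4)[OF i(1)]
  note D = consecD[OF xy]
  let ?q = "add_arc p ?x ?y"
  note q = pat_add_arc[OF L p xy]
  note e1 = ar_proj[OF A q] and e1s = proj_sel[OF A q]
  have r1: "rank (proj A ?q) = card (defects A p) - 2" using e1s card_add_arc(1)[OF L xy] by simp
  then have "rank (proj A ?q) \<le> rank (proj A p)" using es by simp
  then have small: "enat (rank (proj A ?q)) \<le> r" using member(2)[OF s e] by (meson enat_ord_simps(1) order_trans)
  have s1: "(proj A ?q, proj A ?q \<cdot> f) \<in> \<sigma>"
    using left[OF s e e1 small] proj_right[OF e1 p] e1s arcs_le_add[OF D(3,4)] by simp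
  have m: "?x \<in> defects A p" "?y \<in> defects A p" using mem i by simp_all
  have tm: "t ?x \<in> defects A p" "t ?y \<in> defects A p" using t(1) m by (auto simp: bij_betw_def)
  then have tF: "t ?x \<in> Field A" "t ?y \<in> Field A" by (auto simp: defects_def)
  have "mate (proj A ?q \<cdot> f) (Bot (t ?x)) = Bot (t ?y)"
  proof (rule mult_mateI[OF arD(3)[OF e1] h arD(7)[OF e1]])
    show "Bot (t ?x) \<in> verts A A" "Bot (t ?y) \<in> verts A A" using tF by simp_all
    show "Bot (t ?x) \<noteq> Bot (t ?y)" using tinj[OF m] D(5) by auto
    fix \<tau> :: "'a vertex rel" assume \<tau>: "Relation.sym \<tau>" "Relation.trans \<tau>" "joins (proj A ?q) f A A A \<tau>"
    note J = joinsD[OF arD(3)[OF e1] h \<tau>(3)]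
    have "(Mid ?x, Bot (t ?x)) \<in> \<tau>" "(Mid ?y, Bot (t ?y)) \<in> \<tau>" using J(5) t(2) m D by auto
    moreover have "mate (proj A ?q) (Bot ?x) = Bot ?y"
      using mate_proj[OF L q, of "Bot ?x"] D by (simp add: link_def add_arc_def)
    then have "(Mid ?x, Mid ?y) \<in> \<tau>" using J(3) D by simp
    ultimately show "(Bot (t ?x), Bot (t ?y)) \<in> \<tau>" using \<tau>(1,2) by (metis symD transD)
  qed
  then have dn: "dnf (proj A ?q \<cdot> f) (t ?x) = t ?y"
    by (rule dnf_eqI[OF arD(3)[OF ar_mult[OF e1 f(1)]] tF(1)])
  have "dnf (proj A ?q) \<noteq> dnf (proj A ?q \<cdot> f)"
  proof
    assume "dnf (proj A ?q) = dnf (proj A ?q \<cdot> f)"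
    then have e: "?q (t ?x) = t ?y" using dn e1s by simp
    have "t ?x \<noteq> t ?y" using tinj[OF m] D(5) by auto
    moreover have "p (t ?x) = t ?x" using tm by (simp add: defects_def)
    ultimately have "t ?x = ?x \<and> t ?y = ?y \<or> t ?x = ?y \<and> t ?y = ?x"
      using e D(5) by (auto simp: add_arc_def split: if_splits)
    then show False using i(2) by auto
  qed
  then show thesis using that[OF e1 r1 s1] rank_left[OF e1 f(1)] by simp
qed

text \<open>Right multiplication by \<open>star x\<close> moves the pair to the projection at
  \<open>upf x\<close>; multiplying back by x shows that the images stay different.\<close>

lemma H_pair_projection:
  assumes s: "(x, y) \<in> \<sigma>" and a: "ar A B x" and ne: "x \<noteq> y" and ud: "upf x = upf y" "dnf x = dnf y"
  obtains f where "ar A A f" "upf f = upf x" "dnf f = upf x" "f \<noteq> proj A (upf x)" "(proj A (upf x), f) \<in> \<sigma>"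
proof -
  note b = member[OF s a] and sa = ar_star[OF a]
  let ?f = "y \<cdot> star x"
  have d: "dnf y = upf (star x)" using ud up_star[OF a] by simp
  have s1: "(proj A (upf x), ?f) \<in> \<sigma>"
    using right[OF s a sa] ar_rank_star[OF a] b(2) mult_star_self[OF a] by simp
  have "?f \<noteq> proj A (upf x)"
  proof
    assume "?f = proj A (upf x)"
    then have "?f \<cdot> x = x" using proj_left[OF a arD(11)[OF a]] by simp
    moreover have "?f \<cdot> x = y"
      using assoc[OF b(1) sa a] star_mult_self[OF a] proj_right[OF b(1) pat_dnf[OF b(1)]] ud by simp
    ultimately show False using ne by simp
  qed
  then show thesis
    using that[OF ar_mult[OF b(1) sa] _ _ _ s1] match[OF b(1) sa d] ud up_star[OF a] by simp
qed

text \<open>The first claim combines \<open>H_pair_moves\<close> with the descent from pairs with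
  different patterns. For the second, the related pair is transported to the patterns of z; as there
  are at most two partitions with these patterns, the image related to z is w.\<close>

lemma nab_from_H_pair:
  assumes r: "enat 3 \<le> r" and s: "(x, y) \<in> \<sigma>" and a: "ar A B x" and q: "rank x = q" "3 \<le> q"
    and ne: "x \<noteq> y" and ud: "upf x = upf y" "dnf x = dnf y"
  shows "nab (q - 2) \<sigma>"
    and "ar A' B' z ==> ar A' B' w ==> rank z = q ==> upf z = upf w ==> dnf z = dnf w ==> (z, w) \<in> \<sigma>"
proof -
  interpret D: tl_cong C pm Q r dual by (rule dual_cong)
  note b = member[OF s a]
  let ?p = "upf x"
  note A = arD(1)[OF a] and p = arD(11)[OF a]
  have cp: "card (defects A ?p) = q" using rank_up[OF a] q by simp
  have sd: "(star x, star y) \<in> dual" using dual_iff[OF a b(1)] s by simp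
  have sne: "star x \<noteq> star y" using ne ar_star_star[OF a] ar_star_star[OF b(1)] by metis
  obtain f where f: "ar A A f" "upf f = ?p" "dnf f = ?p" "f \<noteq> proj A ?p" "(proj A ?p, f) \<in> \<sigma>"
    by (rule H_pair_projection[OF s a ne ud])
  obtain u v where e: "ar A A u" "rank u = q - 2" "(u, v) \<in> \<sigma>" "rank v \<le> rank u" "dnf u \<noteq> dnf v"
    by (rule H_pair_moves[OF A p _ f]) (use cp q in auto)
  show nq: "nab (q - 2) \<sigma>"
  proof (cases "3 \<le> q - 2")
    case True
    show ?thesis by (rule nab_from_pair[OF r tl_cong_axioms e(3,1,2) True]) (use e in auto)
  next
    case False
    \<comment> \<open>At rank 1 a pair with different lower patterns is not enough; the dual
      congruence supplies one with different upper patterns.\<close>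
    let ?p' = "upf (star x)"
    obtain g where g: "ar B B g" "upf g = ?p'" "dnf g = ?p'" "g \<noteq> proj B ?p'" "(proj B ?p', g) \<in> dual"
      by (rule D.H_pair_projection[OF sd ar_star[OF a] sne]) (use ud up_star[OF a] up_star[OF b(1)] in auto)
    have cp': "card (defects B ?p') = q" using rank_up[OF ar_star[OF a]] ar_rank_star[OF a] q by simp
    obtain u' v' where e': "ar B B u'" "rank u' = q - 2" "(u', v') \<in> dual" "rank v' \<le> rank u'" "dnf u' \<noteq> dnf v'"
      by (rule D.H_pair_moves[OF arD(2)[OF a] arD(11)[OF ar_star[OF a]] _ g]) (use cp' q in auto)
    have z': "ar B B v'" by (rule D.member(1)[OF e'(3,1)])
    have s': "(star u', star v') \<in> \<sigma>" using e'(3) by (simp add: dual_def)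
    have "rank u = 1" using e(2) False rank_odd[OF e(1)] q by (cases "rank u = 2") auto
    then have q2: "q - 2 = 1" using e by simp
    have r1: "rank v = 1" "rank v' = 1"
      using e(2,4) e'(2,4) q2 rank_ge1[OF member(1)[OF e(3,1)]] rank_ge1[OF z'] by simp_all
    show ?thesis
      unfolding q2
      by (rule nab1[OF r s' ar_star[OF e'(1)] _ _ _ e(3,1)])
        (use r1 e e' q2 ar_rank_star[OF e'(1)] ar_rank_star[OF z'] up_star[OF e'(1)] up_star[OF z'] in auto)
  qed
  assume g: "ar A' B' z" "ar A' B' w" "rank z = q" "upf z = upf w" "dnf z = dnf w"
  show "(z, w) \<in> \<sigma>"
  proof (cases "z = w")
    case True
    then show ?thesis using refl[OF g(1)] g(3) q b(2) by simp
  next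
    case False
    let ?e = "proj A ?p"
    note e = ar_proj[OF A p]
    obtain k where k: "ar A B' k" "upf k = ?p" "dnf k = dnf z" "rank k = q"
      by (rule ex_ar[OF A arD(2)[OF g(1)] p pat_dnf[OF g(1)]]) (use cp g rank_dn[OF g(1)] in auto)
    note sk = ar_star[OF k(1)]
    let ?m = "z \<cdot> star k"
    note m = ar_mult[OF g(1) sk]
    have mm: "upf ?m = upf z" "dnf ?m = ?p" "rank ?m = q"
      using match[OF g(1) sk] up_star[OF k(1)] k g by simp_all
    have fk: "upf (f \<cdot> k) = ?p" "dnf (f \<cdot> k) = dnf z" using match[OF f(1) k(1)] f k by simp_all
    note afk = ar_mult[OF f(1) k(1)]
    let ?h = "?m \<cdot> (f \<cdot> k)"
    note h = ar_mult[OF m afk]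
    have hh: "upf ?h = upf z" "dnf ?h = dnf z" using match[OF m afk] mm fk by simp_all
    have ek: "?e \<cdot> k = k" using proj_left[OF k(1) p] k by simp
    have small: "enat q \<le> r" using b(2) q by simp
    have "(k, f \<cdot> k) \<in> \<sigma>" using right[OF f(5) e k(1)] ek k small by simp
    then have "(?m \<cdot> k, ?h) \<in> \<sigma>" using left[OF _ k(1) m] mm small by simp
    moreover have mk: "?m \<cdot> k = z"
      using assoc[OF g(1) sk k(1)] star_mult_self[OF k(1)] proj_right[OF g(1) pat_dnf[OF g(1)]] k by simp
    ultimately have gh: "(z, ?h) \<in> \<sigma>" by simp
    \<comment> \<open>Otherwise the multipliers could be cancelled, leaving f equal to the
      projection.\<close>
    have "z \<noteq> ?h"
    proof
      assume eq: "z = ?h"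
      note sm = ar_star[OF m]
      have kk: "k \<cdot> star k = ?e" using mult_star_self[OF k(1)] k by simp
      have 1: "star ?m \<cdot> ?m = ?e" using star_mult_self[OF m] mm by simp
      have "star ?m \<cdot> ?h = ?e \<cdot> (f \<cdot> k)" using assoc[OF sm m afk] 1 by simp
      also have "\<dots> = f \<cdot> k" using proj_left[OF afk p] fk by simp
      finally have 2: "star ?m \<cdot> ?h = f \<cdot> k" .
      have "star ?m \<cdot> z = k" using assoc[OF sm m k(1)] 1 ek mk by simp
      then have "f \<cdot> k = k" using 2 eq by simp
      then have "f \<cdot> (k \<cdot> star k) = k \<cdot> star k" using assoc[OF f(1) k(1) sk] by simp
      then have "f \<cdot> ?e = ?e" using kk by simp
      then have "f = ?e" using proj_right[OF f(1) p] f by simp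
      then show False using f by simp
    qed
    moreover have "z = w \<or> w = ?h \<or> z = ?h"
      by (rule H_class_card[OF g(1,2) h g(4,5)]) (use g(4,5) hh in simp_all)
    ultimately have "w = ?h" using False by blast
    then show ?thesis using gh by simp
  qed
qed

end

section \<open>Green relations and the congruences of the list\<close>

lemma less_xi_iff:
  assumes "C \<noteq> {}"
  shows "enat q < xi C \<longleftrightarrow> (\<exists>A\<in>C. q \<le> card (Field A))"
proof
  let ?P = "\<lambda>k. \<forall>A\<in>C. enat (card (Field A)) < k"
  \<comment> \<open>Infinity is a strict bound, so the least element is indeed a bound.\<close>
  have P: "?P (xi C)" unfolding xi_def by (rule LeastI[of ?P \<infinity>]) simp
  {
    assume q: "enat q < xi C"
    show "\<exists>A\<in>C. q \<le> card (Field A)"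
    proof (rule ccontr)
      assume "\<not> ?thesis"
      then have "?P (enat q)" by auto
      then have "xi C \<le> enat q" unfolding xi_def by (rule Least_le)
      then show False using q by simp
    qed
  next
    assume "\<exists>A\<in>C. q \<le> card (Field A)"
    then obtain A where "A \<in> C" "enat q \<le> enat (card (Field A))" by auto
    then show "enat q < xi C" using P by (metis order_le_less_trans)
  }
qed

context tl
begin

lemma ex_pat:
  assumes A: "A \<in> C" and q: "odd q" "q \<le> card (Field A)"
  obtains p where "pat A p" "card (defects A p) = q"
proof -
  have d: "defects A (\<lambda>a. a) = Field A" by (simp add: defects_def)
  have "even (card (Field A) - q)" using C_odd[OF A] q by simp
  then obtain p where "pat A p" "card (defects A p) = q"
    using ex_extension[OF C_lin[OF A] pat_id, of q] q(2) unfolding d by blast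
  then show thesis by (rule that)
qed

lemma enat_le_trans: "m \<le> n ==> enat n \<le> r ==> enat m \<le> r"
  by (meson enat_ord_simps(1) order_trans)

lemma ideal_memI: "ar A B x ==> enat (rank x) \<le> r ==> x \<in> arr (ideal r)"
  by (auto simp: in_ideal)

lemma ideal_memE:
  assumes "x \<in> arr (ideal r)"
  obtains A B where "ar A B x" "enat (rank x) \<le> r"
  using assms by (auto simp: in_ideal)

text \<open>The principal right ideal of x within \<open>ideal r\<close>, identity adjoined;
  \<open>lset\<close> is its left analogue.\<close>

definition rset :: "enat => 'a brauer => 'a brauer set" where
  "rset r x = insert x {x \<cdot> b | b. b \<in> arr (ideal r) \<and> src b = trg x}"

definition lset :: "enat => 'a brauer => 'a brauer set" where
  "lset r x = insert x {b \<cdot> x | b. b \<in> arr (ideal r) \<and> trg b = src x}"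

lemma green_sets:
  "{g x | g. g \<in> right_mults (ideal r) (rn (ideal r) x)} = rset r x"
  "{f x | f. f \<in> left_mults (ideal r) (dm (ideal r) x)} = lset r x"
  unfolding right_mults_def left_mults_def rset_def lset_def by (auto, (rule exI[of _ id], simp)+)

lemma rset_mono:
  assumes y: "ar A B y" and b: "ar B D b" "enat (rank b) \<le> r" and x: "x = y \<cdot> b"
  shows "rset r x \<subseteq> rset r y"
proof
  fix z assume "z \<in> rset r x"
  note xa = ar_mult[OF y b(1)]
  have tx: "trg x = D" "trg y = B" using arD(10)[OF xa] arD(10)[OF y] x by simp_all
  from \<open>z \<in> rset r x\<close> consider "z = x" | c where "c \<in> arr (ideal r)" "src c = D" "z = x \<cdot> c"
    unfolding rset_def tx by auto
  then show "z \<in> rset r y"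
  proof cases
    case 1
    then show ?thesis using x ideal_memI[OF b] arD(9)[OF b(1)] tx unfolding rset_def by blast
  next
    case 2
    obtain D' E where c: "ar D' E c" "enat (rank c) \<le> r" using 2(1) by (rule ideal_memE)
    have c': "ar D E c" using c(1) arD(9)[OF c(1)] 2(2) by simp
    have "z = y \<cdot> (b \<cdot> c)" using assoc[OF y b(1) c'] 2(3) x by simp
    moreover have "b \<cdot> c \<in> arr (ideal r)"
      using ideal_memI[OF ar_mult[OF b(1) c']] enat_le_trans[OF rank_left[OF b(1) c'] b(2)] by simp
    moreover have "src (b \<cdot> c) = trg y" using arD(9)[OF ar_mult[OF b(1) c']] tx by simp
    ultimately show ?thesis unfolding rset_def by blast
  qed
qed

lemma lset_mono:
  assumes y: "ar A B y" and b: "ar D A b" "enat (rank b) \<le> r" and x: "x = b \<cdot> y"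
  shows "lset r x \<subseteq> lset r y"
proof
  fix z assume "z \<in> lset r x"
  note xa = ar_mult[OF b(1) y]
  have tx: "src x = D" "src y = A" using arD(9)[OF xa] arD(9)[OF y] x by simp_all
  from \<open>z \<in> lset r x\<close> consider "z = x" | c where "c \<in> arr (ideal r)" "trg c = D" "z = c \<cdot> x"
    unfolding lset_def tx by auto
  then show "z \<in> lset r y"
  proof cases
    case 1
    then show ?thesis using x ideal_memI[OF b] arD(10)[OF b(1)] tx unfolding lset_def by blast
  next
    case 2
    obtain E D' where c: "ar E D' c" "enat (rank c) \<le> r" using 2(1) by (rule ideal_memE)
    have c': "ar E D c" using c(1) arD(10)[OF c(1)] 2(2) by simp
    have "z = c \<cdot> b \<cdot> y" using assoc[OF c' b(1) y] 2(3) x by simp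
    moreover have "c \<cdot> b \<in> arr (ideal r)"
      using ideal_memI[OF ar_mult[OF c' b(1)]] enat_le_trans[OF rank_right[OF c' b(1)] b(2)] by simp
    moreover have "trg (c \<cdot> b) = src y" using arD(10)[OF ar_mult[OF c' b(1)]] tx by simp
    ultimately show ?thesis unfolding lset_def by blast
  qed
qed

lemma rsetD:
  assumes y: "ar A B y" and z: "z \<in> rset r y"
  shows "src z = A" "rank z \<le> rank y" "rank z = rank y ==> upf z = upf y"
proof -
  have "src z = A \<and> rank z \<le> rank y \<and> (rank z = rank y --> upf z = upf y)"
  proof (cases "z = y")
    case True then show ?thesis using arD(9)[OF y] by simp
  next
    case False
    then obtain b where b: "b \<in> arr (ideal r)" "src b = B" "z = y \<cdot> b"
      using z arD(10)[OF y] unfolding rset_def by auto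
    obtain B' D where "ar B' D b" using b(1) by (rule ideal_memE)
    then have b': "ar B D b" using b(2) arD(9) by metis
    show ?thesis using arD(9)[OF ar_mult[OF y b']] rank_left[OF y b'] up_eq[OF y b'] b(3) by simp
  qed
  then show "src z = A" "rank z \<le> rank y" "rank z = rank y ==> upf z = upf y" by auto
qed

lemma lsetD:
  assumes y: "ar A B y" and z: "z \<in> lset r y"
  shows "trg z = B" "rank z \<le> rank y" "rank z = rank y ==> dnf z = dnf y"
proof -
  have "trg z = B \<and> rank z \<le> rank y \<and> (rank z = rank y --> dnf z = dnf y)"
  proof (cases "z = y")
    case True then show ?thesis using arD(10)[OF y] by simp
  next
    case False
    then obtain b where b: "b \<in> arr (ideal r)" "trg b = A" "z = b \<cdot> y"
      using z arD(9)[OF y] unfolding lset_def by auto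
    obtain D A' where "ar D A' b" using b(1) by (rule ideal_memE)
    then have b': "ar D A b" using b(2) arD(10) by metis
    show ?thesis using arD(10)[OF ar_mult[OF b' y]] rank_right[OF b' y] dn_eq[OF b' y] b(3) by simp
  qed
  then show "trg z = B" "rank z \<le> rank y" "rank z = rank y ==> dnf z = dnf y" by auto
qed

text \<open>Equal upper patterns give x as \<open>y \<cdot> (star y \<cdot> x)\<close>, where the
  multiplier has rank at most that of x and so lies in the ideal. Hence the relation does not depend
  on r.\<close>

lemma green_R_iff:
  assumes x: "ar A B x" "enat (rank x) \<le> r" and y: "ar A' B' y" "enat (rank y) \<le> r"
  shows "(x, y) \<in> green_R (ideal r) \<longleftrightarrow> A = A' \<and> upf x = upf y"
proof -
  have "(x, y) \<in> green_R (ideal r) \<longleftrightarrow> rset r x = rset r y"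
    using ideal_memI[OF x] ideal_memI[OF y] by (simp add: green_R_def green_sets[simplified])
  also have "\<dots> \<longleftrightarrow> A = A' \<and> upf x = upf y"
  proof
    assume e: "rset r x = rset r y"
    then have "x \<in> rset r y" "y \<in> rset r x" unfolding rset_def by blast+
    then show "A = A' \<and> upf x = upf y"
      using rsetD[OF y(1), of x r] rsetD[OF x(1), of y r] arD(9)[OF x(1)] arD(9)[OF y(1)] by simp
  next
    assume e: "A = A' \<and> upf x = upf y"
    have *: "rset r x \<subseteq> rset r y" if x: "ar A B x" "enat (rank x) \<le> r" and y: "ar A B' y" and u: "upf x = upf y" for x y B B'
    proof (rule rset_mono[OF y ar_mult[OF ar_star[OF y] x(1)]])
      show "enat (rank (star y \<cdot> x)) \<le> r" by (rule enat_le_trans[OF rank_right[OF ar_star[OF y] x(1)] x(2)])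
      show "x = y \<cdot> (star y \<cdot> x)"
        using assoc[OF y ar_star[OF y] x(1)] mult_star_self[OF y] proj_left[OF x(1) arD(11)[OF x(1)]] u by simp
    qed
    show "rset r x = rset r y" using *[OF x, of B' y] *[of B' y B x] x y e by auto
  qed
  finally show ?thesis .
qed

lemma green_L_iff:
  assumes x: "ar A B x" "enat (rank x) \<le> r" and y: "ar A' B' y" "enat (rank y) \<le> r"
  shows "(x, y) \<in> green_L (ideal r) \<longleftrightarrow> B = B' \<and> dnf x = dnf y"
proof -
  have "(x, y) \<in> green_L (ideal r) \<longleftrightarrow> lset r x = lset r y"
    using ideal_memI[OF x] ideal_memI[OF y] by (simp add: green_L_def green_sets[simplified])
  also have "\<dots> \<longleftrightarrow> B = B' \<and> dnf x = dnf y"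
  proof
    assume e: "lset r x = lset r y"
    then have "x \<in> lset r y" "y \<in> lset r x" unfolding lset_def by blast+
    then show "B = B' \<and> dnf x = dnf y"
      using lsetD[OF y(1), of x r] lsetD[OF x(1), of y r] arD(10)[OF x(1)] arD(10)[OF y(1)] by simp
  next
    assume e: "B = B' \<and> dnf x = dnf y"
    have *: "lset r x \<subseteq> lset r y" if x: "ar A B x" "enat (rank x) \<le> r" and y: "ar A' B y" and u: "dnf x = dnf y" for x y A A'
    proof (rule lset_mono[OF y ar_mult[OF x(1) ar_star[OF y]]])
      show "enat (rank (x \<cdot> star y)) \<le> r" by (rule enat_le_trans[OF rank_left[OF x(1) ar_star[OF y]] x(2)])
      show "x = x \<cdot> star y \<cdot> y"
        using assoc[OF x(1) ar_star[OF y] y] star_mult_self[OF y] proj_right[OF x(1) pat_dnf[OF x(1)]] u by simp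
    qed
    show "lset r x = lset r y" using *[OF x, of A' y] *[of A' y A x] x y e by auto
  qed
  finally show ?thesis .
qed

definition jset :: "enat => 'a brauer => 'a brauer set" where
  "jset r x = {g (f x) | f g. f \<in> left_mults (ideal r) (dm (ideal r) x) \<and> g \<in> right_mults (ideal r) (rn (ideal r) x)}"

lemma multsE:
  assumes x: "ar A B x" and f: "f \<in> left_mults (ideal r) A" and g: "g \<in> right_mults (ideal r) B"
  obtains A' B' where "ar A' B (f x)" "ar A' B' (g (f x))" "rank (f x) \<le> rank x" "rank (g (f x)) \<le> rank (f x)"
    "f x \<in> lset r x" "g (f x) \<in> rset r (f x)"
proof -
  have "\<exists>A'. ar A' B (f x) \<and> rank (f x) \<le> rank x \<and> f x \<in> lset r x"
  proof (cases "f = id")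
    case True then show ?thesis using x by (auto simp: lset_def)
  next
    case False
    then obtain a where a: "a \<in> arr (ideal r)" "trg a = A" "f = brauer_mult a" using f by (auto simp: left_mults_def)
    obtain A' A'' where "ar A' A'' a" using a(1) by (rule ideal_memE)
    then have a': "ar A' A a" using a(2) arD(10) by metis
    show ?thesis using ar_mult[OF a' x] rank_right[OF a' x] a arD(9)[OF x] by (auto simp: lset_def)
  qed
  then obtain A' where A': "ar A' B (f x)" "rank (f x) \<le> rank x" "f x \<in> lset r x" by blast
  have "\<exists>B'. ar A' B' (g (f x)) \<and> rank (g (f x)) \<le> rank (f x) \<and> g (f x) \<in> rset r (f x)"
  proof (cases "g = id")
    case True then show ?thesis using A' by (auto simp: rset_def)
  next
    case False
    then obtain b where b: "b \<in> arr (ideal r)" "src b = B" "g = (\<lambda>x. x \<cdot> b)" using g by (auto simp: right_mults_def)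
    obtain B' B'' where "ar B' B'' b" using b(1) by (rule ideal_memE)
    then have b': "ar B B'' b" using b(2) arD(9) by metis
    show ?thesis using ar_mult[OF A'(1) b'] rank_left[OF A'(1) b'] b arD(10)[OF A'(1)] by (auto simp: rset_def)
  qed
  then show thesis using that A' by blast
qed

lemma jset_mono:
  assumes y: "ar A B y" and u: "ar A' A u" "enat (rank u) \<le> r" and v: "ar B B' v" "enat (rank v) \<le> r"
    and x: "x = u \<cdot> y \<cdot> v"
  shows "jset r x \<subseteq> jset r y"
proof
  fix z assume z: "z \<in> jset r x"
  note uy = ar_mult[OF u(1) y]
  note xa = ar_mult[OF uy v(1), folded x]
  obtain f g where fg: "z = g (f x)" "f \<in> left_mults (ideal r) A'" "g \<in> right_mults (ideal r) B'"
    using z arD(9,10)[OF xa] by (auto simp: jset_def)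
  have "\<exists>f'. f' \<in> left_mults (ideal r) A \<and> (\<exists>A''. ar A'' B (f' y) \<and> f x = f' y \<cdot> v)"
  proof (cases "f = id")
    case True
    have "brauer_mult u \<in> left_mults (ideal r) A" using ideal_memI[OF u] arD(10)[OF u(1)] by (auto simp: left_mults_def)
    then show ?thesis using True x uy by (intro exI[of _ "brauer_mult u"]) auto
  next
    case False
    then obtain a where a: "a \<in> arr (ideal r)" "trg a = A'" "f = brauer_mult a" using fg(2) by (auto simp: left_mults_def)
    obtain A2 A3 where a2: "ar A2 A3 a" "enat (rank a) \<le> r" using a(1) by (rule ideal_memE)
    then have a': "ar A2 A' a" using a(2) arD(10) by metis
    note au = ar_mult[OF a' u(1)]
    have "a \<cdot> u \<in> arr (ideal r)" by (rule ideal_memI[OF au enat_le_trans[OF rank_left[OF a' u(1)] a2(2)]])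
    then have "brauer_mult (a \<cdot> u) \<in> left_mults (ideal r) A" using arD(10)[OF au] by (auto simp: left_mults_def)
    moreover have "f x = a \<cdot> u \<cdot> y \<cdot> v"
      using assoc[OF a' uy v(1)] assoc[OF a' u(1) y] a(3) x by simp
    ultimately show ?thesis using ar_mult[OF au y] by (intro exI[of _ "brauer_mult (a \<cdot> u)"]) auto
  qed
  then obtain f' A'' where f': "f' \<in> left_mults (ideal r) A" "ar A'' B (f' y)" "f x = f' y \<cdot> v" by blast
  have "\<exists>g'. g' \<in> right_mults (ideal r) B \<and> g (f x) = g' (f' y)"
  proof (cases "g = id")
    case True
    have "(\<lambda>x. x \<cdot> v) \<in> right_mults (ideal r) B" using ideal_memI[OF v] arD(9)[OF v(1)] by (auto simp: right_mults_def)
    then show ?thesis using True f'(3) by (intro exI[of _ "\<lambda>x. x \<cdot> v"]) auto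
  next
    case False
    then obtain b where b: "b \<in> arr (ideal r)" "src b = B'" "g = (\<lambda>x. x \<cdot> b)" using fg(3) by (auto simp: right_mults_def)
    obtain B2 B3 where b2: "ar B2 B3 b" "enat (rank b) \<le> r" using b(1) by (rule ideal_memE)
    then have b': "ar B' B3 b" using b(2) arD(9) by metis
    note vb = ar_mult[OF v(1) b']
    have "v \<cdot> b \<in> arr (ideal r)" by (rule ideal_memI[OF vb enat_le_trans[OF rank_right[OF v(1) b'] b2(2)]])
    then have "(\<lambda>x. x \<cdot> (v \<cdot> b)) \<in> right_mults (ideal r) B" using arD(9)[OF vb] by (auto simp: right_mults_def)
    moreover have "g (f x) = f' y \<cdot> (v \<cdot> b)" using assoc[OF f'(2) v(1) b'] b(3) f'(3) by simp
    ultimately show ?thesis by (intro exI[of _ "\<lambda>x. x \<cdot> (v \<cdot> b)"]) auto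
  qed
  then show "z \<in> jset r y" using fg(1) f'(1) arD(9,10)[OF y] by (auto simp: jset_def)
qed

text \<open>Equal rank provides u linking the upper pattern of x to that of y; then
  \<open>u \<cdot> y\<close> has the upper pattern of x, and x is a right multiple of it as in
  \<open>green_R_iff\<close>.\<close>

lemma green_J_iff:
  assumes x: "ar A B x" "enat (rank x) \<le> r" and y: "ar A' B' y" "enat (rank y) \<le> r"
  shows "(x, y) \<in> green_J (ideal r) \<longleftrightarrow> rank x = rank y"
proof -
  have self: "x \<in> jset r x" for x
    unfolding jset_def left_mults_def right_mults_def mem_Collect_eq by (intro exI[of _ id]) simp
  have "(x, y) \<in> green_J (ideal r) \<longleftrightarrow> jset r x = jset r y"
    using ideal_memI[OF x] ideal_memI[OF y] by (simp add: green_J_def jset_def)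
  also have "\<dots> \<longleftrightarrow> rank x = rank y"
  proof
    have le: "rank z \<le> rank w" if w: "ar D E w" and z: "z \<in> jset r w" for z w D E
    proof -
      obtain f g where "z = g (f w)" "f \<in> left_mults (ideal r) D" "g \<in> right_mults (ideal r) E"
        using z arD(9,10)[OF w] by (auto simp: jset_def)
      then show ?thesis using multsE[OF w, of f r g] by (metis order_trans)
    qed
    assume "jset r x = jset r y"
    then show "rank x = rank y" using le[OF y(1), of x] le[OF x(1), of y] self by (metis order_antisym)
  next
    assume e: "rank x = rank y"
    have *: "jset r x \<subseteq> jset r y"
      if x: "ar A B x" "enat (rank x) \<le> r" and y: "ar A' B' y" and e: "rank x = rank y" for x y A B A' B'
    proof -
      obtain u where u: "ar A A' u" "upf u = upf x" "dnf u = upf y" "rank u = rank x"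
        by (rule ex_ar[OF arD(1)[OF x(1)] arD(1)[OF y] arD(11)[OF x(1)] arD(11)[OF y]])
          (use e rank_up[OF x(1)] rank_up[OF y] in auto)
      note uy = ar_mult[OF u(1) y]
      have up: "upf (u \<cdot> y) = upf x" using match[OF u(1) y u(3)] u(2) by simp
      let ?v = "(star (u \<cdot> y)) \<cdot> x"
      show ?thesis
      proof (rule jset_mono[OF y u(1) _ ar_mult[OF ar_star[OF uy] x(1)]])
        show "enat (rank u) \<le> r" using u(4) x(2) by simp
        show "enat (rank ?v) \<le> r" by (rule enat_le_trans[OF rank_right[OF ar_star[OF uy] x(1)] x(2)])
        show "x = u \<cdot> y \<cdot> ?v"
          using assoc[OF uy ar_star[OF uy] x(1)] mult_star_self[OF uy] proj_left[OF x(1) arD(11)[OF x(1)]] up by simp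
      qed
    qed
    show "jset r x = jset r y" using *[OF x y(1) e] *[OF y x(1) e[symmetric]] by auto
  qed
  finally show ?thesis .
qed

text \<open>Common shape of all congruences in the list: equality together with a condition
  \<open>P\<close> on parallel elements of the ideal. Inclusions are then settled by comparing
  conditions.\<close>

definition Par :: "enat => ('a brauer => 'a brauer => bool) => 'a brauer rel" where
  "Par r P = {(x, y). (\<exists>A B. ar A B x \<and> ar A B y) \<and> enat (rank x) \<le> r \<and> enat (rank y) \<le> r \<and> (x = y \<or> P x y)}"

lemma Par_iff:
  assumes "ar A B x" "ar A B y"
  shows "(x, y) \<in> Par r P \<longleftrightarrow> enat (rank x) \<le> r \<and> enat (rank y) \<le> r \<and> (x = y \<or> P x y)"
  using assms by (auto simp: Par_def)

text \<open>Multipliers come from the ideal, so the rank bound for products is automatic and only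
  the condition \<open>P\<close> has to be carried through.\<close>

lemma Par_congruence:
  assumes sym: "\<And>x y. P x y ==> P y x"
    and trans: "\<And>x y z. P x y ==> P y z ==> x = z \<or> P x z"
    and left: "\<And>x y s A B D. ar A B x ==> ar A B y ==> ar D A s ==> P x y ==>
      s \<cdot> x = s \<cdot> y \<or> P (s \<cdot> x) (s \<cdot> y)"
    and right: "\<And>x y s A B D. ar A B x ==> ar A B y ==> ar B D s ==> P x y ==>
      x \<cdot> s = y \<cdot> s \<or> P (x \<cdot> s) (y \<cdot> s)"
  shows "congruence (ideal r) (Par r P)"
proof (rule congruenceI)
  show "equiv (arr (ideal r)) (Par r P)"
  proof (rule equivI')
    show "Par r P \<subseteq> arr (ideal r) \<times> arr (ideal r)" by (auto simp: Par_def in_ideal; blast)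
    show "(x, x) \<in> Par r P" if "x \<in> arr (ideal r)" for x using that by (auto simp: Par_def in_ideal)
    show "(y, x) \<in> Par r P" if "(x, y) \<in> Par r P" for x y using that sym by (auto simp: Par_def)
    show "(x, z) \<in> Par r P" if xy: "(x, y) \<in> Par r P" and yz: "(y, z) \<in> Par r P" for x y z
    proof -
      obtain A B where a: "ar A B x" "ar A B y" using xy by (auto simp: Par_def)
      obtain A' B' where b: "ar A' B' y" "ar A' B' z" using yz by (auto simp: Par_def)
      have z: "ar A B z" using ar_unique_objs[OF a(2) b(1)] b(2) by simp
      show ?thesis using xy yz trans[of x y z] unfolding Par_iff[OF a] Par_iff[OF a(2) z] Par_iff[OF a(1) z] by blast
    qed
  qed
  show "parallel (ideal r) x y" if "(x, y) \<in> Par r P" for x y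
    using that arD(9,10) by (auto simp: Par_def parallel_def)
  fix x y s assume xy: "(x, y) \<in> Par r P" and s: "s \<in> arr (ideal r)"
  obtain A B where a: "ar A B x" "ar A B y" using xy by (auto simp: Par_def)
  obtain D E where s': "ar D E s" "enat (rank s) \<le> r" using s by (rule ideal_memE)
  have rk: "x = y \<or> P x y" using xy Par_iff[OF a] by simp
  {
    assume "rn (ideal r) s = dm (ideal r) x"
    then have "E = A" using arD(10)[OF s'(1)] arD(9)[OF a(1)] by simp
    then have s1: "ar D A s" using s' by simp
    show "(mul (ideal r) s x, mul (ideal r) s y) \<in> Par r P"
      using rk left[OF a s1] enat_le_trans[OF rank_left[OF s1 a(1)] s'(2)] enat_le_trans[OF rank_left[OF s1 a(2)] s'(2)]
      unfolding ideal_sel Par_iff[OF ar_mult[OF s1 a(1)] ar_mult[OF s1 a(2)]] by blast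
  }
  {
    assume "rn (ideal r) x = dm (ideal r) s"
    then have "D = B" using arD(9)[OF s'(1)] arD(10)[OF a(1)] by simp
    then have s1: "ar B E s" using s' by simp
    show "(mul (ideal r) x s, mul (ideal r) y s) \<in> Par r P"
      using rk right[OF a s1] enat_le_trans[OF rank_right[OF a(1) s1] s'(2)] enat_le_trans[OF rank_right[OF a(2) s1] s'(2)]
      unfolding ideal_sel Par_iff[OF ar_mult[OF a(1) s1] ar_mult[OF a(2) s1]] by blast
  }
qed

definition same_H :: "nat => 'a brauer => 'a brauer => bool" where
  "same_H q x y \<longleftrightarrow> rank x = q \<and> rank y = q \<and> upf x = upf y \<and> dnf x = dnf y"

text \<open>\<open>low q False\<close> gives the Rees congruence at rank q; h adds the pairs of rank
  q + 2 with equal patterns, the contribution of a nontrivial normal subgroup.\<close>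

definition low :: "nat => bool => 'a brauer => 'a brauer => bool" where
  "low q h x y \<longleftrightarrow> rank x \<le> q \<and> rank y \<le> q \<or> h \<and> same_H (q + 2) x y"

text \<open>Equal upper patterns make y a right multiple of x, hence \<open>s \<cdot> y\<close> one
  of \<open>s \<cdot> x\<close>, and vice versa.\<close>

lemma same_H_left:
  assumes x: "ar A B x" and y: "ar A B y" and s: "ar D A s" and h: "same_H q x y"
  shows "rank (s \<cdot> x) = rank (s \<cdot> y)"
    and "rank (s \<cdot> x) = q ==> same_H q (s \<cdot> x) (s \<cdot> y)"
proof -
  have eq: "rank (s \<cdot> y) \<le> rank (s \<cdot> x) \<and>
      (rank (s \<cdot> y) = rank (s \<cdot> x) --> upf (s \<cdot> y) = upf (s \<cdot> x))"
    if x: "ar A B x" and y: "ar A B y" and u: "upf x = upf y" for x y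
  proof -
    note z = ar_mult[OF ar_star[OF x] y] and sx = ar_mult[OF s x]
    have "y = x \<cdot> (star x \<cdot> y)"
      using assoc[OF x ar_star[OF x] y] mult_star_self[OF x] proj_left[OF y arD(11)[OF y]] u by simp
    then have "s \<cdot> y = s \<cdot> x \<cdot> (star x \<cdot> y)" using assoc[OF s x z] by simp
    then show ?thesis using rank_left[OF sx z] up_eq[OF sx z] by simp
  qed
  have u: "upf x = upf y" using h by (simp add: same_H_def)
  show r: "rank (s \<cdot> x) = rank (s \<cdot> y)"
    using eq[OF x y u] eq[OF y x u[symmetric]] by simp
  show "same_H q (s \<cdot> x) (s \<cdot> y)" if "rank (s \<cdot> x) = q"
    using that r eq[OF x y u] dn_eq[OF s x] dn_eq[OF s y] h by (simp add: same_H_def)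
qed

lemma same_H_star: "ar A B x ==> ar A B y ==> same_H q (star x) (star y) \<longleftrightarrow> same_H q x y"
  by (auto simp: same_H_def ar_rank_star up_star)

lemma same_H_right:
  assumes x: "ar A B x" and y: "ar A B y" and s: "ar B D s" and h: "same_H q x y"
  shows "rank (x \<cdot> s) = rank (y \<cdot> s)"
    and "rank (x \<cdot> s) = q ==> same_H q (x \<cdot> s) (y \<cdot> s)"
proof -
  note L = same_H_left[OF ar_star[OF x] ar_star[OF y] ar_star[OF s]]
  have h': "same_H q (star x) (star y)" using same_H_star[OF x y] h by simp
  note xs = ar_mult[OF x s] and ys = ar_mult[OF y s]
  show "rank (x \<cdot> s) = rank (y \<cdot> s)"
    using L(1)[OF h'] star_mult[OF x s] star_mult[OF y s] ar_rank_star[OF xs] ar_rank_star[OF ys] by simp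
  show "same_H q (x \<cdot> s) (y \<cdot> s)" if "rank (x \<cdot> s) = q"
    using L(2)[OF h'] that star_mult[OF x s] star_mult[OF y s] ar_rank_star[OF xs] same_H_star[OF xs ys] by simp
qed

lemma odd_less_add2: "odd m ==> odd q ==> m \<le> q + 2 ==> m \<noteq> q + 2 ==> m \<le> (q::nat)"
  by (cases "m = q + 1") auto

text \<open>A product of rank at most q + 2 has odd rank, so it keeps rank q + 2, with equal
  patterns again, or falls to at most q.\<close>

lemma low_congruence:
  assumes q: "odd q"
  shows "congruence (ideal r) (Par r (low q h))"
proof (rule Par_congruence)
  show "low q h y x" if "low q h x y" for x y using that by (auto simp: low_def same_H_def)
  show "x = z \<or> low q h x z" if "low q h x y" "low q h y z" for x y z using that by (auto simp: low_def same_H_def)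
next
  fix x y s A B D assume a: "ar A B x" "ar A B y" "ar D A s" and l: "low q h x y"
  note sx = ar_mult[OF a(3,1)] and sy = ar_mult[OF a(3,2)]
  have "low q h (s \<cdot> x) (s \<cdot> y)"
  proof (cases "rank x \<le> q \<and> rank y \<le> q")
    case True
    then show ?thesis using rank_right[OF a(3,1)] rank_right[OF a(3,2)] by (auto simp: low_def)
  next
    case False
    then have h: h "same_H (q + 2) x y" using l by (auto simp: low_def)
    have "rank (s \<cdot> x) \<le> q + 2" using rank_right[OF a(3,1)] h by (simp add: same_H_def)
    then show ?thesis
      using same_H_left[OF a h(2)] h(1) odd_less_add2[OF rank_odd[OF sx] q] by (auto simp: low_def)
  qed
  then show "s \<cdot> x = s \<cdot> y \<or> low q h (s \<cdot> x) (s \<cdot> y)" ..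
next
  fix x y s A B D assume a: "ar A B x" "ar A B y" "ar B D s" and l: "low q h x y"
  note sx = ar_mult[OF a(1,3)] and sy = ar_mult[OF a(2,3)]
  have "low q h (x \<cdot> s) (y \<cdot> s)"
  proof (cases "rank x \<le> q \<and> rank y \<le> q")
    case True
    then show ?thesis using rank_left[OF a(1,3)] rank_left[OF a(2,3)] by (auto simp: low_def)
  next
    case False
    then have h: h "same_H (q + 2) x y" using l by (auto simp: low_def)
    have "rank (x \<cdot> s) \<le> q + 2" using rank_left[OF a(1,3)] h by (simp add: same_H_def)
    then show ?thesis
      using same_H_right[OF a h(2)] h(1) odd_less_add2[OF rank_odd[OF sx] q] by (auto simp: low_def)
  qed
  then show "x \<cdot> s = y \<cdot> s \<or> low q h (x \<cdot> s) (y \<cdot> s)" ..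
qed

definition sameL :: "'a brauer => 'a brauer => bool" where
  "sameL x y \<longleftrightarrow> rank x = 1 \<and> rank y = 1 \<and> dnf x = dnf y"

definition sameR :: "'a brauer => 'a brauer => bool" where
  "sameR x y \<longleftrightarrow> rank x = 1 \<and> rank y = 1 \<and> upf x = upf y"

text \<open>Right multiplication is the point: x equals \<open>x \<cdot> star y \<cdot> y\<close>,
  so \<open>x \<cdot> s\<close> ends with the factor \<open>y \<cdot> s\<close> of rank 1 and shares
  its lower pattern.\<close>

lemma sameL_congruence: "congruence (ideal r) (Par r sameL)"
proof (rule Par_congruence)
  fix x y s A B D assume a: "ar A B x" "ar A B y" "ar D A s" and l: "sameL x y"
  then show "s \<cdot> x = s \<cdot> y \<or> sameL (s \<cdot> x) (s \<cdot> y)"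
    using rank1_mult(2)[OF a(3,1)] rank1_mult(2)[OF a(3,2)] by (simp add: sameL_def)
next
  fix x y s A B D assume a: "ar A B x" "ar A B y" "ar B D s" and l: "sameL x y"
  have "x = x \<cdot> star y \<cdot> y" if x: "ar A B x" and y: "ar A B y" and l: "sameL x y" for x y
    using assoc[OF x ar_star[OF y] y] star_mult_self[OF y] proj_right[OF x pat_dnf[OF x]] l by (simp add: sameL_def)
  note x = this[OF a(1,2) l]
  note xy = ar_mult[OF a(1) ar_star[OF a(2)]] and ys = ar_mult[OF a(2,3)]
  have "x \<cdot> s = x \<cdot> star y \<cdot> (y \<cdot> s)"
    using assoc[OF xy a(2,3)] x by simp
  then show "x \<cdot> s = y \<cdot> s \<or> sameL (x \<cdot> s) (y \<cdot> s)"
    using rank1_mult(1)[OF a(1,3)] rank1_mult(1)[OF a(2,3)] rank1_mult(2)[OF xy ys] l by (simp add: sameL_def)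
qed (auto simp: sameL_def)

lemma sameR_congruence: "congruence (ideal r) (Par r sameR)"
proof (rule Par_congruence)
  fix x y s A B D assume a: "ar A B x" "ar A B y" "ar B D s" and l: "sameR x y"
  then show "x \<cdot> s = y \<cdot> s \<or> sameR (x \<cdot> s) (y \<cdot> s)"
    using rank1_mult(1)[OF a(1,3)] rank1_mult(1)[OF a(2,3)] by (simp add: sameR_def)
next
  fix x y s A B D assume a: "ar A B x" "ar A B y" "ar D A s" and l: "sameR x y"
  have x: "x = y \<cdot> (star y \<cdot> x)"
    using assoc[OF a(2) ar_star[OF a(2)] a(1)] mult_star_self[OF a(2)] proj_left[OF a(1) arD(11)[OF a(1)]] l by (simp add: sameR_def)
  note yx = ar_mult[OF ar_star[OF a(2)] a(1)] and sy = ar_mult[OF a(3,2)]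
  have "s \<cdot> x = s \<cdot> y \<cdot> (star y \<cdot> x)"
    using assoc[OF a(3,2) yx] x by simp
  then show "s \<cdot> x = s \<cdot> y \<or> sameR (s \<cdot> x) (s \<cdot> y)"
    using rank1_mult(2)[OF a(3,1)] rank1_mult(2)[OF a(3,2)] rank1_mult(1)[OF sy yx] l by (simp add: sameR_def)
qed (auto simp: sameR_def)

lemma Nabla_Par: "Nabla (ideal r) = Par r (\<lambda>x y. True)"
proof (intro equalityI subsetI)
  fix z assume "z \<in> Nabla (ideal r)"
  then obtain x y where z: "z = (x, y)" "x \<in> arr (ideal r)" "y \<in> arr (ideal r)" "src x = src y" "trg x = trg y"
    by (auto simp: Nabla_def parallel_def)
  obtain A B where x: "ar A B x" "enat (rank x) \<le> r" using z(2) by (rule ideal_memE)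
  obtain A' B' where y: "ar A' B' y" "enat (rank y) \<le> r" using z(3) by (rule ideal_memE)
  have "ar A B y" using y(1) z(4,5) arD(9,10)[OF x(1)] arD(9,10)[OF y(1)] by simp
  then show "z \<in> Par r (\<lambda>x y. True)" using z(1) x y Par_iff[of A B x y] by simp
next
  fix z assume "z \<in> Par r (\<lambda>x y. True)"
  then obtain x y A B where z: "z = (x, y)" "ar A B x" "ar A B y" "enat (rank x) \<le> r" "enat (rank y) \<le> r"
    by (auto simp: Par_def)
  then show "z \<in> Nabla (ideal r)"
    using ideal_memI arD(9,10)[OF z(2)] arD(9,10)[OF z(3)] by (simp add: Nabla_def parallel_def)
qed

lemma Delta_Par: "Delta (ideal r) = Par r (\<lambda>x y. False)"
proof (intro equalityI subsetI)
  fix z assume "z \<in> Delta (ideal r)"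
  then obtain x where z: "z = (x, x)" "x \<in> arr (ideal r)" by (auto simp: Delta_def)
  obtain A B where x: "ar A B x" "enat (rank x) \<le> r" using z(2) by (rule ideal_memE)
  then show "z \<in> Par r (\<lambda>x y. False)" using z(1) Par_iff[of A B x x] by simp
qed (auto simp: Delta_def Par_def intro: ideal_memI)

end

section \<open>Group H-classes and normal subgroups\<close>

context tl
begin

lemma ideal_infinity: "ideal \<infinity> = Q"
  by (simp add: ideal_def sub_psg_def rank_ideal_def)

lemma ex_anti:
  assumes pm: pm and AB: "A \<in> C" "B \<in> C" "pat A p" "pat B q" "card (defects A p) = card (defects B q)"
  obtains x where "ar A B x" "ncr (A\<inverse>) B x" "upf x = p" "dnf x = q"
proof -
  have "\<exists>x\<in>brauer_hom A B. ncr (A\<inverse>) B x \<and> upf x = p \<and> dnf x = q"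
    by (rule ex_ncr) (use AB C_lin pat_converse[OF C_lin[OF AB(1)] AB(3)] in \<open>simp_all add: fin_lin_converse\<close>)
  then obtain x where a: "x \<in> brauer_hom A B" "ncr (A\<inverse>) B x" "upf x = p" "dnf x = q" by blast
  have "ar A B x" unfolding ar_def using a pm AB by blast
  then show thesis by (rule that[OF _ a(2-4)])
qed

text \<open>Two transversals would have to be both order preserving and order reversing.\<close>

lemma both_signs_rank:
  assumes a: "ar A B \<alpha>" and n: "ncr A B \<alpha>" "ncr (A\<inverse>) B \<alpha>"
  shows "rank \<alpha> \<le> 1"
proof (rule ccontr)
  assume "\<not> rank \<alpha> \<le> 1"
  then have c: "\<not> card (defects A (upf \<alpha>)) \<le> Suc 0" using rank_up[OF a] by simp
  note h = arD(3)[OF a] and L = arD(5)[OF a] and M = arD(6)[OF a]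
  obtain a1 a2 where 12: "a1 \<in> defects A (upf \<alpha>)" "a2 \<in> defects A (upf \<alpha>)" "a1 \<noteq> a2"
    using c card_le_Suc0_iff_eq[OF finite_defects[OF L]] by blast
  have key: False if d: "x \<in> defects A (upf \<alpha>)" "y \<in> defects A (upf \<alpha>)" and lt: "pos A x < pos A y" for x y
  proof -
    obtain t where t: "\<And>a. a \<in> defects A (upf \<alpha>) ==> mate \<alpha> (Top a) = Bot (t a)" using bij_betw_defects[OF h] by metis
    have F: "x \<in> Field A" "y \<in> Field A" using d by (auto simp: defects_def)
    have 1: "pos B (t x) < pos B (t y)" by (rule ncr_transversals[OF h M n(1) t[OF d(1)] t[OF d(2)] F lt])
    note r = relabel[OF h, of "A\<inverse>" B]
    have lt': "pos (A\<inverse>) y < pos (A\<inverse>) x" using pos_converse[OF L F(1)] pos_converse[OF L F(2)] lt by simp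
    have "pos B (t y) < pos B (t x)"
      by (rule ncr_transversals[OF r(1) M, of y _ x]) (use r n t d F lt' in simp_all)
    then show False using 1 by simp
  qed
  have "a1 \<in> Field A" "a2 \<in> Field A" using 12 by (auto simp: defects_def)
  then have "pos A a1 \<noteq> pos A a2" using pos_eq_iff[OF L] 12(3) by simp
  then show False using key[OF 12(1,2)] key[OF 12(2,1)] by linarith
qed

lemma ex_H_pair:
  assumes pm: pm and AB: "A \<in> C" "B \<in> C" "pat A p" "pat B q" "card (defects A p) = card (defects B q)"
    and n: "2 \<le> card (defects A p)"
  obtains x y where "ar A B x" "ar A B y" "x \<noteq> y" "upf x = p" "upf y = p" "dnf x = q" "dnf y = q"
proof -
  obtain x where x: "ar A B x" "ncr A B x" "upf x = p" "dnf x = q" using ex_ar[OF AB] by metis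
  obtain y where y: "ar A B y" "ncr (A\<inverse>) B y" "upf y = p" "dnf y = q" using ex_anti[OF pm AB] by metis
  have "x \<noteq> y" using both_signs_rank[OF x(1,2)] y(2) rank_up[OF x(1)] x(3) n by auto
  then show thesis using that x y by blast
qed

lemma same_H_eq:
  assumes "\<not> pm" "ar A B x" "ar A B y" "same_H q x y"
  shows "x = y"
proof -
  have "ncr A B x" "ncr A B y" using assms(1-3) unfolding ar_def by simp_all
  then show ?thesis using planar_eq[OF assms(2,3)] assms(4) by (simp add: same_H_def)
qed

text \<open>Green relations of the category are those of \<open>ideal \<infinity>\<close>, so the
  class consists of all partitions with the patterns of its identity.\<close>

lemma group_H_classE:
  assumes g: "group_H_class Q H" and q: "H \<subseteq> rank_class Q q"
  obtains A e where "ar A A e" "rank e = q" "e \<in> H" "one (group_of Q H) = e"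
    "H = {x. ar A A x \<and> same_H q e x}"
proof -
  define e where "e = one (group_of Q H)"
  have gr: "group (group_of Q H)" and H: "H \<in> arr Q // green_H Q" and dr: "\<And>x. x \<in> H ==> src x = trg x"
    using g by (auto simp: group_H_class_def)
  interpret G: group "group_of Q H" by (rule gr)
  have e: "e \<in> H" using G.one_closed by (simp add: e_def group_of_def)
  have "e \<in> arr Q" "rank e = q" using e q by (auto simp: rank_class_def)
  then obtain A B where AB: "ar A B e" using in_arr by blast
  have "A = B" using dr[OF e] arD(9,10)[OF AB] by simp
  with AB have a: "ar A A e" by simp
  obtain x0 where x0: "x0 \<in> arr Q" "H = green_H Q `` {x0}" using H by (auto simp: quotient_def)
  obtain A0 B0 where a0: "ar A0 B0 x0" using x0(1) in_arr by blast
  have gH: "(x0, y) \<in> green_H Q \<longleftrightarrow> ar A0 B0 y \<and> upf x0 = upf y \<and> dnf x0 = dnf y" for y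
  proof -
    have "(x0, y) \<in> green_H Q \<longleftrightarrow> y \<in> arr Q \<and> (x0, y) \<in> green_H Q" by (auto simp: green_H_def green_R_def)
    also have "\<dots> \<longleftrightarrow> ar A0 B0 y \<and> upf x0 = upf y \<and> dnf x0 = dnf y"
    proof -
      have "(x0, y) \<in> green_H Q \<longleftrightarrow> A0 = A' \<and> B0 = B' \<and> upf x0 = upf y \<and> dnf x0 = dnf y" if y: "ar A' B' y" for A' B'
        using green_R_iff[OF a0 _ y, of \<infinity>] green_L_iff[OF a0 _ y, of \<infinity>] by (auto simp: green_H_def ideal_infinity)
      then show ?thesis using in_arr by blast
    qed
    finally show ?thesis .
  qed
  have HE: "H = {x. ar A0 B0 x \<and> upf x0 = upf x \<and> dnf x0 = dnf x}" unfolding x0(2) using gH by auto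
  have "A0 = A" "B0 = A" "upf x0 = upf e" "dnf x0 = dnf e" using e HE ar_unique_objs[OF _ a] by auto
  then have HH: "H = {x. ar A A x \<and> same_H q e x}"
    unfolding HE using \<open>rank e = q\<close> rank_up[OF a] rank_up[of A A] by (auto simp: same_H_def)
  show thesis by (rule that[OF a \<open>rank e = q\<close> e e_def[symmetric] HH])
qed

text \<open>From rank 3 on, the planar and the anti-planar partition with given patterns are
  different.\<close>

lemma card_H_class:
  assumes g: "group_H_class Q H" and q: "H \<subseteq> rank_class Q q" "3 \<le> q"
  shows "card H = (if pm then 2 else 1)"
proof -
  obtain A e where e: "ar A A e" "rank e = q" "e \<in> H" "H = {x. ar A A x \<and> same_H q e x}"
    by (rule group_H_classE[OF g q(1)])
  show ?thesis
  proof (cases pm)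
    case False
    have "H = {e}"
    proof (intro equalityI subsetI)
      fix x assume "x \<in> H"
      then have x: "ar A A x" "same_H q e x" unfolding e(4) by simp_all
      show "x \<in> {e}" using same_H_eq[OF False e(1) x] by simp
    qed (use e(3) in simp)
    then show ?thesis using False by simp
  next
    case True
    have c: "card (defects A (upf e)) = card (defects A (dnf e))" "2 \<le> card (defects A (upf e))"
      using rank_up[OF e(1)] rank_dn[OF e(1)] e(2) q(2) by simp_all
    obtain x y where xy: "ar A A x" "ar A A y" "x \<noteq> y" "upf x = upf e" "upf y = upf e" "dnf x = dnf e" "dnf y = dnf e"
      by (rule ex_H_pair[OF True arD(1,1)[OF e(1)] arD(11)[OF e(1)] pat_dnf[OF e(1)] c])
    have "H = {x, y}"
    proof (intro equalityI subsetI)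
      fix z assume "z \<in> H"
      then have z: "ar A A z" "same_H q e z" unfolding e(4) by simp_all
      show "z \<in> {x, y}" using H_class_card[OF xy(1,2) z(1)] xy z(2) by (auto simp: same_H_def)
    next
      fix z assume "z \<in> {x, y}"
      then show "z \<in> H" unfolding e(4) using xy e(2) rank_up[OF xy(1)] rank_up[OF xy(2)] rank_up[OF e(1)]
        by (auto simp: same_H_def)
    qed
    then show ?thesis using True xy(3) by simp
  qed
qed

lemma group_order_cyclic:
  assumes g: "group_H_class Q H" and q: "H \<subseteq> rank_class Q q" "3 \<le> q"
  shows "order (group_of Q H) = (if pm then 2 else 1)" "cyclic_group (group_of Q H)"
proof -
  have gr: "group (group_of Q H)" using g by (simp add: group_H_class_def)
  interpret G: group "group_of Q H" by (rule gr)
  have cH: "carrier (group_of Q H) = H" by (simp add: group_of_def)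
  show "order (group_of Q H) = (if pm then 2 else 1)" using card_H_class[OF g q] by (simp add: order_def cH)
  let ?e = "one (group_of Q H)"
  have e: "?e \<in> H" using G.one_closed cH by simp
  have "\<exists>x\<in>H. H \<subseteq> {?e, x}"
  proof (cases "card H = 1")
    case True
    then show ?thesis using e by (metis card_1_singletonE insertCI singletonD subsetI)
  next
    case False
    then have "card H = 2" using card_H_class[OF g q] by (auto split: if_splits)
    then obtain x y where "H = {x, y}" by (auto simp: card_2_iff)
    then show ?thesis using e by auto
  qed
  then obtain x where x: "x \<in> H" "H \<subseteq> {?e, x}" by blast
  have "carrier (group_of Q H) = range (\<lambda>n::int. x [^]\<^bsub>group_of Q H\<^esub> n)"
  proof
    show "carrier (group_of Q H) \<subseteq> range (\<lambda>n::int. x [^]\<^bsub>group_of Q H\<^esub> n)"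
    proof
      fix z assume "z \<in> carrier (group_of Q H)"
      then have "z = x [^]\<^bsub>group_of Q H\<^esub> (0::int) \<or> z = x [^]\<^bsub>group_of Q H\<^esub> (1::int)"
        using x cH G.int_pow_1[of x] by auto
      then show "z \<in> range (\<lambda>n::int. x [^]\<^bsub>group_of Q H\<^esub> n)" by blast
    qed
    show "range (\<lambda>n::int. x [^]\<^bsub>group_of Q H\<^esub> n) \<subseteq> carrier (group_of Q H)" using x(1) cH by auto
  qed
  then show "cyclic_group (group_of Q H)" using G.cyclic_group x(1) cH by auto
qed

lemma normal_cases:
  assumes g: "group_H_class Q H" and q: "H \<subseteq> rank_class Q q" "3 \<le> q" and N: "N \<lhd> group_of Q H"
  shows "N = {one (group_of Q H)} \<or> N = H \<and> pm"
proof -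
  have cH: "carrier (group_of Q H) = H" by (simp add: group_of_def)
  have s: "subgroup N (group_of Q H)" using N by (rule normal_imp_subgroup)
  have sub: "N \<subseteq> H" "one (group_of Q H) \<in> N" using subgroup.subset[OF s] subgroup.one_closed[OF s] cH by simp_all
  have c: "card H = (if pm then 2 else 1)" by (rule card_H_class[OF g q])
  then have fin: "finite H" by (metis card.infinite zero_neq_numeral zero_neq_one)
  show ?thesis
  proof (cases pm)
    case False
    then have "card H = 1" using c by simp
    then show ?thesis using sub by (metis card_1_singletonE subset_singletonD empty_iff insertE)
  next
    case True
    then have "card H = 2" using c by simp
    then obtain x y where "H = {x, y}" by (auto simp: card_2_iff)
    moreover have "N = {e} \<or> N = {x, y}" if "e \<in> N" "N \<subseteq> {x, y}" for e using that by auto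
    ultimately show ?thesis using sub True by simp
  qed
qed

lemma normal_exist:
  assumes g: "group_H_class Q H"
  shows "{one (group_of Q H)} \<lhd> group_of Q H" "H \<lhd> group_of Q H"
proof -
  have gr: "group (group_of Q H)" using g by (simp add: group_H_class_def)
  interpret G: group "group_of Q H" by (rule gr)
  have cH: "carrier (group_of Q H) = H" by (simp add: group_of_def)
  show "{one (group_of Q H)} \<lhd> group_of Q H" by (rule G.one_is_normal)
  have "carrier (group_of Q H) \<lhd> group_of Q H"
    by (rule G.normal_invI[OF G.subgroup_self]) simp
  then show "H \<lhd> group_of Q H" using cH by simp
qed

lemma left_mults_same_H:
  assumes f: "f \<in> left_mults (ideal r) A" and x: "ar A B x" and y: "ar A B y" and h: "same_H q x y"
  obtains A' where "ar A' B (f x)" "ar A' B (f y)" "rank (f x) \<le> q" "rank (f x) = q ==> same_H q (f x) (f y)"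
proof (cases "f = id")
  case True
  then show thesis using that x y h by (auto simp: same_H_def)
next
  case False
  then obtain a where a: "a \<in> arr (ideal r)" "trg a = A" "f = brauer_mult a" using f by (auto simp: left_mults_def)
  obtain D E where "ar D E a" using a(1) by (rule ideal_memE)
  then have a': "ar D A a" using a(2) arD(10) by metis
  show thesis
    using that[of D] ar_mult[OF a' x] ar_mult[OF a' y] rank_right[OF a' x] same_H_left(2)[OF x y a' h] h a(3)
    by (simp add: same_H_def)
qed

lemma right_mults_same_H:
  assumes f: "f \<in> right_mults (ideal r) B" and x: "ar A B x" and y: "ar A B y" and h: "same_H q x y"
  obtains B' where "ar A B' (f x)" "ar A B' (f y)" "rank (f x) \<le> q" "rank (f x) = q ==> same_H q (f x) (f y)"
proof (cases "f = id")
  case True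
  then show thesis using that x y h by (auto simp: same_H_def)
next
  case False
  then obtain a where a: "a \<in> arr (ideal r)" "src a = B" "f = (\<lambda>x. x \<cdot> a)" using f by (auto simp: right_mults_def)
  obtain D E where "ar D E a" using a(1) by (rule ideal_memE)
  then have a': "ar B E a" using a(2) arD(9) by metis
  show thesis
    using that[of E] ar_mult[OF x a'] ar_mult[OF y a'] rank_left[OF x a'] same_H_right(2)[OF x y a' h] h a(3)
    by (simp add: same_H_def)
qed

lemma multI:
  "ar D A a ==> enat (rank a) \<le> r ==> brauer_mult a \<in> left_mults (ideal r) A"
  "ar A D a ==> enat (rank a) \<le> r ==> (\<lambda>x. x \<cdot> a) \<in> right_mults (ideal r) A"
proof -
  show "brauer_mult a \<in> left_mults (ideal r) A" if "ar D A a" "enat (rank a) \<le> r"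
    using ideal_memI[OF that] arD(10)[OF that(1)] by (auto simp: left_mults_def)
  show "(\<lambda>x. x \<cdot> a) \<in> right_mults (ideal r) A" if "ar A D a" "enat (rank a) \<le> r"
    using ideal_memI[OF that] arD(9)[OF that(1)] by (auto simp: right_mults_def)
qed

lemma nu_trivial: "nu (ideal r) {e} \<subseteq> Delta (ideal r)"
  by (auto simp: nu_def Delta_def green_J_def)

text \<open>Any x of rank q is \<open>a \<cdot> f \<cdot> b\<close>, where a and b link its patterns
  to those of e and f lies in \<open>H\<close>; the same a and b serve for all partitions with these
  patterns, so each pair arises from a pair in \<open>H\<close>.\<close>

lemma nu_full:
  assumes r: "enat q \<le> r" and e: "ar A A e" "rank e = q" "e \<in> H" "H = {x. ar A A x \<and> same_H q e x}"
  shows "nu (ideal r) H = {(x, y). (\<exists>A B. ar A B x \<and> ar A B y) \<and> same_H q x y}"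
proof -
  have HD: "ar A A x" "same_H q e x" "rank x = q" if "x \<in> H" for x using that unfolding e(4) by (auto simp: same_H_def)
  have J: "z \<in> green_J (ideal r) `` H \<longleftrightarrow> rank z = q" if z: "ar D E z" for z D E
  proof
    assume "z \<in> green_J (ideal r) `` H"
    then obtain x where x: "x \<in> H" "(x, z) \<in> green_J (ideal r)" by auto
    then have "enat (rank z) \<le> r" by (auto simp: green_J_def in_ideal)
    then show "rank z = q" using green_J_iff[OF HD(1)[OF x(1)] _ z] x HD(3)[OF x(1)] r by simp
  next
    assume "rank z = q"
    then have "(e, z) \<in> green_J (ideal r)" using green_J_iff[OF e(1) _ z] e(2) r by simp
    then show "z \<in> green_J (ideal r) `` H" using e(3) by blast
  qed
  show ?thesis
  proof (intro equalityI subsetI)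
    fix z assume "z \<in> nu (ideal r) H"
    then obtain x y f g where z: "z = (g (f x), g (f y))" "x \<in> H" "y \<in> H"
      "f \<in> left_mults (ideal r) (dm (ideal r) x)" "g \<in> right_mults (ideal r) (rn (ideal r) x)"
      "g (f x) \<in> green_J (ideal r) `` H" unfolding nu_def mem_Collect_eq by blast
    have f: "f \<in> left_mults (ideal r) A" and g: "g \<in> right_mults (ideal r) A"
      using z(4,5) arD(9,10)[OF HD(1)[OF z(2)]] by simp_all
    have h: "same_H q x y" using HD(2)[OF z(2)] HD(2)[OF z(3)] by (auto simp: same_H_def)
    obtain A' where A': "ar A' A (f x)" "ar A' A (f y)" "rank (f x) \<le> q" "rank (f x) = q ==> same_H q (f x) (f y)"
      using left_mults_same_H[OF f HD(1)[OF z(2)] HD(1)[OF z(3)] h] by metis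
    obtain D E where gfx: "ar D E (g (f x))" "rank (g (f x)) \<le> rank (f x)"
      using multsE[OF HD(1)[OF z(2)] f g] by metis
    have rz: "rank (g (f x)) = q" using J[OF gfx(1)] z(6) by simp
    then have h2: "same_H q (f x) (f y)" using A' gfx(2) by simp
    obtain B' where B': "ar A' B' (g (f x))" "ar A' B' (g (f y))" "rank (g (f x)) = q ==> same_H q (g (f x)) (g (f y))"
      using right_mults_same_H[OF g A'(1,2) h2] by metis
    then show "z \<in> {(x, y). (\<exists>A B. ar A B x \<and> ar A B y) \<and> same_H q x y}" using z(1) rz by blast
  next
    fix z assume "z \<in> {(x, y). (\<exists>A B. ar A B x \<and> ar A B y) \<and> same_H q x y}"
    then obtain x y D E where z: "z = (x, y)" "ar D E x" "ar D E y" "same_H q x y" by auto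
    have rk: "rank x = q" "rank y = q" using z(4) by (auto simp: same_H_def)
    obtain a where a: "ar D A a" "upf a = upf x" "dnf a = upf e" "rank a = q"
      by (rule ex_ar[OF arD(1)[OF z(2)] arD(1)[OF e(1)] arD(11)[OF z(2)] arD(11)[OF e(1)]])
        (use rank_up[OF z(2)] rank_up[OF e(1)] rk e(2) in auto)
    obtain b where b: "ar A E b" "upf b = dnf e" "dnf b = dnf x" "rank b = q"
      by (rule ex_ar[OF arD(1)[OF e(1)] arD(2)[OF z(2)] pat_dnf[OF e(1)] pat_dnf[OF z(2)]])
        (use rank_dn[OF z(2)] rank_dn[OF e(1)] rk e(2) in auto)
    note sa = ar_star[OF a(1)] and sb = ar_star[OF b(1)]
    have fac: "\<exists>f\<in>H. w = a \<cdot> f \<cdot> b" if w: "ar D E w" "upf w = upf x" "dnf w = dnf x" for w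
    proof -
      let ?f = "star a \<cdot> w \<cdot> star b"
      note aw = ar_mult[OF sa w(1)] and awb = ar_mult[OF ar_mult[OF sa w(1)] sb]
      note m1 = match[OF sa w(1)] and m2 = match[OF aw sb]
      have e1: "dnf (star a) = upf w" using up_star[OF a(1)] a w by simp
      have e2: "dnf (star a \<cdot> w) = upf (star b)" using m1[OF e1] up_star[OF b(1)] b w by simp
      have "upf ?f = upf e" "dnf ?f = dnf e" "rank ?f = q"
        using m1[OF e1] m2[OF e2] up_star[OF a(1)] up_star[OF b(1)] a b ar_rank_star[OF a(1)] by simp_all
      then have "?f \<in> H" unfolding e(4) using awb e(2) by (simp add: same_H_def)
      moreover have "w = a \<cdot> ?f \<cdot> b"
      proof -
        have "a \<cdot> (star a \<cdot> w \<cdot> star b) = a \<cdot> (star a \<cdot> w) \<cdot> star b"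
          using assoc[OF a(1) aw sb] by simp
        also have "a \<cdot> (star a \<cdot> w) = a \<cdot> star a \<cdot> w" using assoc[OF a(1) sa w(1)] by simp
        also have "\<dots> = w" using mult_star_self[OF a(1)] proj_left[OF w(1) arD(11)[OF w(1)]] a(2) w(2) by simp
        finally have "a \<cdot> ?f = w \<cdot> star b" .
        then have "a \<cdot> ?f \<cdot> b = w \<cdot> (star b \<cdot> b)" using assoc[OF w(1) sb b(1)] by simp
        then show ?thesis using star_mult_self[OF b(1)] proj_right[OF w(1) pat_dnf[OF w(1)]] b(3) w(3) by simp
      qed
      ultimately show ?thesis by blast
    qed
    obtain f1 where f1: "f1 \<in> H" "x = a \<cdot> f1 \<cdot> b" using fac[OF z(2)] by blast
    obtain f2 where f2: "f2 \<in> H" "y = a \<cdot> f2 \<cdot> b" using fac[OF z(3)] z(4) by (auto simp: same_H_def)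
    have "brauer_mult a \<in> left_mults (ideal r) (dm (ideal r) f1)"
      "(\<lambda>x. x \<cdot> b) \<in> right_mults (ideal r) (rn (ideal r) f1)"
      using multI(1)[OF a(1)] multI(2)[OF b(1)] a(4) b(4) r arD(9,10)[OF HD(1)[OF f1(1)]] by simp_all
    moreover have "x \<in> green_J (ideal r) `` H" "y \<in> green_J (ideal r) `` H" using J z(2,3) rk by blast+
    ultimately show "z \<in> nu (ideal r) H"
      unfolding nu_def mem_Collect_eq z(1) using f1 f2
      by (intro exI[of _ f1] exI[of _ f2] exI[of _ "brauer_mult a"] exI[of _ "\<lambda>x. x \<cdot> b"]) simp
  qed
qed

lemma in_rank_ideal: "x \<in> rank_ideal Q (enat q) \<longleftrightarrow> (\<exists>A B. ar A B x) \<and> rank x \<le> q"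
  by (simp add: rank_ideal_def in_arr)

lemma Rees_Par:
  assumes "enat q \<le> r"
  shows "Rees (ideal r) (rank_ideal Q (enat q)) = Par r (low q False)"
proof (intro equalityI subsetI)
  fix z assume "z \<in> Rees (ideal r) (rank_ideal Q (enat q))"
  then have "z \<in> Nabla (sub_psg (ideal r) (rank_ideal Q (enat q))) \<or> z \<in> Delta (ideal r)" by (auto simp: Rees_def)
  then show "z \<in> Par r (low q False)"
  proof
    assume "z \<in> Delta (ideal r)"
    then show ?thesis by (auto simp: Delta_Par Par_def)
  next
    assume "z \<in> Nabla (sub_psg (ideal r) (rank_ideal Q (enat q)))"
    then obtain x y where z: "z = (x, y)" "x \<in> rank_ideal Q (enat q)" "y \<in> rank_ideal Q (enat q)" "src x = src y" "trg x = trg y"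
      by (auto simp: Nabla_def parallel_def sub_psg_def ideal_def)
    obtain A B where x: "ar A B x" "rank x \<le> q" using z(2) in_rank_ideal by blast
    obtain A' B' where y: "ar A' B' y" "rank y \<le> q" using z(3) in_rank_ideal by blast
    have "ar A B y" using y(1) z(4,5) arD(9,10)[OF x(1)] arD(9,10)[OF y(1)] by simp
    then show ?thesis using z(1) x y Par_iff[of A B x y r] enat_le_trans[OF _ assms] by (simp add: low_def)
  qed
next
  fix z assume "z \<in> Par r (low q False)"
  then obtain x y A B where z: "z = (x, y)" "ar A B x" "ar A B y" "enat (rank x) \<le> r" "x = y \<or> rank x \<le> q \<and> rank y \<le> q"
    by (auto simp: Par_def low_def)
  show "z \<in> Rees (ideal r) (rank_ideal Q (enat q))"
  proof (cases "x = y")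
    case True
    then have "z \<in> Delta (ideal r)" using z Par_iff[of A B x x r] by (simp add: Delta_Par)
    then show ?thesis by (simp add: Rees_def)
  next
    case False
    then have "x \<in> rank_ideal Q (enat q)" "y \<in> rank_ideal Q (enat q)" using z in_rank_ideal by auto
    then have "z \<in> Nabla (sub_psg (ideal r) (rank_ideal Q (enat q)))"
      using z(1) arD(9,10)[OF z(2)] arD(9,10)[OF z(3)] by (simp add: Nabla_def parallel_def sub_psg_def ideal_def)
    then show ?thesis by (simp add: Rees_def)
  qed
qed

text \<open>Only triviality of \<open>N\<close> matters: the trivial subgroup contributes equal
  pairs only, and otherwise \<open>N\<close> is the full class.\<close>

lemma Rees_normal_Par:
  assumes r: "enat (q + 2) \<le> r" and g: "group_H_class Q H" "H \<subseteq> rank_class Q (q + 2)" "1 \<le> q" and N: "N \<lhd> group_of Q H"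
  shows "Rees_normal (ideal r) (rank_ideal Q (enat q)) N = Par r (low q (N \<noteq> {one (group_of Q H)}))"
proof -
  have r': "enat q \<le> r" by (rule enat_le_trans[OF _ r]) simp
  obtain A e where e: "ar A A e" "rank e = q + 2" "e \<in> H" "one (group_of Q H) = e" "H = {x. ar A A x \<and> same_H (q + 2) e x}"
    by (rule group_H_classE[OF g(1,2)])
  show ?thesis
  proof (cases "N = {one (group_of Q H)}")
    case True
    have "Delta (ideal r) \<subseteq> Rees (ideal r) (rank_ideal Q (enat q))" by (auto simp: Rees_def)
    then show ?thesis using True nu_trivial[of r] Rees_Par[OF r'] by (auto simp: Rees_normal_def)
  next
    case False
    then have NH: "N = H" using normal_cases[OF g(1,2) _ N] g(3) by auto
    have "Par r (low q False) \<union> {(x, y). (\<exists>A B. ar A B x \<and> ar A B y) \<and> same_H (q + 2) x y} = Par r (low q True)"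
      using r by (auto simp: Par_def low_def same_H_def)
    then show ?thesis using False NH nu_full[OF r e(1-3,5)] Rees_Par[OF r'] by (simp add: Rees_normal_def)
  qed
qed

text \<open>For parallel elements of rank 1 each of the two Green relations compares a single
  pattern.\<close>

lemma lambda_Par:
  assumes "enat 1 \<le> r"
  shows "lambda_cong (ideal r) (rank_ideal Q (enat 1)) = Par r sameL"
    and "rho_cong (ideal r) (rank_ideal Q (enat 1)) = Par r sameR"
proof -
  have r1: "x \<in> rank_ideal Q (enat 1) \<longleftrightarrow> rank x = 1" if "ar A B x" for A B x
    using in_rank_ideal[of x 1] that rank_ge1[OF that] by auto
  have mem: "\<exists>A B. ar A B x \<and> ar A B y \<and> rank x = 1 \<and> rank y = 1"
    if m: "x \<in> rank_ideal Q (enat 1)" "y \<in> rank_ideal Q (enat 1)" "parallel (ideal r) x y" for x y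
  proof -
    obtain A B where x: "ar A B x" using m(1) in_rank_ideal by blast
    obtain A' B' where y: "ar A' B' y" using m(2) in_rank_ideal by blast
    have "ar A B y" using y m(3) arD(9,10)[OF x] arD(9,10)[OF y] by (simp add: parallel_def)
    then show ?thesis using x y r1 m by blast
  qed
  have par: "parallel (ideal r) x y" if "ar A B x" "ar A B y" for A B x y
    using arD(9,10)[OF that(1)] arD(9,10)[OF that(2)] by (simp add: parallel_def)
  have G: "(x, y) \<in> green_L (ideal r) \<longleftrightarrow> dnf x = dnf y" "(x, y) \<in> green_R (ideal r) \<longleftrightarrow> upf x = upf y"
    if "ar A B x" "ar A B y" "rank x = 1" "rank y = 1" for A B x y
    using green_L_iff[OF that(1) _ that(2)] green_R_iff[OF that(1) _ that(2)] that assms by simp_all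
  have 1: "{(x, y) \<in> rank_ideal Q (enat 1) \<times> rank_ideal Q (enat 1). parallel (ideal r) x y \<and> (x, y) \<in> green_L (ideal r)} =
    {(x, y). \<exists>A B. ar A B x \<and> ar A B y \<and> sameL x y}" (is "?X = ?Y")
  proof (intro equalityI subsetI)
    fix z assume "z \<in> ?X"
    then obtain x y where z: "z = (x, y)" "x \<in> rank_ideal Q (enat 1)" "y \<in> rank_ideal Q (enat 1)"
      "parallel (ideal r) x y" "(x, y) \<in> green_L (ideal r)" by auto
    then show "z \<in> ?Y" using mem[OF z(2-4)] G(1) unfolding sameL_def by blast
  next
    fix z assume "z \<in> ?Y"
    then obtain x y A B where "z = (x, y)" "ar A B x" "ar A B y" "sameL x y" by auto
    then show "z \<in> ?X" using r1 par G(1) by (auto simp: sameL_def)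
  qed
  have 2: "{(x, y) \<in> rank_ideal Q (enat 1) \<times> rank_ideal Q (enat 1). parallel (ideal r) x y \<and> (x, y) \<in> green_R (ideal r)} =
    {(x, y). \<exists>A B. ar A B x \<and> ar A B y \<and> sameR x y}" (is "?X = ?Y")
  proof (intro equalityI subsetI)
    fix z assume "z \<in> ?X"
    then obtain x y where z: "z = (x, y)" "x \<in> rank_ideal Q (enat 1)" "y \<in> rank_ideal Q (enat 1)"
      "parallel (ideal r) x y" "(x, y) \<in> green_R (ideal r)" by auto
    then show "z \<in> ?Y" using mem[OF z(2-4)] G(2) unfolding sameR_def by blast
  next
    fix z assume "z \<in> ?Y"
    then obtain x y A B where "z = (x, y)" "ar A B x" "ar A B y" "sameR x y" by auto
    then show "z \<in> ?X" using r1 par G(2) by (auto simp: sameR_def)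
  qed
  have U: "{(x, y). \<exists>A B. ar A B x \<and> ar A B y \<and> P x y} \<union> Delta (ideal r) = Par r P"
    if "\<And>x y. P x y ==> rank x = 1 \<and> rank y = 1" for P
    using that assms by (fastforce simp: Delta_Par Par_def)
  show "lambda_cong (ideal r) (rank_ideal Q (enat 1)) = Par r sameL"
    unfolding lambda_cong_def 1 by (rule U) (simp add: sameL_def)
  show "rho_cong (ideal r) (rank_ideal Q (enat 1)) = Par r sameR"
    unfolding rho_cong_def 2 by (rule U) (simp add: sameR_def)
qed

end

section \<open>Classification of the congruences\<close>

lemma (in tl) nab_mono: "nab q \<sigma> ==> q' \<le> q ==> nab q' \<sigma>"
  unfolding nab_def by (meson order_trans)

context tl_cong
begin

lemma eq_Par:
  assumes "\<And>A B x y. ar A B x ==> ar A B y ==> enat (rank x) \<le> r ==> enat (rank y) \<le> r ==> x \<noteq> y ==> (x, y) \<in> \<sigma> \<longleftrightarrow> P x y"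
  shows "\<sigma> = Par r P"
proof (intro equalityI subsetI)
  fix z assume z: "z \<in> \<sigma>"
  obtain x y where xy: "z = (x, y)" by (cases z)
  obtain A B where a: "ar A B x" "ar A B y" "enat (rank x) \<le> r" "enat (rank y) \<le> r"
    using members z unfolding xy by metis
  then show "z \<in> Par r P" using assms[OF a] z xy Par_iff[OF a(1,2)] by blast
next
  fix z assume "z \<in> Par r P"
  then obtain x y A B where a: "z = (x, y)" "ar A B x" "ar A B y" "enat (rank x) \<le> r" "enat (rank y) \<le> r" "x = y \<or> P x y"
    by (auto simp: Par_def)
  then show "z \<in> \<sigma>" using assms[OF a(2-5)] refl[OF a(2,4)] by blast
qed

lemma pair_cases:
  assumes r: "enat 3 \<le> r" and s: "(x, y) \<in> \<sigma>" "x \<noteq> y" and a: "ar A B x" and q: "rank x = q" "rank y \<le> q" "3 \<le> q"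
  shows "nab q \<sigma> \<or> same_H q x y \<and> nab (q - 2) \<sigma>"
proof (cases "upf x = upf y \<and> dnf x = dnf y")
  case True
  then have "same_H q x y" using q(1) rank_up[OF a] rank_up[OF member(1)[OF s(1) a]] by (simp add: same_H_def)
  then show ?thesis using nab_from_H_pair(1)[OF r s(1) a q(1,3) s(2)] True by blast
next
  case False
  then show ?thesis using nab_from_pair[OF r tl_cong_axioms s(1) a q(1,3,2)] by blast
qed

text \<open>If not everything collapses, the ranks q such that everything of rank at most q is
  related are bounded, and the largest odd one, m, determines \<sigma> up to the pairs of rank m + 2
  with equal patterns. If even rank 1 does not collapse, all proper pairs have rank 1 and they all
  differ on the same side only.\<close>

lemma congruence_cases:
  assumes r: "enat 3 \<le> r"
  shows "\<sigma> = Par r (\<lambda>x y. False) \<or> \<sigma> = Par r sameL \<or> \<sigma> = Par r sameR \<or> \<sigma> = Par r (\<lambda>x y. True) \<or>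
    (\<exists>q h. odd q \<and> enat q < r \<and> (h --> pm) \<and> \<sigma> = Par r (low q h))"
proof (cases "\<forall>A B x. ar A B x \<and> enat (rank x) \<le> r --> nab (rank x) \<sigma>")
  case True
  have "\<sigma> = Par r (\<lambda>x y. True)"
  proof (rule eq_Par)
    fix A B x y assume a: "ar A B x" "ar A B y" "enat (rank x) \<le> r" "enat (rank y) \<le> r"
    have "nab (max (rank x) (rank y)) \<sigma>" using True a by (simp add: max_def)
    then show "(x, y) \<in> \<sigma> \<longleftrightarrow> True" using nabD[OF _ a(1,2)] by simp
  qed
  then show ?thesis by simp
next
  case False
  then obtain A0 B0 x0 where x0: "ar A0 B0 x0" "enat (rank x0) \<le> r" "\<not> nab (rank x0) \<sigma>" by blast
  show ?thesis
  proof (cases "nab 1 \<sigma>")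
    case True
    let ?T = "{q. odd q \<and> nab q \<sigma>}"
    have lt: "q < rank x0" if "nab q \<sigma>" for q using nab_mono[OF that, of "rank x0"] x0(3) by (meson not_less)
    have fin: "finite ?T" by (rule finite_subset[of _ "{..<rank x0}"]) (use lt in auto)
    define m where "m = Max ?T"
    have "1 \<in> ?T" using True by simp
    then have "?T \<noteq> {}" by blast
    then have "m \<in> ?T" unfolding m_def by (rule Max_in[OF fin])
    then have m: "odd m" "nab m \<sigma>" by simp_all
    have max: "q \<le> m" if "odd q" "nab q \<sigma>" for q using Max_ge[OF fin] that by (simp add: m_def)
    have mr: "enat m < r" using lt[OF m(2)] x0(2) by (metis enat_ord_simps(2) order_less_le_trans)
    \<comment> \<open>A pair above rank m cannot collapse its own rank, by maximality, so it has
      equal patterns and collapses everything two ranks below; this leaves only rank m + 2.\<close>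
    have big: "same_H (m + 2) x y" if s: "(x, y) \<in> \<sigma>" "x \<noteq> y" "ar A B x" "rank y \<le> rank x" "m < rank x" for x y A B
    proof -
      have o: "odd (rank x)" by (rule rank_odd[OF s(3)])
      then have 3: "3 \<le> rank x" using s(5) m(1) by (cases "rank x = 1 \<or> rank x = 2") (auto elim!: oddE)
      have "\<not> nab (rank x) \<sigma>" using max[OF o] s(5) by auto
      then have h: "same_H (rank x) x y" "nab (rank x - 2) \<sigma>" using pair_cases[OF r s(1,2,3) HOL.refl s(4) 3] by simp_all
      have "rank x - 2 \<le> m" using max[OF _ h(2)] o 3 by simp
      then have "rank x = m + 2" using odd_less_add2[OF o m(1)] s(5) 3 by linarith
      then show ?thesis using h(1) by simp
    qed
    define h where "h \<longleftrightarrow> (\<exists>A B x y. (x, y) \<in> \<sigma> \<and> x \<noteq> y \<and> ar A B x \<and> same_H (m + 2) x y)"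
    have hs: "h" if "(x, y) \<in> \<sigma>" "x \<noteq> y" "ar A B x" "same_H (m + 2) x y" for x y A B
      unfolding h_def using that by blast
    have m3: "3 \<le> m + 2" using m(1) by (auto elim!: oddE)
    have hpm: "h --> pm"
    proof
      assume h
      then obtain A B x y where "(x, y) \<in> \<sigma>" "x \<noteq> y" "ar A B x" "same_H (m + 2) x y" unfolding h_def by blast
      then show pm using same_H_eq member(1) by metis
    qed
    have "\<sigma> = Par r (low m h)"
    proof (rule eq_Par)
      fix A B x y assume a: "ar A B x" "ar A B y" "enat (rank x) \<le> r" "enat (rank y) \<le> r" "x \<noteq> y"
      show "(x, y) \<in> \<sigma> \<longleftrightarrow> low m h x y"
      proof
        assume s: "(x, y) \<in> \<sigma>"
        have "same_H (m + 2) x y" if k: "\<not> (rank x \<le> m \<and> rank y \<le> m)"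
        proof (cases "rank y \<le> rank x")
          case True
          then show ?thesis using big[OF s a(5,1) True] k by linarith
        next
          case False
          then have "same_H (m + 2) y x" using big[OF sym[OF s] a(5)[symmetric] a(2)] k by linarith
          then show ?thesis by (simp add: same_H_def)
        qed
        then show "low m h x y" using hs[OF s a(5,1)] by (auto simp: low_def)
      next
        assume l: "low m h x y"
        show "(x, y) \<in> \<sigma>"
        proof (cases "rank x \<le> m \<and> rank y \<le> m")
          case True
          then show ?thesis using nabD[OF m(2) a(1,2)] by simp
        next
          case False
          then have h: h "same_H (m + 2) x y" using l by (auto simp: low_def)
          then obtain A' B' x' y' where p: "(x', y') \<in> \<sigma>" "x' \<noteq> y'" "ar A' B' x'" "same_H (m + 2) x' y'" unfolding h_def by blast
          show ?thesis
            by (rule nab_from_H_pair(2)[OF r p(1,3) _ m3 p(2) _ _ a(1,2)]) (use p(4) h(2) in \<open>simp_all add: same_H_def\<close>)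
        qed
      qed
    qed
    then show ?thesis using m(1) mr hpm by blast
  next
    case False
    have one: "rank x = 1" if s: "(x, y) \<in> \<sigma>" "x \<noteq> y" "ar A B x" "rank y \<le> rank x" for x y A B
    proof (rule ccontr)
      assume "rank x \<noteq> 1"
      then have "3 \<le> rank x" using rank_odd[OF s(3)] by (cases "rank x = 0 \<or> rank x = 2") auto
      then have "nab 1 \<sigma>" using pair_cases[OF r s(1,2,3) HOL.refl s(4)] nab_mono[of _ \<sigma> 1] by force
      then show False using False by simp
    qed
    have ones: "rank x = 1 \<and> rank y = 1" if s: "(x, y) \<in> \<sigma>" "x \<noteq> y" "ar A B x" "ar A B y" for x y A B
    proof (cases "rank y \<le> rank x")
      case True
      then show ?thesis using one[OF s(1-3)] rank_ge1[OF s(4)] by simp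
    next
      case False
      then show ?thesis using one[OF sym[OF s(1)] s(2)[symmetric] s(4)] rank_ge1[OF s(3)] by simp
    qed
    \<comment> \<open>\<open>U\<close> and \<open>D\<close> say that some related pair of rank 1
      differs in its upper or in its lower pattern; both together would collapse rank 1.\<close>
    define U where "U \<longleftrightarrow> (\<exists>A B x y. (x, y) \<in> \<sigma> \<and> ar A B x \<and> rank x = 1 \<and> rank y = 1 \<and> upf x \<noteq> upf y)"
    define D where "D \<longleftrightarrow> (\<exists>A B x y. (x, y) \<in> \<sigma> \<and> ar A B x \<and> rank x = 1 \<and> rank y = 1 \<and> dnf x \<noteq> dnf y)"
    have UD: "\<not> (U \<and> D)" unfolding U_def D_def using nab1[OF r] False by metis
    have notU: "upf x = upf y" if "\<not> U" "(x, y) \<in> \<sigma>" "ar A B x" "rank x = 1" "rank y = 1" for x y A B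
      using that unfolding U_def by blast
    have notD: "dnf x = dnf y" if "\<not> D" "(x, y) \<in> \<sigma>" "ar A B x" "rank x = 1" "rank y = 1" for x y A B
      using that unfolding D_def by blast
    consider "\<not> U" "\<not> D" | "U" "\<not> D" | "\<not> U" "D" using UD by blast
    then show ?thesis
    proof cases
      case 1
      have "\<sigma> = Par r (\<lambda>x y. False)"
      proof (rule eq_Par)
        fix A B x y assume a: "ar A B x" "ar A B y" "x \<noteq> y"
        show "(x, y) \<in> \<sigma> \<longleftrightarrow> False"
          using ones[OF _ a(3,1,2)] notU[OF 1(1) _ a(1)] notD[OF 1(2) _ a(1)] rank1_eq[OF a(1,2)] a(3) by blast
      qed
      then show ?thesis by simp
    next
      case 2
      obtain A' B' x' y' where p: "(x', y') \<in> \<sigma>" "ar A' B' x'" "rank x' = 1" "rank y' = 1" "upf x' \<noteq> upf y'"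
        using 2(1) unfolding U_def by blast
      have "\<sigma> = Par r sameL"
      proof (rule eq_Par)
        fix A B x y assume a: "ar A B x" "ar A B y" "x \<noteq> y"
        show "(x, y) \<in> \<sigma> \<longleftrightarrow> sameL x y"
          using ones[OF _ a(3,1,2)] notD[OF 2(2) _ a(1)] rank1_left[OF r p a(1) _ a(2)] by (auto simp: sameL_def)
      qed
      then show ?thesis by simp
    next
      case 3
      obtain A' B' x' y' where p: "(x', y') \<in> \<sigma>" "ar A' B' x'" "rank x' = 1" "rank y' = 1" "dnf x' \<noteq> dnf y'"
        using 3(2) unfolding D_def by blast
      have "\<sigma> = Par r sameR"
      proof (rule eq_Par)
        fix A B x y assume a: "ar A B x" "ar A B y" "x \<noteq> y"
        show "(x, y) \<in> \<sigma> \<longleftrightarrow> sameR x y"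
          using ones[OF _ a(3,1,2)] notU[OF 3(1) _ a(1)] rank1_right[OF r p a(1) _ a(2)] by (auto simp: sameR_def)
      qed
      then show ?thesis by simp
    qed
  qed
qed

end

context tl
begin

lemma Cong_ideal:
  assumes r: "enat 3 \<le> r"
  shows "Cong (ideal r) = {Par r (\<lambda>x y. False), Par r sameL, Par r sameR, Par r (\<lambda>x y. True)} \<union>
    {Par r (low q h) | q h. odd q \<and> enat q < r \<and> (h --> pm)}"
proof (intro equalityI subsetI)
  fix \<sigma> assume "\<sigma> \<in> Cong (ideal r)"
  then interpret tl_cong C pm Q r \<sigma> by unfold_locales (simp add: Cong_def)
  show "\<sigma> \<in> {Par r (\<lambda>x y. False), Par r sameL, Par r sameR, Par r (\<lambda>x y. True)} \<union>
    {Par r (low q h) | q h. odd q \<and> enat q < r \<and> (h --> pm)}"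
    using congruence_cases[OF r] by blast
next
  fix \<sigma> assume s: "\<sigma> \<in> {Par r (\<lambda>x y. False), Par r sameL, Par r sameR, Par r (\<lambda>x y. True)} \<union>
    {Par r (low q h) | q h. odd q \<and> enat q < r \<and> (h --> pm)}"
  have "congruence (ideal r) (Par r (\<lambda>x y. False))" "congruence (ideal r) (Par r (\<lambda>x y. True))"
    by (rule Par_congruence; simp)+
  then show "\<sigma> \<in> Cong (ideal r)"
    using s sameL_congruence sameR_congruence low_congruence unfolding Cong_def by blast
qed

lemma Par_mono: "(\<And>x y. P x y ==> P' x y) ==> Par r P \<subseteq> Par r P'"
  by (auto simp: Par_def)

lemma Par_subsetD: "Par r P \<subseteq> Par r P' ==> ar A B x ==> ar A B y ==> enat (rank x) \<le> r ==> enat (rank y) \<le> r ==>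
    P x y ==> x = y \<or> P' x y"
  using Par_iff[of A B x y r P] Par_iff[of A B x y r P'] by blast

lemma ex_two_patterns:
  assumes A: "A \<in> C" "3 \<le> card (Field A)"
  obtains p q where "pat A p" "pat A q" "p \<noteq> q" "card (defects A p) = 1" "card (defects A q) = 1"
proof -
  note L = C_lin[OF A(1)]
  obtain u where u: "pat A u" "card (defects A u) = 3" using ex_pat[OF A(1), of 3] A(2) by auto
  obtain ds where ds: "length ds = card (defects A u)" "\<And>i. Suc i < length ds ==> consec A u (ds ! i) (ds ! Suc i)"
    using defect_list[OF L, of u] by metis
  have c: "consec A u (ds ! 0) (ds ! 1)" using ds(2)[of 0] ds(1) u(2) by simp
  obtain x y where xy: "consec A u x y" "\<not> arcs_le (add_arc u (ds ! 0) (ds ! 1)) (add_arc u x y)"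
    by (rule other_consec[OF L c]) (use u(2) in simp_all)
  show thesis
    by (rule that[OF pat_add_arc[OF L u(1) c] pat_add_arc[OF L u(1) xy(1)]])
      (use xy(2) card_add_arc(1)[OF L c] card_add_arc(1)[OF L xy(1)] u(2) in auto)
qed

lemma ex_sameR_pair:
  assumes A: "A \<in> C" "3 \<le> card (Field A)"
  obtains x y where "ar A A x" "ar A A y" "rank x = 1" "rank y = 1" "upf x = upf y" "dnf x \<noteq> dnf y"
proof -
  obtain p q where pq: "pat A p" "pat A q" "p \<noteq> q" "card (defects A p) = 1" "card (defects A q) = 1"
    by (rule ex_two_patterns[OF A])
  obtain x where x: "ar A A x" "upf x = p" "dnf x = p" "rank x = 1"
    by (rule ex_ar[OF A(1,1) pq(1,1)]) (use pq in simp_all)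
  obtain y where y: "ar A A y" "upf y = p" "dnf y = q" "rank y = 1"
    by (rule ex_ar[OF A(1,1) pq(1,2)]) (use pq in simp_all)
  show thesis by (rule that[OF x(1) y(1)]) (use x y pq in simp_all)
qed

lemma ex_drop_pair:
  assumes "A \<in> C" "odd q" "q \<le> card (Field A)"
  obtains x y where "ar A A x" "ar A A y" "rank x = q" "rank y = 1"
proof -
  obtain p where p: "pat A p" "card (defects A p) = q" by (rule ex_pat[OF assms])
  obtain p' where p': "pat A p'" "card (defects A p') = 1" by (rule ex_pat[OF assms(1), of 1]) (use assms in \<open>auto elim!: oddE\<close>)
  show thesis
    by (rule that[OF ar_proj[OF assms(1) p(1)] ar_proj[OF assms(1) p'(1)]])
      (use proj_sel(3)[OF assms(1)] p p' in simp_all)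
qed

text \<open>Test pairs live over an object with at least q + 2 points: a pair of ranks q and 1
  detects q, a pair with equal patterns at rank q + 2 detects h.\<close>

lemma low_subset_iff:
  assumes q: "odd q" "enat (q + 2) \<le> r" "enat (q + 2) < xi C" "h --> pm"
    and q': "odd q'"
  shows "Par r (low q h) \<subseteq> Par r (low q' h') \<longleftrightarrow> q < q' \<or> q = q' \<and> (h --> h')"
proof
  assume sub: "Par r (low q h) \<subseteq> Par r (low q' h')"
  obtain A where A: "A \<in> C" "q + 2 \<le> card (Field A)" using q(3) less_xi_iff[OF C_ne] by blast
  have le: "enat k \<le> r" if "k \<le> q + 2" for k by (rule enat_le_trans[OF that q(2)])
  have "q \<le> q'"
  proof (cases "q = 1")
    case True
    then show ?thesis using q' by (auto elim!: oddE)
  next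
    case False
    obtain x y where xy: "ar A A x" "ar A A y" "rank x = q" "rank y = 1"
      by (rule ex_drop_pair[OF A(1) q(1)]) (use A in simp_all)
    have "x = y \<or> low q' h' x y"
      by (rule Par_subsetD[OF sub xy(1,2)]) (use xy q(1) le in \<open>auto simp: low_def elim!: oddE\<close>)
    then show ?thesis using xy(3,4) False by (auto simp: low_def same_H_def)
  qed
  moreover have h' if e: "q = q'" h
  proof -
    obtain p where p: "pat A p" "card (defects A p) = q + 2" by (rule ex_pat[OF A(1), of "q + 2"]) (use q(1) A in simp_all)
    obtain x y where xy: "ar A A x" "ar A A y" "x \<noteq> y" "upf x = p" "upf y = p" "dnf x = p" "dnf y = p"
      by (rule ex_H_pair[OF _ A(1,1) p(1,1)]) (use q(4) e p in simp_all)
    have rk: "rank x = q + 2" "rank y = q + 2" using rank_up[OF xy(1)] rank_up[OF xy(2)] xy p by simp_all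
    have "x = y \<or> low q' h' x y"
      by (rule Par_subsetD[OF sub xy(1,2)]) (use xy rk le e in \<open>auto simp: low_def same_H_def\<close>)
    then show h' using xy(3) rk e by (auto simp: low_def)
  qed
  ultimately show "q < q' \<or> q = q' \<and> (h --> h')" by auto
next
  assume lt: "q < q' \<or> q = q' \<and> (h --> h')"
  have "q + 2 \<le> q'" if "q < q'" using that q(1) q' by (cases "q' = q + 1") auto
  then show "Par r (low q h) \<subseteq> Par r (low q' h')"
    using lt by (intro Par_mono) (auto simp: low_def same_H_def)
qed

text \<open>All named relations are rewritten as \<open>Par\<close>; inclusions then follow from
  implications between conditions, and strictness comes from test pairs.\<close>

lemma congruence_lattice:
  assumes r: "(\<exists>n. r = enat n \<and> odd n \<and> 3 \<le> n \<and> r < xi C) \<or> (r = \<infinity> \<and> xi C = \<infinity>)"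
    and G: "\<forall>q. odd q \<and> enat q < xi C --> group_H_class Q (G q) \<and> G q \<subseteq> rank_class Q q"
  shows "(let I = (\<lambda>q :: nat. rank_ideal Q (enat q));
            S = sub_psg Q (rank_ideal Q r);
            \<Lambda> = lambda_cong S (I 1);
            P = rho_cong S (I 1);
            R1 = Rees S (I 1);
            R = (\<lambda>q N. Rees_normal S (I q) N);
            adm = (\<lambda>q N. odd q \<and> enat q < r \<and> N \<lhd> group_of Q (G (q + 2)));
            Ch = {R q N | q N. adm q N}
        in Cong S = {Delta S, \<Lambda>, P, R1} \<union> Ch \<union> {Nabla S} \<and>
           Delta S \<subset> \<Lambda> \<and> Delta S \<subset> P \<and> \<Lambda> \<subset> R1 \<and> P \<subset> R1 \<and>
           \<not> \<Lambda> \<subseteq> P \<and> \<not> P \<subseteq> \<Lambda> \<and>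
           chain\<^sub>\<subseteq> Ch \<and> R1 \<in> Ch \<and> (\<forall>\<sigma>\<in>Ch. R1 \<subseteq> \<sigma>) \<and>
           (\<forall>q q' N N'. adm q N \<and> adm q' N' -->
              (R q N \<subseteq> R q' N' \<longleftrightarrow> q < q' \<or> q = q' \<and> N \<subseteq> N')) \<and>
           (\<forall>\<sigma>\<in>Ch. \<sigma> \<subset> Nabla S) \<and>
           (\<forall>\<sigma>\<in>Cong S. \<sigma> \<subseteq> Nabla S))"
proof -
  have r3: "enat 3 \<le> r" using r by auto
  have r1: "enat 1 \<le> r" by (rule enat_le_trans[OF _ r3]) simp
  have r1': "enat 1 < r" using r by auto
  \<comment> \<open>For odd r the next odd rank after q is still at most r, and for infinite r there
    is no bound; so \<open>q + 2\<close> stays below \<open>xi C\<close>, where G is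
    specified.\<close>
  have bound: "enat (q + 2) \<le> r" "enat (q + 2) < xi C" if q: "odd q" "enat q < r" for q
  proof -
    have "enat (q + 2) \<le> r \<and> enat (q + 2) < xi C"
      using r
    proof
      assume "\<exists>n. r = enat n \<and> odd n \<and> 3 \<le> n \<and> r < xi C"
      then obtain n where n: "r = enat n" "odd n" "r < xi C" by blast
      have "q + 2 \<le> n" using q n(1,2) by (cases "n = q + 1") auto
      then have le: "enat (q + 2) \<le> r" using n(1) by simp
      then show ?thesis using order_le_less_trans[OF le n(3)] by simp
    qed simp
    then show "enat (q + 2) \<le> r" "enat (q + 2) < xi C" by simp_all
  qed
  have GH: "group_H_class Q (G (q + 2))" "G (q + 2) \<subseteq> rank_class Q (q + 2)" "3 \<le> q + 2" if "odd q" "enat q < r" for q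
    using G bound(2)[OF that] that(1) by (auto elim!: oddE)
  let ?one = "\<lambda>q. one (group_of Q (G (q + 2)))"
  have Rq: "Rees_normal (ideal r) (rank_ideal Q (enat q)) N = Par r (low q (N \<noteq> {?one q}))"
    if "odd q" "enat q < r" "N \<lhd> group_of Q (G (q + 2))" for q N
    by (rule Rees_normal_Par[OF bound(1)[OF that(1,2)] GH(1,2)[OF that(1,2)] _ that(3)]) (use that(1) in \<open>auto elim!: oddE\<close>)
  have two: "G (q + 2) \<noteq> {?one q}" if "odd q" "enat q < r" pm for q
  proof
    assume "G (q + 2) = {?one q}"
    then have "card (G (q + 2)) = card {?one q}" by (rule arg_cong)
    then show False using card_H_class[OF GH[OF that(1,2)]] that(3) by simp
  qed
  let ?Ch = "{Par r (low q h) | q h. odd q \<and> enat q < r \<and> (h --> pm)}"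
  have Ch: "{Rees_normal (ideal r) (rank_ideal Q (enat q)) N | q N. odd q \<and> enat q < r \<and> N \<lhd> group_of Q (G (q + 2))} = ?Ch" (is "?X = _")
  proof (intro equalityI subsetI)
    fix \<sigma> assume "\<sigma> \<in> ?X"
    then obtain q N where q: "\<sigma> = Rees_normal (ideal r) (rank_ideal Q (enat q)) N" "odd q" "enat q < r" "N \<lhd> group_of Q (G (q + 2))"
      by blast
    have "N \<noteq> {?one q} --> pm" using normal_cases[OF GH[OF q(2,3)] q(4)] by blast
    then show "\<sigma> \<in> ?Ch" using Rq[OF q(2-4)] q(1-3) by blast
  next
    fix \<sigma> assume "\<sigma> \<in> ?Ch"
    then obtain q h where q: "\<sigma> = Par r (low q h)" "odd q" "enat q < r" "h --> pm" by blast
    note N = normal_exist[OF GH(1)[OF q(2,3)]]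
    have "\<exists>N. N \<lhd> group_of Q (G (q + 2)) \<and> (N \<noteq> {?one q}) = h"
      using N two[OF q(2,3)] q(4) by (cases h) auto
    then obtain N where N: "N \<lhd> group_of Q (G (q + 2))" "(N \<noteq> {?one q}) = h" by blast
    have "\<sigma> = Rees_normal (ideal r) (rank_ideal Q (enat q)) N" using Rq[OF q(2,3) N(1)] N(2) q(1) by simp
    then show "\<sigma> \<in> ?X" using q(2,3) N(1) by blast
  qed
  have R1Ch: "Par r (low 1 False) \<in> ?Ch" using r1' by (intro CollectI exI[of _ "1::nat"] exI[of _ False]) simp
  obtain A where A: "A \<in> C" "3 \<le> card (Field A)" using bound(2)[of 1] r1' less_xi_iff[OF C_ne] by auto
  \<comment> \<open>This pair belongs to the \<rho>-congruence but not to the \<lambda>-congruence;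
    its mirror image does the converse.\<close>
  obtain x y where xy: "ar A A x" "ar A A y" "rank x = 1" "rank y = 1" "upf x = upf y" "dnf x \<noteq> dnf y"
    by (rule ex_sameR_pair[OF A])
  have sR: "sameR x y" "\<not> sameL x y" using xy by (simp_all add: sameR_def sameL_def)
  have sL: "sameL (star x) (star y)" "\<not> sameR (star x) (star y)"
    using xy ar_rank_star[OF xy(1)] ar_rank_star[OF xy(2)] up_star[OF xy(1)] up_star[OF xy(2)] by (simp_all add: sameR_def sameL_def)
  have ne: "x \<noteq> y" "star x \<noteq> star y" using sR sL by (auto simp: sameR_def sameL_def)
  have R_in: "(x, y) \<in> Par r P \<longleftrightarrow> P x y" for P using Par_iff[OF xy(1,2)] xy(3,4) r1 ne by simp
  have L_in: "(star x, star y) \<in> Par r P \<longleftrightarrow> P (star x) (star y)" for P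
    using Par_iff[OF ar_star[OF xy(1)] ar_star[OF xy(2)]] ar_rank_star[OF xy(1)] ar_rank_star[OF xy(2)] xy(3,4) r1 ne by simp
  have sub1: "Par r sameL \<subseteq> Par r (low 1 False)" "Par r sameR \<subseteq> Par r (low 1 False)"
    by (rule Par_mono; simp add: sameL_def sameR_def low_def)+
  have sub0: "Par r (\<lambda>x y. False) \<subseteq> Par r P" for P by (rule Par_mono) simp
  have low1: "low 1 False x y" "low 1 False (star x) (star y)"
    using xy(3,4) ar_rank_star[OF xy(1)] ar_rank_star[OF xy(2)] by (simp_all add: low_def)
  have strict: "\<sigma> \<subset> Par r (\<lambda>x y. True)" if s: "\<sigma> \<in> ?Ch" for \<sigma>
  proof -
    obtain q h where q: "\<sigma> = Par r (low q h)" "odd q" "enat q < r" using s by blast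
    obtain B where B: "B \<in> C" "q + 2 \<le> card (Field B)" using bound(2)[OF q(2,3)] less_xi_iff[OF C_ne] by blast
    obtain u v where uv: "ar B B u" "ar B B v" "rank u = q + 2" "rank v = 1"
      by (rule ex_drop_pair[OF B(1) _ B(2)]) (use q(2) in simp)
    have "enat (rank u) \<le> r" "enat (rank v) \<le> r" using uv(3,4) bound(1)[OF q(2,3)] r1 by simp_all
    then have "(u, v) \<in> Par r (\<lambda>x y. True)" "(u, v) \<notin> Par r (low q h)"
      using Par_iff[OF uv(1,2)] uv(3,4) by (auto simp: low_def same_H_def)
    moreover have "Par r (low q h) \<subseteq> Par r (\<lambda>x y. True)" by (rule Par_mono) simp
    ultimately show ?thesis unfolding q(1) by blast
  qed
  have sub_iff: "Par r (low q h) \<subseteq> Par r (low q' h') \<longleftrightarrow> q < q' \<or> q = q' \<and> (h --> h')"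
    if "odd q" "enat q < r" "h --> pm" "odd q'" for q q' h h'
    by (rule low_subset_iff[OF that(1) bound[OF that(1,2)] that(3,4)])
  have bot: "Par r (low 1 False) \<subseteq> \<sigma>" if s: "\<sigma> \<in> ?Ch" for \<sigma>
  proof -
    obtain q h where q: "\<sigma> = Par r (low q h)" "odd q" "enat q < r" using s by blast
    show ?thesis unfolding q(1) using sub_iff[of 1 False q h] r1' q(2) by (auto elim!: oddE)
  qed
  have order: "Rees_normal (ideal r) (rank_ideal Q (enat q)) N \<subseteq> Rees_normal (ideal r) (rank_ideal Q (enat q')) N' \<longleftrightarrow>
      q < q' \<or> q = q' \<and> N \<subseteq> N'"
    if a: "odd q" "enat q < r" "N \<lhd> group_of Q (G (q + 2))" and b: "odd q'" "enat q' < r" "N' \<lhd> group_of Q (G (q' + 2))" for q q' N N'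
  proof -
    have cases: "N = {?one q} \<or> N = G (q + 2) \<and> pm" "N' = {?one q'} \<or> N' = G (q' + 2) \<and> pm"
      using normal_cases[OF GH[OF a(1,2)] a(3)] normal_cases[OF GH[OF b(1,2)] b(3)] .
    have key: "(N \<noteq> {?one q} --> N' \<noteq> {?one q'}) \<longleftrightarrow> N \<subseteq> N'" if e: "q = q'"
    proof -
      have "subgroup N' (group_of Q (G (q' + 2)))" by (rule normal_imp_subgroup[OF b(3)])
      then have N': "?one q \<in> N'" "N' \<subseteq> G (q + 2)" using subgroup.one_closed subgroup.subset e by (fastforce simp: group_of_def)+
      have "subgroup N (group_of Q (G (q + 2)))" by (rule normal_imp_subgroup[OF a(3)])
      then have N: "?one q \<in> N" "N \<subseteq> G (q + 2)" using subgroup.one_closed subgroup.subset by (fastforce simp: group_of_def)+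
      show ?thesis using N N' cases e by blast
    qed
    have pm: "N \<noteq> {?one q} --> pm" using cases(1) by blast
    show ?thesis
    proof (cases "q = q'")
      case True
      show ?thesis unfolding Rq[OF a] Rq[OF b] sub_iff[OF a(1,2) pm b(1)] key[OF True] ..
    next
      case False
      then show ?thesis unfolding Rq[OF a] Rq[OF b] sub_iff[OF a(1,2) pm b(1)] by simp
    qed
  qed
  have chain: "chain\<^sub>\<subseteq> ?Ch"
    unfolding chain_subset_def
  proof (intro ballI)
    fix \<sigma> \<tau> assume s: "\<sigma> \<in> ?Ch" and t: "\<tau> \<in> ?Ch"
    obtain q h where q: "\<sigma> = Par r (low q h)" "odd q" "enat q < r" "h --> pm" using s by blast
    obtain q' h' where q': "\<tau> = Par r (low q' h')" "odd q'" "enat q' < r" "h' --> pm" using t by blast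
    show "\<sigma> \<subseteq> \<tau> \<or> \<tau> \<subseteq> \<sigma>"
      unfolding q(1) q'(1) sub_iff[OF q(2-4) q'(2)] sub_iff[OF q'(2-4) q(2)] by auto
  qed
  have top: "\<sigma> \<subseteq> Nabla (ideal r)" if "\<sigma> \<in> Cong (ideal r)" for \<sigma>
    using that by (auto simp: Cong_def congruence_def Nabla_def dest: equiv_memD(4,5))
  have C1: "Cong (ideal r) = {Par r (\<lambda>x y. False), Par r sameL, Par r sameR, Par r (low 1 False)} \<union> ?Ch \<union> {Par r (\<lambda>x y. True)}"
    unfolding Cong_ideal[OF r3] using R1Ch by blast
  have L: "Par r (\<lambda>x y. False) \<subset> Par r sameL" using sub0[of sameL] L_in[of sameL] L_in[of "\<lambda>x y. False"] sL by blast
  have P: "Par r (\<lambda>x y. False) \<subset> Par r sameR" using sub0[of sameR] R_in[of sameR] R_in[of "\<lambda>x y. False"] sR by blast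
  have L1: "Par r sameL \<subset> Par r (low 1 False)" using sub1(1) R_in[of sameL] R_in[of "low 1 False"] sR low1 by blast
  have P1: "Par r sameR \<subset> Par r (low 1 False)" using sub1(2) L_in[of sameR] L_in[of "low 1 False"] sL low1 by blast
  have LP: "\<not> Par r sameL \<subseteq> Par r sameR" using L_in[of sameL] L_in[of sameR] sL by blast
  have PL: "\<not> Par r sameR \<subseteq> Par r sameL" using R_in[of sameL] R_in[of sameR] sR by blast
  show ?thesis
    unfolding Let_def ideal_def[symmetric] lambda_Par[OF r1] Rees_Par[OF r1] Ch Delta_Par
  proof (intro conjI)
    show "Cong (ideal r) = {Par r (\<lambda>x y. False), Par r sameL, Par r sameR, Par r (low 1 False)} \<union> ?Ch \<union> {Nabla (ideal r)}"
      unfolding Nabla_Par by (rule C1)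
    show "\<forall>\<sigma>\<in>?Ch. \<sigma> \<subset> Nabla (ideal r)" unfolding Nabla_Par by (rule ballI, rule strict)
  qed (fact L P L1 P1 LP PL chain R1Ch | rule ballI, rule bot top, assumption |
    intro allI impI, elim conjE, rule order, assumption+)+
qed

end

section \<open>The minimal ideal\<close>

lemma prb_unique:
  assumes "prb_data C X Y" "A \<in> C" "B \<in> C"
  shows "x \<in> X A ==> x \<in> X B ==> A = B" "y \<in> Y A ==> y \<in> Y B ==> A = B"
  using assms unfolding prb_data_def disjoint_family_on_def by blast+

lemma prb_dm: "prb_data C X Y ==> A \<in> C ==> x \<in> X A ==> dm (prb C X Y) (x, y) = A"
  by (simp add: prb_def) (rule the_equality, simp, erule prb_unique(1); simp)

lemma prb_rn: "prb_data C X Y ==> B \<in> C ==> y \<in> Y B ==> rn (prb C X Y) (x, y) = B"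
  by (simp add: prb_def) (rule the_equality, simp, erule prb_unique(2); simp)

lemma prb_arr: "(x, y) \<in> arr (prb C X Y) \<longleftrightarrow> (\<exists>A\<in>C. \<exists>B\<in>C. x \<in> X A \<and> y \<in> Y B)"
  by (auto simp: prb_def)

lemma prb_mul [simp]: "mul (prb C X Y) (x, y) (x', y') = (x, y')"
  by (simp add: prb_def)

lemma EqsD:
  assumes "e \<in> Eqs Z"
  shows "x \<in> Z ==> (x, x) \<in> e" "(x, y) \<in> e ==> (y, x) \<in> e" "(x, y) \<in> e ==> (y, z) \<in> e ==> (x, z) \<in> e"
    "(x, y) \<in> e ==> x \<in> Z \<and> y \<in> Z"
  using assms equiv_memD[of Z e] unfolding Eqs_def by blast+

lemma sigma_cong_iff:
  assumes "prb_data C X Y" "A \<in> C" "B \<in> C" "x \<in> X A" "y \<in> Y B" "\<forall>A\<in>C. E1 A \<in> Eqs (X A) \<and> E2 A \<in> Eqs (Y A)"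
  shows "((x, y), (x', y')) \<in> sigma_cong C X Y E1 E2 \<longleftrightarrow> (x, x') \<in> E1 A \<and> (y, y') \<in> E2 B"
proof
  assume "((x, y), (x', y')) \<in> sigma_cong C X Y E1 E2"
  then obtain A' B' where "A' \<in> C" "B' \<in> C" "x \<in> X A'" "y \<in> Y B'" "(x, x') \<in> E1 A'" "(y, y') \<in> E2 B'"
    by (auto simp: sigma_cong_def)
  moreover from this have "A' = A" "B' = B"
    using prb_unique(1)[OF assms(1) _ assms(2)] prb_unique(2)[OF assms(1) _ assms(3)] assms(4,5) by metis+
  ultimately show "(x, x') \<in> E1 A \<and> (y, y') \<in> E2 B" by simp
next
  assume h: "(x, x') \<in> E1 A \<and> (y, y') \<in> E2 B"
  then have "x' \<in> X A" "y' \<in> Y B" using EqsD(4) assms(2,3,6) by metis+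
  then show "((x, y), (x', y')) \<in> sigma_cong C X Y E1 E2" using h assms by (auto simp: sigma_cong_def)
qed

lemma sigma_cong_arr:
  assumes "(p, q) \<in> sigma_cong C X Y E1 E2"
  obtains A B x y x' y' where "p = (x, y)" "q = (x', y')" "A \<in> C" "B \<in> C" "x \<in> X A" "x' \<in> X A" "y \<in> Y B" "y' \<in> Y B"
  using assms by (auto simp: sigma_cong_def)

lemma congruence_sigma_cong:
  assumes d: "prb_data C X Y" and E: "\<forall>A\<in>C. E1 A \<in> Eqs (X A) \<and> E2 A \<in> Eqs (Y A)"
  shows "congruence (prb C X Y) (sigma_cong C X Y E1 E2)"
proof (rule congruenceI)
  note iff = sigma_cong_iff[OF d _ _ _ _ E]
  have E': "E1 A \<in> Eqs (X A)" "E2 A \<in> Eqs (Y A)" if "A \<in> C" for A using E that by simp_all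
  show "equiv (arr (prb C X Y)) (sigma_cong C X Y E1 E2)"
  proof (rule equivI')
    show "sigma_cong C X Y E1 E2 \<subseteq> arr (prb C X Y) \<times> arr (prb C X Y)" by (auto simp: sigma_cong_def prb_arr)
    fix p assume "p \<in> arr (prb C X Y)"
    then obtain x y A B where p: "p = (x, y)" "A \<in> C" "B \<in> C" "x \<in> X A" "y \<in> Y B" by (cases p) (auto simp: prb_arr)
    show "(p, p) \<in> sigma_cong C X Y E1 E2"
      unfolding p(1) iff[OF p(2-5)] using EqsD(1)[OF E'(1)[OF p(2)] p(4)] EqsD(1)[OF E'(2)[OF p(3)] p(5)] ..
  next
    fix p q assume s: "(p, q) \<in> sigma_cong C X Y E1 E2"
    then obtain A B x y x' y' where p: "p = (x, y)" "q = (x', y')" "A \<in> C" "B \<in> C" "x \<in> X A" "x' \<in> X A" "y \<in> Y B" "y' \<in> Y B"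
      by (rule sigma_cong_arr)
    show "(q, p) \<in> sigma_cong C X Y E1 E2"
      using s unfolding p(1,2) iff[OF p(3,4,5,7)] iff[OF p(3,4,6,8)]
      using EqsD(2)[OF E'(1)[OF p(3)]] EqsD(2)[OF E'(2)[OF p(4)]] by blast
    fix t assume t: "(q, t) \<in> sigma_cong C X Y E1 E2"
    obtain u v where uv: "t = (u, v)" by (cases t)
    show "(p, t) \<in> sigma_cong C X Y E1 E2"
      using s t unfolding p(1,2) uv iff[OF p(3,4,5,7)] iff[OF p(3,4,6,8)]
      using EqsD(3)[OF E'(1)[OF p(3)]] EqsD(3)[OF E'(2)[OF p(4)]] by blast
  qed
  show "parallel (prb C X Y) p q" if s: "(p, q) \<in> sigma_cong C X Y E1 E2" for p q
    using s by (rule sigma_cong_arr) (simp add: parallel_def prb_dm[OF d] prb_rn[OF d])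
next
  note iff = sigma_cong_iff[OF d _ _ _ _ E]
  have E': "E1 A \<in> Eqs (X A)" "E2 A \<in> Eqs (Y A)" if "A \<in> C" for A using E that by simp_all
  fix p q s assume pq: "(p, q) \<in> sigma_cong C X Y E1 E2" and s: "s \<in> arr (prb C X Y)"
  from pq obtain A B x y x' y' where p: "p = (x, y)" "q = (x', y')" "A \<in> C" "B \<in> C" "x \<in> X A" "x' \<in> X A" "y \<in> Y B" "y' \<in> Y B"
    by (rule sigma_cong_arr)
  obtain u v D F where u: "s = (u, v)" "D \<in> C" "F \<in> C" "u \<in> X D" "v \<in> Y F" using s by (cases s) (auto simp: prb_arr)
  have h: "(x, x') \<in> E1 A" "(y, y') \<in> E2 B" using pq[unfolded p(1,2)] iff[OF p(3,4,5,7)] by simp_all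
  show "(mul (prb C X Y) s p, mul (prb C X Y) s q) \<in> sigma_cong C X Y E1 E2"
    unfolding p(1,2) u(1) prb_mul iff[OF u(2) p(4) u(4) p(7)] using EqsD(1)[OF E'(1)[OF u(2)] u(4)] h(2) ..
  show "(mul (prb C X Y) p s, mul (prb C X Y) q s) \<in> sigma_cong C X Y E1 E2"
    unfolding p(1,2) u(1) prb_mul iff[OF p(3) u(3) p(5) u(5)] using h(1) EqsD(1)[OF E'(2)[OF u(3)] u(5)] ..
qed

text \<open>Multiplying a related pair by a suitable element replaces both second coordinates, or
  both first ones, by any chosen point. The two coordinates therefore vary independently.\<close>

lemma prb_congruence_sigma:
  assumes d: "prb_data C X Y" and c: "congruence (prb C X Y) \<tau>"
  obtains E1 E2 where "\<forall>A\<in>C. E1 A \<in> Eqs (X A) \<and> E2 A \<in> Eqs (Y A)" "\<tau> = sigma_cong C X Y E1 E2"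
proof -
  have eq: "equiv (arr (prb C X Y)) \<tau>" using c by (simp add: congruence_def)
  have arrI: "(x, y) \<in> arr (prb C X Y)" if "A \<in> C" "B \<in> C" "x \<in> X A" "y \<in> Y B" for x y A B
    using that unfolding prb_arr by blast
  note refl = equiv_memD(1)[OF eq] and sym = equiv_memD(2)[OF eq] and trans = equiv_memD(3)[OF eq]
  have ne: "\<exists>x. x \<in> X A" "\<exists>y. y \<in> Y A" if "A \<in> C" for A using d that by (auto simp: prb_data_def)
  have shape: "\<exists>A B. A \<in> C \<and> B \<in> C \<and> x \<in> X A \<and> x' \<in> X A \<and> y \<in> Y B \<and> y' \<in> Y B" if s: "((x, y), (x', y')) \<in> \<tau>" for x y x' y'
  proof -
    obtain A B A' B' where a: "A \<in> C" "B \<in> C" "x \<in> X A" "y \<in> Y B" "A' \<in> C" "B' \<in> C" "x' \<in> X A'" "y' \<in> Y B'"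
      using equiv_memD(4,5)[OF eq s] unfolding prb_arr by blast
    have "parallel (prb C X Y) (x, y) (x', y')" using c s by (auto simp: congruence_def)
    then have "A = A'" "B = B'" using prb_dm[OF d] prb_rn[OF d] a by (simp_all add: parallel_def)
    then show ?thesis using a by blast
  qed
  \<comment> \<open>The coordinate w only makes the product defined; it exists since the set
    \<open>X B\<close> is nonempty.\<close>
  have R: "((x, z), (x', z)) \<in> \<tau>"
    if s: "((x, y), (x', y')) \<in> \<tau>" and z: "z \<in> Y D" "D \<in> C" for x y x' y' z D
  proof -
    obtain A B where a: "A \<in> C" "B \<in> C" "x \<in> X A" "x' \<in> X A" "y \<in> Y B" "y' \<in> Y B" using shape[OF s] by blast
    obtain w where w: "w \<in> X B" using ne(1)[OF a(2)] by blast
    have "rn (prb C X Y) (x, y) = dm (prb C X Y) (w, z)" using prb_rn[OF d a(2,5)] prb_dm[OF d a(2) w] by simp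
    then have "(mul (prb C X Y) (x, y) (w, z), mul (prb C X Y) (x', y') (w, z)) \<in> \<tau>"
      using c s arrI[OF a(2) z(2) w z(1)] unfolding congruence_def by blast
    then show ?thesis by simp
  qed
  have L: "((z, y), (z, y')) \<in> \<tau>"
    if s: "((x, y), (x', y')) \<in> \<tau>" and z: "z \<in> X D" "D \<in> C" for x y x' y' z D
  proof -
    obtain A B where a: "A \<in> C" "B \<in> C" "x \<in> X A" "x' \<in> X A" "y \<in> Y B" "y' \<in> Y B" using shape[OF s] by blast
    obtain w where w: "w \<in> Y A" using ne(2)[OF a(1)] by blast
    have "rn (prb C X Y) (z, w) = dm (prb C X Y) (x, y)" using prb_rn[OF d a(1) w] prb_dm[OF d a(1,3)] by simp
    then have "(mul (prb C X Y) (z, w) (x, y), mul (prb C X Y) (z, w) (x', y')) \<in> \<tau>"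
      using c s arrI[OF z(2) a(1) z(1) w] unfolding congruence_def by blast
    then show ?thesis by simp
  qed
  define E1 where "E1 A = {(x, x'). x \<in> X A \<and> x' \<in> X A \<and> (\<forall>B\<in>C. \<forall>y\<in>Y B. ((x, y), (x', y)) \<in> \<tau>)}" for A
  define E2 where "E2 B = {(y, y'). y \<in> Y B \<and> y' \<in> Y B \<and> (\<forall>A\<in>C. \<forall>x\<in>X A. ((x, y), (x, y')) \<in> \<tau>)}" for B
  have E: "E1 A \<in> Eqs (X A) \<and> E2 A \<in> Eqs (Y A)" if A: "A \<in> C" for A
  proof
    have "equiv (X A) (E1 A)"
    proof (rule equivI')
      show "E1 A \<subseteq> X A \<times> X A" by (auto simp: E1_def)
      show "(x, x) \<in> E1 A" if "x \<in> X A" for x using refl arrI[OF A _ that] that by (simp add: E1_def)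
      show "(y, x) \<in> E1 A" if "(x, y) \<in> E1 A" for x y using that sym by (simp add: E1_def)
      show "(x, z) \<in> E1 A" if h: "(x, y) \<in> E1 A" "(y, z) \<in> E1 A" for x y z
      proof -
        have "((x, u), (z, u)) \<in> \<tau>" if "B \<in> C" "u \<in> Y B" for u B
          by (rule trans[of _ "(y, u)"]) (use h that in \<open>auto simp: E1_def\<close>)
        then show ?thesis using h by (simp add: E1_def)
      qed
    qed
    then show "E1 A \<in> Eqs (X A)" by (simp add: Eqs_def)
    have "equiv (Y A) (E2 A)"
    proof (rule equivI')
      show "E2 A \<subseteq> Y A \<times> Y A" by (auto simp: E2_def)
      show "(x, x) \<in> E2 A" if "x \<in> Y A" for x using refl arrI[OF _ A _ that] that by (simp add: E2_def)
      show "(y, x) \<in> E2 A" if "(x, y) \<in> E2 A" for x y using that sym by (simp add: E2_def)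
      show "(x, z) \<in> E2 A" if h: "(x, y) \<in> E2 A" "(y, z) \<in> E2 A" for x y z
      proof -
        have "((u, x), (u, z)) \<in> \<tau>" if "B \<in> C" "u \<in> X B" for u B
          by (rule trans[of _ "(u, y)"]) (use h that in \<open>auto simp: E2_def\<close>)
        then show ?thesis using h by (simp add: E2_def)
      qed
    qed
    then show "E2 A \<in> Eqs (Y A)" by (simp add: Eqs_def)
  qed
  have "\<tau> = sigma_cong C X Y E1 E2"
  proof (intro equalityI subsetI)
    fix t assume t: "t \<in> \<tau>"
    obtain x y x' y' where xy: "t = ((x, y), (x', y'))" by (metis surj_pair)
    obtain A B where a: "A \<in> C" "B \<in> C" "x \<in> X A" "x' \<in> X A" "y \<in> Y B" "y' \<in> Y B" using shape t unfolding xy by blast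
    have "(x, x') \<in> E1 A" "(y, y') \<in> E2 B" using R[OF t[unfolded xy]] L[OF t[unfolded xy]] a by (simp_all add: E1_def E2_def)
    then show "t \<in> sigma_cong C X Y E1 E2" unfolding xy sigma_cong_def using a by blast
  next
    fix t assume "t \<in> sigma_cong C X Y E1 E2"
    then obtain x y x' y' A B where t: "t = ((x, y), (x', y'))" "A \<in> C" "B \<in> C" "x \<in> X A" "x' \<in> X A" "y \<in> Y B" "y' \<in> Y B"
      "(x, x') \<in> E1 A" "(y, y') \<in> E2 B" by (auto simp: sigma_cong_def)
    \<comment> \<open>One coordinate is changed at a time.\<close>
    have "((x, y), (x', y)) \<in> \<tau>" "((x', y), (x', y')) \<in> \<tau>" using t by (simp_all add: E1_def E2_def)
    then show "t \<in> \<tau>" unfolding t(1) by (rule trans)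
  qed
  then show thesis using that[of E1 E2] E by blast
qed

text \<open>The sets being nonempty, a reflexive pair in one coordinate tests the inclusion in the
  other.\<close>

lemma sigma_cong_subset_iff:
  assumes d: "prb_data C X Y" and E: "\<forall>A\<in>C. E1 A \<in> Eqs (X A) \<and> E2 A \<in> Eqs (Y A)"
    and F: "\<forall>A\<in>C. F1 A \<in> Eqs (X A) \<and> F2 A \<in> Eqs (Y A)"
  shows "sigma_cong C X Y E1 E2 \<subseteq> sigma_cong C X Y F1 F2 \<longleftrightarrow> (\<forall>A\<in>C. E1 A \<subseteq> F1 A \<and> E2 A \<subseteq> F2 A)"
proof
  assume sub: "sigma_cong C X Y E1 E2 \<subseteq> sigma_cong C X Y F1 F2"
  have key: "(x, x') \<in> F1 A \<and> (y, y') \<in> F2 A" if A: "A \<in> C" and xy: "(x, x') \<in> E1 A" "(y, y') \<in> E2 A" for A x x' y y'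
  proof -
    have m: "x \<in> X A" "y \<in> Y A" using EqsD(4) xy E A by metis+
    have "((x, y), (x', y')) \<in> sigma_cong C X Y E1 E2" using sigma_cong_iff[OF d A A m E] xy by simp
    then show ?thesis using sub sigma_cong_iff[OF d A A m F] by blast
  qed
  show "\<forall>A\<in>C. E1 A \<subseteq> F1 A \<and> E2 A \<subseteq> F2 A"
  proof
    fix A assume A: "A \<in> C"
    obtain x y where xy: "x \<in> X A" "y \<in> Y A" using d A unfolding prb_data_def by blast
    then have "(x, x) \<in> E1 A" "(y, y) \<in> E2 A" using EqsD(1) E A by metis+
    then show "E1 A \<subseteq> F1 A \<and> E2 A \<subseteq> F2 A" using key[OF A] by auto
  qed
next
  assume le: "\<forall>A\<in>C. E1 A \<subseteq> F1 A \<and> E2 A \<subseteq> F2 A"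
  show "sigma_cong C X Y E1 E2 \<subseteq> sigma_cong C X Y F1 F2"
  proof (rule subrelI)
    fix p q assume pq: "(p, q) \<in> sigma_cong C X Y E1 E2"
    then obtain A B x y x' y' where p: "p = (x, y)" "q = (x', y')" "A \<in> C" "B \<in> C" "x \<in> X A" "x' \<in> X A" "y \<in> Y B" "y' \<in> Y B"
      by (rule sigma_cong_arr)
    show "(p, q) \<in> sigma_cong C X Y F1 F2"
      using pq le p(3,4) unfolding p(1,2) sigma_cong_iff[OF d p(3,4,5,7) E] sigma_cong_iff[OF d p(3,4,5,7) F] by blast
  qed
qed

section \<open>Transport of congruences along isomorphisms\<close>

lemma congruence_pull:
  assumes f: "psg_iso S T f"
    and closed: "\<And>x y. x \<in> arr S ==> y \<in> arr S ==> rn S x = dm S y ==> mul S x y \<in> arr S"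
    and c: "congruence T \<tau>" and \<sigma>: "\<sigma> = {(x, y). x \<in> arr S \<and> y \<in> arr S \<and> (f x, f y) \<in> \<tau>}"
  shows "congruence S \<sigma>"
proof -
  have eq: "equiv (arr T) \<tau>" using c by (simp add: congruence_def)
  have fT: "f x \<in> arr T" if "x \<in> arr S" for x using f that by (auto simp: psg_iso_def bij_betw_def)
  have dr: "dm T (f x) = dm S x" "rn T (f x) = rn S x" if "x \<in> arr S" for x using f that by (auto simp: psg_iso_def)
  have m: "f (mul S x y) = mul T (f x) (f y)" if "x \<in> arr S" "y \<in> arr S" "rn S x = dm S y" for x y
    using f that by (auto simp: psg_iso_def)
  show ?thesis
  proof (rule congruenceI)
    show "equiv (arr S) \<sigma>"
    proof (rule equivI')
      show "\<sigma> \<subseteq> arr S \<times> arr S" using \<sigma> by blast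
      show "(x, x) \<in> \<sigma>" if "x \<in> arr S" for x using equiv_memD(1)[OF eq fT[OF that]] that \<sigma> by blast
      show "(y, x) \<in> \<sigma>" if "(x, y) \<in> \<sigma>" for x y using that equiv_memD(2)[OF eq] \<sigma> by blast
      show "(x, z) \<in> \<sigma>" if "(x, y) \<in> \<sigma>" "(y, z) \<in> \<sigma>" for x y z using that equiv_memD(3)[OF eq] \<sigma> by blast
    qed
    have par: "parallel T (f x) (f y)" if "(x, y) \<in> \<sigma>" for x y using c that \<sigma> by (auto simp: congruence_def)
    show "parallel S x y" if "(x, y) \<in> \<sigma>" for x y using par[OF that] that \<sigma> dr by (simp add: parallel_def)
    fix x y s assume xy: "(x, y) \<in> \<sigma>" and s: "s \<in> arr S"
    have M: "x \<in> arr S" "y \<in> arr S" "(f x, f y) \<in> \<tau>" using xy \<sigma> by blast+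
    have p: "dm S y = dm S x" "rn S y = rn S x" using par[OF xy] dr M by (simp_all add: parallel_def)
    show "(mul S s x, mul S s y) \<in> \<sigma>" if e: "rn S s = dm S x"
    proof -
      have "(mul T (f s) (f x), mul T (f s) (f y)) \<in> \<tau>"
        using c M(3) fT[OF s] dr s M e unfolding congruence_def by fastforce
      then show ?thesis unfolding \<sigma> using m[OF s M(1)] m[OF s M(2)] closed[OF s M(1)] closed[OF s M(2)] e p by simp
    qed
    show "(mul S x s, mul S y s) \<in> \<sigma>" if e: "rn S x = dm S s"
    proof -
      have "(mul T (f x) (f s), mul T (f y) (f s)) \<in> \<tau>"
        using c M(3) fT[OF s] dr s M e unfolding congruence_def by fastforce
      then show ?thesis unfolding \<sigma> using m[OF M(1) s] m[OF M(2) s] closed[OF M(1) s] closed[OF M(2) s] e p by simp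
    qed
  qed
qed

lemma psg_iso_inv:
  assumes f: "psg_iso S T f"
    and closed: "\<And>x y. x \<in> arr S ==> y \<in> arr S ==> rn S x = dm S y ==> mul S x y \<in> arr S"
  shows "psg_iso T S (inv_into (arr S) f)"
    and "x \<in> arr T ==> y \<in> arr T ==> rn T x = dm T y ==> mul T x y \<in> arr T"
proof -
  let ?g = "inv_into (arr S) f"
  have b: "bij_betw f (arr S) (arr T)" using f by (simp add: psg_iso_def)
  have g: "?g x \<in> arr S" "f (?g x) = x" "dm S (?g x) = dm T x" "rn S (?g x) = rn T x" if "x \<in> arr T" for x
    using bij_betw_apply[OF bij_betw_inv_into[OF b] that] bij_betw_inv_into_right[OF b that] f by (auto simp: psg_iso_def)
  have m: "mul S (?g x) (?g y) \<in> arr S" "f (mul S (?g x) (?g y)) = mul T x y"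
    if "x \<in> arr T" "y \<in> arr T" "rn T x = dm T y" for x y
    using closed[of "?g x" "?g y"] f g[OF that(1)] g[OF that(2)] that(3) by (auto simp: psg_iso_def)
  show "psg_iso T S ?g"
    unfolding psg_iso_def
  proof (intro conjI ballI impI)
    show "bij_betw ?g (arr T) (arr S)" by (rule bij_betw_inv_into[OF b])
    show "?g (mul T x y) = mul S (?g x) (?g y)" if "x \<in> arr T" "y \<in> arr T" "rn T x = dm T y" for x y
      using m[OF that] bij_betw_inv_into_left[OF b] by metis
  qed (simp_all add: g)
  show "mul T x y \<in> arr T" if "x \<in> arr T" "y \<in> arr T" "rn T x = dm T y" for x y
    using m[OF that] bij_betw_apply[OF b] by metis
qed

text \<open>Congruences are pulled back along f and along its inverse. Closure under defined
  products is assumed separately because the record does not impose it.\<close>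

lemma Cong_psg_iso:
  assumes f: "psg_iso S T f"
    and closed: "\<And>x y. x \<in> arr S ==> y \<in> arr S ==> rn S x = dm S y ==> mul S x y \<in> arr S"
  shows "Cong S = {{(x, y). x \<in> arr S \<and> y \<in> arr S \<and> (f x, f y) \<in> \<tau>} | \<tau>. congruence T \<tau>}" (is "_ = ?R")
proof (intro equalityI subsetI)
  fix \<sigma> assume "\<sigma> \<in> Cong S"
  then have c: "congruence S \<sigma>" by (simp add: Cong_def)
  then have eq: "equiv (arr S) \<sigma>" by (simp add: congruence_def)
  let ?g = "inv_into (arr S) f"
  have "congruence T {(x, y). x \<in> arr T \<and> y \<in> arr T \<and> (?g x, ?g y) \<in> \<sigma>}" (is "congruence T ?\<tau>")
    by (rule congruence_pull[OF psg_iso_inv(1)[OF f closed] psg_iso_inv(2)[OF f closed] c HOL.refl])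
  moreover have "\<sigma> = {(x, y). x \<in> arr S \<and> y \<in> arr S \<and> (f x, f y) \<in> ?\<tau>}"
  proof -
    have b: "bij_betw f (arr S) (arr T)" using f by (simp add: psg_iso_def)
    have "(x, y) \<in> \<sigma> ==> x \<in> arr S \<and> y \<in> arr S" for x y using equiv_memD(4,5)[OF eq] by blast
    then show ?thesis using bij_betw_inv_into_left[OF b] bij_betw_apply[OF b] by auto
  qed
  ultimately show "\<sigma> \<in> ?R" by blast
next
  fix \<sigma> assume "\<sigma> \<in> ?R"
  then show "\<sigma> \<in> Cong S" using congruence_pull[OF f closed] unfolding Cong_def by blast
qed

lemma lattice_isoI:
  assumes b: "bij_betw g L' L" and o: "\<And>x y. x \<in> L' ==> y \<in> L' ==> R' x y \<longleftrightarrow> R (g x) (g y)"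
  shows "lattice_iso L R L' R'"
  unfolding lattice_iso_def
proof (intro exI conjI ballI)
  show "bij_betw (inv_into L' g) L L'" by (rule bij_betw_inv_into[OF b])
  fix x y assume "x \<in> L" "y \<in> L"
  then show "R x y \<longleftrightarrow> R' (inv_into L' g x) (inv_into L' g y)"
    using o[of "inv_into L' g x" "inv_into L' g y"] bij_betw_inv_into_right[OF b] bij_betw_apply[OF bij_betw_inv_into[OF b]] by simp
qed

section \<open>Patterns with one defect as planar equivalences\<close>

definition eqv :: "'a rel => ('a => 'a) => 'a rel" where
  "eqv A p = {(a, b). a \<in> Field A \<and> (b = a \<or> b = p a)}"

text \<open>Arcs become classes of size 2 and the defect the singleton class. For such classes
  separated or nested means non-crossing, and a defect not covered by an arc is a singleton class
  not nested by another class.\<close>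

lemma bij_betw_eqv:
  assumes A: "fin_lin A"
  shows "bij_betw (eqv A) {p. pat A p \<and> card (defects A p) = 1} (planar_Eq2_open A)"
proof (rule bij_betw_imageI)
  show "inj_on (eqv A) {p. pat A p \<and> card (defects A p) = 1}"
  proof (rule inj_onI, rule ext)
    fix p q a assume p: "p \<in> {p. pat A p \<and> card (defects A p) = 1}" and q: "q \<in> {p. pat A p \<and> card (defects A p) = 1}"
      and e: "eqv A p = eqv A q"
    show "p a = q a"
    proof (cases "a \<in> Field A")
      case True
      then have "(a, p a) \<in> eqv A q" "(a, q a) \<in> eqv A p" using e by (auto simp: eqv_def)
      then show ?thesis by (auto simp: eqv_def)
    next
      case False
      then show ?thesis using p q patD(1) by (metis mem_Collect_eq)
    qed
  qed
  have L: "less_in A a b \<longleftrightarrow> pos A a < pos A b" if "a \<in> Field A" "b \<in> Field A" for a b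
    by (rule less_in_iff[OF A that])
  have pe: "pos A a = pos A b \<longleftrightarrow> a = b" if "a \<in> Field A" "b \<in> Field A" for a b by (rule pos_eq_iff[OF A that])
  show "eqv A ` {p. pat A p \<and> card (defects A p) = 1} = planar_Eq2_open A"
  proof (intro equalityI subsetI)
    fix \<epsilon> assume "\<epsilon> \<in> eqv A ` {p. pat A p \<and> card (defects A p) = 1}"
    then obtain p where \<epsilon>: "\<epsilon> = eqv A p" and p: "pat A p" and c: "card (defects A p) = 1" by blast
    have pF: "p a \<in> Field A" if "a \<in> Field A" for a using patD(2)[OF p that] .
    have pp: "p (p a) = a" for a by (rule patD(3)[OF p])
    have "equiv (Field A) \<epsilon>" unfolding \<epsilon> by (rule equivI') (auto simp: eqv_def pF pp)
    moreover have cl: "U \<in> Field A // \<epsilon> \<longleftrightarrow> (\<exists>a\<in>Field A. U = {a, p a})" for U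
    proof -
      have "\<epsilon> `` {a} = {a, p a}" if "a \<in> Field A" for a using that by (auto simp: \<epsilon> eqv_def)
      then show ?thesis by (auto simp: quotient_def)
    qed
    have cl_le: "\<exists>a\<in>Field A. U = {a, p a} \<and> pos A a \<le> pos A (p a)" if U: "U \<in> Field A // \<epsilon>" for U
    proof -
      obtain a where a: "a \<in> Field A" "U = {a, p a}" using U cl by blast
      show ?thesis
      proof (cases "pos A a \<le> pos A (p a)")
        case False
        then show ?thesis using a pF pp by (intro bexI[of _ "p a"]) auto
      qed (use a in blast)
    qed
    have card1: "card {a, p a} = 1 \<longleftrightarrow> p a = a" for a by (auto simp: card_insert_if)
    obtain d where d: "defects A p = {d}" using c by (auto simp: card_1_singleton_iff)
    then have dF: "d \<in> Field A" "p d = d" by (auto simp: defects_def)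
    have "\<exists>!U. U \<in> Field A // \<epsilon> \<and> card U = 1"
    proof (rule ex1I)
      show "{d} \<in> Field A // \<epsilon> \<and> card {d} = 1" using dF by (auto simp: cl intro!: bexI[of _ d])
      fix U assume U: "U \<in> Field A // \<epsilon> \<and> card U = 1"
      then obtain a where a: "a \<in> Field A" "U = {a, p a}" using cl by blast
      then have "p a = a" using U card1 by simp
      then have "a \<in> defects A p" using a by (simp add: defects_def)
      then show "U = {d}" using d a \<open>p a = a\<close> by simp
    qed
    moreover have "card U = 1 \<or> card U = 2" if U: "U \<in> Field A // \<epsilon>" for U
    proof -
      obtain a where "U = {a, p a}" using U cl by blast
      then show ?thesis using card1[of a] card_2_iff[of U] by metis
    qed
    moreover have "planar_equiv A \<epsilon>"
      unfolding planar_equiv_def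
    proof (intro ballI impI)
      fix U V assume U: "U \<in> Field A // \<epsilon>" and V: "V \<in> Field A // \<epsilon>" and ne: "U \<noteq> V"
      obtain a where a: "a \<in> Field A" "U = {a, p a}" "pos A a \<le> pos A (p a)" using cl_le[OF U] by blast
      obtain b where b: "b \<in> Field A" "V = {b, p b}" "pos A b \<le> pos A (p b)" using cl_le[OF V] by blast
      have dis: "a \<noteq> b" "a \<noteq> p b" "p a \<noteq> b" "p a \<noteq> p b"
        using ne a(2) b(2) pp by (metis insert_commute)+
      note F = a(1) b(1) pF[OF a(1)] pF[OF b(1)]
      have nest: "nested_by A {y, p y} {x, p x}"
        if x: "x \<in> Field A" "y \<in> Field A" "pos A x < pos A y" "pos A y < pos A (p x)" for x y
      proof -
        have "pos A x < pos A (p y)" "pos A (p y) < pos A (p x)" using patD(4)[OF p x] by simp_all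
        then show ?thesis
          unfolding nested_by_def using x pF[OF x(1)] pF[OF x(2)] L
          by (intro bexI[of _ x] bexI[of _ "p x"]) auto
      qed
      have P: "pos A a \<noteq> pos A b" "pos A a \<noteq> pos A (p b)" "pos A (p a) \<noteq> pos A b" using pe F dis by simp_all
      consider "pos A (p a) < pos A b" | "pos A (p b) < pos A a" | "pos A a < pos A b" "pos A b < pos A (p a)"
        | "pos A b < pos A a" "pos A a < pos A (p b)"
        using P by linarith
      then show "separated A U V \<or> nested_by A U V \<or> nested_by A V U"
      proof cases
        case 1
        then have "separated A U V" using a b F L by (auto simp: separated_def)
        then show ?thesis ..
      next
        case 2
        then have "separated A U V" using a b F L by (auto simp: separated_def)
        then show ?thesis ..
      next
        case 3
        then show ?thesis using nest[OF a(1) b(1)] a b by simp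
      next
        case 4
        then show ?thesis using nest[OF b(1) a(1)] a b by simp
      qed
    qed
    moreover have "\<not> (\<exists>V\<in>Field A // \<epsilon>. V \<noteq> U \<and> nested_by A U V)" if U: "U \<in> Field A // \<epsilon>" "card U = 1" for U
    proof
      assume "\<exists>V\<in>Field A // \<epsilon>. V \<noteq> U \<and> nested_by A U V"
      then obtain V where V: "V \<in> Field A // \<epsilon>" "nested_by A U V" by blast
      obtain a where a: "a \<in> Field A" "U = {a, p a}" using U(1) cl by blast
      obtain b where b: "b \<in> Field A" "V = {b, p b}" using V(1) cl by blast
      have fa: "p a = a" using a U(2) card1 by simp
      obtain v w where v: "v \<in> V" "w \<in> V" "less_in A v a" "less_in A a w" using V(2) a unfolding nested_by_def by blast
      have F: "v \<in> Field A" "w \<in> Field A" using v b pF by auto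
      have lt: "pos A v < pos A a" "pos A a < pos A w" using v L F a(1) by simp_all
      then have "v \<noteq> w" by auto
      then have "w = p v" using v b pp by auto
      then show False using patD(4)[OF p F(1) a(1) lt(1)] lt(2) fa by simp
    qed
    ultimately show "\<epsilon> \<in> planar_Eq2_open A" by (auto simp: planar_Eq2_open_def Eq2_def Eqs_def)
  next
    fix \<epsilon> assume "\<epsilon> \<in> planar_Eq2_open A"
    then have eq: "equiv (Field A) \<epsilon>" and one: "\<exists>!U. U \<in> Field A // \<epsilon> \<and> card U = 1"
      and card: "\<And>U. U \<in> Field A // \<epsilon> ==> card U = 1 \<or> card U = 2" and pl: "planar_equiv A \<epsilon>"
      and op: "\<And>U V. U \<in> Field A // \<epsilon> ==> card U = 1 ==> V \<in> Field A // \<epsilon> ==> V \<noteq> U ==> \<not> nested_by A U V"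
      by (auto simp: planar_Eq2_open_def Eq2_def Eqs_def)
    \<comment> \<open>The partner of a is the other member of its class, and a itself for a
      singleton class; off the field p is the identity, as patterns require.\<close>
    define p where "p a = (if a \<in> Field A then SOME b. \<epsilon> `` {a} = {a, b} else a)" for a
    have cls: "\<epsilon> `` {a} \<in> Field A // \<epsilon>" if "a \<in> Field A" for a using that by (rule quotientI)
    have p: "\<epsilon> `` {a} = {a, p a}" if a: "a \<in> Field A" for a
    proof -
      have m: "a \<in> \<epsilon> `` {a}" using equiv_memD(1)[OF eq a] by simp
      have "\<exists>b. U = {a, b}" if "a \<in> U" "card U = 1 \<or> card U = 2" for U
        using that by (auto simp: card_1_singleton_iff card_2_iff)
      then have "\<exists>b. \<epsilon> `` {a} = {a, b}" using m card[OF cls[OF a]] .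
      from someI_ex[OF this] show ?thesis using a by (simp add: p_def)
    qed
    have rel: "(a, b) \<in> \<epsilon> \<longleftrightarrow> b = a \<or> b = p a" if "a \<in> Field A" for a b using p[OF that] by blast
    have pF: "p a \<in> Field A" if "a \<in> Field A" for a using rel[OF that, of "p a"] equiv_memD(5)[OF eq] by blast
    have pp: "p (p a) = a" if a: "a \<in> Field A" for a
    proof -
      have "(p a, a) \<in> \<epsilon>" using rel[OF a, of "p a"] equiv_memD(2)[OF eq] by blast
      then have "a = p a \<or> a = p (p a)" using rel[OF pF[OF a]] by blast
      then show ?thesis by metis
    qed
    have cl: "{a, p a} \<in> Field A // \<epsilon>" if "a \<in> Field A" for a using cls[OF that] p[OF that] by simp
    have "pat A p"
      unfolding pat_def
    proof (intro conjI allI ballI impI; (elim conjE)?)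
      show "p a = a" if "a \<notin> Field A" for a using that by (simp add: p_def)
      show "p a \<in> Field A" "p (p a) = a" if "a \<in> Field A" for a using pF pp that by simp_all
      fix a b assume ab: "a \<in> Field A" "b \<in> Field A" and lt: "pos A a < pos A b" "pos A b < pos A (p a)"
      note F = pF[OF ab(1)] pF[OF ab(2)]
      have ne: "{a, p a} \<noteq> {b, p b}" using lt by (metis insert_iff less_irrefl singletonD)
      have "separated A {a, p a} {b, p b} \<or> nested_by A {a, p a} {b, p b} \<or> nested_by A {b, p b} {a, p a}"
        by (rule pl[unfolded planar_equiv_def, rule_format, OF cl[OF ab(1)] cl[OF ab(2)] ne])
      moreover have "\<not> separated A {a, p a} {b, p b}" using lt ab F L by (auto simp: separated_def)
      moreover have "\<not> nested_by A {a, p a} {b, p b}"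
      proof
        assume "nested_by A {a, p a} {b, p b}"
        then obtain v w where v: "v \<in> {b, p b}" "w \<in> {b, p b}" "less_in A v a" "less_in A (p a) w" unfolding nested_by_def by blast
        then have "pos A v < pos A a" "pos A (p a) < pos A w" using L ab F by auto
        then show False using v(1,2) lt by auto
      qed
      ultimately have n: "nested_by A {b, p b} {a, p a}" by blast
      then obtain v w where v: "v \<in> {a, p a}" "w \<in> {a, p a}" "less_in A v b" "less_in A v (p b)" "less_in A b w" "less_in A (p b) w"
        unfolding nested_by_def by blast
      then have lt': "pos A v < pos A b" "pos A v < pos A (p b)" "pos A b < pos A w" "pos A (p b) < pos A w" using L ab F by auto
      then have "v = a" "w = p a" using v(1,2) lt by auto
      then show "pos A a < pos A (p b)" "pos A (p b) < pos A (p a)" using lt' by simp_all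
      \<comment> \<open>A fixed point under the arc would be a singleton class nested by it.\<close>
      show "p b \<noteq> b" using op[OF cl[OF ab(2)] _ cl[OF ab(1)] ne] n by auto
    qed
    moreover have "card (defects A p) = 1"
    proof -
      obtain U where u: "U \<in> Field A // \<epsilon> \<and> card U = 1" "\<forall>V. V \<in> Field A // \<epsilon> \<and> card V = 1 --> V = U"
        using one by (rule ex1E)
      note U = conjunct1[OF u(1)] conjunct2[OF u(1)] u(2)[rule_format, OF conjI]
      obtain d where d: "d \<in> Field A" "U = \<epsilon> `` {d}" using U(1) by (auto simp: quotient_def)
      have "p d = d" using U(2) p[OF d(1)] d(2) by (auto simp: card_insert_if split: if_splits)
      moreover have "a = d" if a: "a \<in> Field A" "p a = a" for a
      proof -
        have "{a} = U" using U(3)[OF cl[OF a(1)]] a(2) by simp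
        moreover have "d \<in> U" unfolding d(2) p[OF d(1)] by simp
        ultimately show ?thesis by blast
      qed
      ultimately have "defects A p = {d}" using d(1) unfolding defects_def by blast
      then show ?thesis by simp
    qed
    moreover have "\<epsilon> = eqv A p" using rel equiv_memD(4)[OF eq] by (auto simp: eqv_def)
    ultimately show "\<epsilon> \<in> eqv A ` {p. pat A p \<and> card (defects A p) = 1}" by blast
  qed
qed


section \<open>Rank one as a partial rectangular band\<close>

context tl
begin

text \<open>The tag A forces disjointness: different orders on one set, such as an order and its
  converse, may have the same planar equivalences.\<close>

abbreviation vec where "vec A \<equiv> {A} \<times> planar_Eq2_open A"

definition coord :: "'a brauer => ('a rel \<times> 'a rel) \<times> ('a rel \<times> 'a rel)" where
  "coord x = ((src x, eqv (src x) (upf x)), (trg x, eqv (trg x) (dnf x)))"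

lemma coord_ar: "ar A B x ==> coord x = ((A, eqv A (upf x)), (B, eqv B (dnf x)))"
  using arD(9,10) by (simp add: coord_def)

abbreviation I1 where "I1 \<equiv> rank_ideal Q 1"
abbreviation S1 where "S1 \<equiv> sub_psg Q I1"

lemma rank_1_memE:
  assumes "x \<in> I1"
  obtains A B where "ar A B x" "rank x = 1"
  using assms in_rank_ideal[of x 1] rank_ge1 unfolding one_enat_def by (metis le_antisym)

lemma rank_1_memI: "ar A B x ==> rank x = 1 ==> x \<in> I1"
  using in_rank_ideal[of x 1] unfolding one_enat_def by auto

lemma ex_pat1:
  assumes "A \<in> C"
  obtains p where "pat A p" "card (defects A p) = 1"
  by (rule ex_pat[OF assms, of 1]) (use C_odd[OF assms] in \<open>auto elim!: oddE\<close>)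

lemma ex_rank_1:
  assumes "A \<in> C" "B \<in> C"
  obtains x where "ar A B x" "rank x = 1"
proof -
  obtain p where p: "pat A p" "card (defects A p) = 1" by (rule ex_pat1[OF assms(1)])
  obtain q where q: "pat B q" "card (defects B q) = 1" by (rule ex_pat1[OF assms(2)])
  show thesis by (rule ex_ar[OF assms p(1) q(1)]) (use p q that in simp_all)
qed

lemma prb_data_vec: "prb_data C vec vec"
proof -
  have "planar_Eq2_open A \<noteq> {}" if A: "A \<in> C" for A
  proof -
    obtain p where "pat A p" "card (defects A p) = 1" by (rule ex_pat1[OF A])
    then have "eqv A p \<in> planar_Eq2_open A" using bij_betw_apply[OF bij_betw_eqv[OF C_lin[OF A]]] by blast
    then show ?thesis by blast
  qed
  then show ?thesis by (auto simp: prb_data_def disjoint_family_on_def)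
qed

lemma eqv_mem: "ar A B x ==> rank x = 1 ==> eqv A (upf x) \<in> planar_Eq2_open A"
  "ar A B x ==> rank x = 1 ==> eqv B (dnf x) \<in> planar_Eq2_open B"
proof -
  assume a: "ar A B x" "rank x = 1"
  show "eqv A (upf x) \<in> planar_Eq2_open A"
    using bij_betw_apply[OF bij_betw_eqv[OF arD(5)[OF a(1)]]] arD(11)[OF a(1)] rank_up[OF a(1)] a(2) by simp
  show "eqv B (dnf x) \<in> planar_Eq2_open B"
    using bij_betw_apply[OF bij_betw_eqv[OF arD(6)[OF a(1)]]] pat_dnf[OF a(1)] rank_dn[OF a(1)] a(2) by simp
qed

text \<open>A partition of rank 1 is determined by its two patterns, and a product takes the upper
  one from the first and the lower one from the second factor.\<close>

lemma rank_1_iso: "psg_iso (S1) (prb C vec vec) coord"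
proof -
  have inj: "inj_on coord (I1)"
  proof (rule inj_onI)
    fix x y assume m: "x \<in> I1" "y \<in> I1" and e: "coord x = coord y"
    obtain A B where a: "ar A B x" "rank x = 1" using m(1) by (rule rank_1_memE)
    obtain A' B' where b': "ar A' B' y" "rank y = 1" using m(2) by (rule rank_1_memE)
    have "A' = A" "B' = B" using e coord_ar[OF a(1)] coord_ar[OF b'(1)] by simp_all
    with b' have b: "ar A B y" "rank y = 1" by simp_all
    have q: "eqv A (upf x) = eqv A (upf y)" "eqv B (dnf x) = eqv B (dnf y)" using e coord_ar[OF a(1)] coord_ar[OF b(1)] by simp_all
    note I = bij_betw_imp_inj_on[OF bij_betw_eqv]
    have "upf x = upf y"
      using inj_onD[OF I[OF arD(5)[OF a(1)]], OF q(1)] arD(11)[OF a(1)] arD(11)[OF b(1)] rank_up[OF a(1)] rank_up[OF b(1)] a b by simp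
    moreover have "dnf x = dnf y"
      using inj_onD[OF I[OF arD(6)[OF a(1)]], OF q(2)] pat_dnf[OF a(1)] pat_dnf[OF b(1)] rank_dn[OF a(1)] rank_dn[OF b(1)] a b by simp
    ultimately show "x = y" by (rule rank1_eq[OF a(1) b(1) a(2)])
  qed
  have img: "coord ` I1 = arr (prb C vec vec)"
  proof (intro equalityI subsetI)
    fix z assume "z \<in> coord ` I1"
    then obtain x where z: "z = coord x" "x \<in> I1" by blast
    obtain A B where a: "ar A B x" "rank x = 1" using z(2) by (rule rank_1_memE)
    show "z \<in> arr (prb C vec vec)"
      unfolding z(1) coord_ar[OF a(1)] prb_arr using eqv_mem[OF a] arD(1,2)[OF a(1)] by blast
  next
    fix z assume "z \<in> arr (prb C vec vec)"
    then obtain A B u w where z: "z = ((A, u), (B, w))" "A \<in> C" "B \<in> C" "u \<in> planar_Eq2_open A" "w \<in> planar_Eq2_open B"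
      by (cases z) (auto simp: prb_arr)
    obtain p where p: "pat A p" "card (defects A p) = 1" "eqv A p = u"
      using z(4) unfolding bij_betw_imp_surj_on[OF bij_betw_eqv[OF C_lin[OF z(2)]], symmetric] by blast
    obtain q where q: "pat B q" "card (defects B q) = 1" "eqv B q = w"
      using z(5) unfolding bij_betw_imp_surj_on[OF bij_betw_eqv[OF C_lin[OF z(3)]], symmetric] by blast
    obtain x where a: "ar A B x" "upf x = p" "dnf x = q" "rank x = 1"
      by (rule ex_ar[OF z(2,3) p(1) q(1)]) (use p q in simp_all)
    have "z = coord x" using coord_ar[OF a(1)] a z p q by simp
    then show "z \<in> coord ` I1" using rank_1_memI[OF a(1,4)] by blast
  qed
  show ?thesis
    unfolding psg_iso_def
  proof (intro conjI ballI impI)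
    show "bij_betw coord (arr (S1)) (arr (prb C vec vec))"
      using inj img by (simp add: bij_betw_def sub_psg_def)
    fix x assume m: "x \<in> arr (S1)"
    then have m': "x \<in> I1" by (simp add: sub_psg_def)
    obtain A B where a: "ar A B x" "rank x = 1" using m' by (rule rank_1_memE)
    show "dm (prb C vec vec) (coord x) = dm (S1) x"
      "rn (prb C vec vec) (coord x) = rn (S1) x"
      unfolding coord_ar[OF a(1)] using arD(9,10)[OF a(1)] arD(1,2)[OF a(1)] eqv_mem[OF a]
        prb_dm[OF prb_data_vec] prb_rn[OF prb_data_vec] by (simp_all add: sub_psg_def)
    fix y assume n: "y \<in> arr (S1)"
      and e: "rn (S1) x = dm (S1) y"
    then have n': "y \<in> I1" by (simp add: sub_psg_def)
    obtain B' D where b': "ar B' D y" "rank y = 1" using n' by (rule rank_1_memE)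
    have "B' = B" using e arD(10)[OF a(1)] arD(9)[OF b'(1)] by (simp add: sub_psg_def)
    with b' have b: "ar B D y" "rank y = 1" by simp_all
    note ab = ar_mult[OF a(1) b(1)]
    show "coord (mul (S1) x y) = mul (prb C vec vec) (coord x) (coord y)"
      using coord_ar[OF ab] coord_ar[OF a(1)] coord_ar[OF b(1)] rank1_mult(1)[OF a(1) b(1) a(2)] rank1_mult(2)[OF a(1) b(1) b(2)]
      by (simp add: sub_psg_def)
  qed
qed

text \<open>An element x of an ideal J can be flanked by factors of rank 1 carrying the upper
  pattern of y on the left and its lower pattern on the right; the product has rank 1 and the
  patterns of y, hence is y.\<close>

lemma minimal_ideal_rank_1: "minimal_ideal Q (I1)"
  unfolding minimal_ideal_def
proof (intro conjI allI impI)
  obtain A where A: "A \<in> C" using C_ne by blast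
  show "is_ideal Q (I1)"
    unfolding is_ideal_def
  proof (intro conjI ballI impI)
    obtain \<alpha> where "ar A A \<alpha>" "rank \<alpha> = 1" by (rule ex_rank_1[OF A A])
    then show "I1 \<noteq> {}" using rank_1_memI by blast
    show "I1 \<subseteq> arr Q" by (auto simp: rank_ideal_def)
    fix x s assume x: "x \<in> I1" and s: "s \<in> arr Q"
    obtain B D where b: "ar B D x" "rank x = 1" using x by (rule rank_1_memE)
    obtain E F where f: "ar E F s" using s in_arr by blast
    show "mul Q s x \<in> I1" if e: "rn Q s = dm Q x"
    proof -
      have "ar E B s" using f e arD(10)[OF f] arD(9)[OF b(1)] by simp
      then show ?thesis using rank_1_memI[OF ar_mult[OF _ b(1)]] rank1_mult(2)[OF _ b(1) b(2)] by simp
    qed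
    show "mul Q x s \<in> I1" if e: "rn Q x = dm Q s"
    proof -
      have "ar D F s" using f e arD(9)[OF f] arD(10)[OF b(1)] by simp
      then show ?thesis using rank_1_memI[OF ar_mult[OF b(1)]] rank1_mult(1)[OF b(1) _ b(2)] by simp
    qed
  qed
  fix J assume J: "is_ideal Q J"
  show "I1 \<subseteq> J"
  proof
    fix y assume "y \<in> I1"
    then obtain B D where y: "ar B D y" "rank y = 1" by (rule rank_1_memE)
    obtain x where x: "x \<in> J" "x \<in> arr Q" using J unfolding is_ideal_def by blast
    obtain E F where f: "ar E F x" using x(2) in_arr by blast
    obtain p where p: "pat E p" "card (defects E p) = 1" by (rule ex_pat1[OF arD(1)[OF f]])
    obtain u where u: "ar B E u" "upf u = upf y" "rank u = 1"
      by (rule ex_ar[OF arD(1)[OF y(1)] arD(1)[OF f] arD(11)[OF y(1)] p(1)]) (use p rank_up[OF y(1)] y(2) in simp_all)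
    obtain q where q: "pat F q" "card (defects F q) = 1" by (rule ex_pat1[OF arD(2)[OF f]])
    obtain v where v: "ar F D v" "dnf v = dnf y" "rank v = 1"
      by (rule ex_ar[OF arD(2)[OF f] arD(2)[OF y(1)] q(1) pat_dnf[OF y(1)]]) (use q rank_dn[OF y(1)] y(2) in simp_all)
    note ux = ar_mult[OF u(1) f]
    note uxv = ar_mult[OF ux v(1)]
    have r1: "rank (u \<cdot> x) = 1" "upf (u \<cdot> x) = upf u" using rank1_mult(1)[OF u(1) f u(3)] by simp_all
    have "u \<cdot> x \<cdot> v = y"
      by (rule rank1_eq[OF uxv y(1)])
        (use rank1_mult(1)[OF ux v(1) r1(1)] rank1_mult(2)[OF ux v(1) v(3)] r1(2) u(2) v(2) in simp_all)
    moreover have "u \<cdot> x \<in> J"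
      using J x(1) in_arr u(1) arD(10)[OF u(1)] arD(9)[OF f] unfolding is_ideal_def by fastforce
    moreover from this have "u \<cdot> x \<cdot> v \<in> J"
      using J in_arr v(1) arD(10)[OF ux] arD(9)[OF v(1)] unfolding is_ideal_def by fastforce
    ultimately show "y \<in> J" by simp
  qed
qed

lemma Cong_rank_1:
  "Cong (S1) =
    {{(\<alpha>, \<beta>). \<alpha> \<in> I1 \<and> \<beta> \<in> I1 \<and> (coord \<alpha>, coord \<beta>) \<in> sigma_cong C vec vec E1 E2} | E1 E2.
      \<forall>A\<in>C. E1 A \<in> Eqs (vec A) \<and> E2 A \<in> Eqs (vec A)}"
proof -
  have closed: "mul (S1) x y \<in> arr (S1)"
    if "x \<in> arr (S1)" "y \<in> arr (S1)"
      "rn (S1) x = dm (S1) y" for x y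
  proof -
    have "x \<in> I1" "y \<in> arr Q" "rn Q x = dm Q y" using that by (auto simp: sub_psg_def rank_ideal_def)
    then have "mul Q x y \<in> I1"
      using minimal_ideal_rank_1 unfolding minimal_ideal_def is_ideal_def by blast
    then show ?thesis by (simp add: sub_psg_def)
  qed
  have iff: "congruence (prb C vec vec) \<tau> \<longleftrightarrow>
      (\<exists>E1 E2. (\<forall>A\<in>C. E1 A \<in> Eqs (vec A) \<and> E2 A \<in> Eqs (vec A)) \<and> \<tau> = sigma_cong C vec vec E1 E2)" for \<tau>
  proof
    assume "congruence (prb C vec vec) \<tau>"
    then obtain E1 E2 where "\<forall>A\<in>C. E1 A \<in> Eqs (vec A) \<and> E2 A \<in> Eqs (vec A)" "\<tau> = sigma_cong C vec vec E1 E2"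
      by (rule prb_congruence_sigma[OF prb_data_vec])
    then show "\<exists>E1 E2. (\<forall>A\<in>C. E1 A \<in> Eqs (vec A) \<and> E2 A \<in> Eqs (vec A)) \<and> \<tau> = sigma_cong C vec vec E1 E2" by blast
  qed (use congruence_sigma_cong[OF prb_data_vec] in blast)
  have a: "arr (S1) = I1" by (simp add: sub_psg_def)
  have "Cong (S1) = {{(\<alpha>, \<beta>). \<alpha> \<in> I1 \<and> \<beta> \<in> I1 \<and> (coord \<alpha>, coord \<beta>) \<in> \<tau>} | \<tau>.
      congruence (prb C vec vec) \<tau>}"
    using Cong_psg_iso[OF rank_1_iso] closed unfolding a by blast
  then show ?thesis unfolding iff by (rule HOL.trans) blast
qed

text \<open>The isomorphism is built from pairs of families to congruences: equivalences are tagged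
  by \<open>lift\<close>, combined by \<open>sigma_cong\<close> and pulled back along
  \<open>coord\<close>. Extensional functions make the families unique.\<close>

lemma lattice_iso_rank_1:
  "lattice_iso (Cong (S1)) (\<subseteq>)
    ((\<Pi>\<^sub>E A\<in>C. Eqs (planar_Eq2_open A)) \<times> (\<Pi>\<^sub>E A\<in>C. Eqs (planar_Eq2_open A)))
    (\<lambda>(E1, E2) (F1, F2). \<forall>A\<in>C. E1 A \<subseteq> F1 A \<and> E2 A \<subseteq> F2 A)"
    (is "lattice_iso ?L _ (?P \<times> ?P) ?R")
proof -
  define lift :: "('a rel => 'a rel rel) => 'a rel => ('a rel \<times> 'a rel) rel"
    where "lift E A = {((A, a), (A, b)) | a b. (a, b) \<in> E A}" for E A
  define pull where "pull \<tau> = {(\<alpha>, \<beta>). \<alpha> \<in> I1 \<and> \<beta> \<in> I1 \<and> (coord \<alpha>, coord \<beta>) \<in> \<tau>}" for \<tau>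
  define g where "g = (\<lambda>(E1, E2). pull (sigma_cong C vec vec (lift E1) (lift E2)))"
  have lift: "lift E A \<in> Eqs (vec A)" if "E A \<in> Eqs (planar_Eq2_open A)" for E A
    unfolding Eqs_def
  proof (rule CollectI, rule equivI')
    show "lift E A \<subseteq> vec A \<times> vec A" using EqsD(4)[OF that] unfolding lift_def by blast
    show "(x, x) \<in> lift E A" if "x \<in> vec A" for x using EqsD(1)[OF \<open>E A \<in> _\<close>] that by (auto simp: lift_def)
    show "(y, x) \<in> lift E A" if "(x, y) \<in> lift E A" for x y using EqsD(2)[OF \<open>E A \<in> _\<close>] that by (auto simp: lift_def)
    show "(x, z) \<in> lift E A" if xyz: "(x, y) \<in> lift E A" "(y, z) \<in> lift E A" for x y z
    proof -
      obtain a b where ab: "x = (A, a)" "y = (A, b)" "(a, b) \<in> E A" using xyz(1) by (auto simp: lift_def)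
      obtain c where c: "z = (A, c)" "(b, c) \<in> E A" using xyz(2) ab(2) by (auto simp: lift_def)
      show ?thesis using EqsD(3)[OF \<open>E A \<in> _\<close> ab(3) c(2)] ab(1) c(1) by (simp add: lift_def)
    qed
  qed
  have lifts: "\<forall>A\<in>C. lift E1 A \<in> Eqs (vec A) \<and> lift E2 A \<in> Eqs (vec A)" if "E1 \<in> ?P" "E2 \<in> ?P" for E1 E2
    using lift PiE_mem[OF that(1)] PiE_mem[OF that(2)] by blast
  have lift_le: "lift E A \<subseteq> lift F A \<longleftrightarrow> E A \<subseteq> F A" for E F A by (auto simp: lift_def)
  have img: "coord ` I1 = arr (prb C vec vec)"
    using rank_1_iso by (simp add: psg_iso_def bij_betw_def sub_psg_def)
  have pull_le: "pull \<sigma> \<subseteq> pull \<tau> \<longleftrightarrow> \<sigma> \<subseteq> \<tau>" if "\<sigma> \<subseteq> arr (prb C vec vec) \<times> arr (prb C vec vec)" for \<sigma> \<tau>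
  proof
    assume le: "pull \<sigma> \<subseteq> pull \<tau>"
    show "\<sigma> \<subseteq> \<tau>"
    proof (rule subrelI)
      fix p q assume pq: "(p, q) \<in> \<sigma>"
      then obtain \<alpha> \<beta> where "\<alpha> \<in> I1" "\<beta> \<in> I1" "p = coord \<alpha>" "q = coord \<beta>"
        using \<open>\<sigma> \<subseteq> _\<close> unfolding img[symmetric] by blast
      then show "(p, q) \<in> \<tau>" using le pq unfolding pull_def by blast
    qed
  qed (auto simp: pull_def)
  have arr: "sigma_cong C vec vec E1 E2 \<subseteq> arr (prb C vec vec) \<times> arr (prb C vec vec)" for E1 E2
    by (auto simp: sigma_cong_def prb_arr)
  have ord: "?R e f \<longleftrightarrow> g e \<subseteq> g f" if ef: "e \<in> ?P \<times> ?P" "f \<in> ?P \<times> ?P" for e f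
  proof -
    obtain E1 E2 F1 F2 where h: "e = (E1, E2)" "f = (F1, F2)" "E1 \<in> ?P" "E2 \<in> ?P" "F1 \<in> ?P" "F2 \<in> ?P" using ef by blast
    show ?thesis
      unfolding h(1,2) g_def prod.case pull_le[OF arr] sigma_cong_subset_iff[OF prb_data_vec lifts[OF h(3,4)] lifts[OF h(5,6)]] lift_le ..
  qed
  have "inj_on g (?P \<times> ?P)"
  proof (rule inj_onI)
    fix e f assume ef: "e \<in> ?P \<times> ?P" "f \<in> ?P \<times> ?P" "g e = g f"
    obtain E1 E2 F1 F2 where h: "e = (E1, E2)" "f = (F1, F2)" "E1 \<in> ?P" "E2 \<in> ?P" "F1 \<in> ?P" "F2 \<in> ?P" using ef by blast
    have "?R e f" "?R f e" using ord[OF ef(1,2)] ord[OF ef(2,1)] ef(3) by simp_all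
    then have "E1 A = F1 A" "E2 A = F2 A" if "A \<in> C" for A using that h by auto
    then show "e = f" using PiE_ext[OF h(3,5)] PiE_ext[OF h(4,6)] h by simp
  qed
  moreover have "g ` (?P \<times> ?P) = ?L"
  proof (intro equalityI subsetI)
    fix \<sigma> assume "\<sigma> \<in> g ` (?P \<times> ?P)"
    then obtain E1 E2 where "\<sigma> = pull (sigma_cong C vec vec (lift E1) (lift E2))" "E1 \<in> ?P" "E2 \<in> ?P" by (auto simp: g_def)
    then show "\<sigma> \<in> ?L" unfolding Cong_rank_1 pull_def using lifts by blast
  next
    fix \<sigma> assume "\<sigma> \<in> ?L"
    then obtain E1 E2 where s: "\<sigma> = pull (sigma_cong C vec vec E1 E2)" and E: "\<forall>A\<in>C. E1 A \<in> Eqs (vec A) \<and> E2 A \<in> Eqs (vec A)"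
      unfolding Cong_rank_1 pull_def by blast
    \<comment> \<open>On \<open>C\<close> this is inverse to \<open>lift\<close>; restriction to
      \<open>C\<close> makes the family extensional.\<close>
    define drop where "drop E = (\<lambda>A\<in>C. {(a, b). ((A, a), (A, b)) \<in> E A})" for E :: "'a rel => ('a rel \<times> 'a rel) rel"
    have dropP: "drop E \<in> ?P" if "\<And>A. A \<in> C ==> E A \<in> Eqs (vec A)" for E
    proof (rule PiE_I)
      fix A assume A: "A \<in> C"
      note e = EqsD[OF that[OF A]]
      have "equiv (planar_Eq2_open A) {(a, b). ((A, a), (A, b)) \<in> E A}" (is "equiv _ ?E")
      proof (rule equivI')
        show "?E \<subseteq> planar_Eq2_open A \<times> planar_Eq2_open A" using e(4) by blast
        show "(a, a) \<in> ?E" if "a \<in> planar_Eq2_open A" for a using that e(1)[of "(A, a)"] by simp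
        show "(b, a) \<in> ?E" if "(a, b) \<in> ?E" for a b using that e(2)[of "(A, a)" "(A, b)"] by simp
        show "(a, c) \<in> ?E" if "(a, b) \<in> ?E" "(b, c) \<in> ?E" for a b c
          using that e(3)[of "(A, a)" "(A, b)" "(A, c)"] by simp
      qed
      then show "drop E A \<in> Eqs (planar_Eq2_open A)" using A by (simp add: drop_def Eqs_def)
    qed (simp add: drop_def)
    have lift_drop: "lift (drop E) A = E A" if A: "A \<in> C" "E A \<in> Eqs (vec A)" for E A
    proof -
      have "E A \<subseteq> vec A \<times> vec A" by (rule subrelI) (use EqsD(4)[OF A(2)] in simp)
      then show ?thesis using A(1) by (auto simp: lift_def drop_def)
    qed
    have "sigma_cong C vec vec (lift (drop E1)) (lift (drop E2)) = sigma_cong C vec vec E1 E2"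
      using E lift_drop unfolding sigma_cong_def by auto
    then have "g (drop E1, drop E2) = \<sigma>" by (simp add: g_def s)
    then show "\<sigma> \<in> g ` (?P \<times> ?P)" using dropP E by blast
  qed
  ultimately have "bij_betw g (?P \<times> ?P) ?L" by (rule bij_betw_imageI)
  then show ?thesis by (rule lattice_isoI) (rule ord)
qed

end

theorem theorem8p7:
  fixes C :: "'a rel set"
    and Q :: "('a rel, 'a brauer) psemigroup"
    and G :: "nat \<Rightarrow> 'a brauer set"
  assumes "C \<noteq> {}"
    and "\<forall>A\<in>C. Linear_order A \<and> finite (Field A) \<and> odd (card (Field A))"
    and "Q = TL C \<or> Q = TLpm C"
    and "\<forall>q. odd q \<and> enat q < xi C \<longrightarrow> group_H_class Q (G q) \<and> G q \<subseteq> rank_class Q q"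
  shows
    "minimal_ideal Q (rank_ideal Q 1) \<and>
     (\<exists>(X :: 'a rel \<Rightarrow> ('a rel \<times> 'a rel) set) (Y :: 'a rel \<Rightarrow> ('a rel \<times> 'a rel) set) \<phi>.
        prb_data C X Y \<and>
        psg_iso (sub_psg Q (rank_ideal Q 1)) (prb C X Y) \<phi> \<and>
        Cong (sub_psg Q (rank_ideal Q 1)) =
          {{(\<alpha>, \<beta>). \<alpha> \<in> rank_ideal Q 1 \<and> \<beta> \<in> rank_ideal Q 1 \<and>
                    (\<phi> \<alpha>, \<phi> \<beta>) \<in> sigma_cong C X Y E1 E2} | E1 E2.
             \<forall>A\<in>C. E1 A \<in> Eqs (X A) \<and> E2 A \<in> Eqs (Y A)}) \<and>
     lattice_iso
       (Cong (sub_psg Q (rank_ideal Q 1))) (\<subseteq>)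
       ((\<Pi>\<^sub>E A\<in>C. Eqs (planar_Eq2_open A)) \<times> (\<Pi>\<^sub>E A\<in>C. Eqs (planar_Eq2_open A)))
       (\<lambda>(E1, E2) (F1, F2). \<forall>A\<in>C. E1 A \<subseteq> F1 A \<and> E2 A \<subseteq> F2 A) \<and>
     (\<forall>r :: enat. (\<exists>n. r = enat n \<and> odd n \<and> 3 \<le> n \<and> r < xi C) \<or> (r = \<infinity> \<and> xi C = \<infinity>) \<longrightarrow>
       (let I = (\<lambda>q :: nat. rank_ideal Q (enat q));
            S = sub_psg Q (rank_ideal Q r);
            \<Lambda> = lambda_cong S (I 1);
            P = rho_cong S (I 1);
            R1 = Rees S (I 1);
            R = (\<lambda>q N. Rees_normal S (I q) N);
            adm = (\<lambda>q N. odd q \<and> enat q < r \<and> N \<lhd> group_of Q (G (q + 2)));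
            Ch = {R q N | q N. adm q N}
        in Cong S = {Delta S, \<Lambda>, P, R1} \<union> Ch \<union> {Nabla S} \<and>
           Delta S \<subset> \<Lambda> \<and> Delta S \<subset> P \<and> \<Lambda> \<subset> R1 \<and> P \<subset> R1 \<and>
           \<not> \<Lambda> \<subseteq> P \<and> \<not> P \<subseteq> \<Lambda> \<and>
           chain\<^sub>\<subseteq> Ch \<and> R1 \<in> Ch \<and> (\<forall>\<sigma>\<in>Ch. R1 \<subseteq> \<sigma>) \<and>
           (\<forall>q q' N N'. adm q N \<and> adm q' N' \<longrightarrow>
              (R q N \<subseteq> R q' N' \<longleftrightarrow> q < q' \<or> q = q' \<and> N \<subseteq> N')) \<and>
           (\<forall>\<sigma>\<in>Ch. \<sigma> \<subset> Nabla S) \<and>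
           (\<forall>\<sigma>\<in>Cong S. \<sigma> \<subseteq> Nabla S))) \<and>
     (\<forall>q. odd q \<and> 3 \<le> q \<and> enat q < xi C \<longrightarrow>
        (Q = TL C \<longrightarrow> order (group_of Q (G q)) = 1) \<and>
        (Q = TLpm C \<longrightarrow> cyclic_group (group_of Q (G q)) \<and> order (group_of Q (G q)) = 2))"
proof -
  have tl: "tl C pm (if pm then TLpm C else TL C)" for pm
    by unfold_locales (use assms(1,2) in \<open>simp_all add: fin_lin_def\<close>)
  obtain pm where "Q = (if pm then TLpm C else TL C)" using assms(3) by metis
  then interpret tl C pm Q using tl by simp
  \<comment> \<open>The conclusion speaks about Q under either equation, independently of the sign
    chosen above, and for small \<open>C\<close> the two categories may coincide; so the order is
    computed for any presentation of Q.\<close>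
  have ord: "order (group_of Q (G q)) = (if pm' then 2 else 1) \<and> cyclic_group (group_of Q (G q))"
    if q: "odd q" "3 \<le> q" "enat q < xi C" and Q: "Q = (if pm' then TLpm C else TL C)" for q pm'
  proof -
    interpret T: tl C pm' Q using tl[of pm'] Q by simp
    have "group_H_class Q (G q)" "G q \<subseteq> rank_class Q q" using assms(4) q by simp_all
    then show ?thesis using T.group_order_cyclic q(2) by blast
  qed
  show ?thesis
  proof (intro conjI)
    show "minimal_ideal Q (rank_ideal Q 1)" by (rule minimal_ideal_rank_1)
    show "\<exists>(X :: 'a rel => ('a rel \<times> 'a rel) set) (Y :: 'a rel => ('a rel \<times> 'a rel) set) \<phi>.
        prb_data C X Y \<and> psg_iso (sub_psg Q (rank_ideal Q 1)) (prb C X Y) \<phi> \<and>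
        Cong (sub_psg Q (rank_ideal Q 1)) =
          {{(\<alpha>, \<beta>). \<alpha> \<in> rank_ideal Q 1 \<and> \<beta> \<in> rank_ideal Q 1 \<and> (\<phi> \<alpha>, \<phi> \<beta>) \<in> sigma_cong C X Y E1 E2} | E1 E2.
             \<forall>A\<in>C. E1 A \<in> Eqs (X A) \<and> E2 A \<in> Eqs (Y A)}"
      by (intro exI conjI) (rule prb_data_vec rank_1_iso Cong_rank_1)+
    show "lattice_iso (Cong (sub_psg Q (rank_ideal Q 1))) (\<subseteq>)
       ((\<Pi>\<^sub>E A\<in>C. Eqs (planar_Eq2_open A)) \<times> (\<Pi>\<^sub>E A\<in>C. Eqs (planar_Eq2_open A)))
       (\<lambda>(E1, E2) (F1, F2). \<forall>A\<in>C. E1 A \<subseteq> F1 A \<and> E2 A \<subseteq> F2 A)"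
      by (rule lattice_iso_rank_1)
  next
    show "\<forall>q. odd q \<and> 3 \<le> q \<and> enat q < xi C -->
        (Q = TL C --> order (group_of Q (G q)) = 1) \<and>
        (Q = TLpm C --> cyclic_group (group_of Q (G q)) \<and> order (group_of Q (G q)) = 2)"
      using ord[of _ False] ord[of _ True] by simp
  qed (intro allI impI, rule congruence_lattice[OF _ assms(4)], assumption)
qed

end
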